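(* Let $\lambda\ge\kappa\ge\aleph_0$ be regular cardinals such that $\gamma<\kappa\Rightarrow 2^{\gamma}<\lambda$. Let $\mathcal{D}$ be a weakly Boolean $(\lambda,\kappa)$-pretopos in which $\{0\}\subseteq\mathrm{Sub}_{\mathcal{D}}(1)$ is a $\kappa$-prime ideal, i.e. if the intersection of $<\kappa$-many subobjects of $1$ is $0$ then one of them is $0$. Then for any coherent category $\mathcal{C}$, the class $\mathbf{Coh}(\mathcal{C},\mathcal{D})$ of coherent functors is closed in $\mathcal{D}^{\mathcal{C}}$ under $<\kappa$-ultraproducts (i.e. ultraproducts along ultrafilters on sets $I$ with $|I|<\kappa$). Moreover, for such $I$ and an ultrafilter $U$ on $I$, given subobjects $A_i\hookrightarrow X_i\hookleftarrow B_i$ in $\mathcal{D}$ $(i\in I)$, we have $(\prod_i A_i)/U\le(\prod_i B_i)/U$ (as subobjects of $(\prod_i X_i)/U$) iff $\{i:A_i\le B_i\}\in U$.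
   Context: A $\lambda$-geometric category is a coherent category with pullback-stable unions of fewer than $\lambda$ subobjects. A $\lambda$-pretopos is a $\lambda$-geometric category which is Barr-exact (internal equivalence relations are effective) and has disjoint, pullback-stable coproducts of size $<\lambda$. $(\lambda,\kappa)$-regularity: a $(\lambda,\kappa)$-tree is a rooted tree $P$ in which every vertex has degree $<\lambda$ and every branch has length $<\kappa$; view $P$ as a poset with least element the root, so that a functor $F:P^{op}\to\mathcal{D}$ has arrows from the value at a vertex to the value at its predecessors. $F$ is proper if for any vertex the arrows to it from its immediate successors (its 1-neighbourhood; the vertex having successors) form a jointly epimorphic family, and $F$ restricted to any branch is limit-preserving. $F$ is completely proper if it is proper and the transfinite cocompositions of the branches (i.e. the maps $\lim F|_b\to F(\mathrm{root})$, for $b$ a branch) form an effective epimorphic family on $F(\mathrm{root})$. $\mathcal{D}$ is $(\lambda,\kappa)$-regular if for any $(\lambda,\kappa)$-tree $P$ every proper diagram $P^{op}\to\mathcal{D}$ is completely proper. A $(\lambda,\kappa)$-pretopos is a $\lambda$-pretopos which has limits of size $<\kappa$, such that for any object $x$ the $<\kappa$ meets distribute over $<\lambda$ joins in $\mathrm{Sub}_{\mathcal{D}}(x)$ (for $\gamma<\kappa$ and families $(a_{i,j})_{j\in J_i}$, $i<\gamma$, $|J_i|<\lambda$: $\bigcap_{i<\gamma}\bigcup_{j\in J_i}a_{i,j}=\bigcup_{f\in\prod_i J_i}\bigcap_{i<\gamma}a_{i,f(i)}$, the right-hand supremum existing), and which is $(\lambda,\kappa)$-regular. Weakly Boolean: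 for any subobjects $a\hookrightarrow x\hookleftarrow b$ either $a\le b$ or there is $0\ne u\le a$ with $u\cap b=0$ ($0$ the initial object). Ultraproducts: $(\prod_{i\in I}D_i)/U=\mathrm{colim}_{J\in U}\prod_{i\in J}D_i$, a filtered colimit over the projection maps; pointwise in $\mathcal{D}^{\mathcal{C}}$. (A $\lambda$-pretopos has filtered colimits of size $<\lambda$.) *)

theory Defs
  imports "HOL-Library.FuncSet"
begin

unbundle cardinal_syntax

section \<open>Categories, functors, limits and colimits\<close>

text \<open>\<open>Comp D g f\<close> is the composite "first \<open>f\<close>, then \<open>g\<close>".\<close>

record ('o, 'm) cat =
  Obj :: "'o set"
  Arr :: "'m set"
  Dom :: "'m \<Rightarrow> 'o"
  Cod :: "'m \<Rightarrow> 'o"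
  Id :: "'o \<Rightarrow> 'm"
  Comp :: "'m \<Rightarrow> 'm \<Rightarrow> 'm"

definition hom :: "('o, 'm) cat \<Rightarrow> 'o \<Rightarrow> 'o \<Rightarrow> 'm set" where
  "hom D x y = {f \<in> Arr D. Dom D f = x \<and> Cod D f = y}"

definition category :: "('o, 'm) cat \<Rightarrow> bool" where
  "category D \<longleftrightarrow>
     (\<forall>f \<in> Arr D. Dom D f \<in> Obj D \<and> Cod D f \<in> Obj D) \<and>
     (\<forall>x \<in> Obj D. Id D x \<in> hom D x x) \<and>
     (\<forall>f \<in> Arr D. \<forall>g \<in> Arr D. Dom D g = Cod D f \<longrightarrow> Comp D g f \<in> hom D (Dom D f) (Cod D g)) \<and>
     (\<forall>f \<in> Arr D. Comp D f (Id D (Dom D f)) = f \<and> Comp D (Id D (Cod D f)) f = f) \<and>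
     (\<forall>f \<in> Arr D. \<forall>g \<in> Arr D. \<forall>h \<in> Arr D. Dom D g = Cod D f \<and> Dom D h = Cod D g \<longrightarrow>
        Comp D h (Comp D g f) = Comp D (Comp D h g) f)"

record ('a, 'b, 'o, 'm) func =
  FObj :: "'a \<Rightarrow> 'o"
  FArr :: "'b \<Rightarrow> 'm"

definition is_functor :: "('a, 'b) cat \<Rightarrow> ('o, 'm) cat \<Rightarrow> ('a, 'b, 'o, 'm) func \<Rightarrow> bool" where
  "is_functor C D F \<longleftrightarrow>
     (\<forall>x \<in> Obj C. FObj F x \<in> Obj D) \<and>
     (\<forall>f \<in> Arr C. FArr F f \<in> hom D (FObj F (Dom C f)) (FObj F (Cod C f))) \<and>
     (\<forall>x \<in> Obj C. FArr F (Id C x) = Id D (FObj F x)) \<and>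
     (\<forall>f \<in> Arr C. \<forall>g \<in> Arr C. Dom C g = Cod C f \<longrightarrow>
        FArr F (Comp C g f) = Comp D (FArr F g) (FArr F f))"

definition func_comp ::
  "('o, 'm, 'p, 'n) func \<Rightarrow> ('a, 'b, 'o, 'm) func \<Rightarrow> ('a, 'b, 'p, 'n) func" where
  "func_comp G F = \<lparr>FObj = FObj G \<circ> FObj F, FArr = FArr G \<circ> FArr F\<rparr>"

definition is_cone ::
  "('a, 'b) cat \<Rightarrow> ('o, 'm) cat \<Rightarrow> ('a, 'b, 'o, 'm) func \<Rightarrow> 'o \<Rightarrow> ('a \<Rightarrow> 'm) \<Rightarrow> bool" where
  "is_cone J D F x p \<longleftrightarrow>
     x \<in> Obj D \<and> (\<forall>j \<in> Obj J. p j \<in> hom D x (FObj F j)) \<and>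
     (\<forall>f \<in> Arr J. Comp D (FArr F f) (p (Dom J f)) = p (Cod J f))"

definition is_limit ::
  "('a, 'b) cat \<Rightarrow> ('o, 'm) cat \<Rightarrow> ('a, 'b, 'o, 'm) func \<Rightarrow> 'o \<Rightarrow> ('a \<Rightarrow> 'm) \<Rightarrow> bool" where
  "is_limit J D F x p \<longleftrightarrow>
     is_cone J D F x p \<and>
     (\<forall>y q. is_cone J D F y q \<longrightarrow> (\<exists>!h. h \<in> hom D y x \<and> (\<forall>j \<in> Obj J. Comp D (p j) h = q j)))"

definition is_cocone ::
  "('a, 'b) cat \<Rightarrow> ('o, 'm) cat \<Rightarrow> ('a, 'b, 'o, 'm) func \<Rightarrow> 'o \<Rightarrow> ('a \<Rightarrow> 'm) \<Rightarrow> bool" where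
  "is_cocone J D F x c \<longleftrightarrow>
     x \<in> Obj D \<and> (\<forall>j \<in> Obj J. c j \<in> hom D (FObj F j) x) \<and>
     (\<forall>f \<in> Arr J. Comp D (c (Cod J f)) (FArr F f) = c (Dom J f))"

definition is_colimit ::
  "('a, 'b) cat \<Rightarrow> ('o, 'm) cat \<Rightarrow> ('a, 'b, 'o, 'm) func \<Rightarrow> 'o \<Rightarrow> ('a \<Rightarrow> 'm) \<Rightarrow> bool" where
  "is_colimit J D F x c \<longleftrightarrow>
     is_cocone J D F x c \<and>
     (\<forall>y d. is_cocone J D F y d \<longrightarrow> (\<exists>!h. h \<in> hom D x y \<and> (\<forall>j \<in> Obj J. Comp D h (c j) = d j)))"

text \<open>
  Limits of size \<open>< r\<close>, for an infinite cardinal \<open>r\<close>: every category with fewer than \<open>r\<close> arrows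
  (hence fewer than \<open>r\<close> objects) has an isomorphic copy with objects and arrows taken from the
  field of \<open>r\<close>, so index categories on that type suffice.  Finite limits are the case \<open>natLeq\<close>.
\<close>

definition has_limits :: "'k rel \<Rightarrow> ('o, 'm) cat \<Rightarrow> bool" where
  "has_limits r D \<longleftrightarrow>
     (\<forall>(J :: ('k, 'k) cat) F. category J \<and> |Arr J| <o r \<and> is_functor J D F \<longrightarrow>
        (\<exists>x p. is_limit J D F x p))"

definition is_initial :: "('o, 'm) cat \<Rightarrow> 'o \<Rightarrow> bool" where
  "is_initial D z \<longleftrightarrow> z \<in> Obj D \<and> (\<forall>x \<in> Obj D. \<exists>!f. f \<in> hom D z x)"

definition is_terminal :: "('o, 'm) cat \<Rightarrow> 'o \<Rightarrow> bool" where
  "is_terminal D t \<longleftrightarrow> t \<in> Obj D \<and> (\<forall>x \<in> Obj D. \<exists>!f. f \<in> hom D x t)"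

definition is_product ::
  "('o, 'm) cat \<Rightarrow> 'i set \<Rightarrow> ('i \<Rightarrow> 'o) \<Rightarrow> 'o \<Rightarrow> ('i \<Rightarrow> 'm) \<Rightarrow> bool" where
  "is_product D I X x p \<longleftrightarrow>
     x \<in> Obj D \<and> (\<forall>i \<in> I. p i \<in> hom D x (X i)) \<and>
     (\<forall>y \<in> Obj D. \<forall>q. (\<forall>i \<in> I. q i \<in> hom D y (X i)) \<longrightarrow>
        (\<exists>!h. h \<in> hom D y x \<and> (\<forall>i \<in> I. Comp D (p i) h = q i)))"

definition is_coproduct ::
  "('o, 'm) cat \<Rightarrow> 'i set \<Rightarrow> ('i \<Rightarrow> 'o) \<Rightarrow> 'o \<Rightarrow> ('i \<Rightarrow> 'm) \<Rightarrow> bool" where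
  "is_coproduct D I X x c \<longleftrightarrow>
     x \<in> Obj D \<and> (\<forall>i \<in> I. c i \<in> hom D (X i) x) \<and>
     (\<forall>y \<in> Obj D. \<forall>d. (\<forall>i \<in> I. d i \<in> hom D (X i) y) \<longrightarrow>
        (\<exists>!h. h \<in> hom D x y \<and> (\<forall>i \<in> I. Comp D h (c i) = d i)))"

text \<open>\<open>is_pullback D f g p q\<close>: the square \<open>f p = g q\<close> is a pullback, with \<open>p\<close> a map to the domain
  of \<open>f\<close> and \<open>q\<close> a map to the domain of \<open>g\<close>.\<close>

definition is_pullback :: "('o, 'm) cat \<Rightarrow> 'm \<Rightarrow> 'm \<Rightarrow> 'm \<Rightarrow> 'm \<Rightarrow> bool" where
  "is_pullback D f g p q \<longleftrightarrow>
     f \<in> Arr D \<and> g \<in> Arr D \<and> Cod D f = Cod D g \<and>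
     p \<in> Arr D \<and> q \<in> Arr D \<and> Dom D p = Dom D q \<and> Cod D p = Dom D f \<and> Cod D q = Dom D g \<and>
     Comp D f p = Comp D g q \<and>
     (\<forall>y \<in> Obj D. \<forall>h \<in> hom D y (Dom D f). \<forall>k \<in> hom D y (Dom D g). Comp D f h = Comp D g k \<longrightarrow>
        (\<exists>!u. u \<in> hom D y (Dom D p) \<and> Comp D p u = h \<and> Comp D q u = k))"

text \<open>\<open>a'\<close> is the pullback of \<open>a\<close> along \<open>f\<close> (a map with codomain \<open>Dom D f\<close>).\<close>

definition is_base_change :: "('o, 'm) cat \<Rightarrow> 'm \<Rightarrow> 'm \<Rightarrow> 'm \<Rightarrow> bool" where
  "is_base_change D f a a' \<longleftrightarrow> (\<exists>q. is_pullback D f a a' q)"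

definition is_mono :: "('o, 'm) cat \<Rightarrow> 'm \<Rightarrow> bool" where
  "is_mono D a \<longleftrightarrow>
     a \<in> Arr D \<and>
     (\<forall>y \<in> Obj D. \<forall>h \<in> hom D y (Dom D a). \<forall>k \<in> hom D y (Dom D a).
        Comp D a h = Comp D a k \<longrightarrow> h = k)"

definition is_coequalizer :: "('o, 'm) cat \<Rightarrow> 'm \<Rightarrow> 'm \<Rightarrow> 'm \<Rightarrow> bool" where
  "is_coequalizer D f g e \<longleftrightarrow>
     f \<in> Arr D \<and> g \<in> Arr D \<and> Dom D f = Dom D g \<and> Cod D f = Cod D g \<and>
     e \<in> Arr D \<and> Dom D e = Cod D f \<and> Comp D e f = Comp D e g \<and>
     (\<forall>h \<in> Arr D. Dom D h = Cod D f \<and> Comp D h f = Comp D h g \<longrightarrow>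
        (\<exists>!k. k \<in> hom D (Cod D e) (Cod D h) \<and> Comp D k e = h))"

definition is_regular_epi :: "('o, 'm) cat \<Rightarrow> 'm \<Rightarrow> bool" where
  "is_regular_epi D e \<longleftrightarrow> (\<exists>f g. is_coequalizer D f g e)"

definition jointly_epi :: "('o, 'm) cat \<Rightarrow> 'o \<Rightarrow> 'i set \<Rightarrow> ('i \<Rightarrow> 'm) \<Rightarrow> bool" where
  "jointly_epi D x I f \<longleftrightarrow>
     (\<forall>i \<in> I. f i \<in> Arr D \<and> Cod D (f i) = x) \<and>
     (\<forall>y \<in> Obj D. \<forall>h \<in> hom D x y. \<forall>k \<in> hom D x y.
        (\<forall>i \<in> I. Comp D h (f i) = Comp D k (f i)) \<longrightarrow> h = k)"

text \<open>A family is effective epimorphic if \<open>x\<close> is the colimit of the sieve generated by it,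
  i.e. maps out of \<open>x\<close> are the same as compatible families.\<close>

definition effective_epi_family :: "('o, 'm) cat \<Rightarrow> 'o \<Rightarrow> 'i set \<Rightarrow> ('i \<Rightarrow> 'm) \<Rightarrow> bool" where
  "effective_epi_family D x I f \<longleftrightarrow>
     x \<in> Obj D \<and> (\<forall>i \<in> I. f i \<in> Arr D \<and> Cod D (f i) = x) \<and>
     (\<forall>y \<in> Obj D. \<forall>g. (\<forall>i \<in> I. g i \<in> hom D (Dom D (f i)) y) \<and>
        (\<forall>i \<in> I. \<forall>j \<in> I. \<forall>z \<in> Obj D. \<forall>p \<in> hom D z (Dom D (f i)). \<forall>q \<in> hom D z (Dom D (f j)).
           Comp D (f i) p = Comp D (f j) q \<longrightarrow> Comp D (g i) p = Comp D (g j) q) \<longrightarrow>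
        (\<exists>!h. h \<in> hom D x y \<and> (\<forall>i \<in> I. Comp D h (f i) = g i)))"

section \<open>Subobjects\<close>

text \<open>Subobjects are represented by monomorphisms, preordered by factorization; unions and
  intersections are least upper and greatest lower bounds in that preorder.\<close>

definition Sub :: "('o, 'm) cat \<Rightarrow> 'o \<Rightarrow> 'm set" where
  "Sub D x = {a. is_mono D a \<and> Cod D a = x}"

definition sub_le :: "('o, 'm) cat \<Rightarrow> 'm \<Rightarrow> 'm \<Rightarrow> bool" where
  "sub_le D a b \<longleftrightarrow> (\<exists>h \<in> hom D (Dom D a) (Dom D b). Comp D b h = a)"

definition is_union :: "('o, 'm) cat \<Rightarrow> 'o \<Rightarrow> 'i set \<Rightarrow> ('i \<Rightarrow> 'm) \<Rightarrow> 'm \<Rightarrow> bool" where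
  "is_union D x I a u \<longleftrightarrow>
     (\<forall>i \<in> I. a i \<in> Sub D x) \<and> u \<in> Sub D x \<and> (\<forall>i \<in> I. sub_le D (a i) u) \<and>
     (\<forall>v \<in> Sub D x. (\<forall>i \<in> I. sub_le D (a i) v) \<longrightarrow> sub_le D u v)"

definition is_inter :: "('o, 'm) cat \<Rightarrow> 'o \<Rightarrow> 'i set \<Rightarrow> ('i \<Rightarrow> 'm) \<Rightarrow> 'm \<Rightarrow> bool" where
  "is_inter D x I a w \<longleftrightarrow>
     (\<forall>i \<in> I. a i \<in> Sub D x) \<and> w \<in> Sub D x \<and> (\<forall>i \<in> I. sub_le D w (a i)) \<and>
     (\<forall>v \<in> Sub D x. (\<forall>i \<in> I. sub_le D v (a i)) \<longrightarrow> sub_le D v w)"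

text \<open>Unions of fewer than \<open>r\<close> subobjects exist and are stable under pullback; finite unions (the
  empty one included) are the case \<open>natLeq\<close>.\<close>

definition has_stable_unions :: "'l rel \<Rightarrow> ('o, 'm) cat \<Rightarrow> bool" where
  "has_stable_unions r D \<longleftrightarrow>
     (\<forall>x \<in> Obj D. \<forall>(I :: 'l set) a. |I| <o r \<and> (\<forall>i \<in> I. a i \<in> Sub D x) \<longrightarrow>
        (\<exists>u. is_union D x I a u) \<and>
        (\<forall>u f a' u'. is_union D x I a u \<and> f \<in> Arr D \<and> Cod D f = x \<and>
           (\<forall>i \<in> I. is_base_change D f (a i) (a' i)) \<and> is_base_change D f u u' \<longrightarrow>
           is_union D (Dom D f) I a' u'))"

section \<open>Coherent categories and functors\<close>

definition regular_category :: "('o, 'm) cat \<Rightarrow> bool" where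
  "regular_category D \<longleftrightarrow>
     category D \<and> has_limits natLeq D \<and>
     (\<forall>f p q. is_pullback D f f p q \<longrightarrow> (\<exists>e. is_coequalizer D p q e)) \<and>
     (\<forall>f e e'. is_regular_epi D e \<and> is_base_change D f e e' \<longrightarrow> is_regular_epi D e')"

definition coherent_category :: "('o, 'm) cat \<Rightarrow> bool" where
  "coherent_category D \<longleftrightarrow> regular_category D \<and> has_stable_unions natLeq D"

definition coherent_functor ::
  "('a, 'b) cat \<Rightarrow> ('o, 'm) cat \<Rightarrow> ('a, 'b, 'o, 'm) func \<Rightarrow> bool" where
  "coherent_functor C D F \<longleftrightarrow>
     is_functor C D F \<and>
     (\<forall>(J :: (nat, nat) cat) G x p.
        category J \<and> |Arr J| <o natLeq \<and> is_functor J C G \<and> is_limit J C G x p \<longrightarrow>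
        is_limit J D (func_comp F G) (FObj F x) (\<lambda>j. FArr F (p j))) \<and>
     (\<forall>e. is_regular_epi C e \<longrightarrow> is_regular_epi D (FArr F e)) \<and>
     (\<forall>x \<in> Obj C. \<forall>(I :: nat set) a u. finite I \<and> is_union C x I a u \<longrightarrow>
        is_union D (FObj F x) I (\<lambda>i. FArr F (a i)) (FArr F u))"

definition Coh :: "('a, 'b) cat \<Rightarrow> ('o, 'm) cat \<Rightarrow> ('a, 'b, 'o, 'm) func set" where
  "Coh C D = {F. coherent_functor C D F}"

definition lambda_geometric :: "'l rel \<Rightarrow> ('o, 'm) cat \<Rightarrow> bool" where
  "lambda_geometric lam D \<longleftrightarrow> coherent_category D \<and> has_stable_unions lam D"

definition internal_equivalence :: "('o, 'm) cat \<Rightarrow> 'm \<Rightarrow> 'm \<Rightarrow> bool" where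
  "internal_equivalence D r0 r1 \<longleftrightarrow>
     r0 \<in> Arr D \<and> r1 \<in> Arr D \<and> Dom D r0 = Dom D r1 \<and> Cod D r0 = Cod D r1 \<and>
     (\<forall>y \<in> Obj D. \<forall>h \<in> hom D y (Dom D r0). \<forall>k \<in> hom D y (Dom D r0).
        Comp D r0 h = Comp D r0 k \<and> Comp D r1 h = Comp D r1 k \<longrightarrow> h = k) \<and>
     (\<exists>d \<in> hom D (Cod D r0) (Dom D r0).
        Comp D r0 d = Id D (Cod D r0) \<and> Comp D r1 d = Id D (Cod D r0)) \<and>
     (\<exists>s \<in> hom D (Dom D r0) (Dom D r0). Comp D r0 s = r1 \<and> Comp D r1 s = r0) \<and>
     (\<forall>p q. is_pullback D r1 r0 p q \<longrightarrow>
        (\<exists>t \<in> hom D (Dom D p) (Dom D r0).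
           Comp D r0 t = Comp D r0 p \<and> Comp D r1 t = Comp D r1 q))"

definition barr_exact :: "('o, 'm) cat \<Rightarrow> bool" where
  "barr_exact D \<longleftrightarrow>
     regular_category D \<and>
     (\<forall>r0 r1. internal_equivalence D r0 r1 \<longrightarrow> (\<exists>f. is_pullback D f f r0 r1))"

definition has_disjoint_stable_coproducts :: "'l rel \<Rightarrow> ('o, 'm) cat \<Rightarrow> bool" where
  "has_disjoint_stable_coproducts lam D \<longleftrightarrow>
     (\<forall>(I :: 'l set) X. |I| <o lam \<and> (\<forall>i \<in> I. X i \<in> Obj D) \<longrightarrow>
        (\<exists>s c. is_coproduct D I X s c) \<and>
        (\<forall>s c. is_coproduct D I X s c \<longrightarrow>
           (\<forall>i \<in> I. is_mono D (c i)) \<and>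
           (\<forall>i \<in> I. \<forall>j \<in> I. i \<noteq> j \<longrightarrow>
              (\<forall>p q. is_pullback D (c i) (c j) p q \<longrightarrow> is_initial D (Dom D p))) \<and>
           (\<forall>f c'. f \<in> Arr D \<and> Cod D f = s \<and> (\<forall>i \<in> I. is_base_change D f (c i) (c' i)) \<longrightarrow>
              is_coproduct D I (\<lambda>i. Dom D (c' i)) (Dom D f) c')))"

definition lambda_pretopos :: "'l rel \<Rightarrow> ('o, 'm) cat \<Rightarrow> bool" where
  "lambda_pretopos lam D \<longleftrightarrow>
     lambda_geometric lam D \<and> barr_exact D \<and> has_disjoint_stable_coproducts lam D"

section \<open>Trees and regularity\<close>

text \<open>
  A poset is a partial order relation \<open>r\<close> (with underlying set \<open>Field r\<close>);
  \<open>poset_op r\<close> is its opposite as a category, where the pair \<open>(v, u)\<close> is the arrow from \<open>v\<close> to a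
  smaller element \<open>u\<close>.
\<close>

definition poset_op :: "'v rel \<Rightarrow> ('v, 'v \<times> 'v) cat" where
  "poset_op r =
     \<lparr>Obj = Field r, Arr = r\<inverse>, Dom = fst, Cod = snd,
      Id = (\<lambda>v. (v, v)), Comp = (\<lambda>g f. (fst f, snd g))\<rparr>"

definition is_root :: "'v rel \<Rightarrow> 'v \<Rightarrow> bool" where
  "is_root P \<rho> \<longleftrightarrow> \<rho> \<in> Field P \<and> (\<forall>v \<in> Field P. (\<rho>, v) \<in> P)"

definition successors :: "'v rel \<Rightarrow> 'v \<Rightarrow> 'v set" where
  "successors P v =
     {w. (v, w) \<in> P \<and> v \<noteq> w \<and> (\<forall>z. (v, z) \<in> P \<and> (z, w) \<in> P \<longrightarrow> z = v \<or> z = w)}"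

definition branches :: "'v rel \<Rightarrow> 'v set set" where
  "branches P = {b \<in> Chains P. \<forall>b' \<in> Chains P. b \<subseteq> b' \<longrightarrow> b' = b}"

text \<open>Trees may be transfinite: the set below each vertex is well-ordered.  The length of a
  branch is its order type, compared with the initial ordinal \<open>kap\<close>.  The number of neighbours of a
  vertex is below the infinite cardinal \<open>lam\<close> iff the number of its immediate successors is.\<close>

definition is_tree :: "'l rel \<Rightarrow> 'k rel \<Rightarrow> 'v rel \<Rightarrow> bool" where
  "is_tree lam kap P \<longleftrightarrow>
     Partial_order P \<and> (\<exists>\<rho>. is_root P \<rho>) \<and>
     (\<forall>v \<in> Field P. Well_order (Restr P (underS P v))) \<and>
     (\<forall>v \<in> Field P. |successors P v| <o lam) \<and>
     (\<forall>b \<in> branches P. Restr P b <o kap)"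

text \<open>
  Limit preservation on a branch \<open>b\<close>: suprema in \<open>b\<close> of nonempty chains, i.e. cofiltered limits in
  the opposite of \<open>b\<close>, are sent to limits; equivalently, the values at vertices of limit height are
  the limits of the values below.  Preservation of the remaining limits that happen to exist in the
  linear order (its terminal object, binary products, \<open>\<dots>\<close>) is not meant: it would make the value at
  the root terminal.
\<close>

definition branch_continuous ::
  "('o, 'm) cat \<Rightarrow> 'v rel \<Rightarrow> ('v, 'v \<times> 'v, 'o, 'm) func \<Rightarrow> 'v set \<Rightarrow> bool" where
  "branch_continuous D P F b \<longleftrightarrow>
     (\<forall>S s. S \<subseteq> b \<and> S \<noteq> {} \<and> s \<in> b \<and> (\<forall>u \<in> S. (u, s) \<in> P) \<and>
        (\<forall>t \<in> b. (\<forall>u \<in> S. (u, t) \<in> P) \<longrightarrow> (s, t) \<in> P) \<longrightarrow>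
        is_limit (poset_op (Restr P S)) D F (FObj F s) (\<lambda>u. FArr F (s, u)))"

definition proper_diagram ::
  "('o, 'm) cat \<Rightarrow> 'v rel \<Rightarrow> ('v, 'v \<times> 'v, 'o, 'm) func \<Rightarrow> bool" where
  "proper_diagram D P F \<longleftrightarrow>
     is_functor (poset_op P) D F \<and>
     (\<forall>v \<in> Field P. successors P v \<noteq> {} \<longrightarrow>
        jointly_epi D (FObj F v) (successors P v) (\<lambda>w. FArr F (w, v))) \<and>
     (\<forall>b \<in> branches P. branch_continuous D P F b)"

definition completely_proper_diagram ::
  "('o, 'm) cat \<Rightarrow> 'v rel \<Rightarrow> ('v, 'v \<times> 'v, 'o, 'm) func \<Rightarrow> bool" where
  "completely_proper_diagram D P F \<longleftrightarrow>
     proper_diagram D P F \<and>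
     (\<exists>L p. (\<forall>b \<in> branches P. is_limit (poset_op (Restr P b)) D F (L b) (p b)) \<and>
        (\<forall>\<rho>. is_root P \<rho> \<longrightarrow> effective_epi_family D (FObj F \<rho>) (branches P) (\<lambda>b. p b \<rho>)))"

text \<open>
  The vertices of the trees below are partial functions from \<open>'k\<close> to \<open>'l\<close>.  This is no restriction:
  enumerating the successors of each vertex by elements of \<open>lam\<close>, a vertex of height \<open>\<alpha> < kap\<close> is
  described by the \<open>\<alpha>\<close>-sequence of the choices leading to it, up to copies of a vertex of limit
  height over the same predecessors.  Such copies do not matter, since keeping only one vertex (with
  what is above it) over each such set of predecessors leaves a proper diagram proper, with the
  remaining branches being branches of the original tree.
\<close>

definition lk_regular :: "'l rel \<Rightarrow> 'k rel \<Rightarrow> ('o, 'm) cat \<Rightarrow> bool" where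
  "lk_regular lam kap D \<longleftrightarrow>
     (\<forall>(P :: ('k \<Rightarrow> 'l option) rel) F.
        is_tree lam kap P \<and> proper_diagram D P F \<longrightarrow> completely_proper_diagram D P F)"

definition meets_distribute_over_joins :: "'l rel \<Rightarrow> 'k rel \<Rightarrow> ('o, 'm) cat \<Rightarrow> bool" where
  "meets_distribute_over_joins lam kap D \<longleftrightarrow>
     (\<forall>x \<in> Obj D. \<forall>(I :: 'k set) (J :: 'k \<Rightarrow> 'l set) a u m g.
        |I| <o kap \<and> (\<forall>i \<in> I. |J i| <o lam) \<and>
        (\<forall>i \<in> I. is_union D x (J i) (a i) (u i)) \<and> is_inter D x I u m \<and>
        (\<forall>f \<in> Pi\<^sub>E I J. is_inter D x I (\<lambda>i. a i (f i)) (g f)) \<longrightarrow>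
        is_union D x (Pi\<^sub>E I J) g m)"

definition lk_pretopos :: "'l rel \<Rightarrow> 'k rel \<Rightarrow> ('o, 'm) cat \<Rightarrow> bool" where
  "lk_pretopos lam kap D \<longleftrightarrow>
     lambda_pretopos lam D \<and> has_limits kap D \<and>
     meets_distribute_over_joins lam kap D \<and> lk_regular lam kap D"

definition weakly_boolean :: "('o, 'm) cat \<Rightarrow> bool" where
  "weakly_boolean D \<longleftrightarrow>
     (\<forall>x \<in> Obj D. \<forall>a \<in> Sub D x. \<forall>b \<in> Sub D x.
        sub_le D a b \<or>
        (\<exists>u \<in> Sub D x. \<not> is_initial D (Dom D u) \<and> sub_le D u a \<and>
           (\<exists>w. is_inter D x {u, b} id w \<and> is_initial D (Dom D w))))"

text \<open>The empty family is included, so a \<open>kap\<close>-prime ideal is proper.\<close>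

definition zero_kappa_prime :: "'k rel \<Rightarrow> ('o, 'm) cat \<Rightarrow> bool" where
  "zero_kappa_prime kap D \<longleftrightarrow>
     (\<forall>t (I :: 'k set) a w.
        is_terminal D t \<and> |I| <o kap \<and> is_inter D t I a w \<and> is_initial D (Dom D w) \<longrightarrow>
        (\<exists>i \<in> I. is_initial D (Dom D (a i))))"

section \<open>Ultraproducts\<close>

definition ultrafilter_on :: "'i set \<Rightarrow> 'i set set \<Rightarrow> bool" where
  "ultrafilter_on I U \<longleftrightarrow>
     U \<subseteq> Pow I \<and> I \<in> U \<and> {} \<notin> U \<and>
     (\<forall>J \<in> U. \<forall>K \<in> U. J \<inter> K \<in> U) \<and>
     (\<forall>J \<in> U. \<forall>K. J \<subseteq> K \<and> K \<subseteq> I \<longrightarrow> K \<in> U) \<and>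
     (\<forall>J. J \<subseteq> I \<longrightarrow> J \<in> U \<or> I - J \<in> U)"

text \<open>
  An ultraproduct of a family \<open>X\<close> along \<open>U\<close> consists of products \<open>FObj (udiag E) J\<close> of the \<open>X i\<close>,
  \<open>i \<in> J\<close>, for \<open>J \<in> U\<close>, with projections \<open>uproj E J i\<close>, made into a diagram by the projection
  maps (from \<open>J\<close> to \<open>K\<close> for \<open>K \<subseteq> J\<close>), and of a colimit \<open>uobj E\<close> of this diagram with cocone
  \<open>uinj E\<close>.
\<close>

record ('i, 'o, 'm) ultra =
  udiag :: "('i set, 'i set \<times> 'i set, 'o, 'm) func"
  uproj :: "'i set \<Rightarrow> 'i \<Rightarrow> 'm"
  uobj :: 'o
  uinj :: "'i set \<Rightarrow> 'm"

definition inclusion_order :: "'i set set \<Rightarrow> 'i set rel" where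
  "inclusion_order U = {(K, J). K \<in> U \<and> J \<in> U \<and> K \<subseteq> J}"

definition is_ultraproduct ::
  "('o, 'm) cat \<Rightarrow> 'i set set \<Rightarrow> ('i \<Rightarrow> 'o) \<Rightarrow> ('i, 'o, 'm) ultra \<Rightarrow> bool" where
  "is_ultraproduct D U X E \<longleftrightarrow>
     is_functor (poset_op (inclusion_order U)) D (udiag E) \<and>
     (\<forall>J \<in> U. is_product D J X (FObj (udiag E) J) (uproj E J)) \<and>
     (\<forall>J \<in> U. \<forall>K \<in> U. K \<subseteq> J \<longrightarrow>
        (\<forall>i \<in> K. Comp D (uproj E K i) (FArr (udiag E) (J, K)) = uproj E J i)) \<and>
     is_colimit (poset_op (inclusion_order U)) D (udiag E) (uobj E) (uinj E)"

text \<open>\<open>h\<close> is the map between ultraproducts induced by a family of maps \<open>f i\<close>.  The map \<open>m\<close> below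
  is the product of the \<open>f i\<close> over \<open>J\<close>.\<close>

definition is_ultraproduct_map ::
  "('o, 'm) cat \<Rightarrow> 'i set set \<Rightarrow> ('i, 'o, 'm) ultra \<Rightarrow> ('i, 'o, 'm) ultra \<Rightarrow>
   ('i \<Rightarrow> 'm) \<Rightarrow> 'm \<Rightarrow> bool" where
  "is_ultraproduct_map D U E E' f h \<longleftrightarrow>
     h \<in> hom D (uobj E) (uobj E') \<and>
     (\<forall>J \<in> U. \<forall>m \<in> hom D (FObj (udiag E) J) (FObj (udiag E') J).
        (\<forall>i \<in> J. Comp D (uproj E' J i) m = Comp D (f i) (uproj E J i)) \<longrightarrow>
        Comp D h (uinj E J) = Comp D (uinj E' J) m)"

text \<open>Ultraproducts in the functor category are pointwise.\<close>

definition is_functor_ultraproduct ::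
  "('a, 'b) cat \<Rightarrow> ('o, 'm) cat \<Rightarrow> 'i set set \<Rightarrow> ('i \<Rightarrow> ('a, 'b, 'o, 'm) func) \<Rightarrow>
   ('a, 'b, 'o, 'm) func \<Rightarrow> bool" where
  "is_functor_ultraproduct C D U F G \<longleftrightarrow>
     is_functor C D G \<and>
     (\<exists>E. (\<forall>c \<in> Obj C. is_ultraproduct D U (\<lambda>i. FObj (F i) c) (E c) \<and> uobj (E c) = FObj G c) \<and>
        (\<forall>f \<in> Arr C.
           is_ultraproduct_map D U (E (Dom C f)) (E (Cod C f)) (\<lambda>i. FArr (F i) f) (FArr G f)))"

end

theory Submission
  imports Defs
begin

text \<open>
  Over a pretopos one can argue with generalized elements \<open>z \<rightarrow> X\<close>, where existence and disjunction are
  only asked for after passing to a cover of \<open>z\<close> of size \<open>< lam\<close>.  An element of an ultraproduct is then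
  locally a family \<open>(\<xi>\<^sub>i)\<close>, \<open>i \<in> J \<in> U\<close>, of elements of the factors, and two families give the same element
  iff locally they agree on a member of \<open>U\<close>; this holds in the quotient of the coproduct of the partial
  products by the evident equivalence relation, hence in every ultraproduct.  In these terms the
  preservation of finite limits is immediate.  For regular epimorphisms one has to lift fewer than \<open>kap\<close>
  elements \<open>\<xi>\<^sub>i\<close> at once, which is regularity applied to the tower of partial wide pullbacks; for finite
  unions one has to choose disjuncts for fewer than \<open>kap\<close> elements at once, which is distributivity,
  and one of the finitely many choices is constant on a member of \<open>U\<close>.

  Weak Booleanness and primeness of \<open>0\<close> make the subobjects of \<open>1\<close> two-valued, so a nonzero object
  covers \<open>1\<close>.  If \<open>A\<^sub>i \<le> B\<^sub>i\<close> fails for all \<open>i\<close> in a member of \<open>U\<close>, then nonzero \<open>u\<^sub>i \<le> A\<^sub>i\<close> disjoint from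
  \<open>B\<^sub>i\<close> have elements simultaneously over a nonzero cover of \<open>1\<close>, and these form an element of the
  ultraproduct of the \<open>A\<^sub>i\<close> that cannot lie in that of the \<open>B\<^sub>i\<close>.
\<close>

section \<open>Arrows, subobjects and small limits\<close>

locale category_loc =
  fixes D :: "('o, 'm) cat"
  assumes category: "category D"
begin

abbreviation cmp (infixr "\<odot>" 70) where "g \<odot> f \<equiv> Comp D g f"

lemma hom_iff: "f \<in> hom D x y \<longleftrightarrow> f \<in> Arr D \<and> Dom D f = x \<and> Cod D f = y"
  by (simp add: hom_def)

lemma dom_obj [simp]: "f \<in> Arr D \<Longrightarrow> Dom D f \<in> Obj D"
  and cod_obj [simp]: "f \<in> Arr D \<Longrightarrow> Cod D f \<in> Obj D"
  using category unfolding category_def by blast+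

lemma id_arr [simp]: "x \<in> Obj D \<Longrightarrow> Id D x \<in> Arr D"
  and dom_id [simp]: "x \<in> Obj D \<Longrightarrow> Dom D (Id D x) = x"
  and cod_id [simp]: "x \<in> Obj D \<Longrightarrow> Cod D (Id D x) = x"
  using category unfolding category_def hom_def by blast+

lemma comp_arr [simp]: "\<lbrakk>f \<in> Arr D; g \<in> Arr D; Dom D g = Cod D f\<rbrakk> \<Longrightarrow> g \<odot> f \<in> Arr D"
  and dom_comp [simp]: "\<lbrakk>f \<in> Arr D; g \<in> Arr D; Dom D g = Cod D f\<rbrakk> \<Longrightarrow> Dom D (g \<odot> f) = Dom D f"
  and cod_comp [simp]: "\<lbrakk>f \<in> Arr D; g \<in> Arr D; Dom D g = Cod D f\<rbrakk> \<Longrightarrow> Cod D (g \<odot> f) = Cod D g"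
  using category unfolding category_def hom_def by blast+

lemma comp_id_right [simp]: "\<lbrakk>f \<in> Arr D; Dom D f = x\<rbrakk> \<Longrightarrow> f \<odot> Id D x = f"
  and comp_id_left [simp]: "\<lbrakk>f \<in> Arr D; Cod D f = x\<rbrakk> \<Longrightarrow> Id D x \<odot> f = f"
  using category unfolding category_def by blast+

lemma comp_assoc [simp]:
  "\<lbrakk>f \<in> Arr D; g \<in> Arr D; h \<in> Arr D; Dom D g = Cod D f; Dom D h = Cod D g\<rbrakk> \<Longrightarrow>
    (h \<odot> g) \<odot> f = h \<odot> (g \<odot> f)"
  using category unfolding category_def by metis

lemma comp_hom: "\<lbrakk>f \<in> hom D x y; g \<in> hom D y z\<rbrakk> \<Longrightarrow> g \<odot> f \<in> hom D x z"
  by (simp add: hom_iff)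

lemma comp_eq_assoc:
  "\<lbrakk>g \<odot> f = k; f \<in> Arr D; g \<in> Arr D; h \<in> Arr D; Dom D g = Cod D f; Dom D f = Cod D h\<rbrakk> \<Longrightarrow>
    g \<odot> (f \<odot> h) = k \<odot> h"
  by (metis comp_assoc)

lemma sub_leI: "\<lbrakk>h \<in> Arr D; b \<in> Arr D; Cod D h = Dom D b; b \<odot> h = a\<rbrakk> \<Longrightarrow> sub_le D a b"
  unfolding sub_le_def hom_def by fastforce

lemma sub_leE:
  assumes "sub_le D a b" "a \<in> Arr D"
  obtains h where "h \<in> Arr D" "Dom D h = Dom D a" "Cod D h = Dom D b" "b \<odot> h = a"
  using assms unfolding sub_le_def hom_def by blast

lemma sub_le_refl: "a \<in> Arr D \<Longrightarrow> sub_le D a a"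
  by (rule sub_leI[of "Id D (Dom D a)"]) auto

lemma sub_le_cod: "\<lbrakk>sub_le D a b; b \<in> Arr D\<rbrakk> \<Longrightarrow> Cod D a = Cod D b \<and> a \<in> Arr D"
  unfolding sub_le_def hom_def by auto

lemma sub_le_trans:
  assumes "sub_le D a b" "sub_le D b c" "c \<in> Arr D"
  shows "sub_le D a c"
proof -
  have b: "b \<in> Arr D" using sub_le_cod assms by blast
  have a: "a \<in> Arr D" using sub_le_cod assms b by blast
  obtain h where h: "h \<in> Arr D" "Dom D h = Dom D a" "Cod D h = Dom D b" "b \<odot> h = a"
    using assms a by (blast elim: sub_leE)
  obtain k where k: "k \<in> Arr D" "Dom D k = Dom D b" "Cod D k = Dom D c" "c \<odot> k = b"
    using assms b by (blast elim: sub_leE)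
  show ?thesis by (rule sub_leI[of "k \<odot> h"]) (use h k assms in \<open>auto simp flip: comp_assoc\<close>)
qed

lemma sub_le_precomp:
  "\<lbrakk>sub_le D a b; b \<in> Arr D; f \<in> Arr D; Cod D f = Dom D a\<rbrakk> \<Longrightarrow> sub_le D (a \<odot> f) b"
  by (metis sub_leI sub_le_cod sub_le_trans)

lemma sub_le_postcomp:
  assumes "sub_le D a b" "b \<in> Arr D" "g \<in> Arr D" "Dom D g = Cod D b"
  shows "sub_le D (g \<odot> a) (g \<odot> b)"
proof -
  obtain h where "h \<in> Arr D" "Dom D h = Dom D a" "Cod D h = Dom D b" "b \<odot> h = a"
    using assms sub_le_cod by (blast elim: sub_leE)
  then show ?thesis by (intro sub_leI[of h]) (use assms in auto)
qed

lemma sub_le_comp: "\<lbrakk>h \<in> Arr D; b \<in> Arr D; Cod D h = Dom D b\<rbrakk> \<Longrightarrow> sub_le D (b \<odot> h) b"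
  by (rule sub_leI) auto

lemma sub_le_of_Id: "\<lbrakk>sub_le D (Id D x) m; m \<in> Arr D; f \<in> Arr D; Cod D f = x\<rbrakk> \<Longrightarrow> sub_le D f m"
  by (metis cod_obj comp_id_left dom_id sub_le_precomp)

lemma Sub_iff: "a \<in> Sub D x \<longleftrightarrow> is_mono D a \<and> Cod D a = x"
  by (simp add: Sub_def)

lemma mono_arr: "is_mono D a \<Longrightarrow> a \<in> Arr D"
  by (simp add: is_mono_def)

lemma mono_cancel:
  "\<lbrakk>m \<odot> h = m \<odot> k; is_mono D m; h \<in> Arr D; k \<in> Arr D; Dom D h = Dom D k; Cod D h = Dom D m;
    Cod D k = Dom D m\<rbrakk> \<Longrightarrow> h = k"
  unfolding is_mono_def hom_def using dom_obj by blast

lemma monoI: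
  assumes "a \<in> Arr D"
    "\<And>h k. \<lbrakk>h \<in> Arr D; k \<in> Arr D; Dom D h = Dom D k; Cod D h = Dom D a; Cod D k = Dom D a;
      a \<odot> h = a \<odot> k\<rbrakk> \<Longrightarrow> h = k"
  shows "is_mono D a"
  using assms unfolding is_mono_def hom_def by auto

lemma mono_id: "x \<in> Obj D \<Longrightarrow> is_mono D (Id D x)"
  by (rule monoI) auto

lemma mono_comp:
  assumes "is_mono D m" "is_mono D n" "Cod D n = Dom D m"
  shows "is_mono D (m \<odot> n)"
proof (rule monoI)
  show "m \<odot> n \<in> Arr D" using assms mono_arr by simp
next
  fix h k
  assume *: "h \<in> Arr D" "k \<in> Arr D" "Dom D h = Dom D k" "Cod D h = Dom D (m \<odot> n)"
    "Cod D k = Dom D (m \<odot> n)" "(m \<odot> n) \<odot> h = (m \<odot> n) \<odot> k"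
  have a: "m \<in> Arr D" "n \<in> Arr D" using assms mono_arr by auto
  have "m \<odot> (n \<odot> h) = m \<odot> (n \<odot> k)" using * a assms by simp
  then have "n \<odot> h = n \<odot> k" using mono_cancel[of m "n \<odot> h" "n \<odot> k"] * a assms by simp
  then show "h = k" using mono_cancel[of n h k] * a assms by simp
qed

lemma pullback_facts:
  assumes "is_pullback D f g p q"
  shows "f \<in> Arr D" "g \<in> Arr D" "Cod D f = Cod D g" "p \<in> Arr D" "q \<in> Arr D" "Dom D q = Dom D p"
    "Cod D p = Dom D f" "Cod D q = Dom D g" "f \<odot> p = g \<odot> q"
  using assms unfolding is_pullback_def by auto

lemma pullback_ex1:
  assumes "is_pullback D f g p q" "y \<in> Obj D" "h \<in> hom D y (Dom D f)" "k \<in> hom D y (Dom D g)"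
    "f \<odot> h = g \<odot> k"
  shows "\<exists>!u. u \<in> hom D y (Dom D p) \<and> p \<odot> u = h \<and> q \<odot> u = k"
proof -
  have *: "\<forall>y \<in> Obj D. \<forall>h \<in> hom D y (Dom D f). \<forall>k \<in> hom D y (Dom D g). f \<odot> h = g \<odot> k \<longrightarrow>
        (\<exists>!u. u \<in> hom D y (Dom D p) \<and> p \<odot> u = h \<and> q \<odot> u = k)"
    using assms(1) unfolding is_pullback_def by (elim conjE) assumption
  show ?thesis by (rule *[rule_format]) (rule assms)+
qed

lemma pullback_lift:
  assumes "is_pullback D f g p q" "h \<in> Arr D" "k \<in> Arr D" "Dom D h = Dom D k"
    "Cod D h = Dom D f" "Cod D k = Dom D g" "f \<odot> h = g \<odot> k"
  obtains u where "u \<in> Arr D" "Dom D u = Dom D h" "Cod D u = Dom D p" "p \<odot> u = h" "q \<odot> u = k"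
proof -
  have "\<exists>!u. u \<in> hom D (Dom D h) (Dom D p) \<and> p \<odot> u = h \<and> q \<odot> u = k"
    by (rule pullback_ex1[OF assms(1)]) (use assms in \<open>auto simp: hom_iff\<close>)
  then obtain u where "u \<in> hom D (Dom D h) (Dom D p) \<and> p \<odot> u = h \<and> q \<odot> u = k" by (elim ex1E)
  then show ?thesis by (intro that[of u]) (simp_all add: hom_iff)
qed

lemma pullback_unique:
  assumes "is_pullback D f g p q" "h \<in> Arr D" "k \<in> Arr D" "Dom D h = Dom D k"
    "Cod D h = Dom D p" "Cod D k = Dom D p" "p \<odot> h = p \<odot> k" "q \<odot> h = q \<odot> k"
  shows "h = k"
proof -
  note pf = pullback_facts[OF assms(1)]
  have e: "f \<odot> (p \<odot> h) = g \<odot> (q \<odot> h)"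
    using pf(1-8) assms(2-) comp_eq_assoc[OF pf(9)] by simp
  have "\<exists>!u. u \<in> hom D (Dom D h) (Dom D p) \<and> p \<odot> u = p \<odot> h \<and> q \<odot> u = q \<odot> h"
    by (rule pullback_ex1[OF assms(1)]) (use e pf(1-8) assms(2-6) in \<open>auto simp: hom_iff\<close>)
  moreover have "h \<in> hom D (Dom D h) (Dom D p) \<and> p \<odot> h = p \<odot> h \<and> q \<odot> h = q \<odot> h"
    using assms by (simp add: hom_iff)
  moreover have "k \<in> hom D (Dom D h) (Dom D p) \<and> p \<odot> k = p \<odot> h \<and> q \<odot> k = q \<odot> h"
    using assms by (simp add: hom_iff)
  ultimately show ?thesis by (elim ex1E) metis
qed

lemma pullback_mono:
  assumes "is_pullback D f g p q" "is_mono D g"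
  shows "is_mono D p"
proof (rule monoI)
  note pf = pullback_facts[OF assms(1)]
  show "p \<in> Arr D" using pf by simp
  fix h k
  assume *: "h \<in> Arr D" "k \<in> Arr D" "Dom D h = Dom D k" "Cod D h = Dom D p"
    "Cod D k = Dom D p" "p \<odot> h = p \<odot> k"
  have "g \<odot> (q \<odot> h) = f \<odot> (p \<odot> h)" "g \<odot> (q \<odot> k) = f \<odot> (p \<odot> k)"
    using pf * by (metis comp_assoc)+
  then have "g \<odot> (q \<odot> h) = g \<odot> (q \<odot> k)" using * by simp
  then have "q \<odot> h = q \<odot> k"
    using mono_cancel[of g "q \<odot> h" "q \<odot> k"] pf * assms by simp
  then show "h = k" using pullback_unique[OF assms(1)] * by blast
qed

lemma product_facts:
  assumes "is_product D I X x p"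
  shows "x \<in> Obj D" "\<And>i. i \<in> I \<Longrightarrow> p i \<in> Arr D" "\<And>i. i \<in> I \<Longrightarrow> Dom D (p i) = x"
    "\<And>i. i \<in> I \<Longrightarrow> Cod D (p i) = X i"
  using assms unfolding is_product_def hom_def by auto

lemma product_ex1:
  assumes "is_product D I X x p" "y \<in> Obj D" "\<And>i. i \<in> I \<Longrightarrow> q i \<in> hom D y (X i)"
  shows "\<exists>!h. h \<in> hom D y x \<and> (\<forall>i \<in> I. p i \<odot> h = q i)"
proof -
  have "\<forall>y \<in> Obj D. \<forall>q. (\<forall>i \<in> I. q i \<in> hom D y (X i)) \<longrightarrow>
        (\<exists>!h. h \<in> hom D y x \<and> (\<forall>i \<in> I. p i \<odot> h = q i))"
    using assms(1) unfolding is_product_def by (elim conjE) assumption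
  then show ?thesis using assms(2,3) by (elim ballE allE[of _ q] impE) auto
qed

lemma product_lift:
  assumes "is_product D I X x p" "y \<in> Obj D" "\<And>i. i \<in> I \<Longrightarrow> q i \<in> hom D y (X i)"
  obtains h where "h \<in> Arr D" "Dom D h = y" "Cod D h = x" "\<And>i. i \<in> I \<Longrightarrow> p i \<odot> h = q i"
proof -
  have "\<exists>!h. h \<in> hom D y x \<and> (\<forall>i \<in> I. p i \<odot> h = q i)" by (rule product_ex1[OF assms])
  then obtain h where "h \<in> hom D y x \<and> (\<forall>i \<in> I. p i \<odot> h = q i)" by (elim ex1E)
  then show ?thesis by (intro that[of h]) (simp_all add: hom_iff)
qed

lemma product_exists:
  assumes "is_product D I X x p" "y \<in> Obj D" "\<And>i. i \<in> I \<Longrightarrow> q i \<in> hom D y (X i)"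
  shows "\<exists>h. h \<in> Arr D \<and> Dom D h = y \<and> Cod D h = x \<and> (\<forall>i\<in>I. p i \<odot> h = q i)"
proof -
  have "\<exists>!h. h \<in> hom D y x \<and> (\<forall>i \<in> I. p i \<odot> h = q i)"
    by (rule product_ex1[OF assms(1,2)]) (rule assms(3))
  then obtain h where "h \<in> hom D y x \<and> (\<forall>i \<in> I. p i \<odot> h = q i)" by (elim ex1E)
  then show ?thesis by (intro exI[of _ h]) (simp add: hom_iff)
qed

lemma product_unique:
  assumes "is_product D I X x p" "h \<in> Arr D" "k \<in> Arr D" "Dom D h = Dom D k" "Cod D h = x"
    "Cod D k = x" "\<And>i. i \<in> I \<Longrightarrow> p i \<odot> h = p i \<odot> k"
  shows "h = k"
proof -
  note pf = product_facts[OF assms(1)]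
  have "\<exists>!u. u \<in> hom D (Dom D h) x \<and> (\<forall>i\<in>I. p i \<odot> u = p i \<odot> h)"
    by (rule product_ex1[OF assms(1)]) (use pf assms(2-6) in \<open>auto simp: hom_iff\<close>)
  moreover have "h \<in> hom D (Dom D h) x \<and> (\<forall>i\<in>I. p i \<odot> h = p i \<odot> h)"
    "k \<in> hom D (Dom D h) x \<and> (\<forall>i\<in>I. p i \<odot> k = p i \<odot> h)"
    using assms by (simp_all add: hom_iff)
  ultimately show ?thesis by (elim ex1E) metis
qed

definition is_equalizer :: "'m \<Rightarrow> 'm \<Rightarrow> 'm \<Rightarrow> bool" where
  "is_equalizer f g e \<longleftrightarrow> is_mono D e \<and> Cod D e = Dom D f \<and> f \<odot> e = g \<odot> e \<and>
     (\<forall>h \<in> Arr D. Cod D h = Dom D f \<and> f \<odot> h = g \<odot> h \<longrightarrow> sub_le D h e)"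

definition is_wide_pullback :: "'o \<Rightarrow> 'i set \<Rightarrow> ('i \<Rightarrow> 'm) \<Rightarrow> 'm \<Rightarrow> ('i \<Rightarrow> 'm) \<Rightarrow> bool" where
  "is_wide_pullback z I w p0 p \<longleftrightarrow>
     p0 \<in> Arr D \<and> Cod D p0 = z \<and>
     (\<forall>i\<in>I. p i \<in> Arr D \<and> Dom D (p i) = Dom D p0 \<and> Cod D (p i) = Dom D (w i) \<and> w i \<odot> p i = p0) \<and>
     (\<forall>t q. t \<in> Arr D \<and> Cod D t = z \<and>
        (\<forall>i\<in>I. q i \<in> Arr D \<and> Dom D (q i) = Dom D t \<and> Cod D (q i) = Dom D (w i) \<and> w i \<odot> q i = t) \<longrightarrow>
        (\<exists>!h. h \<in> hom D (Dom D t) (Dom D p0) \<and> p0 \<odot> h = t \<and> (\<forall>i\<in>I. p i \<odot> h = q i)))"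

lemma wide_pullback_facts:
  assumes "is_wide_pullback z I w p0 p"
  shows "p0 \<in> Arr D" "Cod D p0 = z" "\<And>i. i \<in> I \<Longrightarrow> p i \<in> Arr D"
    "\<And>i. i \<in> I \<Longrightarrow> Dom D (p i) = Dom D p0" "\<And>i. i \<in> I \<Longrightarrow> Cod D (p i) = Dom D (w i)"
    "\<And>i. i \<in> I \<Longrightarrow> w i \<odot> p i = p0"
  using assms unfolding is_wide_pullback_def by auto

lemma wide_pullback_ex1:
  assumes "is_wide_pullback z I w p0 p" "t \<in> Arr D" "Cod D t = z"
    "\<And>i. i \<in> I \<Longrightarrow> q i \<in> Arr D \<and> Dom D (q i) = Dom D t \<and> Cod D (q i) = Dom D (w i) \<and> w i \<odot> q i = t"
  shows "\<exists>!h. h \<in> hom D (Dom D t) (Dom D p0) \<and> p0 \<odot> h = t \<and> (\<forall>i\<in>I. p i \<odot> h = q i)"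
proof -
  have "\<forall>t q. t \<in> Arr D \<and> Cod D t = z \<and>
        (\<forall>i\<in>I. q i \<in> Arr D \<and> Dom D (q i) = Dom D t \<and> Cod D (q i) = Dom D (w i) \<and> w i \<odot> q i = t) \<longrightarrow>
        (\<exists>!h. h \<in> hom D (Dom D t) (Dom D p0) \<and> p0 \<odot> h = t \<and> (\<forall>i\<in>I. p i \<odot> h = q i))"
    using assms(1) unfolding is_wide_pullback_def by (elim conjE) assumption
  then show ?thesis using assms(2-) by (elim allE[of _ t] allE[of _ q] impE) auto
qed

lemma wide_pullback_lift:
  assumes "is_wide_pullback z I w p0 p" "t \<in> Arr D" "Cod D t = z"
    "\<And>i. i \<in> I \<Longrightarrow> q i \<in> Arr D \<and> Dom D (q i) = Dom D t \<and> Cod D (q i) = Dom D (w i) \<and> w i \<odot> q i = t"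
  obtains h where "h \<in> Arr D" "Dom D h = Dom D t" "Cod D h = Dom D p0" "p0 \<odot> h = t"
    "\<And>i. i \<in> I \<Longrightarrow> p i \<odot> h = q i"
proof -
  have "\<exists>!h. h \<in> hom D (Dom D t) (Dom D p0) \<and> p0 \<odot> h = t \<and> (\<forall>i\<in>I. p i \<odot> h = q i)"
    by (rule wide_pullback_ex1[OF assms])
  then obtain h where "h \<in> hom D (Dom D t) (Dom D p0) \<and> p0 \<odot> h = t \<and> (\<forall>i\<in>I. p i \<odot> h = q i)"
    by (elim ex1E)
  then show ?thesis by (intro that[of h]) (simp_all add: hom_iff)
qed

lemma wide_pullback_unique:
  assumes "is_wide_pullback z I w p0 p" "h \<in> Arr D" "k \<in> Arr D" "Dom D h = Dom D k"
    "Cod D h = Dom D p0" "Cod D k = Dom D p0" "p0 \<odot> h = p0 \<odot> k"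
    "\<And>i. i \<in> I \<Longrightarrow> w i \<in> Arr D"
    "\<And>i. i \<in> I \<Longrightarrow> p i \<odot> h = p i \<odot> k"
  shows "h = k"
proof -
  note pf = wide_pullback_facts[OF assms(1)]
  have 1: "w i \<odot> (p i \<odot> h) = p0 \<odot> h" if "i \<in> I" for i
    using that by (intro comp_eq_assoc[OF pf(6)]) (use pf assms in auto)
  have "\<exists>!u. u \<in> hom D (Dom D (p0 \<odot> h)) (Dom D p0) \<and> p0 \<odot> u = p0 \<odot> h \<and> (\<forall>i\<in>I. p i \<odot> u = p i \<odot> h)"
    by (rule wide_pullback_ex1[OF assms(1)]) (use 1 pf assms(2-6) in auto)
  moreover have "h \<in> hom D (Dom D (p0 \<odot> h)) (Dom D p0) \<and> p0 \<odot> h = p0 \<odot> h \<and> (\<forall>i\<in>I. p i \<odot> h = p i \<odot> h)"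
    "k \<in> hom D (Dom D (p0 \<odot> h)) (Dom D p0) \<and> p0 \<odot> k = p0 \<odot> h \<and> (\<forall>i\<in>I. p i \<odot> k = p i \<odot> h)"
    using assms(2-7,9) pf(1) by (simp_all add: hom_iff)
  ultimately show ?thesis by (elim ex1E) metis
qed

lemma iso_of_Id_le:
  assumes "is_mono D m" "sub_le D (Id D (Cod D m)) m"
  obtains s where "s \<in> Arr D" "Dom D s = Cod D m" "Cod D s = Dom D m" "m \<odot> s = Id D (Cod D m)"
    "s \<odot> m = Id D (Dom D m)"
proof -
  have m: "m \<in> Arr D" using assms mono_arr by simp
  obtain s where s: "s \<in> Arr D" "Dom D s = Cod D m" "Cod D s = Dom D m" "m \<odot> s = Id D (Cod D m)"
    using assms m by (auto elim!: sub_leE)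
  have "m \<odot> (s \<odot> m) = m \<odot> Id D (Dom D m)" using s m comp_eq_assoc[OF s(4)] by simp
  then have "s \<odot> m = Id D (Dom D m)" using mono_cancel[OF _ assms(1)] s m by simp
  then show ?thesis using s that by blast
qed

end

lemma (in category_loc) ex_equalizer:
  assumes fl: "has_limits natLeq D"
    and fg: "f \<in> Arr D" "g \<in> Arr D" "Dom D f = Dom D g" "Cod D f = Cod D g"
  shows "\<exists>e. is_equalizer f g e"
proof -
  define J :: "(nat, nat) cat" where
    "J = \<lparr>Obj = {0,1}, Arr = {0,1,2,3}, Dom = (\<lambda>a. if a = 1 then 1 else 0),
      Cod = (\<lambda>a. if a = 0 then 0 else 1), Id = (\<lambda>a. a), Comp = (\<lambda>b a. if a < 2 then b else a)\<rparr>"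
  define F where "F = \<lparr>FObj = (\<lambda>j::nat. if j = 0 then Dom D f else Cod D f),
    FArr = (\<lambda>a::nat. if a = 0 then Id D (Dom D f) else if a = 1 then Id D (Cod D f) else if a = 2 then f else g)\<rparr>"
  have "category J" unfolding category_def hom_def J_def by auto
  moreover have "is_functor J D F" unfolding is_functor_def
  proof (intro conjI ballI impI)
    fix a b assume *: "a \<in> Arr J" "b \<in> Arr J" "Dom J b = Cod J a"
    have ab: "a \<in> {0,1,2,3}" "b \<in> {0,1,2,3}" using *(1,2) unfolding J_def by simp_all
    have "(if b = 1 then 1 else 0) = (if a = 0 then 0 else 1 :: nat)" using *(3) unfolding J_def by simp
    then have ab3: "if a = 0 then b \<noteq> 1 else b = 1" by presburger
    show "FArr F (Comp J b a) = FArr F b \<odot> FArr F a"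
    proof (cases "a = 0")
      case True
      have "b \<in> {0,2,3}" using ab(2) ab3 True by auto
      then show ?thesis unfolding True by (elim insertE emptyE) (simp_all add: J_def F_def fg)
    next
      case False
      then have "b = 1" "a \<in> {1,2,3}" using ab(1) ab3 by auto
      then show ?thesis by (elim insertE emptyE) (simp_all add: J_def F_def fg)
    qed
  next
    fix a assume "a \<in> Arr J"
    then have "a \<in> {0,1,2,3}" unfolding J_def by simp
    then show "FArr F a \<in> hom D (FObj F (Dom J a)) (FObj F (Cod J a))"
      by (elim insertE emptyE) (simp_all add: J_def F_def fg hom_iff)
  qed (auto simp: J_def F_def fg)
  moreover have "|Arr J| <o natLeq" unfolding J_def by (simp flip: finite_iff_ordLess_natLeq)
  ultimately obtain x p where lim: "is_limit J D F x p"
    using fl unfolding has_limits_def by blast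
  then have cone: "is_cone J D F x p" unfolding is_limit_def by simp
  define e where "e = p 0"
  have p: "e \<in> Arr D" "Dom D e = x" "Cod D e = Dom D f" "f \<odot> e = p 1" "g \<odot> e = p 1" "x \<in> Obj D"
  proof -
    have c: "x \<in> Obj D" "\<And>j. j \<in> Obj J \<Longrightarrow> p j \<in> hom D x (FObj F j)"
      "\<And>a. a \<in> Arr J \<Longrightarrow> FArr F a \<odot> p (Dom J a) = p (Cod J a)"
      using cone unfolding is_cone_def by auto
    show "x \<in> Obj D" by fact
    show "e \<in> Arr D" "Dom D e = x" "Cod D e = Dom D f"
      using c(2)[of 0] unfolding e_def J_def F_def by (auto simp: hom_iff)
    show "f \<odot> e = p 1" "g \<odot> e = p 1"
      using c(3)[of 2] c(3)[of 3] unfolding e_def J_def F_def by auto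
  qed
  have uni: "\<exists>!u. u \<in> hom D (Dom D h) x \<and> e \<odot> u = h \<and> p 1 \<odot> u = f \<odot> h"
    if "h \<in> Arr D" "Cod D h = Dom D f" "f \<odot> h = g \<odot> h" for h
  proof -
    have "is_cone J D F (Dom D h) (\<lambda>j. if j = 0 then h else f \<odot> h)"
      unfolding is_cone_def
    proof (intro conjI ballI)
      fix a assume "a \<in> Arr J"
      then have "a \<in> {0,1,2,3}" unfolding J_def by simp
      then show "FArr F a \<odot> (if Dom J a = 0 then h else f \<odot> h) = (if Cod J a = 0 then h else f \<odot> h)"
        using that by (elim insertE emptyE) (simp_all add: J_def F_def fg)
    qed (use that fg in \<open>auto simp: J_def F_def hom_iff\<close>)
    then have "\<exists>!u. u \<in> hom D (Dom D h) x \<and> (\<forall>j \<in> Obj J. p j \<odot> u = (if j = 0 then h else f \<odot> h))"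
      using lim unfolding is_limit_def by blast
    then show ?thesis unfolding J_def e_def by simp
  qed
  have "is_equalizer f g e" unfolding is_equalizer_def
  proof (intro conjI ballI impI)
    show "is_mono D e"
    proof (rule monoI)
      fix h k assume *: "h \<in> Arr D" "k \<in> Arr D" "Dom D h = Dom D k" "Cod D h = Dom D e"
        "Cod D k = Dom D e" "e \<odot> h = e \<odot> k"
      have e: "f \<odot> (e \<odot> u) = p 1 \<odot> u" "f \<odot> (e \<odot> u) = g \<odot> (e \<odot> u)"
        if "u \<in> Arr D" "Cod D u = x" for u
        using p fg that by (metis comp_assoc)+
      have "\<exists>!u. u \<in> hom D (Dom D (e \<odot> h)) x \<and> e \<odot> u = e \<odot> h \<and> p 1 \<odot> u = f \<odot> (e \<odot> h)"
        by (rule uni) (use * p fg e in auto)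
      moreover have ph: "p 1 \<odot> h = f \<odot> (e \<odot> h)" using e(1)[of h] * p by simp
      moreover have "p 1 \<odot> k = f \<odot> (e \<odot> h)" unfolding *(6) using e(1)[of k] * p by simp
      moreover have "h \<in> hom D (Dom D (e \<odot> h)) x" "k \<in> hom D (Dom D (e \<odot> h)) x"
        using * p by (simp_all add: hom_iff)
      ultimately show "h = k" using *(6) by (elim ex1E) metis
    qed (use p in auto)
    fix h assume "h \<in> Arr D" "Cod D h = Dom D f \<and> f \<odot> h = g \<odot> h"
    then have "\<exists>!u. u \<in> hom D (Dom D h) x \<and> e \<odot> u = h \<and> p 1 \<odot> u = f \<odot> h" using uni by simp
    then obtain u where "u \<in> hom D (Dom D h) x \<and> e \<odot> u = h \<and> p 1 \<odot> u = f \<odot> h" by (elim ex1E)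
    then show "sub_le D h e" by (intro sub_leI[of u]) (use p in \<open>auto simp: hom_iff\<close>)
  qed (use p in auto)
  then show ?thesis by blast
qed

lemma (in category_loc) ex_product_of_limits:
  fixes r :: "'k rel" and I :: "'i set"
  assumes lims: "has_limits r D" and r: "Card_order r" and I: "|I| <o r"
    and X: "\<And>i. i \<in> I \<Longrightarrow> X i \<in> Obj D"
  shows "\<exists>x p. is_product D I X x p"
proof -
  obtain K :: "'k set" where K: "|I| =o |K|" "|K| <o r"
    using internalize_card_of_ordLess[of I r] I by blast
  obtain \<phi> where \<phi>: "bij_betw \<phi> I K" using K(1) card_of_ordIso by blast
  define \<psi> where "\<psi> = inv_into I \<phi>"
  have \<psi>: "\<psi> k \<in> I" "\<phi> (\<psi> k) = k" if "k \<in> K" for k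
    using bij_betw_inv_into_right[OF \<phi>] that bij_betw_apply[OF bij_betw_inv_into[OF \<phi>]] unfolding \<psi>_def by auto
  have \<phi>': "\<phi> i \<in> K" "\<psi> (\<phi> i) = i" if "i \<in> I" for i
    using bij_betw_inv_into_left[OF \<phi>] that bij_betw_apply[OF \<phi>] unfolding \<psi>_def by auto
  define J :: "('k, 'k) cat" where
    "J = \<lparr>Obj = K, Arr = K, Dom = (\<lambda>a. a), Cod = (\<lambda>a. a), Id = (\<lambda>a. a), Comp = (\<lambda>b a. a)\<rparr>"
  define F where "F = \<lparr>FObj = (\<lambda>j. X (\<psi> j)), FArr = (\<lambda>a. Id D (X (\<psi> a)))\<rparr>"
  have "category J" unfolding category_def hom_def J_def by auto
  moreover have "is_functor J D F" unfolding is_functor_def hom_def J_def F_def using X \<psi> by auto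
  moreover have "|Arr J| <o r" unfolding J_def using K by simp
  ultimately obtain x p where lim: "is_limit J D F x p"
    using lims unfolding has_limits_def by blast
  have cone_iff: "is_cone J D F y q \<longleftrightarrow> y \<in> Obj D \<and> (\<forall>k\<in>K. q k \<in> hom D y (X (\<psi> k)))" for y q
    unfolding is_cone_def J_def F_def hom_def by auto
  have "is_product D I X x (\<lambda>i. p (\<phi> i))" unfolding is_product_def
  proof (intro conjI ballI allI impI)
    have "is_cone J D F x p" using lim unfolding is_limit_def by simp
    then show "x \<in> Obj D" "\<And>i. i \<in> I \<Longrightarrow> p (\<phi> i) \<in> hom D x (X i)" unfolding cone_iff using \<phi>' by force+
    fix y q assume *: "y \<in> Obj D" "\<forall>i\<in>I. q i \<in> hom D y (X i)"
    have "is_cone J D F y (\<lambda>k. q (\<psi> k))" unfolding cone_iff using * \<psi> by auto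
    then have "\<exists>!h. h \<in> hom D y x \<and> (\<forall>j\<in>Obj J. p j \<odot> h = q (\<psi> j))"
      using lim unfolding is_limit_def by blast
    moreover have "(\<forall>j\<in>Obj J. p j \<odot> h = q (\<psi> j)) = (\<forall>i\<in>I. p (\<phi> i) \<odot> h = q i)" for h
      unfolding J_def using \<phi>' \<psi> by (simp, metis)
    ultimately show "\<exists>!h. h \<in> hom D y x \<and> (\<forall>i\<in>I. p (\<phi> i) \<odot> h = q i)" by simp
  qed
  then show ?thesis by blast
qed

lemma (in category_loc) ex_wide_pullback:
  fixes r :: "'k rel" and I :: "'i set"
  assumes fl: "has_limits natLeq D" and lims: "has_limits r D" and r: "Card_order r" "natLeq \<le>o r"
    and I: "|I| <o r" and z: "z \<in> Obj D" and w: "\<And>i. i \<in> I \<Longrightarrow> w i \<in> Arr D \<and> Cod D (w i) = z"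
  shows "\<exists>p0 p. is_wide_pullback z I w p0 p"
proof -
  define K where "K = insert None (Some ` I)"
  have "|{None} \<union> Some ` I| <o r"
  proof (rule card_of_Un_ordLess_infinite_Field)
    show "\<not> finite (Field r)" "Card_order r"
      using r cinfinite_mono[OF r(2) natLeq_cinfinite] unfolding cinfinite_def by auto
    show "|{None}| <o r" using r finite_iff_ordLess_natLeq ordLess_ordLeq_trans by blast
    show "|Some ` I| <o r" using I card_of_image ordLeq_ordLess_trans by blast
  qed
  then have K: "|K| <o r" unfolding K_def by simp
  define X where "X = (\<lambda>k. case k of None \<Rightarrow> z | Some i \<Rightarrow> Dom D (w i))"
  have "\<And>k. k \<in> K \<Longrightarrow> X k \<in> Obj D" unfolding K_def X_def using z w by auto
  then obtain P \<pi> where P: "is_product D K X P \<pi>"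
    using ex_product_of_limits[OF lims r(1) K] by blast
  obtain Z \<rho> where Z: "is_product D I (\<lambda>i. z) Z \<rho>"
    using ex_product_of_limits[OF lims r(1) I, of "\<lambda>i. z"] z by blast
  note Pf = product_facts[OF P] and Zf = product_facts[OF Z]
  have K0: "None \<in> K" "\<And>i. i \<in> I \<Longrightarrow> Some i \<in> K" unfolding K_def by auto
  have \<pi>0: "\<pi> None \<in> Arr D" "Dom D (\<pi> None) = P" "Cod D (\<pi> None) = z"
    using Pf K0(1) unfolding X_def by auto
  have \<pi>s: "\<pi> (Some i) \<in> Arr D" "Dom D (\<pi> (Some i)) = P" "Cod D (\<pi> (Some i)) = Dom D (w i)"
    if "i \<in> I" for i
    using Pf K0(2) that unfolding X_def by auto
  have "w i \<odot> \<pi> (Some i) \<in> hom D P z" if "i \<in> I" for i using \<pi>s[OF that] w[OF that] by (simp add: hom_iff)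
  with product_lift[OF Z Pf(1), of "\<lambda>i. w i \<odot> \<pi> (Some i)"]
  obtain a where a: "a \<in> Arr D" "Dom D a = P" "Cod D a = Z" "\<And>i. i \<in> I \<Longrightarrow> \<rho> i \<odot> a = w i \<odot> \<pi> (Some i)"
    by blast
  have "\<pi> None \<in> hom D P z" if "i \<in> I" for i using \<pi>0 by (simp add: hom_iff)
  with product_lift[OF Z Pf(1), of "\<lambda>i. \<pi> None"]
  obtain b where b: "b \<in> Arr D" "Dom D b = P" "Cod D b = Z" "\<And>i. i \<in> I \<Longrightarrow> \<rho> i \<odot> b = \<pi> None"
    by blast
  obtain e where e: "is_equalizer a b e" using ex_equalizer[OF fl, of a b] a b by auto
  then have ef: "is_mono D e" "e \<in> Arr D" "Cod D e = P" "a \<odot> e = b \<odot> e"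
    unfolding is_equalizer_def using a mono_arr by auto
  define p0 where "p0 = \<pi> None \<odot> e"
  define p where "p = (\<lambda>i. \<pi> (Some i) \<odot> e)"
  have p0: "p0 \<in> Arr D" "Dom D p0 = Dom D e" "Cod D p0 = z" unfolding p0_def using \<pi>0 ef by auto
  have p: "p i \<in> Arr D" "Dom D (p i) = Dom D e" "Cod D (p i) = Dom D (w i)" if "i \<in> I" for i
    unfolding p_def using \<pi>s[OF that] ef by auto
  have wp: "w i \<odot> p i = p0" if "i \<in> I" for i
  proof -
    have "w i \<odot> p i = (\<rho> i \<odot> a) \<odot> e" unfolding a(4)[OF that] p_def using \<pi>s[OF that] w[OF that] ef by simp
    also have "\<dots> = \<rho> i \<odot> (b \<odot> e)" using a(1-3) ef Zf(2-4)[OF that] by simp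
    also have "\<dots> = (\<rho> i \<odot> b) \<odot> e" using b(1-3) ef Zf(2-4)[OF that] by simp
    finally show ?thesis unfolding b(4)[OF that] p0_def .
  qed
  have "is_wide_pullback z I w p0 p" unfolding is_wide_pullback_def
  proof (intro conjI ballI allI impI)
    fix t q assume *: "t \<in> Arr D \<and> Cod D t = z \<and>
       (\<forall>i\<in>I. q i \<in> Arr D \<and> Dom D (q i) = Dom D t \<and> Cod D (q i) = Dom D (w i) \<and> w i \<odot> q i = t)"
    have "(case k of None \<Rightarrow> t | Some i \<Rightarrow> q i) \<in> hom D (Dom D t) (X k)" if "k \<in> K" for k
      using that * unfolding K_def X_def by (auto simp: hom_iff)
    then obtain h' where h': "h' \<in> Arr D" "Dom D h' = Dom D t" "Cod D h' = P"
      and h'': "\<And>k. k \<in> K \<Longrightarrow> \<pi> k \<odot> h' = (case k of None \<Rightarrow> t | Some i \<Rightarrow> q i)"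
      using product_lift[OF P, of "Dom D t" "\<lambda>k. case k of None \<Rightarrow> t | Some i \<Rightarrow> q i"] * by auto
    have "a \<odot> h' = b \<odot> h'"
    proof (rule product_unique[OF Z])
      fix i assume i: "i \<in> I"
      have "\<rho> i \<odot> (a \<odot> h') = (w i \<odot> \<pi> (Some i)) \<odot> h'"
        using comp_eq_assoc[OF a(4)[OF i]] Zf(2-4)[OF i] a(1-3) h' by simp
      also have "\<dots> = w i \<odot> q i" using h''[OF K0(2)[OF i]] \<pi>s[OF i] w[OF i] h' by simp
      also have "\<dots> = t" using * i by simp
      also have "t = \<rho> i \<odot> (b \<odot> h')"
        using comp_eq_assoc[OF b(4)[OF i]] h''[OF K0(1)] Zf(2-4)[OF i] b(1-3) h' by simp
      finally show "\<rho> i \<odot> (a \<odot> h') = \<rho> i \<odot> (b \<odot> h')" .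
    qed (use a(1-3) b(1-3) h' in auto)
    then have "sub_le D h' e" using e h' a unfolding is_equalizer_def by simp
    then obtain h where h: "h \<in> Arr D" "Dom D h = Dom D t" "Cod D h = Dom D e" "e \<odot> h = h'"
      using h' by (metis sub_leE)
    show "\<exists>!h. h \<in> hom D (Dom D t) (Dom D p0) \<and> p0 \<odot> h = t \<and> (\<forall>i\<in>I. p i \<odot> h = q i)"
    proof (rule ex1I[of _ h], intro conjI ballI)
      show "h \<in> hom D (Dom D t) (Dom D p0)" using h p0 by (simp add: hom_iff)
      show "p0 \<odot> h = t" unfolding p0_def using h \<pi>0 ef h''[OF K0(1)] by simp
      show "p i \<odot> h = q i" if "i \<in> I" for i
        unfolding p_def using h \<pi>s[OF that] ef h''[OF K0(2)[OF that]] by simp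
    next
      fix k assume k: "k \<in> hom D (Dom D t) (Dom D p0) \<and> p0 \<odot> k = t \<and> (\<forall>i\<in>I. p i \<odot> k = q i)"
      have k': "k \<in> Arr D" "Dom D k = Dom D t" "Cod D k = Dom D e" using k p0 by (auto simp: hom_iff)
      have "e \<odot> k = h'"
      proof (rule product_unique[OF P])
        fix j assume j: "j \<in> K"
        show "\<pi> j \<odot> (e \<odot> k) = \<pi> j \<odot> h'"
        proof (cases j)
          case None
          have "\<pi> None \<odot> (e \<odot> k) = p0 \<odot> k" unfolding p0_def using k' \<pi>0 ef by simp
          then show ?thesis using None k h''[OF j] by simp
        next
          case (Some i)
          then have i: "i \<in> I" using j unfolding K_def by auto
          have "\<pi> (Some i) \<odot> (e \<odot> k) = p i \<odot> k" unfolding p_def using k' \<pi>s[OF i] ef by simp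
          then show ?thesis using Some i k h''[OF j] by simp
        qed
      qed (use k' ef h' in auto)
      then show "k = h" using mono_cancel[of e k h] ef h k' by simp
    qed
  qed (use p0 p wp in auto)
  then show ?thesis by blast
qed

lemma (in category_loc) ex_pullback:
  assumes fl: "has_limits natLeq D"
    and fg: "f \<in> Arr D" "g \<in> Arr D" "Cod D f = Cod D g"
  shows "\<exists>p q. is_pullback D f g p q"
proof -
  define w where "w = (\<lambda>b. if b then f else g)"
  have "|UNIV :: bool set| <o natLeq" by (simp flip: finite_iff_ordLess_natLeq)
  then obtain p0 p where W: "is_wide_pullback (Cod D f) UNIV w p0 p"
    using ex_wide_pullback[OF fl fl natLeq_Card_order, of UNIV "Cod D f" w]
      ordLeq_refl[OF natLeq_Card_order] fg unfolding w_def by (metis (full_types) cod_obj)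
  note Wf = wide_pullback_facts[OF W]
  have "is_pullback D f g (p True) (p False)" unfolding is_pullback_def
  proof (intro conjI ballI impI)
    fix y h k assume *: "y \<in> Obj D" "h \<in> hom D y (Dom D f)" "k \<in> hom D y (Dom D g)" "f \<odot> h = g \<odot> k"
    have "\<exists>!u. u \<in> hom D (Dom D (f \<odot> h)) (Dom D p0) \<and> p0 \<odot> u = f \<odot> h \<and>
      (\<forall>b\<in>UNIV. p b \<odot> u = (if b then h else k))"
      by (rule wide_pullback_ex1[OF W]) (use * fg in \<open>auto simp: w_def hom_iff\<close>)
    moreover have "(u \<in> hom D (Dom D (f \<odot> h)) (Dom D p0) \<and> p0 \<odot> u = f \<odot> h \<and>
      (\<forall>b\<in>UNIV. p b \<odot> u = (if b then h else k))) \<longleftrightarrow>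
      (u \<in> hom D y (Dom D (p True)) \<and> p True \<odot> u = h \<and> p False \<odot> u = k)" for u
    proof -
      have "p0 \<odot> u = f \<odot> h" if "u \<in> Arr D" "Cod D u = Dom D p0" "p True \<odot> u = h"
        using that Wf(3-6)[of True] fg unfolding w_def by (metis (full_types) UNIV_I comp_assoc)
      moreover have "Dom D (f \<odot> h) = y" using * fg by (simp add: hom_iff)
      ultimately show ?thesis using Wf(4)[of True] by (auto simp: hom_iff all_bool_eq split: if_splits)
    qed
    ultimately show "\<exists>!u. u \<in> hom D y (Dom D (p True)) \<and> p True \<odot> u = h \<and> p False \<odot> u = k" by simp
  qed (use fg Wf(3-6)[of True] Wf(3-6)[of False] in \<open>auto simp: w_def\<close>)
  then show ?thesis by blast
qed

section \<open>Covers and local truth\<close>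

locale geometric_category = category_loc D for D :: "('o, 'm) cat" +
  fixes lam :: "'l rel"
  assumes lam: "Card_order lam" "regularCard lam" "natLeq \<le>o lam"
    and geometric: "lambda_geometric lam D"
begin

lemma finite_limits: "has_limits natLeq D"
  and regular: "regular_category D"
  and stable_unions: "has_stable_unions lam D"
  using geometric unfolding lambda_geometric_def coherent_category_def regular_category_def by auto

lemma Cinfinite_lam: "Cinfinite lam"
  using lam cinfinite_mono[OF lam(3) natLeq_cinfinite] by simp

lemma finite_ordLess_lam: "finite S \<Longrightarrow> |S| <o lam"
  using lam(3) finite_iff_ordLess_natLeq ordLess_ordLeq_trans by blast

lemma image_ordLess_lam: "|S| <o lam \<Longrightarrow> |f ` S| <o lam"
  using card_of_image ordLeq_ordLess_trans by blast

lemma UN_ordLess_lam: "\<lbrakk>|S| <o lam; \<And>i. i \<in> S \<Longrightarrow> |A i| <o lam\<rbrakk> \<Longrightarrow> |\<Union>i\<in>S. A i| <o lam"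
  using card_of_UNION_ordLess_infinite_Field_regularCard[OF lam(2) Cinfinite_lam] by blast

lemma reindex_lam:
  assumes "|S| <o lam"
  obtains I :: "'l set" and \<phi> where "|I| <o lam" "bij_betw \<phi> I S"
proof -
  obtain I :: "'l set" where "|S| =o |I|" "|I| <o lam"
    using assms internalize_card_of_ordLess[of S lam] by blast
  then show ?thesis using that card_of_ordIso ordIso_symmetric by blast
qed

lemma ex_eq: "\<lbrakk>f \<in> Arr D; g \<in> Arr D; Dom D f = Dom D g; Cod D f = Cod D g\<rbrakk> \<Longrightarrow> \<exists>e. is_equalizer f g e"
  using ex_equalizer[OF finite_limits] by blast

lemma ex_pb: "\<lbrakk>f \<in> Arr D; g \<in> Arr D; Cod D f = Cod D g\<rbrakk> \<Longrightarrow> \<exists>p q. is_pullback D f g p q"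
  using ex_pullback[OF finite_limits] by blast

lemma sub_le_pullback_iff:
  assumes "is_pullback D f m p q" "h \<in> Arr D" "Cod D h = Dom D f"
  shows "sub_le D h p \<longleftrightarrow> sub_le D (f \<odot> h) m"
proof
  note pf = pullback_facts[OF assms(1)]
  { assume "sub_le D h p"
    then obtain k where k: "k \<in> Arr D" "Dom D k = Dom D h" "Cod D k = Dom D p" "p \<odot> k = h"
      using assms by (metis sub_leE)
    have "m \<odot> (q \<odot> k) = f \<odot> h"
      unfolding k(4)[symmetric] using comp_eq_assoc[OF pf(9), of k] pf(1-8) k(1-3) by simp
    then show "sub_le D (f \<odot> h) m" by (intro sub_leI[of "q \<odot> k"]) (use pf k in auto) }
  { assume "sub_le D (f \<odot> h) m"
    then obtain k where k: "k \<in> Arr D" "Dom D k = Dom D h" "Cod D k = Dom D m" "m \<odot> k = f \<odot> h"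
      using assms pf by (metis sub_leE comp_arr dom_comp)
    obtain u where "u \<in> Arr D" "Dom D u = Dom D h" "Cod D u = Dom D p" "p \<odot> u = h"
      using pullback_lift[OF assms(1,2) k(1)] k assms(2,3) by metis
    then show "sub_le D h p" by (intro sub_leI[of u]) (use pf in auto) }
qed

definition cover :: "'o \<Rightarrow> 'm set \<Rightarrow> bool" where
  "cover x S \<longleftrightarrow> x \<in> Obj D \<and> (\<forall>f\<in>S. f \<in> Arr D \<and> Cod D f = x) \<and>
     (\<forall>m\<in>Sub D x. (\<forall>f\<in>S. sub_le D f m) \<longrightarrow> sub_le D (Id D x) m)"

lemma cover_arr: "\<lbrakk>cover x S; f \<in> S\<rbrakk> \<Longrightarrow> f \<in> Arr D \<and> Cod D f = x"
  and cover_obj: "cover x S \<Longrightarrow> x \<in> Obj D"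
  unfolding cover_def by auto

lemma cover_Id_le:
  "\<lbrakk>cover x S; is_mono D m; Cod D m = x; \<And>f. f \<in> S \<Longrightarrow> sub_le D f m\<rbrakk> \<Longrightarrow> sub_le D (Id D x) m"
  unfolding cover_def by (simp add: Sub_iff)

lemma cover_factor:
  assumes "cover z S" "a \<in> Arr D" "Dom D a = z" "is_mono D m" "Cod D m = Cod D a"
    "\<And>f. f \<in> S \<Longrightarrow> sub_le D (a \<odot> f) m"
  shows "sub_le D a m"
proof -
  obtain p q where pb: "is_pullback D a m p q" using ex_pb assms mono_arr by metis
  note pf = pullback_facts[OF pb]
  have "p \<in> Sub D z" using pullback_mono[OF pb] assms pf by (simp add: Sub_iff)
  moreover have "sub_le D f p" if "f \<in> S" for f
    using sub_le_pullback_iff[OF pb, of f] cover_arr[OF assms(1) that] assms that by simp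
  ultimately have "sub_le D (Id D z) p" using assms(1) unfolding cover_def by blast
  then have "sub_le D (a \<odot> Id D z) m"
    using sub_le_pullback_iff[OF pb, of "Id D z"] cover_obj[OF assms(1)] assms by simp
  then show ?thesis using assms by simp
qed

lemma cover_eq:
  assumes "cover z S" "h \<in> Arr D" "k \<in> Arr D" "Dom D h = z" "Dom D k = z" "Cod D h = Cod D k"
    "\<And>f. f \<in> S \<Longrightarrow> h \<odot> f = k \<odot> f"
  shows "h = k"
proof -
  obtain e where e: "is_equalizer h k e" using ex_eq[of h k] assms by auto
  then have ef: "is_mono D e" "Cod D e = z" "h \<odot> e = k \<odot> e" "e \<in> Arr D"
    using assms mono_arr unfolding is_equalizer_def by auto
  have "sub_le D f e" if "f \<in> S" for f
    using e cover_arr[OF assms(1) that] assms(4,7) that unfolding is_equalizer_def by simp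
  then have "sub_le D (Id D z) e" using cover_Id_le[OF assms(1)] ef by blast
  then obtain s where "s \<in> Arr D" "Dom D s = Dom D (Id D z)" "Cod D s = Dom D e" "e \<odot> s = Id D z"
    by (rule sub_leE) (simp add: cover_obj[OF assms(1)])
  then have s: "s \<in> Arr D" "Dom D s = z" "Cod D s = Dom D e" "e \<odot> s = Id D z"
    using cover_obj[OF assms(1)] by simp_all
  have "(h \<odot> e) \<odot> s = (k \<odot> e) \<odot> s" by (simp only: ef(3))
  then show ?thesis using s ef(2,4) assms(2-6) by simp
qed

lemma cover_id: "x \<in> Obj D \<Longrightarrow> cover x {Id D x}"
  unfolding cover_def by auto

lemma cover_trans:
  assumes "cover x S" "\<And>f. f \<in> S \<Longrightarrow> cover (Dom D f) (T f)"
  shows "cover x (\<Union>f\<in>S. (\<lambda>g. f \<odot> g) ` T f)"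
  unfolding cover_def
proof (intro conjI ballI impI)
  show "x \<in> Obj D" using assms cover_obj by simp
  show "k \<in> Arr D" "Cod D k = x" if "k \<in> (\<Union>f\<in>S. (\<lambda>g. f \<odot> g) ` T f)" for k
    using that cover_arr[OF assms(1)] cover_arr[OF assms(2)] by auto
  fix m assume m: "m \<in> Sub D x" "\<forall>k\<in>(\<Union>f\<in>S. (\<lambda>g. f \<odot> g) ` T f). sub_le D k m"
  have "sub_le D f m" if "f \<in> S" for f
    by (rule cover_factor[OF assms(2)[OF that]]) (use m cover_arr[OF assms(1) that] that in \<open>auto simp: Sub_iff\<close>)
  then show "sub_le D (Id D x) m" using m assms(1) unfolding cover_def by blast
qed

lemma cover_mono:
  assumes "cover x S" "\<And>f. f \<in> S \<Longrightarrow> \<exists>g\<in>T. sub_le D f g" "\<And>g. g \<in> T \<Longrightarrow> g \<in> Arr D \<and> Cod D g = x"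
  shows "cover x T"
  unfolding cover_def
proof (intro conjI ballI impI)
  fix m assume m: "m \<in> Sub D x" "\<forall>k\<in>T. sub_le D k m"
  have "m \<in> Arr D" using m mono_arr by (simp add: Sub_iff)
  then have "sub_le D f m" if "f \<in> S" for f using assms(2)[OF that] m sub_le_trans by blast
  then show "sub_le D (Id D x) m" using m assms(1) unfolding cover_def by blast
qed (use assms cover_obj in auto)

lemma regular_epi_arr: "is_regular_epi D e \<Longrightarrow> e \<in> Arr D"
  unfolding is_regular_epi_def is_coequalizer_def by auto

lemma coequalizer_ex1:
  assumes "is_coequalizer D f g e" "h \<in> Arr D" "Dom D h = Cod D f" "h \<odot> f = h \<odot> g"
  shows "\<exists>!k. k \<in> hom D (Cod D e) (Cod D h) \<and> k \<odot> e = h"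
proof -
  have "\<forall>h \<in> Arr D. Dom D h = Cod D f \<and> Comp D h f = Comp D h g \<longrightarrow>
        (\<exists>!k. k \<in> hom D (Cod D e) (Cod D h) \<and> Comp D k e = h)"
    using assms(1) unfolding is_coequalizer_def by (elim conjE) assumption
  then show ?thesis using assms(2-) by simp
qed

lemma regular_epi_cover:
  assumes "is_regular_epi D e"
  shows "cover (Cod D e) {e}"
  unfolding cover_def
proof (intro conjI ballI impI)
  obtain f g where fg: "is_coequalizer D f g e" using assms unfolding is_regular_epi_def by blast
  then have a: "f \<in> Arr D" "g \<in> Arr D" "Dom D f = Dom D g" "Cod D f = Cod D g" "e \<in> Arr D"
    "Dom D e = Cod D f" "e \<odot> f = e \<odot> g"
    unfolding is_coequalizer_def by auto
  fix m assume m: "m \<in> Sub D (Cod D e)" "\<forall>f\<in>{e}. sub_le D f m"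
  then have mm: "is_mono D m" "m \<in> Arr D" "Cod D m = Cod D e" using mono_arr by (auto simp: Sub_iff)
  obtain k where k: "k \<in> Arr D" "Dom D k = Dom D e" "Cod D k = Dom D m" "m \<odot> k = e"
    using m a by (metis sub_leE singletonI)
  have "m \<odot> (k \<odot> f) = m \<odot> (k \<odot> g)" using a k mm comp_eq_assoc[OF k(4)] by simp
  then have "k \<odot> f = k \<odot> g" using mono_cancel[of m "k \<odot> f" "k \<odot> g"] a k mm by simp
  then have "\<exists>!t. t \<in> hom D (Cod D e) (Cod D k) \<and> t \<odot> e = k"
    by (intro coequalizer_ex1[OF fg]) (use k a in auto)
  then obtain t where "t \<in> hom D (Cod D e) (Cod D k) \<and> t \<odot> e = k" by (elim ex1E)
  then have t: "t \<in> Arr D" "Dom D t = Cod D e" "Cod D t = Dom D m" "t \<odot> e = k" using k by (auto simp: hom_iff)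
  have "\<exists>!u. u \<in> hom D (Cod D e) (Cod D e) \<and> u \<odot> e = e"
    by (intro coequalizer_ex1[OF fg]) (use a in auto)
  moreover have "m \<odot> t \<in> hom D (Cod D e) (Cod D e) \<and> (m \<odot> t) \<odot> e = e"
    using t mm k a by (simp add: hom_iff)
  moreover have "Id D (Cod D e) \<in> hom D (Cod D e) (Cod D e) \<and> Id D (Cod D e) \<odot> e = e"
    using a by (simp add: hom_iff)
  ultimately have "m \<odot> t = Id D (Cod D e)" by (elim ex1E) metis
  then show "sub_le D (Id D (Cod D e)) m" by (intro sub_leI[of t]) (use t mm in auto)
qed (use regular_epi_arr[OF assms] in auto)

lemma regular_epi_pullback:
  "\<lbrakk>is_pullback D f e e' q; is_regular_epi D e\<rbrakk> \<Longrightarrow> is_regular_epi D e'"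
  using regular unfolding regular_category_def is_base_change_def by blast

text \<open>For a kernel pair \<open>p, q\<close> of \<open>f\<close>, the induced map between the kernel pairs of \<open>f\<close> and of the
  second factor \<open>m\<close> is a composite of pullbacks of the regular epimorphism \<open>e\<close>, so the two
  projections of the kernel pair of \<open>m\<close> agree.\<close>

lemma ex_image:
  assumes f: "f \<in> Arr D"
  obtains e m where "is_regular_epi D e" "is_mono D m" "Dom D m = Cod D e" "Dom D e = Dom D f"
    "Cod D m = Cod D f" "m \<odot> e = f"
proof -
  obtain p q where pq: "is_pullback D f f p q" using ex_pb f by blast
  note pf = pullback_facts[OF pq]
  obtain e where e: "is_coequalizer D p q e" using pq regular unfolding regular_category_def by blast
  have re: "is_regular_epi D e" using e unfolding is_regular_epi_def by blast
  have ea: "e \<in> Arr D" "Dom D e = Dom D f" "e \<odot> p = e \<odot> q" using e pf unfolding is_coequalizer_def by auto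
  have "\<exists>!m. m \<in> hom D (Cod D e) (Cod D f) \<and> m \<odot> e = f"
    by (intro coequalizer_ex1[OF e]) (use f pf in auto)
  then obtain m where "m \<in> hom D (Cod D e) (Cod D f) \<and> m \<odot> e = f" by (elim ex1E)
  then have m: "m \<in> Arr D" "Dom D m = Cod D e" "Cod D m = Cod D f" "m \<odot> e = f" by (auto simp: hom_iff)
  have "is_mono D m"
  proof (rule monoI[OF m(1)])
    fix h k assume *: "h \<in> Arr D" "k \<in> Arr D" "Dom D h = Dom D k" "Cod D h = Dom D m"
      "Cod D k = Dom D m" "m \<odot> h = m \<odot> k"
    obtain e1 h1 where 1: "is_pullback D h e e1 h1" using ex_pb[of h e] * ea m by auto
    note f1 = pullback_facts[OF 1]
    obtain e2 k2 where 2: "is_pullback D (k \<odot> e1) e e2 k2" using ex_pb[of "k \<odot> e1" e] * ea m f1 by auto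
    have "Dom D (k \<odot> e1) = Dom D e1" using f1 * by simp
    note f2 = pullback_facts[OF 2, unfolded this]
    have c: "cover (Dom D h) {e1}" "cover (Dom D e1) {e2}"
      using regular_epi_cover[OF regular_epi_pullback[OF 1 re]] f1
        regular_epi_cover[OF regular_epi_pullback[OF 2 re]] f2 by auto
    have he: "h \<odot> (e1 \<odot> e2) = e \<odot> (h1 \<odot> e2)" using comp_eq_assoc[OF f1(9)] f1(1-8) f2(1-8) * by simp
    have ke: "k \<odot> (e1 \<odot> e2) = e \<odot> k2" using f1(1-8) f2 * by simp
    have "f \<odot> (h1 \<odot> e2) = m \<odot> (e \<odot> (h1 \<odot> e2))"
      using comp_eq_assoc[OF m(4)] ea m f1(1-8) f2(1-8) * by simp
    also have "\<dots> = m \<odot> (k \<odot> (e1 \<odot> e2))"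
      unfolding he[symmetric] using comp_eq_assoc[OF *(6)] * m f1(1-8) f2(1-8) by simp
    also have "\<dots> = f \<odot> k2" unfolding ke using comp_eq_assoc[OF m(4)] ea m f1(1-8) f2(1-8) * by simp
    finally obtain u where u: "u \<in> Arr D" "Cod D u = Dom D p" "p \<odot> u = h1 \<odot> e2" "q \<odot> u = k2"
      using pullback_lift[OF pq, of "h1 \<odot> e2" k2] ea f1(1-8) f2(1-8) by auto
    have "e \<odot> (h1 \<odot> e2) = e \<odot> k2"
      unfolding u(3,4)[symmetric] using comp_eq_assoc[OF ea(3), of u] u ea pf by simp
    then have 3: "(h \<odot> e1) \<odot> e2 = (k \<odot> e1) \<odot> e2" using he ke *(1-5) f1(1-8) f2(1-8) by simp
    have 4: "h \<odot> e1 = k \<odot> e1"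
      by (rule cover_eq[OF c(2)]) (use 3 *(1-5) f1(1-8) f2(1-8) in auto)
    show "h = k" by (rule cover_eq[OF c(1)]) (use 4 *(1-5) f1(1-8) in auto)
  qed
  then show ?thesis using that[OF re] ea m by simp
qed

lemma cover_regular_epi:
  assumes "e \<in> Arr D" "cover (Cod D e) {e}"
  shows "is_regular_epi D e"
proof -
  obtain r m where rm: "is_regular_epi D r" "is_mono D m" "Dom D m = Cod D r" "Dom D r = Dom D e"
    "Cod D m = Cod D e" "m \<odot> r = e" using ex_image[OF assms(1)] .
  have a: "r \<in> Arr D" "m \<in> Arr D" using rm regular_epi_arr mono_arr by auto
  have "sub_le D e m" by (rule sub_leI[of r]) (use rm a in auto)
  then have "sub_le D (Id D (Cod D m)) m" using assms(2) rm unfolding cover_def by (simp add: Sub_iff)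
  then obtain s where s: "s \<in> Arr D" "Dom D s = Cod D m" "Cod D s = Dom D m" "m \<odot> s = Id D (Cod D m)"
    "s \<odot> m = Id D (Dom D m)" using iso_of_Id_le rm(2) by blast
  obtain f g where fg: "is_coequalizer D f g r" using rm unfolding is_regular_epi_def by blast
  then have b: "f \<in> Arr D" "g \<in> Arr D" "Dom D f = Dom D g" "Cod D f = Cod D g"
    "Dom D r = Cod D f" "r \<odot> f = r \<odot> g" unfolding is_coequalizer_def by auto
  have "e \<odot> f = m \<odot> (r \<odot> f)" using comp_eq_assoc[OF rm(6), of f] a b rm by simp
  also have "\<dots> = e \<odot> g" unfolding b(6) using comp_eq_assoc[OF rm(6), of g] a b rm by simp
  finally have ef: "e \<odot> f = e \<odot> g" .
  have re: "s \<odot> e = r" using comp_eq_assoc[OF s(5), of r] s a rm by simp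
  have "is_coequalizer D f g e" unfolding is_coequalizer_def
  proof (intro conjI ballI impI)
    fix h assume h: "h \<in> Arr D" "Dom D h = Cod D f \<and> h \<odot> f = h \<odot> g"
    have "\<exists>!k. k \<in> hom D (Cod D r) (Cod D h) \<and> k \<odot> r = h"
      by (intro coequalizer_ex1[OF fg]) (use h in auto)
    then obtain k where "k \<in> hom D (Cod D r) (Cod D h) \<and> k \<odot> r = h" by (elim ex1E)
    then have k: "k \<in> Arr D" "Dom D k = Cod D r" "Cod D k = Cod D h" "k \<odot> r = h" by (auto simp: hom_iff)
    show "\<exists>!k. k \<in> hom D (Cod D e) (Cod D h) \<and> k \<odot> e = h"
    proof (rule ex1I[of _ "k \<odot> s"])
      show "k \<odot> s \<in> hom D (Cod D e) (Cod D h) \<and> (k \<odot> s) \<odot> e = h"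
        using k s rm assms re by (simp add: hom_iff)
      fix k' assume k': "k' \<in> hom D (Cod D e) (Cod D h) \<and> k' \<odot> e = h"
      show "k' = k \<odot> s"
        by (rule cover_eq[OF assms(2)]) (use k k' s rm assms re in \<open>auto simp: hom_iff\<close>)
    qed
  qed (use b rm ef assms in auto)
  then show ?thesis unfolding is_regular_epi_def by blast
qed

lemma ex_join:
  assumes "|S| <o lam" "x \<in> Obj D" "\<forall>f\<in>S. f \<in> Arr D \<and> Cod D f = x"
  obtains (join) \<phi> and I :: "'l set" and e m u where "bij_betw \<phi> I S" "|I| <o lam"
    "\<And>i. i \<in> I \<Longrightarrow> is_regular_epi D (e i) \<and> is_mono D (m i) \<and> Dom D (m i) = Cod D (e i) \<and>
       Dom D (e i) = Dom D (\<phi> i) \<and> Cod D (m i) = x \<and> m i \<odot> e i = \<phi> i"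
    "is_union D x I m u"
proof -
  obtain I :: "'l set" and \<phi> where I: "|I| <o lam" "bij_betw \<phi> I S" using reindex_lam[OF assms(1)] .
  have "\<exists>e m. is_regular_epi D e \<and> is_mono D m \<and> Dom D m = Cod D e \<and>
       Dom D e = Dom D (\<phi> i) \<and> Cod D m = x \<and> m \<odot> e = \<phi> i" if "i \<in> I" for i
  proof -
    have "\<phi> i \<in> Arr D" "Cod D (\<phi> i) = x" using assms(3) bij_betw_apply[OF I(2) that] by auto
    then show ?thesis using ex_image[of "\<phi> i"] by metis
  qed
  then obtain e m where em: "\<And>i. i \<in> I \<Longrightarrow> is_regular_epi D (e i) \<and> is_mono D (m i) \<and> Dom D (m i) = Cod D (e i) \<and>
       Dom D (e i) = Dom D (\<phi> i) \<and> Cod D (m i) = x \<and> m i \<odot> e i = \<phi> i" by metis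
  then have "\<forall>i\<in>I. m i \<in> Sub D x" by (simp add: Sub_iff)
  then obtain u where "is_union D x I m u"
    using stable_unions assms(2) I(1) unfolding has_stable_unions_def by blast
  then show ?thesis using join[OF I(2,1) em] by blast
qed

lemma sub_le_cover_precomp:
  assumes "is_regular_epi D e" "is_mono D n" "a \<in> Arr D" "Dom D a = Cod D e" "Cod D n = Cod D a"
    "sub_le D (a \<odot> e) n"
  shows "sub_le D a n"
  by (rule cover_factor[OF regular_epi_cover[OF assms(1)]]) (use assms in auto)

lemma cover_pullback:
  assumes S: "cover x S" "|S| <o lam" and h: "h \<in> Arr D" "Cod D h = x"
  shows "\<exists>T. cover (Dom D h) T \<and> |T| <o lam \<and> (\<forall>g\<in>T. \<exists>f\<in>S. sub_le D (h \<odot> g) f)"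
proof -
  have Sa: "\<forall>f\<in>S. f \<in> Arr D \<and> Cod D f = x" using cover_arr[OF S(1)] by blast
  obtain \<phi> and I :: "'l set" and e m u where I: "bij_betw \<phi> I S" "|I| <o lam"
    and em: "\<And>i. i \<in> I \<Longrightarrow> is_regular_epi D (e i) \<and> is_mono D (m i) \<and> Dom D (m i) = Cod D (e i) \<and>
       Dom D (e i) = Dom D (\<phi> i) \<and> Cod D (m i) = x \<and> m i \<odot> e i = \<phi> i"
    and u: "is_union D x I m u"
    by (rule ex_join[OF S(2) cover_obj[OF S(1)] Sa]) (rule that; assumption?)
  have ea: "e i \<in> Arr D" "m i \<in> Arr D" if "i \<in> I" for i using em[OF that] regular_epi_arr mono_arr by auto
  have um: "u \<in> Sub D x" "is_mono D u" "u \<in> Arr D" "Cod D u = x"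
    using u mono_arr unfolding is_union_def by (auto simp: Sub_iff)
  have "sub_le D f u" if "f \<in> S" for f
  proof -
    obtain i where i: "i \<in> I" "f = \<phi> i" using I(1) \<open>f \<in> S\<close> unfolding bij_betw_def by auto
    have "sub_le D (m i) u" using u i unfolding is_union_def by blast
    then have "sub_le D (m i \<odot> e i) u" using sub_le_precomp[of "m i" u "e i"] um ea[OF i(1)] em[OF i(1)] by simp
    then show ?thesis using em[OF i(1)] i by simp
  qed
  then have Iu: "sub_le D (Id D x) u" using S(1) um unfolding cover_def by blast
  have "\<exists>n q. is_pullback D h (m i) n q" if "i \<in> I" for i
    using ex_pb[of h "m i"] h ea[OF that] em[OF that] by simp
  then obtain n q where nq: "\<And>i. i \<in> I \<Longrightarrow> is_pullback D h (m i) (n i) (q i)" by metis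
  obtain u' r where u': "is_pullback D h u u' r" using ex_pb[of h u] h um by auto
  have "is_union D (Dom D h) I n u'"
  proof -
    have "\<forall>i\<in>I. is_base_change D h (m i) (n i)" "is_base_change D h u u'"
      using nq u' unfolding is_base_change_def by blast+
    moreover have "\<forall>i\<in>I. m i \<in> Sub D x" using em by (simp add: Sub_iff)
    ultimately show ?thesis
      using stable_unions u h I(2) cover_obj[OF S(1)] unfolding has_stable_unions_def by blast
  qed
  note un = this
  have "\<exists>e' r. is_pullback D (q i) (e i) e' r" if "i \<in> I" for i
    using ex_pb[of "q i" "e i"] pullback_facts[OF nq[OF that]] ea[OF that] em[OF that] by simp
  then obtain e' r' where e': "\<And>i. i \<in> I \<Longrightarrow> is_pullback D (q i) (e i) (e' i) (r' i)" by metis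
  define T where "T = (\<lambda>i. n i \<odot> e' i) ` I"
  have "cover (Dom D h) T" unfolding cover_def
  proof (intro conjI ballI impI)
    show "Dom D h \<in> Obj D" using h by simp
    show "t \<in> Arr D" "Cod D t = Dom D h" if "t \<in> T" for t
      using that pullback_facts[OF nq] pullback_facts[OF e'] unfolding T_def by auto
    fix k assume k: "k \<in> Sub D (Dom D h)" "\<forall>t\<in>T. sub_le D t k"
    have km: "is_mono D k" "Cod D k = Dom D h" "k \<in> Arr D" using k mono_arr by (auto simp: Sub_iff)
    have "sub_le D (n i) k" if i: "i \<in> I" for i
      by (rule sub_le_cover_precomp[OF regular_epi_pullback[OF e'[OF i]]])
        (use em[OF i] km k pullback_facts[OF nq[OF i]] pullback_facts[OF e'[OF i]] i in \<open>auto simp: T_def\<close>)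
    then have 1: "sub_le D u' k" using un k(1) unfolding is_union_def by blast
    have "sub_le D h u" using sub_le_of_Id[OF Iu] h um by simp
    then have "sub_le D (Id D (Dom D h)) u'"
      using sub_le_pullback_iff[OF u', of "Id D (Dom D h)"] h by simp
    then show "sub_le D (Id D (Dom D h)) k" using 1 sub_le_trans km by blast
  qed
  moreover have "\<exists>f\<in>S. sub_le D (h \<odot> g) f" if "g \<in> T" for g
  proof -
    obtain i where i: "i \<in> I" "g = n i \<odot> e' i" using \<open>g \<in> T\<close> unfolding T_def by blast
    note f1 = pullback_facts[OF nq[OF i(1)]] and f2 = pullback_facts[OF e'[OF i(1)]]
    have "h \<odot> g = m i \<odot> (q i \<odot> e' i)" unfolding i(2)
      using comp_eq_assoc[OF f1(9), of "e' i"] f1 f2 by simp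
    also have "\<dots> = \<phi> i \<odot> r' i" unfolding f2(9)
      using comp_eq_assoc[of "m i" "e i" "\<phi> i" "r' i"] f1(1-8) f2(1-8) em[OF i(1)] by simp
    finally have "h \<odot> g = \<phi> i \<odot> r' i" .
    moreover have \<phi>: "\<phi> i \<in> S" using bij_betw_apply[OF I(1) i(1)] .
    ultimately show ?thesis using sub_le_comp[of "r' i" "\<phi> i"] cover_arr[OF S(1) \<phi>] f2 em[OF i(1)]
      by (intro bexI[OF _ \<phi>]) simp
  qed
  ultimately show ?thesis using image_ordLess_lam[OF I(2)] unfolding T_def by blast
qed

end

context geometric_category
begin

definition locally :: "'o \<Rightarrow> ('m \<Rightarrow> bool) \<Rightarrow> bool" where
  "locally z \<Phi> \<longleftrightarrow> (\<exists>S. cover z S \<and> |S| <o lam \<and> (\<forall>f\<in>S. \<Phi> f))"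

definition sieve :: "'o \<Rightarrow> ('m \<Rightarrow> bool) \<Rightarrow> bool" where
  "sieve z \<Phi> \<longleftrightarrow> (\<forall>f k. f \<in> Arr D \<and> Cod D f = z \<and> k \<in> Arr D \<and> Cod D k = Dom D f \<and> \<Phi> f \<longrightarrow> \<Phi> (f \<odot> k))"

lemma sieveI:
  "(\<And>f k. \<lbrakk>f \<in> Arr D; Cod D f = z; k \<in> Arr D; Cod D k = Dom D f; \<Phi> f\<rbrakk> \<Longrightarrow> \<Phi> (f \<odot> k)) \<Longrightarrow> sieve z \<Phi>"
  unfolding sieve_def by blast

lemma sieveD:
  "\<lbrakk>sieve z \<Phi>; \<Phi> f; f \<in> Arr D; Cod D f = z; k \<in> Arr D; Cod D k = Dom D f\<rbrakk> \<Longrightarrow> \<Phi> (f \<odot> k)"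
  unfolding sieve_def by blast

lemma locally_obj: "locally z \<Phi> \<Longrightarrow> z \<in> Obj D"
  unfolding locally_def using cover_obj by blast

lemma locally_mono:
  "\<lbrakk>locally z \<Phi>; \<And>f. \<lbrakk>f \<in> Arr D; Cod D f = z; \<Phi> f\<rbrakk> \<Longrightarrow> \<Psi> f\<rbrakk> \<Longrightarrow> locally z \<Psi>"
  unfolding locally_def using cover_arr by blast

lemma locally_Id: "\<lbrakk>z \<in> Obj D; \<Phi> (Id D z)\<rbrakk> \<Longrightarrow> locally z \<Phi>"
  unfolding locally_def using cover_id finite_ordLess_lam[of "{Id D z}"] by blast

lemma locally_bind:
  assumes "locally z \<Phi>"
    "\<And>f. \<lbrakk>f \<in> Arr D; Cod D f = z; \<Phi> f\<rbrakk> \<Longrightarrow> locally (Dom D f) (\<lambda>g. \<Psi> (f \<odot> g))"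
  shows "locally z \<Psi>"
proof -
  obtain S where S: "cover z S" "|S| <o lam" "\<forall>f\<in>S. \<Phi> f" using assms(1) unfolding locally_def by blast
  have "\<forall>f\<in>S. \<exists>T. cover (Dom D f) T \<and> |T| <o lam \<and> (\<forall>g\<in>T. \<Psi> (f \<odot> g))"
    using assms(2) S cover_arr[OF S(1)] unfolding locally_def by blast
  then obtain T where T: "\<And>f. f \<in> S \<Longrightarrow> cover (Dom D f) (T f)" "\<And>f. f \<in> S \<Longrightarrow> |T f| <o lam"
    "\<And>f g. f \<in> S \<Longrightarrow> g \<in> T f \<Longrightarrow> \<Psi> (f \<odot> g)" by metis
  have "cover z (\<Union>f\<in>S. (\<lambda>g. f \<odot> g) ` T f)" using cover_trans[OF S(1) T(1)] .
  moreover have "|\<Union>f\<in>S. (\<lambda>g. f \<odot> g) ` T f| <o lam"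
    by (rule UN_ordLess_lam[OF S(2)]) (simp add: image_ordLess_lam T(2))
  ultimately show ?thesis unfolding locally_def using T(3) by blast
qed

lemma locally_cover:
  assumes S: "cover x S" "|S| <o lam" and h: "h \<in> Arr D" "Cod D h = x"
  shows "locally (Dom D h) (\<lambda>g. \<exists>f\<in>S. sub_le D (h \<odot> g) f)"
  using cover_pullback[OF assms] unfolding locally_def by blast

lemma locally_pull:
  assumes "locally z \<Phi>" "h \<in> Arr D" "Cod D h = z"
  shows "locally (Dom D h) (\<lambda>g. \<exists>f k. \<Phi> f \<and> f \<in> Arr D \<and> Cod D f = z \<and> k \<in> Arr D \<and>
    Cod D k = Dom D f \<and> Dom D k = Dom D g \<and> h \<odot> g = f \<odot> k)"
proof -
  obtain S where S: "cover z S" "|S| <o lam" "\<forall>f\<in>S. \<Phi> f" using assms(1) unfolding locally_def by blast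
  show ?thesis
  proof (rule locally_mono[OF locally_cover[OF S(1,2) assms(2,3)]])
    fix g assume g: "g \<in> Arr D" "Cod D g = Dom D h" "\<exists>f\<in>S. sub_le D (h \<odot> g) f"
    then obtain f where f: "f \<in> S" "sub_le D (h \<odot> g) f" by blast
    obtain k where "k \<in> Arr D" "Dom D k = Dom D (h \<odot> g)" "Cod D k = Dom D f" "f \<odot> k = h \<odot> g"
      using f(2) by (rule sub_leE) (use g assms in simp)
    then show "\<exists>f k. \<Phi> f \<and> f \<in> Arr D \<and> Cod D f = z \<and> k \<in> Arr D \<and>
      Cod D k = Dom D f \<and> Dom D k = Dom D g \<and> h \<odot> g = f \<odot> k"
      using f(1) S(3) cover_arr[OF S(1) f(1)] g assms by (intro exI[of _ f] exI[of _ k]) simp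
  qed
qed

lemma locally_pull_sieve:
  assumes "locally z \<Phi>" "sieve z \<Phi>" "h \<in> Arr D" "Cod D h = z"
  shows "locally (Dom D h) (\<lambda>g. \<Phi> (h \<odot> g))"
  by (rule locally_mono[OF locally_pull[OF assms(1,3,4)]]) (use sieveD[OF assms(2)] in fastforce)

lemma locally_conj:
  assumes "locally z \<Phi>" "locally z \<Psi>" "sieve z \<Phi>" "sieve z \<Psi>"
  shows "locally z (\<lambda>f. \<Phi> f \<and> \<Psi> f)"
proof (rule locally_bind[OF assms(1)])
  fix f assume f: "f \<in> Arr D" "Cod D f = z" "\<Phi> f"
  show "locally (Dom D f) (\<lambda>g. \<Phi> (f \<odot> g) \<and> \<Psi> (f \<odot> g))"
    by (rule locally_mono[OF locally_pull_sieve[OF assms(2,4) f(1,2)]]) (use sieveD[OF assms(3)] f in blast)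
qed

lemma sieve_ball: "(\<And>a. a \<in> A \<Longrightarrow> sieve z (\<Phi> a)) \<Longrightarrow> sieve z (\<lambda>f. \<forall>a\<in>A. \<Phi> a f)"
  unfolding sieve_def by blast

lemma locally_ball_finite:
  assumes "finite A" "z \<in> Obj D" "\<And>a. a \<in> A \<Longrightarrow> locally z (\<Phi> a)" "\<And>a. a \<in> A \<Longrightarrow> sieve z (\<Phi> a)"
  shows "locally z (\<lambda>f. \<forall>a\<in>A. \<Phi> a f)"
  using assms(1,3,4)
proof (induction A)
  case empty
  then show ?case using locally_Id assms(2) by simp
next
  case (insert a A)
  have "locally z (\<lambda>f. \<Phi> a f \<and> (\<forall>a\<in>A. \<Phi> a f))"
    by (rule locally_conj) (use insert in \<open>auto intro!: sieve_ball\<close>)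
  then show ?case by simp
qed

lemma locally_eq:
  assumes "locally z (\<lambda>f. h \<odot> f = k \<odot> f)" "h \<in> Arr D" "k \<in> Arr D" "Dom D h = z" "Dom D k = z"
    "Cod D h = Cod D k"
  shows "h = k"
  using assms(1) cover_eq[OF _ assms(2-)] unfolding locally_def by blast

lemma locally_factor:
  assumes "locally z (\<lambda>f. sub_le D (h \<odot> f) m)" "h \<in> Arr D" "Dom D h = z" "is_mono D m" "Cod D m = Cod D h"
  shows "sub_le D h m"
  using assms(1) cover_factor[OF _ assms(2-)] unfolding locally_def by blast

lemma cover_of_locally:
  assumes "locally x (\<lambda>f. \<exists>g\<in>T. sub_le D f g)" "\<And>g. g \<in> T \<Longrightarrow> g \<in> Arr D \<and> Cod D g = x"
  shows "cover x T"
  using assms cover_mono unfolding locally_def by blast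

lemma regular_epi_lift:
  assumes "is_regular_epi D e" "y \<in> Arr D" "Cod D y = Cod D e"
  shows "locally (Dom D y) (\<lambda>f. sub_le D (y \<odot> f) e)"
  using locally_cover[OF regular_epi_cover[OF assms(1)] _ assms(2,3)] finite_ordLess_lam[of "{e}"] by simp

lemma regular_epi_of_locally:
  assumes "e \<in> Arr D" "locally (Cod D e) (\<lambda>f. sub_le D f e)"
  shows "is_regular_epi D e"
  by (rule cover_regular_epi[OF assms(1)], rule cover_of_locally) (use assms in auto)

lemma ex_image_union:
  assumes G: "|G| <o lam" and x: "x \<in> Obj D" and Ga: "\<forall>g\<in>G. g \<in> Arr D \<and> Cod D g = x"
  obtains (image_union) r where "is_mono D r" "Cod D r = x" "\<And>g. g \<in> G \<Longrightarrow> sub_le D g r"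
    "cover (Dom D r) {l \<in> Arr D. Cod D l = Dom D r \<and> r \<odot> l \<in> G}"
    "|{l \<in> Arr D. Cod D l = Dom D r \<and> r \<odot> l \<in> G}| <o lam"
proof -
  obtain \<phi> and I :: "'l set" and e m r where I: "bij_betw \<phi> I G" "|I| <o lam"
    and em: "\<And>i. i \<in> I \<Longrightarrow> is_regular_epi D (e i) \<and> is_mono D (m i) \<and> Dom D (m i) = Cod D (e i) \<and>
       Dom D (e i) = Dom D (\<phi> i) \<and> Cod D (m i) = x \<and> m i \<odot> e i = \<phi> i"
    and u: "is_union D x I m r"
    by (rule ex_join[OF G x Ga]) (rule that; assumption?)
  have ea: "e i \<in> Arr D" "m i \<in> Arr D" if "i \<in> I" for i using em[OF that] regular_epi_arr mono_arr by auto
  have r: "is_mono D r" "r \<in> Arr D" "Cod D r = x"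
    using u mono_arr unfolding is_union_def by (auto simp: Sub_iff)
  have Gr: "sub_le D g r" if "g \<in> G" for g
  proof -
    obtain i where i: "i \<in> I" "g = \<phi> i" using I(1) \<open>g \<in> G\<close> unfolding bij_betw_def by auto
    have "sub_le D (m i) r" using u i unfolding is_union_def by blast
    then have "sub_le D (m i \<odot> e i) r" using sub_le_precomp[of "m i" r "e i"] r ea[OF i(1)] em[OF i(1)] by simp
    then show ?thesis using em[OF i(1)] i by simp
  qed
  define L where "L = {l \<in> Arr D. Cod D l = Dom D r \<and> r \<odot> l \<in> G}"
  have "inj_on (\<lambda>l. r \<odot> l) L"
  proof (rule inj_onI)
    fix l l' assume "l \<in> L" "l' \<in> L" and eq: "r \<odot> l = r \<odot> l'"
    then have l: "l \<in> Arr D" "Cod D l = Dom D r" "l' \<in> Arr D" "Cod D l' = Dom D r" unfolding L_def by auto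
    then have "Dom D l = Dom D l'" using dom_comp[of l r] dom_comp[of l' r] eq r by simp
    then show "l = l'" using mono_cancel[OF eq r(1)] l by simp
  qed
  moreover have "(\<lambda>l. r \<odot> l) ` L \<subseteq> G" unfolding L_def by blast
  ultimately have "|L| \<le>o |G|" using card_of_ordLeq by blast
  then have cL: "|L| <o lam" using G ordLeq_ordLess_trans by blast
  have "cover (Dom D r) L" unfolding cover_def
  proof (intro conjI ballI impI)
    fix n assume n: "n \<in> Sub D (Dom D r)" "\<forall>l\<in>L. sub_le D l n"
    then have nm: "is_mono D n" "n \<in> Arr D" "Cod D n = Dom D r" using mono_arr by (auto simp: Sub_iff)
    have rn: "r \<odot> n \<in> Sub D x" using mono_comp[OF r(1) nm(1)] nm r by (simp add: Sub_iff)
    then have rnm: "is_mono D (r \<odot> n)" by (simp add: Sub_iff)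
    have "sub_le D (m i) (r \<odot> n)" if i: "i \<in> I" for i
    proof (rule sub_le_cover_precomp[of "e i"])
      have \<phi>: "\<phi> i \<in> G" using bij_betw_apply[OF I(1) i] .
      then have \<phi>a: "\<phi> i \<in> Arr D" using Ga by blast
      obtain l where l: "l \<in> Arr D" "Dom D l = Dom D (\<phi> i)" "Cod D l = Dom D r" "r \<odot> l = \<phi> i"
        using sub_leE[OF Gr[OF \<phi>] \<phi>a] by blast
      then have "l \<in> L" unfolding L_def using \<phi> by simp
      then have "sub_le D l n" using n by blast
      then have "sub_le D (r \<odot> l) (r \<odot> n)" using sub_le_postcomp nm r by simp
      then show "sub_le D (m i \<odot> e i) (r \<odot> n)" using em[OF i] l by simp
    qed (use em[OF i] ea[OF i] rnm nm r in auto)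
    then have "sub_le D r (r \<odot> n)" using u rn unfolding is_union_def by blast
    then obtain k where k: "k \<in> Arr D" "Dom D k = Dom D r" "Cod D k = Dom D (r \<odot> n)" "(r \<odot> n) \<odot> k = r"
      by (rule sub_leE) (use r in auto)
    then have k': "Cod D k = Dom D n" using r nm by simp
    have "r \<odot> (n \<odot> k) = r \<odot> Id D (Dom D r)" using k(1,2,4) k' r nm by simp
    then have "n \<odot> k = Id D (Dom D r)"
      by (rule mono_cancel[OF _ r(1)]) (use k(1,2) k' r nm in auto)
    then show "sub_le D (Id D (Dom D r)) n" by (intro sub_leI[of k]) (use k(1) k' nm in auto)
  qed (use r in \<open>auto simp: L_def\<close>)
  then show ?thesis using image_union[OF r(1,3) Gr] cL unfolding L_def by blast
qed

lemma ex_finite_product: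
  "\<lbrakk>finite I; \<And>i. i \<in> I \<Longrightarrow> X i \<in> Obj D\<rbrakk> \<Longrightarrow> \<exists>x p. is_product D I X x p"
  using ex_product_of_limits[OF finite_limits natLeq_Card_order] finite_iff_ordLess_natLeq by metis

lemma ex_binary_product:
  assumes "x \<in> Obj D" "y \<in> Obj D"
  obtains (prod) P p q where "P \<in> Obj D" "p \<in> Arr D" "Dom D p = P" "Cod D p = x"
    "q \<in> Arr D" "Dom D q = P" "Cod D q = y"
    "\<And>f g. \<lbrakk>f \<in> Arr D; g \<in> Arr D; Dom D f = Dom D g; Cod D f = x; Cod D g = y\<rbrakk> \<Longrightarrow>
      \<exists>h. h \<in> Arr D \<and> Dom D h = Dom D f \<and> Cod D h = P \<and> p \<odot> h = f \<and> q \<odot> h = g"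
    "\<And>h k. \<lbrakk>h \<in> Arr D; k \<in> Arr D; Dom D h = Dom D k; Cod D h = P; Cod D k = P;
      p \<odot> h = p \<odot> k; q \<odot> h = q \<odot> k\<rbrakk> \<Longrightarrow> h = k"
proof -
  have "\<exists>P \<pi>. is_product D UNIV (\<lambda>b. if b then x else y) P \<pi>"
    by (rule ex_finite_product) (use assms in auto)
  then obtain P \<pi> where P: "is_product D UNIV (\<lambda>b. if b then x else y) P \<pi>" by blast
  note Pf = product_facts[OF P]
  show ?thesis
  proof (rule prod[of P "\<pi> True" "\<pi> False"])
    fix f g assume *: "f \<in> Arr D" "g \<in> Arr D" "Dom D f = Dom D g" "Cod D f = x" "Cod D g = y"
    have "(if b then f else g) \<in> hom D (Dom D f) (if b then x else y)" for b using * by (simp add: hom_iff)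
    then obtain h where "h \<in> Arr D" "Dom D h = Dom D f" "Cod D h = P"
      "\<And>b. \<pi> b \<odot> h = (if b then f else g)"
      using product_lift[OF P, of "Dom D f" "\<lambda>b. if b then f else g"] * by auto
    then show "\<exists>h. h \<in> Arr D \<and> Dom D h = Dom D f \<and> Cod D h = P \<and> \<pi> True \<odot> h = f \<and> \<pi> False \<odot> h = g"
      by auto
  next
    fix h k assume "h \<in> Arr D" "k \<in> Arr D" "Dom D h = Dom D k" "Cod D h = P" "Cod D k = P"
      "\<pi> True \<odot> h = \<pi> True \<odot> k" "\<pi> False \<odot> h = \<pi> False \<odot> k"
    then show "h = k" using product_unique[OF P, of h k] by (metis (full_types))
  qed (use Pf in auto)
qed

text \<open>A function glued from local pieces: its graph is the union of the images of the pieces of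
  graph, and compatibility makes the projection of the graph to \<open>z\<close> a monomorphism.\<close>

lemma locally_glue:
  assumes loc: "locally z (\<lambda>f. \<exists>g. R f g)" and y: "y \<in> Obj D"
    and ty: "\<And>f g. R f g \<Longrightarrow> g \<in> Arr D \<and> Dom D g = Dom D f \<and> Cod D g = y"
    and comp: "\<And>f g f' g' p q. \<lbrakk>R f g; R f' g'; f \<in> Arr D; f' \<in> Arr D; Cod D f = z; Cod D f' = z;
      p \<in> Arr D; q \<in> Arr D; Dom D p = Dom D q; Cod D p = Dom D f; Cod D q = Dom D f'; f \<odot> p = f' \<odot> q\<rbrakk>
      \<Longrightarrow> g \<odot> p = g' \<odot> q"
  shows "\<exists>h. h \<in> Arr D \<and> Dom D h = z \<and> Cod D h = y \<and> locally z (\<lambda>f. R f (h \<odot> f))"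
proof -
  obtain S where S: "cover z S" "|S| <o lam" "\<forall>f\<in>S. \<exists>g. R f g" using loc unfolding locally_def by blast
  obtain g where g: "\<And>f. f \<in> S \<Longrightarrow> R f (g f)" using S(3) by metis
  have z: "z \<in> Obj D" using cover_obj[OF S(1)] .
  obtain P p q where P: "P \<in> Obj D" and p: "p \<in> Arr D" "Dom D p = P" "Cod D p = z"
    and q: "q \<in> Arr D" "Dom D q = P" "Cod D q = y"
    and pr: "\<And>f g. \<lbrakk>f \<in> Arr D; g \<in> Arr D; Dom D f = Dom D g; Cod D f = z; Cod D g = y\<rbrakk> \<Longrightarrow>
      \<exists>h. h \<in> Arr D \<and> Dom D h = Dom D f \<and> Cod D h = P \<and> p \<odot> h = f \<and> q \<odot> h = g"
    and pru: "\<And>h k. \<lbrakk>h \<in> Arr D; k \<in> Arr D; Dom D h = Dom D k; Cod D h = P; Cod D k = P;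
      p \<odot> h = p \<odot> k; q \<odot> h = q \<odot> k\<rbrakk> \<Longrightarrow> h = k"
    by (rule ex_binary_product[OF z y]) (rule that; assumption?)
  note Sf = cover_arr[OF S(1)] and gf = ty[OF g]
  have "\<exists>h. h \<in> Arr D \<and> Dom D h = Dom D f \<and> Cod D h = P \<and> p \<odot> h = f \<and> q \<odot> h = g f" if "f \<in> S" for f
    using pr[of f "g f"] Sf[OF that] gf[OF that] by simp
  then obtain t where t: "\<And>f. f \<in> S \<Longrightarrow> t f \<in> Arr D \<and> Dom D (t f) = Dom D f \<and> Cod D (t f) = P"
    and pt: "\<And>f. f \<in> S \<Longrightarrow> p \<odot> t f = f" and qt: "\<And>f. f \<in> S \<Longrightarrow> q \<odot> t f = g f" by metis
  have "\<forall>k\<in>t ` S. k \<in> Arr D \<and> Cod D k = P" using t by auto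
  then obtain r where r: "is_mono D r" "Cod D r = P" and tr: "\<And>k. k \<in> t ` S \<Longrightarrow> sub_le D k r"
    and c: "cover (Dom D r) {l \<in> Arr D. Cod D l = Dom D r \<and> r \<odot> l \<in> t ` S}"
      "|{l \<in> Arr D. Cod D l = Dom D r \<and> r \<odot> l \<in> t ` S}| <o lam"
    by (rule ex_image_union[OF image_ordLess_lam[OF S(2)] P]) (rule that; assumption?)
  have ra: "r \<in> Arr D" using r mono_arr by blast
  let ?L = "{l \<in> Arr D. Cod D l = Dom D r \<and> r \<odot> l \<in> t ` S}"
  have elem: "locally (Dom D a) (\<lambda>k. \<exists>f\<in>S. \<exists>u. u \<in> Arr D \<and> Dom D u = Dom D k \<and> Cod D u = Dom D f \<and> r \<odot> (a \<odot> k) = t f \<odot> u)"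
    if a: "a \<in> Arr D" "Cod D a = Dom D r" for a
  proof (rule locally_mono[OF locally_cover[OF c a]])
    fix k assume k: "k \<in> Arr D" "Cod D k = Dom D a" "\<exists>l\<in>?L. sub_le D (a \<odot> k) l"
    then obtain l f where l: "l \<in> Arr D" "Cod D l = Dom D r" "r \<odot> l = t f" "f \<in> S" "sub_le D (a \<odot> k) l" by blast
    obtain u where u: "u \<in> Arr D" "Dom D u = Dom D (a \<odot> k)" "Cod D u = Dom D l" "l \<odot> u = a \<odot> k"
      using l(5) by (rule sub_leE) (use k a in simp)
    have "Dom D l = Dom D f" using dom_comp[of l r] l ra t by metis
    moreover have "r \<odot> (a \<odot> k) = t f \<odot> u"
      unfolding u(4)[symmetric] using comp_eq_assoc[OF l(3)] l(1,2) ra u(1,3) by simp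
    ultimately show "\<exists>f\<in>S. \<exists>u. u \<in> Arr D \<and> Dom D u = Dom D k \<and> Cod D u = Dom D f \<and> r \<odot> (a \<odot> k) = t f \<odot> u"
      using l(4) u(1-3) k(1,2) a by (intro bexI[of _ f] exI[of _ u]) auto
  qed
  have "is_mono D (p \<odot> r)"
  proof (rule monoI)
    fix a b assume *: "a \<in> Arr D" "b \<in> Arr D" "Dom D a = Dom D b" "Cod D a = Dom D (p \<odot> r)"
      "Cod D b = Dom D (p \<odot> r)" "(p \<odot> r) \<odot> a = (p \<odot> r) \<odot> b"
    have ab: "Cod D a = Dom D r" "Cod D b = Dom D r" using * p r ra by auto
    have pab: "p \<odot> (r \<odot> a) = p \<odot> (r \<odot> b)" using * p r ra by simp
    show "a = b"
    proof (rule locally_eq)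
      show "locally (Dom D a) (\<lambda>k. a \<odot> k = b \<odot> k)"
      proof (rule locally_bind[OF elem[OF *(1) ab(1)]])
        fix k assume k: "k \<in> Arr D" "Cod D k = Dom D a"
          "\<exists>f\<in>S. \<exists>u. u \<in> Arr D \<and> Dom D u = Dom D k \<and> Cod D u = Dom D f \<and> r \<odot> (a \<odot> k) = t f \<odot> u"
        then obtain f u where f: "f \<in> S" and u: "u \<in> Arr D" "Dom D u = Dom D k" "Cod D u = Dom D f"
          and fu: "r \<odot> (a \<odot> k) = t f \<odot> u" by blast
        have "locally (Dom D (b \<odot> k)) (\<lambda>k'. \<exists>f\<in>S. \<exists>u. u \<in> Arr D \<and> Dom D u = Dom D k' \<and> Cod D u = Dom D f \<and> r \<odot> ((b \<odot> k) \<odot> k') = t f \<odot> u)"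
          by (rule elem) (use k(1,2) * ab in auto)
        then have "locally (Dom D k) (\<lambda>k'. \<exists>f\<in>S. \<exists>u. u \<in> Arr D \<and> Dom D u = Dom D k' \<and> Cod D u = Dom D f \<and> r \<odot> ((b \<odot> k) \<odot> k') = t f \<odot> u)"
          using k(1,2) * by simp
        then show "locally (Dom D k) (\<lambda>k'. a \<odot> (k \<odot> k') = b \<odot> (k \<odot> k'))"
        proof (rule locally_mono)
          fix k' assume k': "k' \<in> Arr D" "Cod D k' = Dom D k"
            "\<exists>f\<in>S. \<exists>u. u \<in> Arr D \<and> Dom D u = Dom D k' \<and> Cod D u = Dom D f \<and> r \<odot> ((b \<odot> k) \<odot> k') = t f \<odot> u"
          then obtain f' u' where f': "f' \<in> S" and u': "u' \<in> Arr D" "Dom D u' = Dom D k'" "Cod D u' = Dom D f'"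
            and "r \<odot> ((b \<odot> k) \<odot> k') = t f' \<odot> u'" by blast
          then have fu': "r \<odot> (b \<odot> (k \<odot> k')) = t f' \<odot> u'" using *(1-3) ab k(1,2) k'(1,2) ra by simp
          have fu2: "r \<odot> (a \<odot> (k \<odot> k')) = t f \<odot> (u \<odot> k')"
            using comp_eq_assoc[of r "a \<odot> k" "t f \<odot> u" k'] fu *(1-3) ab k(1,2) k'(1,2) ra u t[OF f] by simp
          have pf: "p \<odot> (t f \<odot> (u \<odot> k')) = f \<odot> (u \<odot> k')"
            using comp_eq_assoc[OF pt[OF f], of "u \<odot> k'"] t[OF f] p u k'(1,2) by simp
          have pf': "p \<odot> (t f' \<odot> u') = f' \<odot> u'"
            using comp_eq_assoc[OF pt[OF f'], of u'] t[OF f'] p u' by simp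
          have "p \<odot> (r \<odot> (a \<odot> (k \<odot> k'))) = p \<odot> (r \<odot> (b \<odot> (k \<odot> k')))"
          proof -
            have "(p \<odot> (r \<odot> a)) \<odot> (k \<odot> k') = (p \<odot> (r \<odot> b)) \<odot> (k \<odot> k')" by (simp only: pab)
            then show ?thesis using *(1-3) ab k(1,2) k'(1,2) ra r p by simp
          qed
          then have 1: "f \<odot> (u \<odot> k') = f' \<odot> u'" unfolding fu' fu2 pf pf' .
          have 2: "g f \<odot> (u \<odot> k') = g f' \<odot> u'"
            by (rule comp[OF g[OF f] g[OF f'] _ _ _ _ _ _ _ _ _ 1]) (use Sf[OF f] Sf[OF f'] u u' k'(1,2) in auto)
          have qf: "q \<odot> (t f \<odot> (u \<odot> k')) = g f \<odot> (u \<odot> k')"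
            using comp_eq_assoc[OF qt[OF f], of "u \<odot> k'"] t[OF f] q u k'(1,2) by simp
          have qf': "q \<odot> (t f' \<odot> u') = g f' \<odot> u'"
            using comp_eq_assoc[OF qt[OF f'], of u'] t[OF f'] q u' by simp
          have "t f \<odot> (u \<odot> k') = t f' \<odot> u'"
          proof (rule pru)
            show "p \<odot> (t f \<odot> (u \<odot> k')) = p \<odot> (t f' \<odot> u')" unfolding pf pf' by fact
            show "q \<odot> (t f \<odot> (u \<odot> k')) = q \<odot> (t f' \<odot> u')" unfolding qf qf' by fact
          qed (use t[OF f] t[OF f'] u u' k'(1,2) in auto)
          then have "r \<odot> (a \<odot> (k \<odot> k')) = r \<odot> (b \<odot> (k \<odot> k'))" unfolding fu' fu2 .
          then show "a \<odot> (k \<odot> k') = b \<odot> (k \<odot> k')"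
            by (rule mono_cancel[OF _ r(1)]) (use *(1-3) ab k(1,2) k'(1,2) in auto)
        qed
      qed
    qed (use * in auto)
  qed (use p r ra in auto)
  note mono = this
  have lift: "\<exists>l. l \<in> Arr D \<and> Dom D l = Dom D f \<and> Cod D l = Dom D r \<and> r \<odot> l = t f" if f: "f \<in> S" for f
    using sub_leE[OF tr[of "t f"]] t[OF f] f by (metis imageI)
  have prl: "(p \<odot> r) \<odot> l = f" if "f \<in> S" "l \<in> Arr D" "Cod D l = Dom D r" "r \<odot> l = t f" for f l
    using that pt[OF that(1)] p r ra by simp
  have "sub_le D (Id D (Cod D (p \<odot> r))) (p \<odot> r)"
  proof (rule cover_Id_le[OF _ mono])
    show "cover (Cod D (p \<odot> r)) S" using S(1) p r ra by simp
    fix f assume f: "f \<in> S"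
    obtain l where l: "l \<in> Arr D" "Dom D l = Dom D f" "Cod D l = Dom D r" "r \<odot> l = t f" using lift[OF f] by blast
    show "sub_le D f (p \<odot> r)" by (rule sub_leI[of l]) (use l(1-3) prl[OF f l(1,3,4)] p r ra in auto)
  qed simp
  then obtain s where s: "s \<in> Arr D" "Dom D s = Cod D (p \<odot> r)" "Cod D s = Dom D (p \<odot> r)"
    "s \<odot> (p \<odot> r) = Id D (Dom D (p \<odot> r))" using iso_of_Id_le[OF mono] by blast
  have s': "Dom D s = z" "Cod D s = Dom D r" using s p r ra by auto
  define h where "h = q \<odot> (r \<odot> s)"
  have h: "h \<in> Arr D" "Dom D h = z" "Cod D h = y" unfolding h_def using q r ra s(1) s' by auto
  have "R f (h \<odot> f)" if f: "f \<in> S" for f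
  proof -
    obtain l where l: "l \<in> Arr D" "Dom D l = Dom D f" "Cod D l = Dom D r" "r \<odot> l = t f" using lift[OF f] by blast
    have "s \<odot> f = (s \<odot> (p \<odot> r)) \<odot> l" using prl[OF f l(1,3,4)] s(1) s' l(1,3) p r ra by simp
    also have "\<dots> = l" unfolding s(4) using l(1-3) p r ra by simp
    finally have sf: "s \<odot> f = l" .
    have "h \<odot> f = q \<odot> (r \<odot> (s \<odot> f))" unfolding h_def using q r ra s(1) s' Sf[OF f] by simp
    also have "\<dots> = g f" unfolding sf l(4) qt[OF f] ..
    finally show ?thesis using g[OF f] by simp
  qed
  then have "locally z (\<lambda>f. R f (h \<odot> f))" using S(1,2) unfolding locally_def by blast
  then show ?thesis using h by blast
qed

end

section \<open>Colimits over down-directed families in a pretopos\<close>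

locale pretopos = geometric_category D lam for D :: "('o, 'm) cat" and lam :: "'l rel" +
  assumes pretopos: "lambda_pretopos lam D"
begin

lemma coproducts: "has_disjoint_stable_coproducts lam D" and exact: "barr_exact D"
  using pretopos unfolding lambda_pretopos_def by auto

lemma initial_of_coproduct: "is_coproduct D {} X z c \<Longrightarrow> is_initial D z"
  and coproduct_of_initial: "is_initial D z \<Longrightarrow> is_coproduct D {} X z c"
  unfolding is_initial_def is_coproduct_def by simp_all

lemma ex_initial: "\<exists>z. is_initial D z"
proof -
  have "\<exists>s c. is_coproduct D ({} :: 'l set) (\<lambda>i. undefined) s c"
    using coproducts finite_ordLess_lam[of "{} :: 'l set"] unfolding has_disjoint_stable_coproducts_def by simp
  then show ?thesis using initial_of_coproduct by blast
qed

lemma strict_initial: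
  assumes z: "is_initial D z" and f: "f \<in> Arr D" "Cod D f = z"
  shows "is_initial D (Dom D f)"
proof -
  have c: "is_coproduct D ({} :: 'l set) (\<lambda>i. undefined) z (\<lambda>i. undefined)"
    by (rule coproduct_of_initial[OF z])
  have "\<forall>f. f \<in> Arr D \<and> Cod D f = z \<longrightarrow>
      (\<forall>c'. is_coproduct D ({} :: 'l set) (\<lambda>i. Dom D (c' i)) (Dom D f) c')"
    using coproducts[unfolded has_disjoint_stable_coproducts_def, rule_format, of "{} :: 'l set" "\<lambda>i. undefined"]
      finite_ordLess_lam[of "{} :: 'l set"] c by simp blast
  then have "is_coproduct D ({} :: 'l set) (\<lambda>i. Dom D (undefined i)) (Dom D f) undefined"
    using f by blast
  then show ?thesis by (rule initial_of_coproduct)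
qed

lemma initial_ex1: "\<lbrakk>is_initial D z; x \<in> Obj D\<rbrakk> \<Longrightarrow> \<exists>!f. f \<in> hom D z x"
  unfolding is_initial_def by blast

lemma initial_eq:
  assumes "is_initial D z" "f \<in> Arr D" "g \<in> Arr D" "Dom D f = z" "Dom D g = z" "Cod D f = Cod D g"
  shows "f = g"
proof -
  have "\<exists>!f'. f' \<in> hom D z (Cod D f)" using initial_ex1 assms by simp
  moreover have "f \<in> hom D z (Cod D f)" "g \<in> hom D z (Cod D f)" using assms by (simp_all add: hom_iff)
  ultimately show ?thesis by (elim ex1E) metis
qed

lemma initial_arrow:
  assumes "is_initial D z" "x \<in> Obj D"
  obtains f where "f \<in> Arr D" "Dom D f = z" "Cod D f = x"
proof -
  obtain f where "f \<in> hom D z x" using initial_ex1[OF assms] by (elim ex1E)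
  then show ?thesis by (intro that[of f]) (simp_all add: hom_iff)
qed

lemma locally_initial:
  assumes "is_initial D z"
  shows "locally z \<Phi>"
proof -
  have z: "z \<in> Obj D" using assms unfolding is_initial_def by blast
  have "cover z {}" unfolding cover_def
  proof (intro conjI ballI impI)
    fix m assume "m \<in> Sub D z"
    then have m: "m \<in> Arr D" "Cod D m = z" using mono_arr by (auto simp: Sub_iff)
    obtain f where f: "f \<in> Arr D" "Dom D f = z" "Cod D f = Dom D m"
      using initial_arrow[OF assms, of "Dom D m"] m by auto
    have "m \<odot> f = Id D z" by (rule initial_eq[OF assms]) (use f m z in auto)
    then show "sub_le D (Id D z) m" by (intro sub_leI[of f]) (use f m in auto)
  qed (use z in auto)
  then show ?thesis using finite_ordLess_lam[of "{}"] unfolding locally_def by (intro exI[of _ "{}"]) simp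
qed

lemma initial_of_locally:
  assumes "locally z (\<lambda>f. is_initial D (Dom D f))"
  shows "is_initial D z"
proof -
  obtain o' where o': "is_initial D o'" using ex_initial by blast
  obtain i where i: "i \<in> Arr D" "Dom D i = o'" "Cod D i = z" using initial_arrow[OF o' locally_obj[OF assms]] .
  have "is_mono D i"
    by (rule monoI[OF i(1)]) (use i initial_eq strict_initial[OF o'] in metis)
  have "sub_le D (Id D z) i"
  proof (rule locally_factor[OF _ _ _ \<open>is_mono D i\<close>])
    show "locally z (\<lambda>f. sub_le D (Id D z \<odot> f) i)"
    proof (rule locally_mono[OF assms])
      fix f assume f: "f \<in> Arr D" "Cod D f = z" "is_initial D (Dom D f)"
      have "o' \<in> Obj D" using i by auto
      then obtain k where k: "k \<in> Arr D" "Dom D k = Dom D f" "Cod D k = o'" using initial_arrow[OF f(3)] by metis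
      have "i \<odot> k = Id D z \<odot> f" by (rule initial_eq[OF f(3)]) (use k i f in auto)
      then show "sub_le D (Id D z \<odot> f) i" by (intro sub_leI[of k]) (use k i in auto)
    qed
  qed (use i locally_obj[OF assms] in auto)
  then obtain s where "s \<in> Arr D" "Dom D s = Dom D (Id D z)" "Cod D s = Dom D i"
    by (rule sub_leE) (use locally_obj[OF assms] in auto)
  then show ?thesis using strict_initial[OF o', of s] i locally_obj[OF assms] by simp
qed

lemma coproduct_ex1:
  assumes "is_coproduct D I X x c" "y \<in> Obj D" "\<And>i. i \<in> I \<Longrightarrow> d i \<in> hom D (X i) y"
  shows "\<exists>!h. h \<in> hom D x y \<and> (\<forall>i \<in> I. h \<odot> c i = d i)"
proof -
  have "\<forall>y \<in> Obj D. \<forall>d. (\<forall>i \<in> I. d i \<in> hom D (X i) y) \<longrightarrow>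
        (\<exists>!h. h \<in> hom D x y \<and> (\<forall>i \<in> I. h \<odot> c i = d i))"
    using assms(1) unfolding is_coproduct_def by (elim conjE) assumption
  then show ?thesis using assms(2,3) by (elim ballE allE[of _ d] impE) auto
qed

lemma coproduct_cover:
  assumes c: "is_coproduct D I X s c"
  shows "cover s (c ` I)"
  unfolding cover_def
proof (intro conjI ballI impI)
  have s: "s \<in> Obj D" and ca: "\<And>i. i \<in> I \<Longrightarrow> c i \<in> Arr D \<and> Dom D (c i) = X i \<and> Cod D (c i) = s"
    using c unfolding is_coproduct_def by (auto simp: hom_iff)
  show "s \<in> Obj D" by fact
  show "f \<in> Arr D" "Cod D f = s" if "f \<in> c ` I" for f using ca that by auto
  fix m assume m: "m \<in> Sub D s" "\<forall>f\<in>c ` I. sub_le D f m"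
  then have ma: "m \<in> Arr D" "Cod D m = s" using mono_arr by (auto simp: Sub_iff)
  have "\<exists>l. l \<in> Arr D \<and> Dom D l = X i \<and> Cod D l = Dom D m \<and> m \<odot> l = c i" if "i \<in> I" for i
    using sub_leE[of "c i" m] m(2) ca[OF that] that by (metis imageI)
  then obtain l where l: "\<And>i. i \<in> I \<Longrightarrow> l i \<in> Arr D \<and> Dom D (l i) = X i \<and> Cod D (l i) = Dom D m \<and> m \<odot> l i = c i"
    by metis
  have "\<exists>!h. h \<in> hom D s (Dom D m) \<and> (\<forall>i \<in> I. h \<odot> c i = l i)"
    by (rule coproduct_ex1[OF c]) (use l ma in \<open>auto simp: hom_iff\<close>)
  then obtain h where h: "h \<in> hom D s (Dom D m) \<and> (\<forall>i \<in> I. h \<odot> c i = l i)" by (elim ex1E)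
  then have ha: "h \<in> Arr D" "Dom D h = s" "Cod D h = Dom D m" by (auto simp: hom_iff)
  have "\<exists>!u. u \<in> hom D s s \<and> (\<forall>i \<in> I. u \<odot> c i = c i)"
    by (rule coproduct_ex1[OF c s]) (use ca in \<open>auto simp: hom_iff\<close>)
  moreover have "m \<odot> h \<in> hom D s s \<and> (\<forall>i \<in> I. (m \<odot> h) \<odot> c i = c i)"
    using ha ma ca h l by (simp add: hom_iff)
  moreover have "Id D s \<in> hom D s s \<and> (\<forall>i \<in> I. Id D s \<odot> c i = c i)" using s ca by (simp add: hom_iff)
  ultimately have "m \<odot> h = Id D s" by (elim ex1E) metis
  then show "sub_le D (Id D s) m" by (intro sub_leI[of h]) (use ha ma in auto)
qed

lemma ex_coproduct:
  assumes I: "|I| <o lam" and X: "\<And>i. i \<in> I \<Longrightarrow> X i \<in> Obj D"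
  obtains (coprod) s c where "s \<in> Obj D" "\<And>i. i \<in> I \<Longrightarrow> is_mono D (c i)"
    "\<And>i. i \<in> I \<Longrightarrow> c i \<in> Arr D \<and> Dom D (c i) = X i \<and> Cod D (c i) = s"
    "\<And>i j a b. \<lbrakk>i \<in> I; j \<in> I; i \<noteq> j; a \<in> Arr D; b \<in> Arr D; Dom D a = Dom D b; Cod D a = X i; Cod D b = X j;
       c i \<odot> a = c j \<odot> b\<rbrakk> \<Longrightarrow> is_initial D (Dom D a)"
    "cover s (c ` I)"
proof -
  obtain J :: "'l set" and \<phi> where J: "|J| <o lam" and \<phi>: "bij_betw \<phi> J I" using reindex_lam[OF I] .
  define \<psi> where "\<psi> = inv_into J \<phi>"
  have \<psi>: "\<psi> i \<in> J" "\<phi> (\<psi> i) = i" if "i \<in> I" for i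
    using bij_betw_inv_into_right[OF \<phi>] that bij_betw_apply[OF bij_betw_inv_into[OF \<phi>]] unfolding \<psi>_def by auto
  have \<phi>J: "\<phi> j \<in> I" if "j \<in> J" for j using bij_betw_apply[OF \<phi> that] .
  have "\<forall>j\<in>J. (X \<circ> \<phi>) j \<in> Obj D" using X \<phi>J by simp
  note C = coproducts[unfolded has_disjoint_stable_coproducts_def, THEN spec[of _ J],
      THEN spec[of _ "X \<circ> \<phi>"], THEN mp, OF conjI[OF J this]]
  obtain s c where c: "is_coproduct D J (X \<circ> \<phi>) s c" using C[THEN conjunct1] by blast
  then have ca: "s \<in> Obj D" "\<And>j. j \<in> J \<Longrightarrow> c j \<in> Arr D \<and> Dom D (c j) = X (\<phi> j) \<and> Cod D (c j) = s"
    unfolding is_coproduct_def by (auto simp: hom_iff)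
  note C2 = C[THEN conjunct2, THEN spec[of _ s], THEN spec[of _ c], THEN mp, OF c]
  have mono: "is_mono D (c j)" if "j \<in> J" for j using C2[THEN conjunct1] that by (rule bspec)
  have disj: "is_initial D (Dom D p)" if "i \<in> J" "j \<in> J" "i \<noteq> j" "is_pullback D (c i) (c j) p q" for i j p q
    using C2[THEN conjunct2, THEN conjunct1] that by blast
  show ?thesis
  proof (rule coprod[of s "\<lambda>i. c (\<psi> i)"])
    fix i j a b assume *: "i \<in> I" "j \<in> I" "i \<noteq> j" "a \<in> Arr D" "b \<in> Arr D" "Dom D a = Dom D b" "Cod D a = X i"
      "Cod D b = X j" "c (\<psi> i) \<odot> a = c (\<psi> j) \<odot> b"
    have "\<psi> i \<noteq> \<psi> j" using \<psi> * by metis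
    obtain p q where pq: "is_pullback D (c (\<psi> i)) (c (\<psi> j)) p q"
      using ex_pb[of "c (\<psi> i)" "c (\<psi> j)"] ca \<psi> * by auto
    obtain u where u: "u \<in> Arr D" "Dom D u = Dom D a" "Cod D u = Dom D p"
      using pullback_lift[OF pq *(4,5,6)] ca \<psi> * by metis
    then show "is_initial D (Dom D a)"
      using strict_initial[OF disj[OF _ _ \<open>\<psi> i \<noteq> \<psi> j\<close> pq], of u] \<psi> * by simp
  next
    have "(\<lambda>i. c (\<psi> i)) ` I = c ` J"
      using \<psi> \<phi>J bij_betw_inv_into_left[OF \<phi>] unfolding \<psi>_def by (force simp: image_iff)
    then show "cover s ((\<lambda>i. c (\<psi> i)) ` I)" using coproduct_cover[OF c] by simp
  qed (use ca mono \<psi> in auto)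
qed

end

locale directed_diagram = pretopos D lam for D :: "('o, 'm) cat" and lam :: "'l rel" +
  fixes U :: "'i set set" and T :: "('i set, 'i set \<times> 'i set, 'o, 'm) func"
  assumes small: "|U| <o lam" and Int: "\<And>J K. \<lbrakk>J \<in> U; K \<in> U\<rbrakk> \<Longrightarrow> J \<inter> K \<in> U"
    and diagram: "is_functor (poset_op (inclusion_order U)) D T"
begin

abbreviation "ob J \<equiv> FObj T J"
abbreviation "tr J K \<equiv> FArr T (J, K)"
abbreviation "index \<equiv> poset_op (inclusion_order U)"

lemma Obj_index: "Obj index = U"
  unfolding poset_op_def inclusion_order_def Field_def by auto

lemma Arr_index: "f \<in> Arr index \<longleftrightarrow> fst f \<in> U \<and> snd f \<in> U \<and> snd f \<subseteq> fst f"
  unfolding poset_op_def inclusion_order_def by (cases f) auto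

lemma Dom_index: "Dom index = fst" and Cod_index: "Cod index = snd"
  unfolding poset_op_def by auto

lemma ob_obj [simp]: "J \<in> U \<Longrightarrow> ob J \<in> Obj D"
  using diagram unfolding is_functor_def Obj_index by blast

lemma tr_arr:
  assumes "J \<in> U" "K \<in> U" "K \<subseteq> J"
  shows "tr J K \<in> Arr D" "Dom D (tr J K) = ob J" "Cod D (tr J K) = ob K"
proof -
  have "(J, K) \<in> Arr index" using assms by (simp add: Arr_index)
  then have "tr J K \<in> hom D (ob J) (ob K)"
    using diagram unfolding is_functor_def by (metis Dom_index Cod_index fst_conv snd_conv)
  then show "tr J K \<in> Arr D" "Dom D (tr J K) = ob J" "Cod D (tr J K) = ob K" by (simp_all add: hom_iff)
qed

lemma tr_id: "J \<in> U \<Longrightarrow> tr J J = Id D (ob J)"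
  using diagram unfolding is_functor_def Obj_index by (simp add: poset_op_def)

lemma tr_comp:
  assumes "J \<in> U" "K \<in> U" "L \<in> U" "K \<subseteq> J" "L \<subseteq> K"
  shows "tr K L \<odot> tr J K = tr J L"
proof -
  have "(J, K) \<in> Arr index" "(K, L) \<in> Arr index" using assms by (simp_all add: Arr_index)
  then have "FArr T (Comp index (K, L) (J, K)) = tr K L \<odot> tr J K"
    using diagram unfolding is_functor_def by (simp add: Dom_index Cod_index)
  then show ?thesis by (simp add: poset_op_def)
qed

lemma tr_comp_assoc:
  assumes "J \<in> U" "K \<in> U" "L \<in> U" "K \<subseteq> J" "L \<subseteq> K" "x \<in> Arr D" "Cod D x = ob J"
  shows "tr K L \<odot> (tr J K \<odot> x) = tr J L \<odot> x"
  by (rule comp_eq_assoc[OF tr_comp]) (use assms tr_arr in auto)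

lemma cocone_iff:
  "is_cocone index D T x c \<longleftrightarrow> x \<in> Obj D \<and>
     (\<forall>J\<in>U. c J \<in> Arr D \<and> Dom D (c J) = ob J \<and> Cod D (c J) = x) \<and>
     (\<forall>J\<in>U. \<forall>K\<in>U. K \<subseteq> J \<longrightarrow> c K \<odot> tr J K = c J)"
proof -
  have "(\<forall>f\<in>Arr index. c (Cod index f) \<odot> FArr T f = c (Dom index f)) \<longleftrightarrow>
     (\<forall>J\<in>U. \<forall>K\<in>U. K \<subseteq> J \<longrightarrow> c K \<odot> tr J K = c J)"
    unfolding Ball_def Arr_index Dom_index Cod_index by auto
  then show ?thesis unfolding is_cocone_def Obj_index by (simp add: hom_iff)
qed

definition separated :: "('i set \<Rightarrow> 'm) \<Rightarrow> bool" where
  "separated c \<longleftrightarrow> (\<forall>J\<in>U. \<forall>K\<in>U. \<forall>a b. a \<in> Arr D \<and> b \<in> Arr D \<and> Dom D a = Dom D b \<and> Cod D a = ob J \<and>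
     Cod D b = ob K \<and> c J \<odot> a = c K \<odot> b \<longrightarrow>
     locally (Dom D a) (\<lambda>f. \<exists>L\<in>U. L \<subseteq> J \<inter> K \<and> tr J L \<odot> (a \<odot> f) = tr K L \<odot> (b \<odot> f)))"

text \<open>The coproduct of the diagram modulo the relation of having equal images at some later stage.\<close>

lemma ex_separated_cocone: "\<exists>x c. is_cocone index D T x c \<and> separated c"
proof -
  obtain S s where S: "S \<in> Obj D" and sm: "\<And>J. J \<in> U \<Longrightarrow> is_mono D (s J)"
    and sa: "\<And>J. J \<in> U \<Longrightarrow> s J \<in> Arr D \<and> Dom D (s J) = ob J \<and> Cod D (s J) = S"
    and sd: "\<And>J K a b. \<lbrakk>J \<in> U; K \<in> U; J \<noteq> K; a \<in> Arr D; b \<in> Arr D; Dom D a = Dom D b; Cod D a = ob J;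
       Cod D b = ob K; s J \<odot> a = s K \<odot> b\<rbrakk> \<Longrightarrow> is_initial D (Dom D a)"
    and sc: "cover S (s ` U)"
    by (rule ex_coproduct[OF small, of "\<lambda>J. ob J"], erule ob_obj) (rule that; assumption?)
  obtain Q p q where Q: "Q \<in> Obj D" and p: "p \<in> Arr D" "Dom D p = Q" "Cod D p = S"
    and q: "q \<in> Arr D" "Dom D q = Q" "Cod D q = S"
    and pr: "\<And>f g. \<lbrakk>f \<in> Arr D; g \<in> Arr D; Dom D f = Dom D g; Cod D f = S; Cod D g = S\<rbrakk> \<Longrightarrow>
      \<exists>h. h \<in> Arr D \<and> Dom D h = Dom D f \<and> Cod D h = Q \<and> p \<odot> h = f \<and> q \<odot> h = g"
    and pru: "\<And>h k. \<lbrakk>h \<in> Arr D; k \<in> Arr D; Dom D h = Dom D k; Cod D h = Q; Cod D k = Q;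
      p \<odot> h = p \<odot> k; q \<odot> h = q \<odot> k\<rbrakk> \<Longrightarrow> h = k"
    by (rule ex_binary_product[OF S S]) (rule that; assumption?)
  define good where "good J K L \<longleftrightarrow> J \<in> U \<and> K \<in> U \<and> L \<in> U \<and> L \<subseteq> J \<and> L \<subseteq> K" for J K L
  have ta: "tr J L \<in> Arr D" "Dom D (tr J L) = ob J" "Cod D (tr J L) = ob L"
    "tr K L \<in> Arr D" "Dom D (tr K L) = ob K" "Cod D (tr K L) = ob L" if "good J K L" for J K L
    using tr_arr that unfolding good_def by auto
  have "\<exists>u v. is_pullback D (tr J L) (tr K L) u v" if "good J K L" for J K L
    using ex_pb ta[OF that] by simp
  then obtain u v where uv: "\<And>J K L. good J K L \<Longrightarrow> is_pullback D (tr J L) (tr K L) (u J K L) (v J K L)"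
    by metis
  have uva: "u J K L \<in> Arr D" "v J K L \<in> Arr D" "Dom D (v J K L) = Dom D (u J K L)"
    "Cod D (u J K L) = ob J" "Cod D (v J K L) = ob K" "tr J L \<odot> u J K L = tr K L \<odot> v J K L"
    if "good J K L" for J K L
    using pullback_facts[OF uv[OF that]] ta[OF that] by simp_all
  have "\<exists>h. h \<in> Arr D \<and> Dom D h = Dom D (u J K L) \<and> Cod D h = Q \<and> p \<odot> h = s J \<odot> u J K L \<and> q \<odot> h = s K \<odot> v J K L"
    if "good J K L" for J K L
    using pr[of "s J \<odot> u J K L" "s K \<odot> v J K L"] uva[OF that] sa that unfolding good_def by simp
  then obtain g where g: "\<And>J K L. good J K L \<Longrightarrow> g J K L \<in> Arr D \<and> Dom D (g J K L) = Dom D (u J K L) \<and>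
      Cod D (g J K L) = Q \<and> p \<odot> g J K L = s J \<odot> u J K L \<and> q \<odot> g J K L = s K \<odot> v J K L" by metis
  have gA: "g J K L \<in> Arr D" "Dom D (g J K L) = Dom D (u J K L)" "Cod D (g J K L) = Q"
    and gp: "p \<odot> g J K L = s J \<odot> u J K L" and gq: "q \<odot> g J K L = s K \<odot> v J K L"
    if "good J K L" for J K L
    using g[OF that] by simp_all
  define G where "G = (\<Union>J\<in>U. \<Union>K\<in>U. g J K ` {L \<in> U. L \<subseteq> J \<and> L \<subseteq> K})"
  have G: "x \<in> G \<longleftrightarrow> (\<exists>J K L. good J K L \<and> x = g J K L)" for x unfolding G_def good_def by auto
  have "|{L \<in> U. L \<subseteq> J \<and> L \<subseteq> K}| <o lam" for J K
    using small card_of_mono1[of "{L \<in> U. L \<subseteq> J \<and> L \<subseteq> K}" U] ordLeq_ordLess_trans by blast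
  then have cG: "|G| <o lam" unfolding G_def
    by (intro UN_ordLess_lam small image_ordLess_lam)
  have "\<forall>x\<in>G. x \<in> Arr D \<and> Cod D x = Q"
  proof
    fix x assume "x \<in> G"
    then obtain J K L where "good J K L" "x = g J K L" using G[of x] by blast
    then show "x \<in> Arr D \<and> Cod D x = Q" using g[of J K L] by simp
  qed
  then obtain r where r: "is_mono D r" "Cod D r = Q" and Gr: "\<And>x. x \<in> G \<Longrightarrow> sub_le D x r"
    and rc: "cover (Dom D r) {l \<in> Arr D. Cod D l = Dom D r \<and> r \<odot> l \<in> G}"
      "|{l \<in> Arr D. Cod D l = Dom D r \<and> r \<odot> l \<in> G}| <o lam"
    by (rule ex_image_union[OF cG Q]) (rule that; assumption?)
  have ra: "r \<in> Arr D" using r mono_arr by blast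
  define r0 where "r0 = p \<odot> r"
  define r1 where "r1 = q \<odot> r"
  have r01: "r0 \<in> Arr D" "Dom D r0 = Dom D r" "Cod D r0 = S" "r1 \<in> Arr D" "Dom D r1 = Dom D r" "Cod D r1 = S"
    unfolding r0_def r1_def using p q r ra by auto
  define gen where "gen a b \<longleftrightarrow> (\<exists>J K L x y. good J K L \<and> x \<in> Arr D \<and> y \<in> Arr D \<and> Dom D x = Dom D a \<and> Dom D y = Dom D a \<and>
    Cod D x = ob J \<and> Cod D y = ob K \<and> tr J L \<odot> x = tr K L \<odot> y \<and> a = s J \<odot> x \<and> b = s K \<odot> y)" for a b
  define rel where "rel a b \<longleftrightarrow> (\<exists>k. k \<in> Arr D \<and> Dom D k = Dom D a \<and> Cod D k = Dom D r \<and> r0 \<odot> k = a \<and> r1 \<odot> k = b)" for a b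
  have rel_gen: "locally (Dom D a) (\<lambda>f. gen (a \<odot> f) (b \<odot> f))"
    if ab: "a \<in> Arr D" "b \<in> Arr D" "Dom D a = Dom D b" "rel a b" for a b
  proof -
    obtain k where k: "k \<in> Arr D" "Dom D k = Dom D a" "Cod D k = Dom D r" "r0 \<odot> k = a" "r1 \<odot> k = b"
      using ab(4) unfolding rel_def by blast
    have "locally (Dom D k) (\<lambda>f. gen (a \<odot> f) (b \<odot> f))"
    proof (rule locally_mono[OF locally_cover[OF rc k(1,3)]])
      fix f assume f: "f \<in> Arr D" "Cod D f = Dom D k"
        "\<exists>l\<in>{l \<in> Arr D. Cod D l = Dom D r \<and> r \<odot> l \<in> G}. sub_le D (k \<odot> f) l"
      then obtain l where l: "l \<in> Arr D" "Cod D l = Dom D r" "r \<odot> l \<in> G" "sub_le D (k \<odot> f) l" by blast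
      obtain w where w: "w \<in> Arr D" "Dom D w = Dom D (k \<odot> f)" "Cod D w = Dom D l" "l \<odot> w = k \<odot> f"
        using l(4) by (rule sub_leE) (use k(1) f in simp)
      obtain J K L where JKL: "good J K L" "r \<odot> l = g J K L" using l(3) G by blast
      note g1 = gA[OF JKL(1)]
      have dl: "Dom D l = Dom D (u J K L)" using dom_comp[of l r] l(1,2) ra JKL(2) g1 by metis
      have w': "Dom D w = Dom D f" "Cod D w = Dom D (u J K L)" using w k(1) f dl by auto
      have gw: "r \<odot> (k \<odot> f) = g J K L \<odot> w"
        unfolding w(4)[symmetric] by (rule comp_eq_assoc[OF JKL(2)]) (use l(1,2) ra w(1,3) in auto)
      have af: "a \<odot> f = s J \<odot> (u J K L \<odot> w)"
      proof -
        have "a \<odot> f = p \<odot> (r \<odot> (k \<odot> f))" using k(4) unfolding r0_def using p r ra k(1-3) f by force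
        also have "\<dots> = (s J \<odot> u J K L) \<odot> w" unfolding gw
          by (rule comp_eq_assoc[OF gp[OF JKL(1)]]) (use p g1 w(1) w' in auto)
        also have "\<dots> = s J \<odot> (u J K L \<odot> w)"
          using uva(1-5)[OF JKL(1)] sa w(1) w' JKL(1) unfolding good_def by simp
        finally show ?thesis .
      qed
      have bf: "b \<odot> f = s K \<odot> (v J K L \<odot> w)"
      proof -
        have "b \<odot> f = q \<odot> (r \<odot> (k \<odot> f))" using k(5) unfolding r1_def using q r ra k(1-3) f by force
        also have "\<dots> = (s K \<odot> v J K L) \<odot> w" unfolding gw
          by (rule comp_eq_assoc[OF gq[OF JKL(1)]]) (use q g1 w(1) w' in auto)
        also have "\<dots> = s K \<odot> (v J K L \<odot> w)"
          using uva(1-5)[OF JKL(1)] sa w(1) w' JKL(1) unfolding good_def by simp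
        finally show ?thesis .
      qed
      have "(tr J L \<odot> u J K L) \<odot> w = (tr K L \<odot> v J K L) \<odot> w" by (simp only: uva(6)[OF JKL(1)])
      then have tuv: "tr J L \<odot> (u J K L \<odot> w) = tr K L \<odot> (v J K L \<odot> w)"
        using uva(1-5)[OF JKL(1)] ta[OF JKL(1)] w(1) w' by simp
      have "Dom D (a \<odot> f) = Dom D f" using ab f k by simp
      then show "gen (a \<odot> f) (b \<odot> f)" unfolding gen_def
        using JKL(1) af bf tuv uva(1-5)[OF JKL(1)] w(1) w'
        by (intro exI[of _ J] exI[of _ K] exI[of _ L] exI[of _ "u J K L \<odot> w"] exI[of _ "v J K L \<odot> w"]) simp
    qed
    then show ?thesis using k(2) by simp
  qed
  have gen_rel: "rel a b"
    if ab: "a \<in> Arr D" "b \<in> Arr D" "Dom D a = Dom D b" "Cod D a = S" "Cod D b = S"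
      "locally (Dom D a) (\<lambda>f. gen (a \<odot> f) (b \<odot> f))" for a b
  proof -
    obtain h where h: "h \<in> Arr D" "Dom D h = Dom D a" "Cod D h = Q" "p \<odot> h = a" "q \<odot> h = b"
      using pr[OF ab(1-5)] by blast
    have "sub_le D h r"
    proof (rule locally_factor[OF _ h(1,2) r(1)])
      show "locally (Dom D a) (\<lambda>f. sub_le D (h \<odot> f) r)"
      proof (rule locally_mono[OF ab(6)])
        fix f assume f: "f \<in> Arr D" "Cod D f = Dom D a" "gen (a \<odot> f) (b \<odot> f)"
        have df: "Dom D (a \<odot> f) = Dom D f" using ab f by simp
        obtain J K L x y where JKL: "good J K L" and x: "x \<in> Arr D" "Dom D x = Dom D f" "Cod D x = ob J"
          and y: "y \<in> Arr D" "Dom D y = Dom D f" "Cod D y = ob K" and xy: "tr J L \<odot> x = tr K L \<odot> y"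
          and ax: "a \<odot> f = s J \<odot> x" and bx: "b \<odot> f = s K \<odot> y" using f(3) unfolding gen_def df by blast
        obtain w where w: "w \<in> Arr D" "Dom D w = Dom D x" "Cod D w = Dom D (u J K L)" "u J K L \<odot> w = x" "v J K L \<odot> w = y"
          by (rule pullback_lift[OF uv[OF JKL] x(1) y(1)]) (use x y xy ta[OF JKL] in auto)
        note g1 = gA[OF JKL]
        have "h \<odot> f = g J K L \<odot> w"
        proof (rule pru)
          have "p \<odot> (h \<odot> f) = s J \<odot> x" using comp_eq_assoc[OF h(4), of f] ax h(1-3) p f by simp
          also have "\<dots> = (s J \<odot> u J K L) \<odot> w"
            unfolding w(4)[symmetric] using uva(1-5)[OF JKL] sa w(1-3) JKL unfolding good_def by simp
          also have "\<dots> = p \<odot> (g J K L \<odot> w)"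
            by (rule comp_eq_assoc[OF gp[OF JKL], symmetric]) (use p g1 w(1-3) in auto)
          finally show "p \<odot> (h \<odot> f) = p \<odot> (g J K L \<odot> w)" .
          have "q \<odot> (h \<odot> f) = s K \<odot> y" using comp_eq_assoc[OF h(5), of f] bx h(1-3) q f by simp
          also have "\<dots> = (s K \<odot> v J K L) \<odot> w"
            unfolding w(5)[symmetric] using uva(1-5)[OF JKL] sa w(1-3) JKL unfolding good_def by simp
          also have "\<dots> = q \<odot> (g J K L \<odot> w)"
            by (rule comp_eq_assoc[OF gq[OF JKL], symmetric]) (use q g1 w(1-3) in auto)
          finally show "q \<odot> (h \<odot> f) = q \<odot> (g J K L \<odot> w)" .
        qed (use h(1-3) f w(1-3) g1 x in auto)
        moreover have "sub_le D (g J K L) r" using Gr G JKL by blast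
        ultimately show "sub_le D (h \<odot> f) r" using sub_le_precomp[of "g J K L" r w] ra w g1 by simp
      qed
    qed (use r h in auto)
    then obtain k where k: "k \<in> Arr D" "Dom D k = Dom D h" "Cod D k = Dom D r" "r \<odot> k = h"
      using h(1) by (rule sub_leE)
    have "r0 \<odot> k = a" "r1 \<odot> k = b" unfolding r0_def r1_def using k h p q r ra by auto
    then show ?thesis unfolding rel_def using k(1-3) h(2) by auto
  qed
  have gen_sieve: "gen (a \<odot> (f \<odot> k)) (b \<odot> (f \<odot> k))"
    if gs: "gen (a \<odot> f) (b \<odot> f)" "a \<in> Arr D" "b \<in> Arr D" "f \<in> Arr D" "k \<in> Arr D" "Cod D f = Dom D a"
      "Dom D b = Dom D a" "Cod D k = Dom D f" for a b f k
  proof -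
    have df: "Dom D (a \<odot> f) = Dom D f" "Dom D (a \<odot> (f \<odot> k)) = Dom D k" using gs by auto
    obtain J K L x y where JKL: "good J K L" and x: "x \<in> Arr D" "Dom D x = Dom D f" "Cod D x = ob J"
      and y: "y \<in> Arr D" "Dom D y = Dom D f" "Cod D y = ob K" and xy: "tr J L \<odot> x = tr K L \<odot> y"
      and ax: "a \<odot> f = s J \<odot> x" and bx: "b \<odot> f = s K \<odot> y" using gs(1) unfolding gen_def df by blast
    have sJ: "s J \<in> Arr D" "Dom D (s J) = ob J" "s K \<in> Arr D" "Dom D (s K) = ob K"
      using sa JKL unfolding good_def by auto
    have "a \<odot> (f \<odot> k) = s J \<odot> (x \<odot> k)"
      using comp_eq_assoc[OF ax, of k] sJ x gs(2-) by simp
    moreover have "b \<odot> (f \<odot> k) = s K \<odot> (y \<odot> k)"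
      using comp_eq_assoc[OF bx, of k] sJ y gs(2-) by simp
    moreover have "tr J L \<odot> (x \<odot> k) = tr K L \<odot> (y \<odot> k)"
      using comp_eq_assoc[OF xy, of k] ta[OF JKL] x y gs(5,8) by simp
    ultimately show ?thesis unfolding gen_def df using JKL x y gs(5,8)
      by (intro exI[of _ J] exI[of _ K] exI[of _ L] exI[of _ "x \<odot> k"] exI[of _ "y \<odot> k"]) simp
  qed
  have sep: "is_initial D (Dom D x) \<or> (J = K \<and> x = y)"
    if "J \<in> U" "K \<in> U" "x \<in> Arr D" "y \<in> Arr D" "Dom D x = Dom D y" "Cod D x = ob J" "Cod D y = ob K"
      "s J \<odot> x = s K \<odot> y" for J K x y
  proof (cases "J = K")
    case True
    have "x = y" by (rule mono_cancel[of "s J"]) (use that sm sa True in auto)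
    then show ?thesis using True by simp
  next
    case False
    then show ?thesis using sd that by blast
  qed
  have gen_trans: "locally (Dom D a) (\<lambda>f. gen (a \<odot> f) (c \<odot> f))"
    if gab: "gen a b" and gbc: "gen b c" and ac: "a \<in> Arr D" "c \<in> Arr D" "b \<in> Arr D" "Dom D c = Dom D a" "Dom D b = Dom D a" for a b c
  proof -
    obtain J K L x y where JKL: "good J K L" and x: "x \<in> Arr D" "Dom D x = Dom D a" "Cod D x = ob J"
      and y: "y \<in> Arr D" "Dom D y = Dom D a" "Cod D y = ob K" and xy: "tr J L \<odot> x = tr K L \<odot> y"
      and ax: "a = s J \<odot> x" and bx: "b = s K \<odot> y" using gab unfolding gen_def by blast
    obtain J' K' L' x' y' where JKL': "good J' K' L'" and x': "x' \<in> Arr D" "Dom D x' = Dom D b" "Cod D x' = ob J'"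
      and y': "y' \<in> Arr D" "Dom D y' = Dom D b" "Cod D y' = ob K'" and xy': "tr J' L' \<odot> x' = tr K' L' \<odot> y'"
      and bx': "b = s J' \<odot> x'" and cx': "c = s K' \<odot> y'" using gbc unfolding gen_def by blast
    have "is_initial D (Dom D y) \<or> (K = J' \<and> y = x')"
      by (rule sep) (use JKL JKL' y x' bx bx' ac in \<open>auto simp: good_def\<close>)
    then show ?thesis
    proof
      assume "is_initial D (Dom D y)"
      then show ?thesis using locally_initial y(2) by simp
    next
      assume e: "K = J' \<and> y = x'"
      have U': "J \<in> U" "K \<in> U" "L \<in> U" "K' \<in> U" "L' \<in> U" "L \<inter> L' \<in> U" "L \<subseteq> J" "L \<subseteq> K" "L' \<subseteq> K" "L' \<subseteq> K'"
        using JKL JKL' Int e unfolding good_def by auto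
      have "tr J (L \<inter> L') \<odot> x = tr L (L \<inter> L') \<odot> (tr J L \<odot> x)" using tr_comp_assoc U' x by simp
      also have "\<dots> = tr K (L \<inter> L') \<odot> y" unfolding xy using tr_comp_assoc U' y by simp
      also have "\<dots> = tr L' (L \<inter> L') \<odot> (tr K L' \<odot> y)" using tr_comp_assoc U' y by simp
      also have "\<dots> = tr L' (L \<inter> L') \<odot> (tr K' L' \<odot> y')" using xy' e by simp
      also have "\<dots> = tr K' (L \<inter> L') \<odot> y'" using tr_comp_assoc U' y' by simp
      finally have t: "tr J (L \<inter> L') \<odot> x = tr K' (L \<inter> L') \<odot> y'" .
      have "good J K' (L \<inter> L')" using U' unfolding good_def by auto
      then have "gen a c" unfolding gen_def using x y' t ax cx' ac
        by (intro exI[of _ J] exI[of _ K'] exI[of _ "L \<inter> L'"] exI[of _ x] exI[of _ y']) simp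
      then show ?thesis by (intro locally_Id) (use ac in auto)
    qed
  qed
  have rel_sym: "rel b a"
    if ab: "a \<in> Arr D" "b \<in> Arr D" "Dom D a = Dom D b" "Cod D a = S" "Cod D b = S" "rel a b" for a b
  proof (rule gen_rel)
    have "locally (Dom D a) (\<lambda>f. gen (b \<odot> f) (a \<odot> f))"
    proof (rule locally_mono[OF rel_gen[OF ab(1-3,6)]])
      fix f assume f: "f \<in> Arr D" "Cod D f = Dom D a" "gen (a \<odot> f) (b \<odot> f)"
      then have "Dom D (b \<odot> f) = Dom D (a \<odot> f)" using ab by simp
      then show "gen (b \<odot> f) (a \<odot> f)" using f(3) unfolding gen_def good_def by metis
    qed
    then show "locally (Dom D b) (\<lambda>f. gen (b \<odot> f) (a \<odot> f))" using ab(3) by simp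
  qed (use ab in auto)
  have rel_trans: "rel a c"
    if ab: "a \<in> Arr D" "b \<in> Arr D" "c \<in> Arr D" "Dom D b = Dom D a" "Dom D c = Dom D a" "Cod D a = S"
      "Cod D b = S" "Cod D c = S" "rel a b" "rel b c" for a b c
  proof (rule gen_rel)
    have l1: "locally (Dom D a) (\<lambda>f. gen (a \<odot> f) (b \<odot> f))" using rel_gen[of a b] ab by simp
    have l2: "locally (Dom D a) (\<lambda>f. gen (b \<odot> f) (c \<odot> f))" using rel_gen[of b c] ab by simp
    have "locally (Dom D a) (\<lambda>f. gen (a \<odot> f) (b \<odot> f) \<and> gen (b \<odot> f) (c \<odot> f))"
    proof (rule locally_conj[OF l1 l2]; rule sieveI)
      fix f k assume f: "f \<in> Arr D" "Cod D f = Dom D a" "k \<in> Arr D" "Cod D k = Dom D f"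
      { assume "gen (a \<odot> f) (b \<odot> f)"
        then show "gen (a \<odot> (f \<odot> k)) (b \<odot> (f \<odot> k))"
          by (rule gen_sieve) (simp_all add: f ab(1-5)) }
      { assume "gen (b \<odot> f) (c \<odot> f)"
        then show "gen (b \<odot> (f \<odot> k)) (c \<odot> (f \<odot> k))"
          by (rule gen_sieve) (simp_all add: f ab(1-5)) }
    qed
    then show "locally (Dom D a) (\<lambda>f. gen (a \<odot> f) (c \<odot> f))"
    proof (rule locally_bind)
      fix f assume f: "f \<in> Arr D" "Cod D f = Dom D a" "gen (a \<odot> f) (b \<odot> f) \<and> gen (b \<odot> f) (c \<odot> f)"
      have "locally (Dom D (a \<odot> f)) (\<lambda>g. gen ((a \<odot> f) \<odot> g) ((c \<odot> f) \<odot> g))"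
        by (rule gen_trans[of "a \<odot> f" "b \<odot> f" "c \<odot> f"]) (simp_all add: f ab(1-5))
      then have l: "locally (Dom D f) (\<lambda>g. gen ((a \<odot> f) \<odot> g) ((c \<odot> f) \<odot> g))" using f ab by simp
      show "locally (Dom D f) (\<lambda>g. gen (a \<odot> (f \<odot> g)) (c \<odot> (f \<odot> g)))"
        by (rule locally_mono[OF l]) (simp add: f(1,2) ab(1-5))
    qed
  qed (use ab in auto)
  have rel_refl: "rel (Id D S) (Id D S)"
  proof (rule gen_rel)
    have "locally S (\<lambda>f. gen (Id D S \<odot> f) (Id D S \<odot> f))"
      unfolding locally_def
    proof (intro exI conjI ballI)
      show "cover S (s ` U)" by fact
      show "|s ` U| <o lam" using image_ordLess_lam small by blast
      fix f assume "f \<in> s ` U"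
      then obtain J where J: "J \<in> U" "f = s J" by blast
      have "gen (s J) (s J)" unfolding gen_def good_def using J sa
        by (intro exI[of _ J] exI[of _ "Id D (ob J)"]) simp
      then show "gen (Id D S \<odot> f) (Id D S \<odot> f)" using J sa by simp
    qed
    then show "locally (Dom D (Id D S)) (\<lambda>f. gen (Id D S \<odot> f) (Id D S \<odot> f))" using S by simp
  qed (use S in auto)
  have rel_k: "rel (r0 \<odot> k) (r1 \<odot> k)" if "k \<in> Arr D" "Cod D k = Dom D r" for k
    unfolding rel_def using that r01 by (intro exI[of _ k]) simp
  have "internal_equivalence D r0 r1" unfolding internal_equivalence_def
  proof (intro conjI ballI allI impI)
    fix y h k assume *: "h \<in> hom D y (Dom D r0)" "k \<in> hom D y (Dom D r0)" "r0 \<odot> h = r0 \<odot> k \<and> r1 \<odot> h = r1 \<odot> k"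
    then have hk: "h \<in> Arr D" "k \<in> Arr D" "Dom D h = y" "Dom D k = y" "Cod D h = Dom D r" "Cod D k = Dom D r"
      using r01 by (auto simp: hom_iff)
    have "r \<odot> h = r \<odot> k"
      by (rule pru) (use * hk p q r ra in \<open>auto simp: r0_def r1_def\<close>)
    then show "h = k" by (rule mono_cancel[OF _ r(1)]) (use hk in auto)
  next
    obtain d where "d \<in> Arr D" "Dom D d = S" "Cod D d = Dom D r" "r0 \<odot> d = Id D S" "r1 \<odot> d = Id D S"
      using rel_refl S unfolding rel_def by auto
    then show "\<exists>d\<in>hom D (Cod D r0) (Dom D r0). r0 \<odot> d = Id D (Cod D r0) \<and> r1 \<odot> d = Id D (Cod D r0)"
      using r01 by (intro bexI[of _ d]) (auto simp: hom_iff)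
  next
    have "rel r0 r1" using rel_k[of "Id D (Dom D r)"] ra r01 by simp
    then have "rel r1 r0" using rel_sym r01 by simp
    then obtain t where "t \<in> Arr D" "Dom D t = Dom D r" "Cod D t = Dom D r" "r0 \<odot> t = r1" "r1 \<odot> t = r0"
      unfolding rel_def r01 by blast
    then show "\<exists>s\<in>hom D (Dom D r0) (Dom D r0). r0 \<odot> s = r1 \<and> r1 \<odot> s = r0"
      using r01 by (intro bexI[of _ t]) (auto simp: hom_iff)
  next
    fix a b assume pb: "is_pullback D r1 r0 a b"
    note pf = pullback_facts[OF pb]
    have pf': "Cod D a = Dom D r" "Cod D b = Dom D r" using pf r01 by auto
    have "rel (r0 \<odot> a) (r1 \<odot> b)"
    proof (rule rel_trans[of _ "r1 \<odot> a"])
      show "rel (r0 \<odot> a) (r1 \<odot> a)" by (rule rel_k[OF pf(4) pf'(1)])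
      show "rel (r1 \<odot> a) (r1 \<odot> b)" unfolding pf(9) by (rule rel_k[OF pf(5) pf'(2)])
    qed (use r01 pf(4-8) pf' in auto)
    then obtain t where "t \<in> Arr D" "Dom D t = Dom D a" "Cod D t = Dom D r" "r0 \<odot> t = r0 \<odot> a" "r1 \<odot> t = r1 \<odot> b"
      unfolding rel_def using pf(4) pf' r01 by auto
    then show "\<exists>t\<in>hom D (Dom D a) (Dom D r0). r0 \<odot> t = r0 \<odot> a \<and> r1 \<odot> t = r1 \<odot> b"
      using r01 by (intro bexI[of _ t]) (auto simp: hom_iff)
  qed (use r01 in auto)
  then obtain e where e: "is_pullback D e e r0 r1" using exact unfolding barr_exact_def by blast
  note ef = pullback_facts[OF e]
  have eS: "Dom D e = S" using ef r01 by simp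
  have rel_e: "e \<odot> a = e \<odot> b" if ab: "a \<in> Arr D" "b \<in> Arr D" "Dom D a = Dom D b" "Cod D a = S" "Cod D b = S" "rel a b" for a b
  proof -
    obtain k where k: "k \<in> Arr D" "Cod D k = Dom D r" "r0 \<odot> k = a" "r1 \<odot> k = b"
      using ab(6) unfolding rel_def by blast
    show ?thesis unfolding k(3,4)[symmetric]
      using comp_eq_assoc[OF ef(9), of k] ef(1,4,5) eS r01 k(1,2) by simp
  qed
  have e_rel: "rel a b" if ab: "a \<in> Arr D" "b \<in> Arr D" "Dom D a = Dom D b" "Cod D a = S" "Cod D b = S" "e \<odot> a = e \<odot> b" for a b
    using pullback_lift[OF e ab(1-3) _ _ ab(6)] ab eS r01 unfolding rel_def by metis
  define c where "c J = e \<odot> s J" for J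
  have ca: "c J \<in> Arr D" "Dom D (c J) = ob J" "Cod D (c J) = Cod D e" if "J \<in> U" for J
    unfolding c_def using sa[OF that] ef(1) eS by auto
  have cce: "c J \<odot> a = e \<odot> (s J \<odot> a)" if "J \<in> U" "a \<in> Arr D" "Cod D a = ob J" for J a
    unfolding c_def using sa[OF that(1)] ef(1) eS that by simp
  have "c K \<odot> tr J K = c J" if JK: "J \<in> U" "K \<in> U" "K \<subseteq> J" for J K
  proof -
    have gd: "good J K K" using JK unfolding good_def by simp
    note t = tr_arr[OF JK]
    have "gen (s J) (s K \<odot> tr J K)" unfolding gen_def
      using gd JK sa[OF JK(1)] sa[OF JK(2)] t tr_id[OF JK(2)]
      by (intro exI[of _ J] exI[of _ K] exI[of _ K] exI[of _ "Id D (ob J)"] exI[of _ "tr J K"]) simp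
    then have "rel (s J) (s K \<odot> tr J K)"
      by (intro gen_rel locally_Id) (use sa[OF JK(1)] sa[OF JK(2)] t JK in auto)
    then have "e \<odot> s J = e \<odot> (s K \<odot> tr J K)"
      by (intro rel_e) (use sa[OF JK(1)] sa[OF JK(2)] t in auto)
    then show ?thesis using cce JK t unfolding c_def[of J] by simp
  qed
  then have cocone: "is_cocone index D T (Cod D e) c" unfolding cocone_iff using ca ef(1) by auto
  have "separated c" unfolding separated_def
  proof (intro ballI allI impI, elim conjE)
    fix J K a b assume *: "J \<in> U" "K \<in> U" "a \<in> Arr D" "b \<in> Arr D" "Dom D a = Dom D b" "Cod D a = ob J"
      "Cod D b = ob K" "c J \<odot> a = c K \<odot> b"
    note sJ = sa[OF *(1)] and sK = sa[OF *(2)]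
    have "rel (s J \<odot> a) (s K \<odot> b)" using * sJ sK cce by (intro e_rel) auto
    then have l: "locally (Dom D (s J \<odot> a)) (\<lambda>f. gen ((s J \<odot> a) \<odot> f) ((s K \<odot> b) \<odot> f))"
      by (intro rel_gen) (use * sJ sK in auto)
    have da: "Dom D (s J \<odot> a) = Dom D a" using * sJ by simp
    show "locally (Dom D a) (\<lambda>f. \<exists>L\<in>U. L \<subseteq> J \<inter> K \<and> tr J L \<odot> (a \<odot> f) = tr K L \<odot> (b \<odot> f))"
    proof (rule locally_bind[OF l[unfolded da]])
      fix f assume f: "f \<in> Arr D" "Cod D f = Dom D a" "gen ((s J \<odot> a) \<odot> f) ((s K \<odot> b) \<odot> f)"
      have df: "Dom D ((s J \<odot> a) \<odot> f) = Dom D f" using f * sJ by simp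
      obtain J' K' L x y where JKL: "good J' K' L" and x: "x \<in> Arr D" "Dom D x = Dom D f" "Cod D x = ob J'"
        and y: "y \<in> Arr D" "Dom D y = Dom D f" "Cod D y = ob K'" and xy: "tr J' L \<odot> x = tr K' L \<odot> y"
        and ax: "(s J \<odot> a) \<odot> f = s J' \<odot> x" and bx: "(s K \<odot> b) \<odot> f = s K' \<odot> y"
        using f(3) unfolding gen_def df by blast
      have ax': "s J \<odot> (a \<odot> f) = s J' \<odot> x" and bx': "s K \<odot> (b \<odot> f) = s K' \<odot> y"
        using ax bx * f sJ sK by simp_all
      have "is_initial D (Dom D (a \<odot> f)) \<or> J = J' \<and> a \<odot> f = x"
        by (rule sep[OF _ _ _ _ _ _ _ ax']) (use JKL * f x in \<open>auto simp: good_def\<close>)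
      moreover have "is_initial D (Dom D (b \<odot> f)) \<or> K = K' \<and> b \<odot> f = y"
        by (rule sep[OF _ _ _ _ _ _ _ bx']) (use JKL * f y in \<open>auto simp: good_def\<close>)
      ultimately consider "is_initial D (Dom D f)" | "J = J'" "a \<odot> f = x" "K = K'" "b \<odot> f = y"
        using * f by auto
      then show "locally (Dom D f) (\<lambda>g. \<exists>L\<in>U. L \<subseteq> J \<inter> K \<and> tr J L \<odot> (a \<odot> (f \<odot> g)) = tr K L \<odot> (b \<odot> (f \<odot> g)))"
      proof cases
        case 1
        then show ?thesis by (rule locally_initial)
      next
        case 2
        show ?thesis
        proof (rule locally_Id)
          show "\<exists>L\<in>U. L \<subseteq> J \<inter> K \<and> tr J L \<odot> (a \<odot> (f \<odot> Id D (Dom D f))) = tr K L \<odot> (b \<odot> (f \<odot> Id D (Dom D f)))"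
            using JKL xy 2 f unfolding good_def by (intro bexI[of _ L]) auto
        qed (use f in simp)
      qed
    qed
  qed
  then show ?thesis using cocone by blast
qed

end

context directed_diagram
begin

lemma separatedD:
  "\<lbrakk>separated c; J \<in> U; K \<in> U; a \<in> Arr D; b \<in> Arr D; Dom D a = Dom D b; Cod D a = ob J; Cod D b = ob K;
    c J \<odot> a = c K \<odot> b\<rbrakk> \<Longrightarrow>
    locally (Dom D a) (\<lambda>f. \<exists>L\<in>U. L \<subseteq> J \<inter> K \<and> tr J L \<odot> (a \<odot> f) = tr K L \<odot> (b \<odot> f))"
  unfolding separated_def by blast

lemma colimit_ex1:
  assumes "is_colimit index D T x c" "is_cocone index D T y d"
  shows "\<exists>!h. h \<in> hom D x y \<and> (\<forall>J\<in>U. h \<odot> c J = d J)"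
  using assms unfolding is_colimit_def Obj_index by blast

lemma colimit_cocone: "is_colimit index D T x c \<Longrightarrow> is_cocone index D T x c"
  unfolding is_colimit_def by simp

lemma cocone_facts:
  assumes "is_cocone index D T x c"
  shows "x \<in> Obj D" "\<And>J. J \<in> U \<Longrightarrow> c J \<in> Arr D" "\<And>J. J \<in> U \<Longrightarrow> Dom D (c J) = ob J"
    "\<And>J. J \<in> U \<Longrightarrow> Cod D (c J) = x" "\<And>J K. \<lbrakk>J \<in> U; K \<in> U; K \<subseteq> J\<rbrakk> \<Longrightarrow> c K \<odot> tr J K = c J"
  using assms unfolding cocone_iff by auto

lemma cocone_tr:
  assumes "is_cocone index D T x c" "J \<in> U" "K \<in> U" "K \<subseteq> J" "a \<in> Arr D" "Cod D a = ob J"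
  shows "c K \<odot> (tr J K \<odot> a) = c J \<odot> a"
  using cocone_facts[OF assms(1)] tr_arr[OF assms(2-4)] assms(2-) by (intro comp_eq_assoc) auto

lemma cocone_eq_of_separated:
  assumes c: "is_cocone index D T x c" "separated c" and d: "is_cocone index D T y d"
    and a: "J \<in> U" "K \<in> U" "a \<in> Arr D" "b \<in> Arr D" "Dom D a = Dom D b" "Cod D a = ob J" "Cod D b = ob K"
    and eq: "c J \<odot> a = c K \<odot> b"
  shows "d J \<odot> a = d K \<odot> b"
proof (rule locally_eq)
  note df = cocone_facts[OF d]
  have "locally (Dom D a) (\<lambda>f. \<exists>L\<in>U. L \<subseteq> J \<inter> K \<and> tr J L \<odot> (a \<odot> f) = tr K L \<odot> (b \<odot> f))"
    using c(2) a eq unfolding separated_def by blast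
  then show "locally (Dom D a) (\<lambda>f. (d J \<odot> a) \<odot> f = (d K \<odot> b) \<odot> f)"
  proof (rule locally_mono)
    fix f assume f: "f \<in> Arr D" "Cod D f = Dom D a"
      "\<exists>L\<in>U. L \<subseteq> J \<inter> K \<and> tr J L \<odot> (a \<odot> f) = tr K L \<odot> (b \<odot> f)"
    then obtain L where L: "L \<in> U" "L \<subseteq> J" "L \<subseteq> K" "tr J L \<odot> (a \<odot> f) = tr K L \<odot> (b \<odot> f)" by blast
    have "d J \<odot> (a \<odot> f) = d L \<odot> (tr J L \<odot> (a \<odot> f))" using cocone_tr[OF d a(1) L(1,2)] a f by simp
    also have "\<dots> = d K \<odot> (b \<odot> f)" unfolding L(4) using cocone_tr[OF d a(2) L(1,3)] a f by simp
    finally show "(d J \<odot> a) \<odot> f = (d K \<odot> b) \<odot> f" using df a f by simp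
  qed
qed (use a cocone_facts[OF d] in auto)

lemma colimit_of_cover_separated:
  assumes c: "is_cocone index D T x c" "cover x (c ` U)" "separated c"
  shows "is_colimit index D T x c"
  unfolding is_colimit_def Obj_index
proof (intro conjI allI impI)
  fix y d assume d: "is_cocone index D T y d"
  note cf = cocone_facts[OF c(1)] and df = cocone_facts[OF d]
  define R where "R f g \<longleftrightarrow> (\<exists>J\<in>U. \<exists>k. k \<in> Arr D \<and> Dom D k = Dom D f \<and> Cod D k = ob J \<and> f = c J \<odot> k \<and> g = d J \<odot> k)" for f g
  have RE: thesis if "R f g" "\<And>J k. \<lbrakk>J \<in> U; k \<in> Arr D; Dom D k = Dom D f; Cod D k = ob J; f = c J \<odot> k; g = d J \<odot> k\<rbrakk> \<Longrightarrow> thesis"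
    for f g thesis
    using that unfolding R_def by blast
  have "locally x (\<lambda>f. \<exists>g. R f g)" unfolding locally_def
  proof (rule exI[of _ "c ` U"], intro conjI ballI)
    show "cover x (c ` U)" "|c ` U| <o lam" using c(2) image_ordLess_lam small by auto
    fix f assume "f \<in> c ` U"
    then obtain J where J: "J \<in> U" "f = c J" by blast
    have "R f (d J)" unfolding R_def
      by (rule bexI[OF _ J(1)], rule exI[of _ "Id D (ob J)"]) (use J cf df in auto)
    then show "\<exists>g. R f g" by blast
  qed
  then have "\<exists>h. h \<in> Arr D \<and> Dom D h = x \<and> Cod D h = y \<and> locally x (\<lambda>f. R f (h \<odot> f))"
  proof (rule locally_glue[OF _ df(1)])
    show "g \<in> Arr D \<and> Dom D g = Dom D f \<and> Cod D g = y" if "R f g" for f g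
      using that by (rule RE) (use df in auto)
    fix f g f' g' p q assume R: "R f g" "R f' g'" and pq: "f \<in> Arr D" "f' \<in> Arr D" "p \<in> Arr D" "q \<in> Arr D"
      "Dom D p = Dom D q" "Cod D p = Dom D f" "Cod D q = Dom D f'" "f \<odot> p = f' \<odot> q"
    obtain J k where J: "J \<in> U" and k: "k \<in> Arr D" "Dom D k = Dom D f" "Cod D k = ob J" "f = c J \<odot> k" "g = d J \<odot> k"
      by (rule RE[OF R(1)])
    obtain J' k' where J': "J' \<in> U" and k': "k' \<in> Arr D" "Dom D k' = Dom D f'" "Cod D k' = ob J'"
      "f' = c J' \<odot> k'" "g' = d J' \<odot> k'"
      by (rule RE[OF R(2)])
    have "f \<odot> p = c J \<odot> (k \<odot> p)" unfolding k(4) using cf J k(1-3) pq(1-7) by simp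
    moreover have "f' \<odot> q = c J' \<odot> (k' \<odot> q)" unfolding k'(4) using cf J' k'(1-3) pq(1-7) by simp
    ultimately have "c J \<odot> (k \<odot> p) = c J' \<odot> (k' \<odot> q)" using pq(8) by simp
    then have "d J \<odot> (k \<odot> p) = d J' \<odot> (k' \<odot> q)"
      by (intro cocone_eq_of_separated[OF c(1,3) d J J']) (use k(1-3) k'(1-3) pq(1-7) in auto)
    then show "g \<odot> p = g' \<odot> q" unfolding k(5) k'(5) using df J J' k(1-3) k'(1-3) pq(1-7) by simp
  qed
  then obtain h where h: "h \<in> Arr D" "Dom D h = x" "Cod D h = y" and hR: "locally x (\<lambda>f. R f (h \<odot> f))" by blast
  have hc: "h \<odot> c J = d J" if J: "J \<in> U" for J
  proof (rule locally_eq)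
    show "locally (ob J) (\<lambda>g. (h \<odot> c J) \<odot> g = d J \<odot> g)"
    proof -
      have "locally (Dom D (c J)) (\<lambda>g. (h \<odot> c J) \<odot> g = d J \<odot> g)"
      proof (rule locally_mono[OF locally_pull[OF hR cf(2)[OF J] cf(4)[OF J]]])
        fix g assume g: "g \<in> Arr D" "Cod D g = Dom D (c J)" "\<exists>f k. R f (h \<odot> f) \<and> f \<in> Arr D \<and> Cod D f = x \<and> k \<in> Arr D \<and>
          Cod D k = Dom D f \<and> Dom D k = Dom D g \<and> c J \<odot> g = f \<odot> k"
        then obtain f k where f: "R f (h \<odot> f)" "f \<in> Arr D" "Cod D f = x" and k: "k \<in> Arr D" "Cod D k = Dom D f" "Dom D k = Dom D g"
          and eq: "c J \<odot> g = f \<odot> k" by blast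
        obtain J' k' where J': "J' \<in> U" and k': "k' \<in> Arr D" "Dom D k' = Dom D f" "Cod D k' = ob J'"
          "f = c J' \<odot> k'" "h \<odot> f = d J' \<odot> k'"
          by (rule RE[OF f(1)])
        have "c J \<odot> g = c J' \<odot> (k' \<odot> k)" unfolding eq using comp_eq_assoc[OF k'(4)[symmetric], of k]
          cf J' k'(1-3) k by simp
        then have 1: "d J \<odot> g = d J' \<odot> (k' \<odot> k)"
          by (intro cocone_eq_of_separated[OF c(1,3) d J J']) (use cf J g(1,2) k'(1-3) k in auto)
        have "(h \<odot> c J) \<odot> g = h \<odot> (f \<odot> k)" using eq h cf J g(1,2) by simp
        also have "\<dots> = (d J' \<odot> k') \<odot> k" using comp_eq_assoc[OF k'(5), of k] h f k by simp
        also have "\<dots> = d J \<odot> g" unfolding 1 using df J' k'(1-3) k by simp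
        finally show "(h \<odot> c J) \<odot> g = d J \<odot> g" .
      qed
      then show ?thesis using cf(3)[OF J] by simp
    qed
  qed (use h cf df J in auto)
  show "\<exists>!h. h \<in> hom D x y \<and> (\<forall>J\<in>U. h \<odot> c J = d J)"
  proof (rule ex1I[of _ h])
    fix h' assume h': "h' \<in> hom D x y \<and> (\<forall>J\<in>U. h' \<odot> c J = d J)"
    show "h' = h" by (rule cover_eq[OF c(2)]) (use h' h hc in \<open>auto simp: hom_iff\<close>)
  qed (use h hc in \<open>auto simp: hom_iff\<close>)
qed (rule c(1))

lemma ex_colimit: "\<exists>x c. is_colimit index D T x c \<and> separated c"
proof -
  obtain x c where c: "is_cocone index D T x c" "separated c" using ex_separated_cocone by blast
  note cf = cocone_facts[OF c(1)]
  have "\<forall>g\<in>c ` U. g \<in> Arr D \<and> Cod D g = x" using cf by auto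
  then obtain r where r: "is_mono D r" "Cod D r = x" and cr: "\<And>g. g \<in> c ` U \<Longrightarrow> sub_le D g r"
    and cov: "cover (Dom D r) {l \<in> Arr D. Cod D l = Dom D r \<and> r \<odot> l \<in> c ` U}"
    by (rule ex_image_union[OF image_ordLess_lam[OF small] cf(1)]) (rule that; assumption?)
  have ra: "r \<in> Arr D" using r mono_arr by blast
  have "\<exists>l. l \<in> Arr D \<and> Dom D l = ob J \<and> Cod D l = Dom D r \<and> r \<odot> l = c J" if "J \<in> U" for J
    using sub_leE[OF cr[of "c J"]] cf that by (metis imageI)
  then obtain l where l: "\<And>J. J \<in> U \<Longrightarrow> l J \<in> Arr D \<and> Dom D (l J) = ob J \<and> Cod D (l J) = Dom D r"
    and rl: "\<And>J. J \<in> U \<Longrightarrow> r \<odot> l J = c J" by metis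
  have "l K \<odot> tr J K = l J" if JK: "J \<in> U" "K \<in> U" "K \<subseteq> J" for J K
  proof (rule mono_cancel[OF _ r(1)])
    note t = tr_arr[OF JK]
    show "r \<odot> (l K \<odot> tr J K) = r \<odot> l J"
      unfolding rl[OF JK(1)] cf(5)[OF JK, symmetric]
      by (rule comp_eq_assoc[OF rl[OF JK(2)]]) (use l JK t ra in auto)
  qed (use l JK tr_arr[OF JK] in auto)
  then have lc: "is_cocone index D T (Dom D r) l" unfolding cocone_iff using l ra by auto
  have lcov: "cover (Dom D r) (l ` U)"
  proof (rule cover_mono[OF cov])
    fix f assume f: "f \<in> {l \<in> Arr D. Cod D l = Dom D r \<and> r \<odot> l \<in> c ` U}"
    then obtain J where J: "J \<in> U" "r \<odot> f = c J" by auto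
    have fa: "f \<in> Arr D" "Cod D f = Dom D r" using f by auto
    have df: "Dom D f = ob J" using dom_comp[of f r] fa ra J(2) cf(3)[OF J(1)] by simp
    have "f = l J"
    proof (rule mono_cancel[OF _ r(1)])
      show "r \<odot> f = r \<odot> l J" unfolding J(2) rl[OF J(1)] ..
    qed (use fa df l[OF J(1)] in auto)
    then show "\<exists>g\<in>l ` U. sub_le D f g" using J(1) fa(1) sub_le_refl[of f] by (intro bexI[of _ f]) auto
  qed (use l in auto)
  have "separated l" unfolding separated_def
  proof (intro ballI allI impI, elim conjE)
    fix J K a b assume *: "J \<in> U" "K \<in> U" "a \<in> Arr D" "b \<in> Arr D" "Dom D a = Dom D b" "Cod D a = ob J"
      "Cod D b = ob K" "l J \<odot> a = l K \<odot> b"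
    have "c J \<odot> a = r \<odot> (l J \<odot> a)" by (rule comp_eq_assoc[OF rl, symmetric]) (use * l ra in auto)
    also have "\<dots> = c K \<odot> b" unfolding *(8) by (rule comp_eq_assoc[OF rl]) (use * l ra in auto)
    finally show "locally (Dom D a) (\<lambda>f. \<exists>L\<in>U. L \<subseteq> J \<inter> K \<and> tr J L \<odot> (a \<odot> f) = tr K L \<odot> (b \<odot> f))"
      using c(2) *(1-7) unfolding separated_def by blast
  qed
  then show ?thesis using colimit_of_cover_separated[OF lc lcov] by blast
qed

lemma colimit_cover:
  assumes c: "is_colimit index D T x c"
  shows "cover x (c ` U)"
  unfolding cover_def
proof (intro conjI ballI impI)
  note cc = colimit_cocone[OF c]
  note cf = cocone_facts[OF cc]
  show "x \<in> Obj D" by (rule cf(1))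
  show "f \<in> Arr D" "Cod D f = x" if "f \<in> c ` U" for f using cf that by auto
  fix m assume m: "m \<in> Sub D x" "\<forall>f\<in>c ` U. sub_le D f m"
  then have ma: "is_mono D m" "m \<in> Arr D" "Cod D m = x" using mono_arr by (auto simp: Sub_iff)
  have "\<exists>l. l \<in> Arr D \<and> Dom D l = ob J \<and> Cod D l = Dom D m \<and> m \<odot> l = c J" if "J \<in> U" for J
    using sub_leE[of "c J" m] m(2) cf that by (metis imageI)
  then obtain l where l: "\<And>J. J \<in> U \<Longrightarrow> l J \<in> Arr D \<and> Dom D (l J) = ob J \<and> Cod D (l J) = Dom D m"
    and ml: "\<And>J. J \<in> U \<Longrightarrow> m \<odot> l J = c J" by metis
  have "l K \<odot> tr J K = l J" if JK: "J \<in> U" "K \<in> U" "K \<subseteq> J" for J K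
  proof (rule mono_cancel[OF _ ma(1)])
    note t = tr_arr[OF JK]
    show "m \<odot> (l K \<odot> tr J K) = m \<odot> l J"
      unfolding ml[OF JK(1)] cf(5)[OF JK, symmetric]
      by (rule comp_eq_assoc[OF ml[OF JK(2)]]) (use l JK t ma in auto)
  qed (use l JK tr_arr[OF JK] in auto)
  then have "is_cocone index D T (Dom D m) l" unfolding cocone_iff using l ma by auto
  then have "\<exists>!h. h \<in> hom D x (Dom D m) \<and> (\<forall>J\<in>U. h \<odot> c J = l J)" by (rule colimit_ex1[OF c])
  then obtain h where "h \<in> hom D x (Dom D m) \<and> (\<forall>J\<in>U. h \<odot> c J = l J)" by (elim ex1E)
  then have h: "h \<in> Arr D" "Dom D h = x" "Cod D h = Dom D m" "\<And>J. J \<in> U \<Longrightarrow> h \<odot> c J = l J"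
    by (auto simp: hom_iff)
  have "(m \<odot> h) \<odot> c J = c J" if "J \<in> U" for J using h ma cf that ml by simp
  moreover have "\<exists>!u. u \<in> hom D x x \<and> (\<forall>J\<in>U. u \<odot> c J = c J)" by (rule colimit_ex1[OF c cc])
  ultimately have "m \<odot> h = Id D x"
    using h(1-3) ma cf by (elim ex1E) (metis comp_hom comp_id_left hom_iff cod_id dom_id id_arr)
  then show "sub_le D (Id D x) m" by (intro sub_leI[of h]) (use h ma in auto)
qed

lemma colimit_separated:
  assumes c: "is_colimit index D T x c"
  shows "separated c"
proof -
  obtain y d where d: "is_colimit index D T y d" "separated d" using ex_colimit by blast
  note cf = cocone_facts[OF colimit_cocone[OF c]] and df = cocone_facts[OF colimit_cocone[OF d(1)]]
  have "\<exists>!h. h \<in> hom D x y \<and> (\<forall>J\<in>U. h \<odot> c J = d J)" by (rule colimit_ex1[OF c colimit_cocone[OF d(1)]])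
  then obtain h where "h \<in> hom D x y \<and> (\<forall>J\<in>U. h \<odot> c J = d J)" by (elim ex1E)
  then have h: "h \<in> Arr D" "Dom D h = x" "Cod D h = y" "\<And>J. J \<in> U \<Longrightarrow> h \<odot> c J = d J"
    by (auto simp: hom_iff)
  show ?thesis unfolding separated_def
  proof (intro ballI allI impI, elim conjE)
    fix J K a b assume *: "J \<in> U" "K \<in> U" "a \<in> Arr D" "b \<in> Arr D" "Dom D a = Dom D b" "Cod D a = ob J"
      "Cod D b = ob K" "c J \<odot> a = c K \<odot> b"
    have "d J \<odot> a = h \<odot> (c J \<odot> a)" by (rule comp_eq_assoc[OF h(4), symmetric]) (use * h(1-3) cf in auto)
    also have "\<dots> = d K \<odot> b" unfolding *(8) by (rule comp_eq_assoc[OF h(4)]) (use * h(1-3) cf in auto)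
    finally show "locally (Dom D a) (\<lambda>f. \<exists>L\<in>U. L \<subseteq> J \<inter> K \<and> tr J L \<odot> (a \<odot> f) = tr K L \<odot> (b \<odot> f))"
      using d(2) *(1-7) unfolding separated_def by blast
  qed
qed

end

section \<open>Ultraproducts through representing families\<close>

locale lk_pretopos_cat = pretopos D lam for D :: "('o, 'm) cat" and lam :: "'l rel" +
  fixes kap :: "'k rel"
  assumes kap: "Card_order kap" "natLeq \<le>o kap"
    and pow: "\<And>\<gamma> :: 'k rel. \<lbrakk>Card_order \<gamma>; \<gamma> <o kap\<rbrakk> \<Longrightarrow> ctwo ^c \<gamma> <o lam"
    and lk: "lk_pretopos lam kap D"
begin

lemma kap_limits: "has_limits kap D"
  and distributive: "meets_distribute_over_joins lam kap D"
  and lk_regular: "lk_regular lam kap D"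
  using lk unfolding lk_pretopos_def by auto

lemma reindex_kap:
  assumes "|A| <o kap"
  obtains B :: "'k set" and \<phi> where "|B| <o kap" "bij_betw \<phi> A B"
proof -
  obtain B :: "'k set" where "|A| =o |B|" "|B| <o kap"
    using assms internalize_card_of_ordLess[of A kap] by blast
  then show ?thesis using that card_of_ordIso by blast
qed

lemma Pow_ordLess_lam:
  assumes "|A| <o kap"
  shows "|Pow A| <o lam"
proof -
  obtain B :: "'k set" and \<phi> where B: "|B| <o kap" "bij_betw \<phi> A B" using reindex_kap[OF assms] .
  have "|Pow A| =o |Pow B|" using bij_betw_Pow[OF B(2)] card_of_ordIso by blast
  moreover have "|Pow B| =o ctwo ^c |B|"
    unfolding cexp_def ctwo_def Field_card_of by (rule card_of_Pow_Func)
  moreover have "ctwo ^c |B| <o lam" using pow[OF card_of_Card_order B(1)] .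
  ultimately show ?thesis by (rule ordIso_ordLess_trans[OF _ ordIso_ordLess_trans])
qed

lemma ex_kap_product:
  "\<lbrakk>|I| <o kap; \<And>i. i \<in> I \<Longrightarrow> X i \<in> Obj D\<rbrakk> \<Longrightarrow> \<exists>x p. is_product D I X x p"
  using ex_product_of_limits[OF kap_limits kap(1)] by blast

end

locale ultrafilter_pretopos = lk_pretopos_cat D lam kap
  for D :: "('o, 'm) cat" and lam :: "'l rel" and kap :: "'k rel" +
  fixes I :: "'i set" and U :: "'i set set"
  assumes I: "|I| <o kap" and U: "ultrafilter_on I U"
begin

lemma U_facts: "U \<subseteq> Pow I" "I \<in> U" "{} \<notin> U" "\<And>J K. \<lbrakk>J \<in> U; K \<in> U\<rbrakk> \<Longrightarrow> J \<inter> K \<in> U"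
  "\<And>J K. \<lbrakk>J \<in> U; J \<subseteq> K; K \<subseteq> I\<rbrakk> \<Longrightarrow> K \<in> U" "\<And>J. J \<subseteq> I \<Longrightarrow> J \<in> U \<or> I - J \<in> U"
  using U unfolding ultrafilter_on_def by blast+

lemma U_sub: "\<lbrakk>J \<in> U; i \<in> J\<rbrakk> \<Longrightarrow> i \<in> I"
  using U_facts(1) by blast

lemma U_small: "|U| <o lam"
  using card_of_mono1[OF U_facts(1)] Pow_ordLess_lam[OF I] ordLeq_ordLess_trans by blast

lemma U_member_small: "J \<in> U \<Longrightarrow> |J| <o kap"
  using card_of_mono1[of J I] U_facts(1) I ordLeq_ordLess_trans by blast

lemma U_Int_finite: "\<lbrakk>finite A; \<And>a. a \<in> A \<Longrightarrow> K a \<in> U\<rbrakk> \<Longrightarrow> \<exists>L\<in>U. \<forall>a\<in>A. L \<subseteq> K a"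
proof (induction A rule: finite_induct)
  case empty
  then show ?case using U_facts(2) by blast
next
  case (insert a A)
  then obtain L where "L \<in> U" "\<forall>a\<in>A. L \<subseteq> K a" by auto
  then show ?case using insert.prems U_facts(4)[of L "K a"] by (intro bexI[of _ "L \<inter> K a"]) auto
qed

definition rep :: "('i, 'o, 'm) ultra \<Rightarrow> 'i set \<Rightarrow> ('i \<Rightarrow> 'm) \<Rightarrow> 'm \<Rightarrow> bool" where
  "rep E J \<xi> y \<longleftrightarrow> J \<in> U \<and> y \<in> Arr D \<and> (\<exists>h. h \<in> Arr D \<and> Dom D h = Dom D y \<and>
     Cod D h = FObj (udiag E) J \<and> (\<forall>i\<in>J. uproj E J i \<odot> h = \<xi> i) \<and> uinj E J \<odot> h = y)"

lemma repE:
  assumes "rep E J \<xi> y"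
  obtains h where "J \<in> U" "y \<in> Arr D" "h \<in> Arr D" "Dom D h = Dom D y" "Cod D h = FObj (udiag E) J"
    "\<And>i. i \<in> J \<Longrightarrow> uproj E J i \<odot> h = \<xi> i" "uinj E J \<odot> h = y"
  using assms unfolding rep_def by blast

lemma directed:
  assumes "is_ultraproduct D U X E"
  shows "directed_diagram D lam U (udiag E)"
proof unfold_locales
  show "is_functor (poset_op (inclusion_order U)) D (udiag E)"
    using assms unfolding is_ultraproduct_def by blast
qed (simp_all add: U_small U_facts(4))

context
  fixes X E
  assumes E: "is_ultraproduct D U X E"
begin

interpretation dd: directed_diagram D lam U "udiag E" using directed[OF E] .

lemma ultra_product: "J \<in> U \<Longrightarrow> is_product D J X (FObj (udiag E) J) (uproj E J)"
  using E unfolding is_ultraproduct_def by blast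

lemma ultra_proj:
  "\<lbrakk>J \<in> U; K \<in> U; K \<subseteq> J; i \<in> K\<rbrakk> \<Longrightarrow> uproj E K i \<odot> FArr (udiag E) (J, K) = uproj E J i"
  using E unfolding is_ultraproduct_def by blast

lemma ultra_colimit: "is_colimit (poset_op (inclusion_order U)) D (udiag E) (uobj E) (uinj E)"
  using E unfolding is_ultraproduct_def by blast

lemmas ultra_cocone = dd.colimit_cocone[OF ultra_colimit]
lemmas ultra_inj = dd.cocone_facts[OF ultra_cocone]

lemma rep_typing:
  assumes "rep E J \<xi> y"
  shows "J \<in> U" "y \<in> Arr D" "Cod D y = uobj E" "\<And>i. i \<in> J \<Longrightarrow> \<xi> i \<in> Arr D"
    "\<And>i. i \<in> J \<Longrightarrow> Dom D (\<xi> i) = Dom D y" "\<And>i. i \<in> J \<Longrightarrow> Cod D (\<xi> i) = X i"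
proof -
  obtain h where J: "J \<in> U" and y: "y \<in> Arr D" and h: "h \<in> Arr D" "Dom D h = Dom D y"
    "Cod D h = FObj (udiag E) J" "\<And>i. i \<in> J \<Longrightarrow> uproj E J i \<odot> h = \<xi> i" "uinj E J \<odot> h = y"
    by (rule repE[OF assms]) (rule that; assumption?)
  note pf = product_facts[OF ultra_product[OF J]]
  show "J \<in> U" "y \<in> Arr D" by fact+
  have "Cod D (uinj E J \<odot> h) = uobj E" using ultra_inj J h(1-3) by simp
  then show "Cod D y = uobj E" using h(5) by simp
  fix i assume i: "i \<in> J"
  have "uproj E J i \<odot> h \<in> Arr D" "Dom D (uproj E J i \<odot> h) = Dom D y" "Cod D (uproj E J i \<odot> h) = X i"
    using pf(2-4)[OF i] h(1-3) by simp_all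
  then show "\<xi> i \<in> Arr D" "Dom D (\<xi> i) = Dom D y" "Cod D (\<xi> i) = X i" using h(4)[OF i] by simp_all
qed

lemma rep_exists:
  assumes "J \<in> U" "z \<in> Obj D" "\<And>i. i \<in> J \<Longrightarrow> \<xi> i \<in> hom D z (X i)"
  obtains y where "y \<in> Arr D" "Dom D y = z" "Cod D y = uobj E" "rep E J \<xi> y"
proof -
  obtain h where h: "h \<in> Arr D" "Dom D h = z" "Cod D h = FObj (udiag E) J" "\<And>i. i \<in> J \<Longrightarrow> uproj E J i \<odot> h = \<xi> i"
    using product_lift[OF ultra_product[OF assms(1)] assms(2,3)] by blast
  show ?thesis
  proof (rule that[of "uinj E J \<odot> h"])
    show "rep E J \<xi> (uinj E J \<odot> h)" unfolding rep_def using assms(1) h ultra_inj by auto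
  qed (use h ultra_inj assms(1) in auto)
qed

lemma rep_locally:
  assumes "y \<in> Arr D" "Cod D y = uobj E"
  shows "locally (Dom D y) (\<lambda>f. \<exists>J \<xi>. rep E J \<xi> (y \<odot> f))"
proof (rule locally_mono[OF locally_cover[OF dd.colimit_cover[OF ultra_colimit] image_ordLess_lam[OF U_small] assms]])
  fix f assume f: "f \<in> Arr D" "Cod D f = Dom D y" "\<exists>g\<in>uinj E ` U. sub_le D (y \<odot> f) g"
  then obtain J where J: "J \<in> U" "sub_le D (y \<odot> f) (uinj E J)" by blast
  obtain h where h: "h \<in> Arr D" "Dom D h = Dom D (y \<odot> f)" "Cod D h = Dom D (uinj E J)" "uinj E J \<odot> h = y \<odot> f"
    using J(2) by (rule sub_leE) (use f assms in simp)
  have "rep E J (\<lambda>i. uproj E J i \<odot> h) (y \<odot> f)"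
    unfolding rep_def using J(1) f(1,2) assms h ultra_inj by auto
  then show "\<exists>J \<xi>. rep E J \<xi> (y \<odot> f)" by blast
qed

lemma rep_subset:
  assumes "rep E J \<xi> y" "K \<in> U" "K \<subseteq> J"
  shows "rep E K \<xi> y"
proof -
  obtain h where J: "J \<in> U" and y: "y \<in> Arr D" and h: "h \<in> Arr D" "Dom D h = Dom D y"
    "Cod D h = FObj (udiag E) J" "\<And>i. i \<in> J \<Longrightarrow> uproj E J i \<odot> h = \<xi> i" "uinj E J \<odot> h = y"
    by (rule repE[OF assms(1)]) (rule that; assumption?)
  note pK = product_facts[OF ultra_product[OF assms(2)]]
  note t = dd.tr_arr[OF J assms(2,3)]
  have "uinj E K \<odot> (FArr (udiag E) (J, K) \<odot> h) = y"
    unfolding h(5)[symmetric] by (rule comp_eq_assoc[OF ultra_inj(5)]) (use J assms h(1-3) t ultra_inj(2-4) in auto)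
  moreover have "uproj E K i \<odot> (FArr (udiag E) (J, K) \<odot> h) = \<xi> i" if "i \<in> K" for i
  proof -
    have iJ: "i \<in> J" using that assms by blast
    show ?thesis unfolding h(4)[OF iJ, symmetric]
      by (rule comp_eq_assoc[OF ultra_proj]) (use J assms that h(1-3) t pK in auto)
  qed
  ultimately show ?thesis unfolding rep_def using assms(2) y h(1-3) t
    by (intro conjI exI[of _ "FArr (udiag E) (J, K) \<odot> h"]) auto
qed

lemma rep_precomp:
  assumes "rep E J \<xi> y" "f \<in> Arr D" "Cod D f = Dom D y"
  shows "rep E J (\<lambda>i. \<xi> i \<odot> f) (y \<odot> f)"
proof -
  obtain h where J: "J \<in> U" and y: "y \<in> Arr D" and h: "h \<in> Arr D" "Dom D h = Dom D y"
    "Cod D h = FObj (udiag E) J" "\<And>i. i \<in> J \<Longrightarrow> uproj E J i \<odot> h = \<xi> i" "uinj E J \<odot> h = y"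
    by (rule repE[OF assms(1)]) (rule that; assumption?)
  note pf = product_facts[OF ultra_product[OF J]]
  have "uinj E J \<odot> (h \<odot> f) = y \<odot> f"
    by (rule comp_eq_assoc[OF h(5)]) (use J h(1-3) ultra_inj assms in auto)
  moreover have "uproj E J i \<odot> (h \<odot> f) = \<xi> i \<odot> f" if "i \<in> J" for i
    by (rule comp_eq_assoc[OF h(4)[OF that]]) (use pf(2-4)[OF that] h(1-3) assms in auto)
  ultimately show ?thesis unfolding rep_def using J y h(1-3) assms
    by (intro conjI exI[of _ "h \<odot> f"]) auto
qed

lemma rep_unique:
  assumes "rep E J \<xi> y" "rep E J \<xi>' y'" "Dom D y = Dom D y'" "\<And>i. i \<in> J \<Longrightarrow> \<xi> i = \<xi>' i"
  shows "y = y'"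
proof -
  obtain h where J: "J \<in> U" and h: "h \<in> Arr D" "Dom D h = Dom D y"
    "Cod D h = FObj (udiag E) J" "\<And>i. i \<in> J \<Longrightarrow> uproj E J i \<odot> h = \<xi> i" "uinj E J \<odot> h = y"
    by (rule repE[OF assms(1)]) (rule that; assumption?)
  obtain h' where h': "h' \<in> Arr D" "Dom D h' = Dom D y'"
    "Cod D h' = FObj (udiag E) J" "\<And>i. i \<in> J \<Longrightarrow> uproj E J i \<odot> h' = \<xi>' i" "uinj E J \<odot> h' = y'"
    by (rule repE[OF assms(2)]) (rule that; assumption?)
  have "h = h'" by (rule product_unique[OF ultra_product[OF J]]) (use h h' assms in auto)
  then show ?thesis using h h' by simp
qed

lemma rep_separated:
  assumes "rep E J \<xi> y" "rep E J' \<xi>' y"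
  shows "locally (Dom D y) (\<lambda>f. \<exists>K\<in>U. K \<subseteq> J \<inter> J' \<and> (\<forall>i\<in>K. \<xi> i \<odot> f = \<xi>' i \<odot> f))"
proof -
  obtain h where J: "J \<in> U" and h: "h \<in> Arr D" "Dom D h = Dom D y"
    "Cod D h = FObj (udiag E) J" "\<And>i. i \<in> J \<Longrightarrow> uproj E J i \<odot> h = \<xi> i" "uinj E J \<odot> h = y"
    by (rule repE[OF assms(1)]) (rule that; assumption?)
  obtain h' where J': "J' \<in> U" and h': "h' \<in> Arr D" "Dom D h' = Dom D y"
    "Cod D h' = FObj (udiag E) J'" "\<And>i. i \<in> J' \<Longrightarrow> uproj E J' i \<odot> h' = \<xi>' i" "uinj E J' \<odot> h' = y"
    by (rule repE[OF assms(2)]) (rule that; assumption?)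
  have "locally (Dom D h) (\<lambda>f. \<exists>L\<in>U. L \<subseteq> J \<inter> J' \<and>
      FArr (udiag E) (J, L) \<odot> (h \<odot> f) = FArr (udiag E) (J', L) \<odot> (h' \<odot> f))"
    by (rule dd.separatedD[OF dd.colimit_separated[OF ultra_colimit] J J']) (simp_all add: h(1-3,5) h'(1-3,5))
  then have l: "locally (Dom D y) (\<lambda>f. \<exists>L\<in>U. L \<subseteq> J \<inter> J' \<and>
      FArr (udiag E) (J, L) \<odot> (h \<odot> f) = FArr (udiag E) (J', L) \<odot> (h' \<odot> f))"
    unfolding h(2) .
  show ?thesis
  proof (rule locally_mono[OF l])
    fix f assume f: "f \<in> Arr D" "Cod D f = Dom D y" "\<exists>L\<in>U. L \<subseteq> J \<inter> J' \<and>
      FArr (udiag E) (J, L) \<odot> (h \<odot> f) = FArr (udiag E) (J', L) \<odot> (h' \<odot> f)"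
    then obtain L where L: "L \<in> U" "L \<subseteq> J" "L \<subseteq> J'"
      "FArr (udiag E) (J, L) \<odot> (h \<odot> f) = FArr (udiag E) (J', L) \<odot> (h' \<odot> f)" by blast
    have "\<xi> i \<odot> f = \<xi>' i \<odot> f" if i: "i \<in> L" for i
    proof -
      have iJ: "i \<in> J" "i \<in> J'" using i L by auto
      note pJ = product_facts[OF ultra_product[OF J]] and pJ' = product_facts[OF ultra_product[OF J']]
        and pL = product_facts[OF ultra_product[OF L(1)]]
      have "\<xi> i \<odot> f = uproj E J i \<odot> (h \<odot> f)"
        by (rule comp_eq_assoc[OF h(4)[OF iJ(1)], symmetric]) (use pJ(2-4)[OF iJ(1)] h(1-3) f in auto)
      also have "\<dots> = uproj E L i \<odot> (FArr (udiag E) (J, L) \<odot> (h \<odot> f))"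
        by (rule comp_eq_assoc[OF ultra_proj[OF J L(1,2) i], symmetric])
          (use pL(2-4)[OF i] dd.tr_arr[OF J L(1,2)] h(1-3) f in auto)
      also have "\<dots> = uproj E J' i \<odot> (h' \<odot> f)" unfolding L(4)
        by (rule comp_eq_assoc[OF ultra_proj[OF J' L(1,3) i]])
          (use pL(2-4)[OF i] dd.tr_arr[OF J' L(1,3)] h'(1-3) f in auto)
      also have "\<dots> = \<xi>' i \<odot> f"
        by (rule comp_eq_assoc[OF h'(4)[OF iJ(2)]]) (use pJ'(2-4)[OF iJ(2)] h'(1-3) f in auto)
      finally show ?thesis .
    qed
    then show "\<exists>K\<in>U. K \<subseteq> J \<inter> J' \<and> (\<forall>i\<in>K. \<xi> i \<odot> f = \<xi>' i \<odot> f)" using L by blast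
  qed
qed

end

lemma ultra_map_rep:
  assumes E: "is_ultraproduct D U X E" and E': "is_ultraproduct D U X' E'"
    and f: "\<And>i. i \<in> I \<Longrightarrow> f i \<in> hom D (X i) (X' i)"
    and h: "is_ultraproduct_map D U E E' f h" and r: "rep E J \<xi> y"
  shows "rep E' J (\<lambda>i. f i \<odot> \<xi> i) (h \<odot> y)"
proof -
  obtain k where J: "J \<in> U" and y: "y \<in> Arr D" and k: "k \<in> Arr D" "Dom D k = Dom D y"
    "Cod D k = FObj (udiag E) J" "\<And>i. i \<in> J \<Longrightarrow> uproj E J i \<odot> k = \<xi> i" "uinj E J \<odot> k = y"
    by (rule repE[OF r]) (rule that; assumption?)
  note pJ = product_facts[OF ultra_product[OF E J]] and pJ' = product_facts[OF ultra_product[OF E' J]]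
  have fa: "f i \<in> Arr D" "Dom D (f i) = X i" "Cod D (f i) = X' i" if "i \<in> J" for i
    using f[OF U_sub[OF J that]] by (simp_all add: hom_iff)
  have ha: "h \<in> Arr D" "Dom D h = uobj E" "Cod D h = uobj E'"
    using h unfolding is_ultraproduct_map_def by (auto simp: hom_iff)
  have "f i \<odot> uproj E J i \<in> hom D (FObj (udiag E) J) (X' i)" if "i \<in> J" for i
    using fa[OF that] pJ(2-4)[OF that] by (simp add: hom_iff)
  then obtain m where m: "m \<in> Arr D" "Dom D m = FObj (udiag E) J" "Cod D m = FObj (udiag E') J"
    "\<And>i. i \<in> J \<Longrightarrow> uproj E' J i \<odot> m = f i \<odot> uproj E J i"
    using product_lift[OF ultra_product[OF E' J] pJ(1), of "\<lambda>i. f i \<odot> uproj E J i"] by blast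
  have hm: "h \<odot> uinj E J = uinj E' J \<odot> m"
    using h J m unfolding is_ultraproduct_map_def by (simp add: hom_iff)
  have "uinj E' J \<odot> (m \<odot> k) = h \<odot> y"
  proof -
    have "h \<odot> y = h \<odot> (uinj E J \<odot> k)" unfolding k(5) ..
    also have "\<dots> = (uinj E' J \<odot> m) \<odot> k"
      by (rule comp_eq_assoc[OF hm]) (use ha ultra_inj[OF E] J k(1-3) in auto)
    finally show ?thesis using ultra_inj[OF E'] J m(1-3) k(1-3) by simp
  qed
  moreover have "uproj E' J i \<odot> (m \<odot> k) = f i \<odot> \<xi> i" if i: "i \<in> J" for i
  proof -
    have "uproj E' J i \<odot> (m \<odot> k) = (f i \<odot> uproj E J i) \<odot> k"
      by (rule comp_eq_assoc[OF m(4)[OF i]]) (use pJ'(2-4)[OF i] m(1-3) k(1-3) in auto)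
    also have "\<dots> = f i \<odot> \<xi> i" unfolding k(4)[OF i, symmetric] using fa[OF i] pJ(2-4)[OF i] k(1-3) by simp
    finally show ?thesis .
  qed
  moreover have "h \<odot> y \<in> Arr D" "Dom D (h \<odot> y) = Dom D y"
    using ha rep_typing[OF E r] by simp_all
  ultimately show ?thesis unfolding rep_def using J m(1-3) k(1-3)
    by (intro conjI exI[of _ "m \<odot> k"]) auto
qed

lemma ex_ultraproduct:
  assumes X: "\<And>i. i \<in> I \<Longrightarrow> X i \<in> Obj D"
  shows "\<exists>E. is_ultraproduct D U X E"
proof -
  have "\<exists>P \<pi>. is_product D J X P \<pi>" if "J \<in> U" for J
    using ex_kap_product[OF U_member_small[OF that]] X U_sub[OF that] by blast
  then obtain P \<pi> where P: "\<And>J. J \<in> U \<Longrightarrow> is_product D J X (P J) (\<pi> J)" by metis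
  note pf = product_facts[OF P]
  have "\<exists>t. t \<in> Arr D \<and> Dom D t = P J \<and> Cod D t = P K \<and> (\<forall>i\<in>K. \<pi> K i \<odot> t = \<pi> J i)"
    if JK: "J \<in> U" "K \<in> U" "K \<subseteq> J" for J K
  proof -
    have "\<pi> J i \<in> hom D (P J) (X i)" if "i \<in> K" for i
      using pf(2-4)[OF JK(1), of i] that JK by (auto simp: hom_iff)
    then show ?thesis by (rule product_exists[OF P[OF JK(2)] pf(1)[OF JK(1)]])
  qed
  note ext = this
  define t where "t J K = (SOME t. t \<in> Arr D \<and> Dom D t = P J \<and> Cod D t = P K \<and> (\<forall>i\<in>K. \<pi> K i \<odot> t = \<pi> J i))" for J K
  have tt: "t J K \<in> Arr D \<and> Dom D (t J K) = P J \<and> Cod D (t J K) = P K \<and> (\<forall>i\<in>K. \<pi> K i \<odot> t J K = \<pi> J i)"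
    if "J \<in> U" "K \<in> U" "K \<subseteq> J" for J K
    unfolding t_def by (rule someI_ex[OF ext[OF that]])
  have t: "t J K \<in> Arr D \<and> Dom D (t J K) = P J \<and> Cod D (t J K) = P K" if "J \<in> U" "K \<in> U" "K \<subseteq> J" for J K
    using tt[OF that] by simp
  have \<pi>t: "\<pi> K i \<odot> t J K = \<pi> J i" if "J \<in> U" "K \<in> U" "K \<subseteq> J" "i \<in> K" for J K i
    using tt[OF that(1-3)] that(4) by simp
  define T :: "('i set, 'i set \<times> 'i set, 'o, 'm) func" where "T = \<lparr>FObj = P, FArr = (\<lambda>f. t (fst f) (snd f))\<rparr>"
  have ObjU: "Obj (poset_op (inclusion_order U)) = U"
    unfolding poset_op_def inclusion_order_def Field_def by auto
  have ArrU: "f \<in> Arr (poset_op (inclusion_order U)) \<longleftrightarrow> fst f \<in> U \<and> snd f \<in> U \<and> snd f \<subseteq> fst f" for f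
    unfolding poset_op_def inclusion_order_def by (cases f) auto
  have DomU: "Dom (poset_op (inclusion_order U)) = fst" "Cod (poset_op (inclusion_order U)) = snd"
    "Id (poset_op (inclusion_order U)) = (\<lambda>v. (v, v))"
    "Comp (poset_op (inclusion_order U)) = (\<lambda>g f. (fst f, snd g))"
    unfolding poset_op_def by auto
  have T: "is_functor (poset_op (inclusion_order U)) D T" unfolding is_functor_def ObjU Ball_def ArrU DomU
  proof (intro conjI allI impI)
    show "FObj T J \<in> Obj D" if "J \<in> U" for J using pf(1)[OF that] unfolding T_def by simp
    show "FArr T f \<in> hom D (FObj T (fst f)) (FObj T (snd f))"
      if "fst f \<in> U \<and> snd f \<in> U \<and> snd f \<subseteq> fst f" for f
      using t[of "fst f" "snd f"] that unfolding T_def by (simp add: hom_iff)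
    show "FArr T (J, J) = Id D (FObj T J)" if J: "J \<in> U" for J
    proof -
      have "t J J = Id D (P J)"
        by (rule product_unique[OF P[OF J]]) (use t[OF J J] \<pi>t[OF J J] pf[OF J] in auto)
      then show ?thesis unfolding T_def by simp
    qed
    fix f g assume *: "fst f \<in> U \<and> snd f \<in> U \<and> snd f \<subseteq> fst f" "fst g \<in> U \<and> snd g \<in> U \<and> snd g \<subseteq> fst g" "fst g = snd f"
    define J K L where "J = fst f" and "K = snd f" and "L = snd g"
    have JK: "J \<in> U" "K \<in> U" "K \<subseteq> J" and KL: "L \<in> U" "L \<subseteq> K" and JL: "L \<subseteq> J"
      using * unfolding J_def K_def L_def by auto
    have "t J L = t K L \<odot> t J K"
    proof (rule product_unique[OF P[OF KL(1)]])
      fix i assume i: "i \<in> L"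
      have "\<pi> L i \<odot> (t K L \<odot> t J K) = \<pi> K i \<odot> t J K"
        by (rule comp_eq_assoc[OF \<pi>t[OF JK(2) KL i]]) (use t[OF JK] t[OF JK(2) KL] pf(2-4)[OF KL(1) i] in auto)
      also have "\<dots> = \<pi> J i" using \<pi>t[OF JK] i KL by blast
      finally show "\<pi> L i \<odot> t J L = \<pi> L i \<odot> (t K L \<odot> t J K)" using \<pi>t[OF JK(1) KL(1) JL i] by simp
    qed (use t[OF JK] t[OF JK(2) KL] t[OF JK(1) KL(1) JL] in auto)
    then show "FArr T (fst f, snd g) = FArr T g \<odot> FArr T f"
      using *(3) unfolding T_def J_def K_def L_def by simp
  qed
  interpret dd: directed_diagram D lam U T by unfold_locales (simp_all add: U_small U_facts(4) T)
  obtain x c where c: "is_colimit (poset_op (inclusion_order U)) D T x c" using dd.ex_colimit by blast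
  have "is_ultraproduct D U X \<lparr>udiag = T, uproj = \<pi>, uobj = x, uinj = c\<rparr>"
    unfolding is_ultraproduct_def using T c P \<pi>t by (simp add: T_def)
  then show ?thesis by blast
qed

lemma ex_ultraproduct_map:
  assumes E: "is_ultraproduct D U X E" and E': "is_ultraproduct D U X' E'"
    and f: "\<And>i. i \<in> I \<Longrightarrow> f i \<in> hom D (X i) (X' i)"
  shows "\<exists>h. is_ultraproduct_map D U E E' f h"
proof -
  interpret dd: directed_diagram D lam U "udiag E" using directed[OF E] .
  interpret dd': directed_diagram D lam U "udiag E'" using directed[OF E'] .
  let ?P = "FObj (udiag E)" and ?P' = "FObj (udiag E')"
  have fa: "f i \<in> Arr D" "Dom D (f i) = X i" "Cod D (f i) = X' i" if "J \<in> U" "i \<in> J" for i J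
    using f[OF U_sub[OF that]] by (simp_all add: hom_iff)
  note pf = product_facts[OF ultra_product[OF E]] and pf' = product_facts[OF ultra_product[OF E']]
  have "\<exists>m. m \<in> Arr D \<and> Dom D m = ?P J \<and> Cod D m = ?P' J \<and> (\<forall>i\<in>J. uproj E' J i \<odot> m = f i \<odot> uproj E J i)"
    if J: "J \<in> U" for J
  proof -
    have "f i \<odot> uproj E J i \<in> hom D (?P J) (X' i)" if "i \<in> J" for i
      using fa[OF J that] pf(2-4)[OF J that] by (simp add: hom_iff)
    then show ?thesis by (rule product_exists[OF ultra_product[OF E' J] pf(1)[OF J]])
  qed
  then obtain m where mm: "\<And>J. J \<in> U \<Longrightarrow> m J \<in> Arr D \<and> Dom D (m J) = ?P J \<and> Cod D (m J) = ?P' J \<and>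
      (\<forall>i\<in>J. uproj E' J i \<odot> m J = f i \<odot> uproj E J i)" by metis
  have m: "m J \<in> Arr D \<and> Dom D (m J) = ?P J \<and> Cod D (m J) = ?P' J" if "J \<in> U" for J
    using mm[OF that] by simp
  have \<pi>m: "uproj E' J i \<odot> m J = f i \<odot> uproj E J i" if "J \<in> U" "i \<in> J" for J i
    using mm[OF that(1)] that(2) by simp
  note i' = ultra_inj[OF E']
  have nat: "m K \<odot> dd.tr J K = dd'.tr J K \<odot> m J" if JK: "J \<in> U" "K \<in> U" "K \<subseteq> J" for J K
  proof (rule product_unique[OF ultra_product[OF E' JK(2)]])
    note t = dd.tr_arr[OF JK] and t' = dd'.tr_arr[OF JK]
    show "m K \<odot> dd.tr J K \<in> Arr D" "dd'.tr J K \<odot> m J \<in> Arr D" "Dom D (m K \<odot> dd.tr J K) = Dom D (dd'.tr J K \<odot> m J)"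
      "Cod D (m K \<odot> dd.tr J K) = ?P' K" "Cod D (dd'.tr J K \<odot> m J) = ?P' K"
      using t t' m JK by auto
    fix i assume i: "i \<in> K"
    then have iJ: "i \<in> J" using JK by blast
    have "uproj E' K i \<odot> (m K \<odot> dd.tr J K) = (f i \<odot> uproj E K i) \<odot> dd.tr J K"
      by (rule comp_eq_assoc[OF \<pi>m[OF JK(2) i]]) (use pf'(2-4)[OF JK(2) i] m JK t in auto)
    also have "\<dots> = f i \<odot> (uproj E K i \<odot> dd.tr J K)"
      using fa[OF JK(2) i] pf(2-4)[OF JK(2) i] t by simp
    also have "\<dots> = uproj E' J i \<odot> m J" unfolding ultra_proj[OF E JK i] \<pi>m[OF JK(1) iJ] ..
    also have "\<dots> = uproj E' K i \<odot> (dd'.tr J K \<odot> m J)"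
      by (rule comp_eq_assoc[OF ultra_proj[OF E' JK i], symmetric]) (use pf'(2-4)[OF JK(2) i] m JK t' in auto)
    finally show "uproj E' K i \<odot> (m K \<odot> dd.tr J K) = uproj E' K i \<odot> (dd'.tr J K \<odot> m J)" .
  qed
  have "is_cocone dd.index D (udiag E) (uobj E') (\<lambda>J. uinj E' J \<odot> m J)"
    unfolding dd.cocone_iff
  proof (intro conjI ballI impI)
    fix J K assume JK: "J \<in> U" "K \<in> U" "K \<subseteq> J"
    note t = dd.tr_arr[OF JK] and t' = dd'.tr_arr[OF JK]
    have "(uinj E' K \<odot> m K) \<odot> dd.tr J K = uinj E' K \<odot> (dd'.tr J K \<odot> m J)"
      unfolding nat[OF JK, symmetric] using i' m JK t by simp
    also have "\<dots> = uinj E' J \<odot> m J"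
      by (rule comp_eq_assoc[OF i'(5)[OF JK]]) (use i' m JK t' in auto)
    finally show "(uinj E' K \<odot> m K) \<odot> dd.tr J K = uinj E' J \<odot> m J" .
  qed (use i' m in auto)
  then have "\<exists>!h. h \<in> hom D (uobj E) (uobj E') \<and> (\<forall>J\<in>U. h \<odot> uinj E J = uinj E' J \<odot> m J)"
    by (rule dd.colimit_ex1[OF ultra_colimit[OF E]])
  then obtain h where h: "h \<in> hom D (uobj E) (uobj E') \<and> (\<forall>J\<in>U. h \<odot> uinj E J = uinj E' J \<odot> m J)"
    by (elim ex1E)
  have "is_ultraproduct_map D U E E' f h" unfolding is_ultraproduct_map_def
  proof (intro conjI ballI impI)
    fix J n assume J: "J \<in> U" and n: "n \<in> hom D (?P J) (?P' J)" "\<forall>i\<in>J. uproj E' J i \<odot> n = f i \<odot> uproj E J i"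
    have "n = m J"
      by (rule product_unique[OF ultra_product[OF E' J]]) (use n m[OF J] \<pi>m[OF J] in \<open>auto simp: hom_iff\<close>)
    then show "h \<odot> uinj E J = uinj E' J \<odot> n" using h J by simp
  qed (use h in auto)
  then show ?thesis by blast
qed

end

section \<open>Fewer than \<open>kap\<close> simultaneous choices\<close>

context geometric_category
begin

lemma effective_epi_family_cover:
  assumes f: "effective_epi_family D x A f"
  shows "cover x (f ` A)"
  unfolding cover_def
proof (intro conjI ballI impI)
  note f' = f[unfolded effective_epi_family_def]
  note x = f'[THEN conjunct1] and fam = f'[THEN conjunct2, THEN conjunct1]
    and E = f'[THEN conjunct2, THEN conjunct2]
  have fa: "f i \<in> Arr D \<and> Cod D (f i) = x" if "i \<in> A" for i using fam that by (rule bspec)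
  have ex: "\<exists>!h. h \<in> hom D x y \<and> (\<forall>i\<in>A. h \<odot> f i = g i)"
    if "y \<in> Obj D" "\<And>i. i \<in> A \<Longrightarrow> g i \<in> hom D (Dom D (f i)) y"
      "\<And>i j z p q. \<lbrakk>i \<in> A; j \<in> A; p \<in> hom D z (Dom D (f i)); q \<in> hom D z (Dom D (f j));
        f i \<odot> p = f j \<odot> q\<rbrakk> \<Longrightarrow> g i \<odot> p = g j \<odot> q" for y g
    by (rule E[THEN bspec, THEN spec, THEN mp, OF that(1)], intro conjI ballI impI)
      (rule that(2), assumption, rule that(3))
  show "x \<in> Obj D" by fact
  show "k \<in> Arr D" "Cod D k = x" if "k \<in> f ` A" for k using that fa by auto
  fix m assume m: "m \<in> Sub D x" "\<forall>k\<in>f ` A. sub_le D k m"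
  then have ma: "is_mono D m" "m \<in> Arr D" "Cod D m = x" using mono_arr by (auto simp: Sub_iff)
  have "\<exists>l. l \<in> Arr D \<and> Dom D l = Dom D (f i) \<and> Cod D l = Dom D m \<and> m \<odot> l = f i" if "i \<in> A" for i
    using sub_leE[of "f i" m] m(2) fa[OF that] that by (metis imageI)
  then obtain l where l: "\<And>i. i \<in> A \<Longrightarrow> l i \<in> Arr D \<and> Dom D (l i) = Dom D (f i) \<and> Cod D (l i) = Dom D m"
    and ml: "\<And>i. i \<in> A \<Longrightarrow> m \<odot> l i = f i" by metis
  have "\<exists>!h. h \<in> hom D x (Dom D m) \<and> (\<forall>i\<in>A. h \<odot> f i = l i)"
  proof (rule ex)
    fix i j z p q assume *: "i \<in> A" "j \<in> A" "p \<in> hom D z (Dom D (f i))" "q \<in> hom D z (Dom D (f j))"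
      "f i \<odot> p = f j \<odot> q"
    then have pq: "p \<in> Arr D" "Dom D p = z" "Cod D p = Dom D (f i)" "q \<in> Arr D" "Dom D q = z" "Cod D q = Dom D (f j)"
      by (simp_all add: hom_iff)
    have "m \<odot> (l i \<odot> p) = f i \<odot> p" by (rule comp_eq_assoc[OF ml]) (use * pq l ma in auto)
    also have "\<dots> = m \<odot> (l j \<odot> q)" unfolding *(5) by (rule comp_eq_assoc[OF ml, symmetric]) (use * pq l ma in auto)
    finally show "l i \<odot> p = l j \<odot> q"
      by (rule mono_cancel[OF _ ma(1)]) (simp_all add: * pq l)
  qed (use ma l in \<open>auto simp: hom_iff\<close>)
  then obtain h where "h \<in> hom D x (Dom D m) \<and> (\<forall>i\<in>A. h \<odot> f i = l i)" by (elim ex1E)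
  then have h: "h \<in> Arr D" "Dom D h = x" "Cod D h = Dom D m" and hl: "\<And>i. i \<in> A \<Longrightarrow> h \<odot> f i = l i"
    by (simp_all add: hom_iff)
  have mh: "(m \<odot> h) \<odot> f i = f i" if "i \<in> A" for i using h hl[OF that] ma fa[OF that] ml[OF that] by simp
  have "\<exists>!h. h \<in> hom D x x \<and> (\<forall>i\<in>A. h \<odot> f i = f i)"
    by (rule ex) (use x fa in \<open>auto simp: hom_iff\<close>)
  moreover have "m \<odot> h \<in> hom D x x \<and> (\<forall>i\<in>A. (m \<odot> h) \<odot> f i = f i)"
    using mh h ma by (simp add: hom_iff)
  moreover have "Id D x \<in> hom D x x \<and> (\<forall>i\<in>A. Id D x \<odot> f i = f i)" using x fa by (simp add: hom_iff)
  ultimately have "m \<odot> h = Id D x" by (elim ex1E) metis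
  then show "sub_le D (Id D x) m" by (intro sub_leI[of h]) (use h ma in auto)
qed

end

context lk_pretopos_cat
begin

lemma kap_infinite: "\<not> finite (Field kap)"
  using cinfinite_mono[OF kap(2) natLeq_cinfinite] unfolding cinfinite_def .

lemma finite_ordLess_kap: "finite A \<Longrightarrow> |A| <o kap"
  using kap(2) finite_iff_ordLess_natLeq ordLess_ordLeq_trans by blast

lemma kap_Well_order: "Well_order kap"
  using kap(1) card_order_on_well_order_on by blast

lemma ex_kap_wide_pullback:
  "\<lbrakk>|A| <o kap; z \<in> Obj D; \<And>i. i \<in> A \<Longrightarrow> w i \<in> Arr D \<and> Cod D (w i) = z\<rbrakk> \<Longrightarrow>
    \<exists>p0 p. is_wide_pullback z A w p0 p"
  using ex_wide_pullback[OF finite_limits kap_limits kap(1,2)] by blast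

end

text \<open>The partial wide pullbacks of a family of regular epimorphisms, indexed by an initial segment
  of \<open>kap\<close>, form a proper diagram on a tree with a single branch.\<close>

locale epi_chain = lk_pretopos_cat D lam kap
  for D :: "('o, 'm) cat" and lam :: "'l rel" and kap :: "'k rel" +
  fixes z :: 'o and top :: 'k and w :: "'k \<Rightarrow> 'm" and p0 :: "'k \<Rightarrow> 'm" and p :: "'k \<Rightarrow> 'k \<Rightarrow> 'm" and l0 :: 'l
  assumes z: "z \<in> Obj D" and top: "top \<in> Field kap"
    and w: "\<And>i. i \<in> underS kap top \<Longrightarrow> is_regular_epi D (w i) \<and> Cod D (w i) = z"
    and wp: "\<And>a. a \<in> under kap top \<Longrightarrow> is_wide_pullback z (underS kap a) w (p0 a) (p a)"
begin

lemma kap_order: "refl_on (Field kap) kap" "trans kap" "antisym kap"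
  "\<And>a b. \<lbrakk>a \<in> Field kap; b \<in> Field kap\<rbrakk> \<Longrightarrow> (a, b) \<in> kap \<or> (b, a) \<in> kap"
proof -
  have "Well_order kap" by (rule kap_Well_order)
  then show r: "refl_on (Field kap) kap" and "trans kap" "antisym kap"
    unfolding well_order_on_def linear_order_on_def partial_order_on_def preorder_on_def by auto
  fix a b assume "a \<in> Field kap" "b \<in> Field kap"
  then show "(a, b) \<in> kap \<or> (b, a) \<in> kap"
    using \<open>Well_order kap\<close> r unfolding well_order_on_def linear_order_on_def total_on_def refl_on_def by metis
qed

lemma kap_refl: "a \<in> Field kap \<Longrightarrow> (a, a) \<in> kap"
  using kap_order(1) unfolding refl_on_def by blast

lemma kap_trans: "\<lbrakk>(a, b) \<in> kap; (b, c) \<in> kap\<rbrakk> \<Longrightarrow> (a, c) \<in> kap"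
  using kap_order(2) by (rule transD)

lemma kap_antisym: "\<lbrakk>(a, b) \<in> kap; (b, a) \<in> kap\<rbrakk> \<Longrightarrow> a = b"
  using kap_order(3) by (rule antisymD)

abbreviation "seg \<equiv> under kap top"

lemma seg_Field: "a \<in> seg \<Longrightarrow> a \<in> Field kap"
  unfolding under_def by (auto intro: FieldI1)

lemma seg_down: "\<lbrakk>(a, b) \<in> kap; b \<in> seg\<rbrakk> \<Longrightarrow> a \<in> seg"
  unfolding under_def using kap_trans by blast

lemma top_seg: "top \<in> seg"
  unfolding under_def using kap_refl[OF top] by simp

lemma below_seg: "\<lbrakk>a \<in> seg; i \<in> underS kap a\<rbrakk> \<Longrightarrow> i \<in> underS kap top"
  unfolding under_def underS_def using kap_trans kap_antisym by blast

lemma underS_mono: "(b, a) \<in> kap \<Longrightarrow> underS kap b \<subseteq> underS kap a"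
  unfolding underS_def using kap_trans kap_antisym by blast

lemma w_arr: "\<lbrakk>a \<in> seg; i \<in> underS kap a\<rbrakk> \<Longrightarrow> w i \<in> Arr D"
  using w below_seg regular_epi_arr by blast

definition tr :: "'k \<Rightarrow> 'k \<Rightarrow> 'm" where
  "tr a b = (SOME t. t \<in> Arr D \<and> Dom D t = Dom D (p0 a) \<and> Cod D t = Dom D (p0 b) \<and> p0 b \<odot> t = p0 a \<and>
     (\<forall>i\<in>underS kap b. p b i \<odot> t = p a i))"

lemma tr:
  assumes "a \<in> seg" "(b, a) \<in> kap"
  shows "tr a b \<in> Arr D" "Dom D (tr a b) = Dom D (p0 a)" "Cod D (tr a b) = Dom D (p0 b)" "p0 b \<odot> tr a b = p0 a"
    "\<And>i. i \<in> underS kap b \<Longrightarrow> p b i \<odot> tr a b = p a i"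
proof -
  have b: "b \<in> seg" using seg_down assms by blast
  note A = wide_pullback_facts[OF wp[OF assms(1)]]
  have S: "i \<in> underS kap a" if "i \<in> underS kap b" for i using that underS_mono[OF assms(2)] by blast
  obtain t where "t \<in> Arr D" "Dom D t = Dom D (p0 a)" "Cod D t = Dom D (p0 b)" "p0 b \<odot> t = p0 a"
    "\<And>i. i \<in> underS kap b \<Longrightarrow> p b i \<odot> t = p a i"
    by (rule wide_pullback_lift[OF wp[OF b] A(1,2), of "p a"]) (use A(3-6) S in auto)
  then have "\<exists>t. t \<in> Arr D \<and> Dom D t = Dom D (p0 a) \<and> Cod D t = Dom D (p0 b) \<and> p0 b \<odot> t = p0 a \<and>
     (\<forall>i\<in>underS kap b. p b i \<odot> t = p a i)" by blast
  from someI_ex[OF this] show "tr a b \<in> Arr D" "Dom D (tr a b) = Dom D (p0 a)" "Cod D (tr a b) = Dom D (p0 b)" "p0 b \<odot> tr a b = p0 a"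
    "\<And>i. i \<in> underS kap b \<Longrightarrow> p b i \<odot> tr a b = p a i"
    unfolding tr_def by blast+
qed

lemma wp_unique:
  assumes "a \<in> seg" "h \<in> Arr D" "k \<in> Arr D" "Dom D h = Dom D k" "Cod D h = Dom D (p0 a)" "Cod D k = Dom D (p0 a)"
    "p0 a \<odot> h = p0 a \<odot> k" "\<And>i. i \<in> underS kap a \<Longrightarrow> p a i \<odot> h = p a i \<odot> k"
  shows "h = k"
  by (rule wide_pullback_unique[OF wp[OF assms(1)] assms(2-7) w_arr[OF assms(1)] assms(8)])

lemma tr_p0:
  assumes "a \<in> seg" "(b, a) \<in> kap" "x \<in> Arr D" "Cod D x = Dom D (p0 a)"
  shows "p0 b \<odot> (tr a b \<odot> x) = p0 a \<odot> x"
  by (rule comp_eq_assoc[OF tr(4)[OF assms(1,2)]])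
    (use assms tr(1-3)[OF assms(1,2)] wide_pullback_facts(1)[OF wp[OF seg_down[OF assms(2,1)]]] in auto)

lemma tr_p:
  assumes "a \<in> seg" "(b, a) \<in> kap" "x \<in> Arr D" "Cod D x = Dom D (p0 a)" "i \<in> underS kap b"
  shows "p b i \<odot> (tr a b \<odot> x) = p a i \<odot> x"
  by (rule comp_eq_assoc[OF tr(5)[OF assms(1,2,5)]])
    (use assms tr(1-3)[OF assms(1,2)] wide_pullback_facts(3,4)[OF wp[OF seg_down[OF assms(2,1)]] assms(5)] in auto)

lemma tr_id:
  assumes a: "a \<in> seg"
  shows "tr a a = Id D (Dom D (p0 a))"
proof -
  have aa: "(a, a) \<in> kap" using kap_refl seg_Field[OF a] by blast
  note A = wide_pullback_facts[OF wp[OF a]]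
  show ?thesis by (rule wp_unique[OF a]) (use tr[OF a aa] A in auto)
qed

lemma tr_comp:
  assumes a: "a \<in> seg" and ba: "(b, a) \<in> kap" and cb: "(c, b) \<in> kap"
  shows "tr b c \<odot> tr a b = tr a c"
proof -
  have b: "b \<in> seg" and c: "c \<in> seg" and ca: "(c, a) \<in> kap" using seg_down kap_trans assms by blast+
  note tab = tr[OF a ba] and tbc = tr[OF b cb] and tac = tr[OF a ca]
  show ?thesis
  proof (rule wp_unique[OF c])
    have "p0 c \<odot> (tr b c \<odot> tr a b) = p0 b \<odot> tr a b" by (rule tr_p0[OF b cb]) (use tab in auto)
    then show "p0 c \<odot> (tr b c \<odot> tr a b) = p0 c \<odot> tr a c" unfolding tab(4) tac(4) .
    fix i assume i: "i \<in> underS kap c"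
    then have ib: "i \<in> underS kap b" using underS_mono[OF cb] by blast
    have "p c i \<odot> (tr b c \<odot> tr a b) = p b i \<odot> tr a b" by (rule tr_p[OF b cb _ _ i]) (use tab in auto)
    then show "p c i \<odot> (tr b c \<odot> tr a b) = p c i \<odot> tr a c" unfolding tab(5)[OF ib] tac(5)[OF i] .
  qed (use tab tbc tac in auto)
qed

lemma tr_successor:
  assumes a: "a \<in> seg" and ba: "(b, a) \<in> kap" "b \<noteq> a" and suc: "underS kap a \<subseteq> insert b (underS kap b)"
  shows "cover (Dom D (p0 b)) {tr a b}"
proof (rule cover_of_locally)
  have b: "b \<in> seg" using seg_down a ba by blast
  have bS: "b \<in> underS kap a" using ba unfolding underS_def by blast
  note A = wide_pullback_facts[OF wp[OF a]] and B = wide_pullback_facts[OF wp[OF b]] and t = tr[OF a ba(1)]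
  have wb: "is_regular_epi D (w b)" "Cod D (w b) = z" "w b \<in> Arr D"
    using w[OF below_seg[OF a bS]] w_arr[OF a bS] by auto
  have l: "locally (Dom D (p0 b)) (\<lambda>f. sub_le D (p0 b \<odot> f) (w b))"
    by (rule regular_epi_lift[OF wb(1) B(1)]) (use B wb in auto)
  show "locally (Dom D (p0 b)) (\<lambda>f. \<exists>g\<in>{tr a b}. sub_le D f g)"
  proof (rule locally_mono[OF l])
    fix f assume f: "f \<in> Arr D" "Cod D f = Dom D (p0 b)" "sub_le D (p0 b \<odot> f) (w b)"
    obtain k where k: "k \<in> Arr D" "Dom D k = Dom D (p0 b \<odot> f)" "Cod D k = Dom D (w b)" "w b \<odot> k = p0 b \<odot> f"
      using f(3) by (rule sub_leE) (use f B in simp)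
    define q where "q i = (if i = b then k else p b i \<odot> f)" for i
    have q: "q i \<in> Arr D \<and> Dom D (q i) = Dom D (p0 b \<odot> f) \<and> Cod D (q i) = Dom D (w i) \<and> w i \<odot> q i = p0 b \<odot> f"
      if "i \<in> underS kap a" for i
    proof (cases "i = b")
      case True
      then show ?thesis using k unfolding q_def by simp
    next
      case False
      then have i: "i \<in> underS kap b" using suc that by blast
      have "w i \<odot> (p b i \<odot> f) = p0 b \<odot> f"
        by (rule comp_eq_assoc[OF B(6)[OF i]]) (use B(3-5)[OF i] f w_arr[OF b i] in auto)
      then show ?thesis using False B(3-5)[OF i] f B(1) unfolding q_def by simp
    qed
    obtain h where h: "h \<in> Arr D" "Dom D h = Dom D (p0 b \<odot> f)" "Cod D h = Dom D (p0 a)" "p0 a \<odot> h = p0 b \<odot> f"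
      "\<And>i. i \<in> underS kap a \<Longrightarrow> p a i \<odot> h = q i"
      by (rule wide_pullback_lift[OF wp[OF a], of "p0 b \<odot> f" q]) (use f B q in auto)
    have "tr a b \<odot> h = f"
    proof (rule wp_unique[OF b])
      show "p0 b \<odot> (tr a b \<odot> h) = p0 b \<odot> f" using tr_p0[OF a ba(1) h(1,3)] h(4) by simp
      fix i assume i: "i \<in> underS kap b"
      then have "i \<noteq> b" "i \<in> underS kap a" using underS_mono[OF ba(1)] unfolding underS_def by auto
      then show "p b i \<odot> (tr a b \<odot> h) = p b i \<odot> f"
        using tr_p[OF a ba(1) h(1,3) i] h(5) unfolding q_def by simp
    qed (use t h(1-3) f B(1) in auto)
    then show "\<exists>g\<in>{tr a b}. sub_le D f g" using sub_leI[of h "tr a b" f] h(1,3) t by simp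
  qed
qed (use tr[OF a ba(1)] in auto)

lemma tr_limit:
  assumes S: "S \<subseteq> seg" "S \<noteq> {}" and s: "s \<in> seg" "\<And>u. u \<in> S \<Longrightarrow> (u, s) \<in> kap"
    and lub: "\<And>t. \<lbrakk>t \<in> seg; \<And>u. u \<in> S \<Longrightarrow> (u, t) \<in> kap\<rbrakk> \<Longrightarrow> (s, t) \<in> kap"
    and y: "y \<in> Obj D" and q: "\<And>u. u \<in> S \<Longrightarrow> q u \<in> hom D y (Dom D (p0 u))"
    and qq: "\<And>u v. \<lbrakk>u \<in> S; v \<in> S; (u, v) \<in> kap\<rbrakk> \<Longrightarrow> tr v u \<odot> q v = q u"
  shows "\<exists>!h. h \<in> hom D y (Dom D (p0 s)) \<and> (\<forall>u\<in>S. tr s u \<odot> h = q u)"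
proof -
  have qa: "q u \<in> Arr D" "Dom D (q u) = y" "Cod D (q u) = Dom D (p0 u)" if "u \<in> S" for u
    using q[OF that] by (simp_all add: hom_iff)
  have Ss: "u \<in> seg" if "u \<in> S" for u using that S by blast
  note P = wide_pullback_facts[OF wp[OF Ss]]
  have q0: "p0 u \<odot> q u = p0 v \<odot> q v" if "u \<in> S" "v \<in> S" for u v
  proof -
    have *: "p0 u \<odot> q u = p0 v \<odot> q v" if "u \<in> S" "v \<in> S" "(u, v) \<in> kap" for u v
      using tr_p0[OF Ss[OF that(2)] that(3), of "q v"] qa that qq[OF that] by simp
    show ?thesis using kap_order(4)[of u v] seg_Field Ss that * by metis
  qed
  have qi: "p u i \<odot> q u = p v i \<odot> q v" if "u \<in> S" "v \<in> S" "i \<in> underS kap u" "i \<in> underS kap v" for u v i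
  proof -
    have *: "p u i \<odot> q u = p v i \<odot> q v" if "u \<in> S" "v \<in> S" "(u, v) \<in> kap" "i \<in> underS kap u" for u v
      using tr_p[OF Ss[OF that(2)] that(3), of "q v" i] qa that qq[OF that(1-3)] by simp
    show ?thesis using kap_order(4)[of u v] seg_Field Ss that * by metis
  qed
  have "\<exists>u\<in>S. i \<in> underS kap u" if i: "i \<in> underS kap s" for i
  proof (rule ccontr)
    assume no: "\<not> (\<exists>u\<in>S. i \<in> underS kap u)"
    have is_: "(i, s) \<in> kap" "i \<noteq> s" using i unfolding underS_def by auto
    then have iseg: "i \<in> seg" using seg_down s by blast
    have "(u, i) \<in> kap" if u: "u \<in> S" for u
    proof (cases "u = i")
      case True
      then show ?thesis using kap_refl[OF seg_Field[OF iseg]] by simp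
    next
      case False
      then have "(i, u) \<notin> kap" using no u unfolding underS_def by auto
      then show ?thesis using kap_order(4)[OF seg_Field[OF Ss[OF u]] seg_Field[OF iseg]] by blast
    qed
    then show False using lub[OF iseg] is_ kap_antisym by blast
  qed
  then obtain U where U: "\<And>i. i \<in> underS kap s \<Longrightarrow> U i \<in> S" "\<And>i. i \<in> underS kap s \<Longrightarrow> i \<in> underS kap (U i)"
    by metis
  obtain u0 where u0: "u0 \<in> S" using S by blast
  have t0: "p0 u0 \<odot> q u0 \<in> Arr D" "Dom D (p0 u0 \<odot> q u0) = y" "Cod D (p0 u0 \<odot> q u0) = z"
    using P(1,2)[OF u0] qa[OF u0] by auto
  have lq: "p (U i) i \<odot> q (U i) \<in> Arr D \<and> Dom D (p (U i) i \<odot> q (U i)) = Dom D (p0 u0 \<odot> q u0) \<and>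
    Cod D (p (U i) i \<odot> q (U i)) = Dom D (w i) \<and> w i \<odot> (p (U i) i \<odot> q (U i)) = p0 u0 \<odot> q u0"
    if i: "i \<in> underS kap s" for i
  proof -
    note Pi = P(3-6)[OF U(1)[OF i] U(2)[OF i]]
    have "w i \<odot> (p (U i) i \<odot> q (U i)) = p0 (U i) \<odot> q (U i)"
      by (rule comp_eq_assoc[OF Pi(4)]) (use Pi(1-3) qa[OF U(1)[OF i]] w_arr[OF s(1) i] in auto)
    also have "\<dots> = p0 u0 \<odot> q u0" using q0[OF U(1)[OF i] u0] .
    finally show ?thesis using Pi(1-3) qa[OF U(1)[OF i]] t0(2) by simp
  qed
  obtain h where h: "h \<in> Arr D" "Dom D h = Dom D (p0 u0 \<odot> q u0)" "Cod D h = Dom D (p0 s)" "p0 s \<odot> h = p0 u0 \<odot> q u0"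
    "\<And>i. i \<in> underS kap s \<Longrightarrow> p s i \<odot> h = p (U i) i \<odot> q (U i)"
    by (rule wide_pullback_lift[OF wp[OF s(1)] t0(1,3), of "\<lambda>i. p (U i) i \<odot> q (U i)"]) (use lq in auto)
  have hy: "Dom D h = y" using h(2) t0(2) by simp
  have hq: "tr s u \<odot> h = q u" if u: "u \<in> S" for u
  proof (rule wp_unique[OF Ss[OF u]])
    note t = tr[OF s(1) s(2)[OF u]]
    show "p0 u \<odot> (tr s u \<odot> h) = p0 u \<odot> q u"
      using tr_p0[OF s(1) s(2)[OF u] h(1,3)] h(4) q0[OF u u0] by simp
    fix i assume i: "i \<in> underS kap u"
    then have is_: "i \<in> underS kap s" using underS_mono[OF s(2)[OF u]] by blast
    show "p u i \<odot> (tr s u \<odot> h) = p u i \<odot> q u"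
      using tr_p[OF s(1) s(2)[OF u] h(1,3) i] h(5)[OF is_] qi[OF u U(1)[OF is_] i U(2)[OF is_]] by simp
  qed (use tr[OF s(1) s(2)[OF u]] h(1,3) hy qa[OF u] in auto)
  show ?thesis
  proof (rule ex1I[of _ h])
    show "h \<in> hom D y (Dom D (p0 s)) \<and> (\<forall>u\<in>S. tr s u \<odot> h = q u)" using h hy hq by (simp add: hom_iff)
    fix k assume k: "k \<in> hom D y (Dom D (p0 s)) \<and> (\<forall>u\<in>S. tr s u \<odot> k = q u)"
    then have ka: "k \<in> Arr D" "Dom D k = y" "Cod D k = Dom D (p0 s)" by (auto simp: hom_iff)
    show "k = h"
    proof (rule wp_unique[OF s(1)])
      show "p0 s \<odot> k = p0 s \<odot> h"
        using tr_p0[OF s(1) s(2)[OF u0] ka(1,3)] k u0 h(4) by simp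
      fix i assume i: "i \<in> underS kap s"
      show "p s i \<odot> k = p s i \<odot> h"
        using tr_p[OF s(1) s(2)[OF U(1)[OF i]] ka(1,3) U(2)[OF i]] k U(1)[OF i] h(5)[OF i] by simp
    qed (use ka h hy in auto)
  qed
qed

definition vertex :: "'k \<Rightarrow> 'k \<Rightarrow> 'l option" where
  "vertex a = (\<lambda>x. if x = a then Some l0 else None)"

definition chain :: "('k \<Rightarrow> 'l option) rel" where
  "chain = dir_image (Restr kap seg) vertex"

definition diagram :: "('k \<Rightarrow> 'l option, ('k \<Rightarrow> 'l option) \<times> ('k \<Rightarrow> 'l option), 'o, 'm) func" where
  "diagram = \<lparr>FObj = (\<lambda>v. Dom D (p0 (inv vertex v))), FArr = (\<lambda>f. tr (inv vertex (fst f)) (inv vertex (snd f)))\<rparr>"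

lemma inj_vertex: "inj vertex"
  unfolding vertex_def by (rule injI) (metis option.distinct(1))

lemma inv_vertex [simp]: "inv vertex (vertex a) = a"
  by (rule inv_f_f[OF inj_vertex])

lemma vertex_eq [simp]: "vertex a = vertex b \<longleftrightarrow> a = b"
  using inj_vertex by (auto dest: injD)

lemma chain_iff: "(x, y) \<in> chain \<longleftrightarrow> (\<exists>a b. x = vertex a \<and> y = vertex b \<and> (a, b) \<in> kap \<and> a \<in> seg \<and> b \<in> seg)"
  unfolding chain_def dir_image_def by auto

lemma chain_vertex [simp]: "(vertex a, vertex b) \<in> chain \<longleftrightarrow> (a, b) \<in> kap \<and> a \<in> seg \<and> b \<in> seg"
  unfolding chain_iff by auto

lemma Field_Restr_seg: "Field (Restr kap seg) = seg"
  using kap_order(1) seg_Field by (intro Refl_Field_Restr2) auto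

lemma Field_chain: "Field chain = vertex ` seg"
  unfolding chain_def dir_image_Field Field_Restr_seg ..

lemma Well_order_chain: "Well_order chain"
  unfolding chain_def
  by (rule Well_order_dir_image[OF Well_order_Restr[OF kap_Well_order] inj_on_subset[OF inj_vertex]]) simp

lemma chain_total:
  assumes "x \<in> Field chain" "y \<in> Field chain"
  shows "(x, y) \<in> chain \<or> (y, x) \<in> chain"
proof -
  obtain a b where ab: "a \<in> seg" "x = vertex a" "b \<in> seg" "y = vertex b"
    using assms unfolding Field_chain by blast
  then show ?thesis using kap_order(4)[OF seg_Field[OF ab(1)] seg_Field[OF ab(3)]] by simp
qed

lemma branches_chain: "branches chain = {Field chain}"
proof -
  have F: "Field chain \<in> Chains chain" unfolding Chains_def using chain_total by blast
  have sub: "b \<subseteq> Field chain" if "b \<in> Chains chain" for b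
    using that unfolding Chains_def by (auto intro: FieldI1)
  show ?thesis unfolding branches_def using F sub by blast
qed

lemma seg_small: "|seg| <o kap"
proof -
  have "seg = underS kap top \<union> {top}" using kap_refl[OF top] unfolding under_def underS_def by blast
  then show ?thesis
    using card_of_Un_ordLess_infinite_Field[OF kap_infinite kap(1) card_of_underS[OF kap(1) top]
        finite_ordLess_kap[of "{top}"]] by simp
qed

lemma chain_short: "Restr chain b <o kap"
proof (rule ccontr)
  assume "\<not> Restr chain b <o kap"
  then have "kap \<le>o Restr chain b"
    using not_ordLess_iff_ordLeq kap_Well_order Well_order_Restr[OF Well_order_chain] by blast
  then have "|Field kap| \<le>o |Field (Restr chain b)|" by (rule card_of_mono2)
  moreover have "|Field (Restr chain b)| \<le>o |vertex ` seg|"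
    by (rule card_of_mono1) (use Field_chain mono_Field[of "Restr chain b" chain] in auto)
  moreover have "|vertex ` seg| <o kap" using card_of_image seg_small ordLeq_ordLess_trans by blast
  moreover have "kap =o |Field kap|" using card_of_Field_ordIso[OF kap(1)] ordIso_symmetric by blast
  ultimately have "kap <o kap" by (meson ordIso_ordLeq_trans ordLeq_ordLess_trans)
  then show False using ordLess_irreflexive by blast
qed

lemma successor_unique: "\<lbrakk>x \<in> successors chain v; y \<in> successors chain v\<rbrakk> \<Longrightarrow> x = y"
proof -
  assume x: "x \<in> successors chain v" and y: "y \<in> successors chain v"
  then have "x \<in> Field chain" "y \<in> Field chain" unfolding successors_def by (auto intro: FieldI2)
  then have "(x, y) \<in> chain \<or> (y, x) \<in> chain" by (rule chain_total)
  then show "x = y" using x y unfolding successors_def by auto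
qed

lemma chain_tree: "is_tree lam kap chain"
  unfolding is_tree_def
proof (intro conjI ballI)
  show "Partial_order chain"
    using Well_order_chain unfolding well_order_on_def linear_order_on_def by blast
  interpret wo: wo_rel "Restr kap seg" using Well_order_Restr[OF kap_Well_order] by (simp add: wo_rel_def)
  have ne: "Field (Restr kap seg) \<noteq> {}" using Field_Restr_seg top_seg by blast
  define m where "m = wo.minim (Field (Restr kap seg))"
  have "m \<in> seg" using wo.minim_in[OF _ ne] Field_Restr_seg unfolding m_def by simp
  moreover have "(m, a) \<in> kap" if "a \<in> seg" for a
    using wo.minim_least[of "Field (Restr kap seg)" a] Field_Restr_seg that unfolding m_def by simp
  ultimately have "is_root chain (vertex m)" unfolding is_root_def Field_chain by auto
  then show "\<exists>\<rho>. is_root chain \<rho>" by blast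
  show "Well_order (Restr chain (underS chain v))" for v by (rule Well_order_Restr[OF Well_order_chain])
  show "|successors chain v| <o lam" for v
  proof (rule finite_ordLess_lam)
    show "finite (successors chain v)"
    proof (cases "successors chain v = {}")
      case False
      then obtain x where "x \<in> successors chain v" by blast
      then have "successors chain v \<subseteq> {x}" using successor_unique by blast
      then show ?thesis using finite_subset by blast
    qed simp
  qed
  show "Restr chain b <o kap" for b by (rule chain_short)
qed

lemma diagram_vertex [simp]: "FObj diagram (vertex a) = Dom D (p0 a)" "FArr diagram (vertex a, vertex b) = tr a b"
  unfolding diagram_def by simp_all

lemma Arr_poset_op: "f \<in> Arr (poset_op P) \<longleftrightarrow> (snd f, fst f) \<in> P"
  unfolding poset_op_def by (cases f) auto

lemma poset_op_simps: "Obj (poset_op P) = Field P" "Dom (poset_op P) = fst" "Cod (poset_op P) = snd"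
  "Id (poset_op P) = (\<lambda>v. (v, v))" "Comp (poset_op P) = (\<lambda>g f. (fst f, snd g))"
  unfolding poset_op_def by simp_all

lemma diagram_functor: "is_functor (poset_op chain) D diagram"
  unfolding is_functor_def poset_op_simps
proof (intro conjI ballI impI)
  show "FObj diagram v \<in> Obj D" if v: "v \<in> Field chain" for v
  proof -
    obtain a where a: "a \<in> seg" "v = vertex a" using v unfolding Field_chain by blast
    then show ?thesis using wide_pullback_facts(1)[OF wp[OF a(1)]] by simp
  qed
  show "FArr diagram f \<in> hom D (FObj diagram (fst f)) (FObj diagram (snd f))" if f: "f \<in> Arr (poset_op chain)" for f
  proof -
    obtain a b where ab: "snd f = vertex b" "fst f = vertex a" "(b, a) \<in> kap" "a \<in> seg"
      using f unfolding Arr_poset_op chain_iff by blast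
    then have "f = (vertex a, vertex b)" by (metis prod.collapse)
    then show ?thesis using tr[OF ab(4,3)] by (simp add: hom_iff)
  qed
  show "FArr diagram (v, v) = Id D (FObj diagram v)" if v: "v \<in> Field chain" for v
    using v tr_id unfolding Field_chain by auto
  fix f g assume fg: "f \<in> Arr (poset_op chain)" "g \<in> Arr (poset_op chain)" "fst g = snd f"
  obtain a b where ab: "snd f = vertex b" "fst f = vertex a" "(b, a) \<in> kap" "a \<in> seg"
    using fg(1) unfolding Arr_poset_op chain_iff by blast
  obtain b' c where bc: "snd g = vertex c" "fst g = vertex b'" "(c, b') \<in> kap"
    using fg(2) unfolding Arr_poset_op chain_iff by blast
  have "b' = b" using fg(3) ab bc by simp
  then have "f = (vertex a, vertex b)" "g = (vertex b, vertex c)" using ab bc by (metis prod.collapse)+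
  then show "FArr diagram (fst f, snd g) = FArr diagram g \<odot> FArr diagram f"
    using tr_comp[OF ab(4,3), of c] bc \<open>b' = b\<close> by simp
qed

lemma chain_limit:
  assumes S: "S \<subseteq> Field chain" "S \<noteq> {}" and s: "s \<in> Field chain" "\<forall>u\<in>S. (u, s) \<in> chain"
    and lub: "\<forall>t\<in>Field chain. (\<forall>u\<in>S. (u, t) \<in> chain) \<longrightarrow> (s, t) \<in> chain"
  shows "is_limit (poset_op (Restr chain S)) D diagram (FObj diagram s) (\<lambda>u. FArr diagram (s, u))"
proof -
  obtain s' where s': "s' \<in> seg" "s = vertex s'" using s unfolding Field_chain by blast
  obtain S' where S': "S' \<subseteq> seg" "S = vertex ` S'" using S(1) unfolding Field_chain by (meson subset_imageE)
  have FS: "Field (Restr chain S) = S"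
    using S(1) Well_order_chain
    by (intro Refl_Field_Restr2) (auto simp: well_order_on_def linear_order_on_def partial_order_on_def preorder_on_def)
  have ub: "(u, s') \<in> kap" if "u \<in> S'" for u using s(2) that unfolding s' S' by simp
  have lub': "(s', t) \<in> kap" if t: "t \<in> seg" "\<And>u. u \<in> S' \<Longrightarrow> (u, t) \<in> kap" for t
  proof -
    have "vertex t \<in> Field chain" using t unfolding Field_chain by blast
    moreover have "\<forall>u\<in>S. (u, vertex t) \<in> chain" using t S' by auto
    ultimately have "(s, vertex t) \<in> chain" using lub by blast
    then show ?thesis using s' by simp
  qed
  have arr: "f \<in> Arr (poset_op (Restr chain S)) \<longleftrightarrow> (\<exists>a b. f = (vertex a, vertex b) \<and> a \<in> S' \<and> b \<in> S' \<and> (b, a) \<in> kap)" for f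
    unfolding Arr_poset_op S'(2) using S'(1) by (cases f) (auto simp: chain_iff)
  have cone_iff: "is_cone (poset_op (Restr chain S)) D diagram y q \<longleftrightarrow> y \<in> Obj D \<and>
      (\<forall>u\<in>S'. q (vertex u) \<in> hom D y (Dom D (p0 u))) \<and>
      (\<forall>a\<in>S'. \<forall>b\<in>S'. (b, a) \<in> kap \<longrightarrow> tr a b \<odot> q (vertex a) = q (vertex b))" for y q
  proof -
    have "(\<forall>f\<in>Arr (poset_op (Restr chain S)). FArr diagram f \<odot> q (fst f) = q (snd f)) \<longleftrightarrow>
      (\<forall>a\<in>S'. \<forall>b\<in>S'. (b, a) \<in> kap \<longrightarrow> tr a b \<odot> q (vertex a) = q (vertex b))" (is "?l = ?r")
    proof (intro iffI ballI impI)
      fix a b assume l: ?l and ab: "a \<in> S'" "b \<in> S'" "(b, a) \<in> kap"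
      then have "(vertex a, vertex b) \<in> Arr (poset_op (Restr chain S))" using arr by blast
      from bspec[OF l this] show "tr a b \<odot> q (vertex a) = q (vertex b)" by simp
    next
      fix f assume r: ?r and "f \<in> Arr (poset_op (Restr chain S))"
      then obtain a b where ab: "f = (vertex a, vertex b)" "a \<in> S'" "b \<in> S'" "(b, a) \<in> kap" using arr by blast
      then show "FArr diagram f \<odot> q (fst f) = q (snd f)" using r by simp
    qed
    then show ?thesis unfolding is_cone_def poset_op_simps(1-3) FS unfolding S'(2) by simp
  qed
  show ?thesis unfolding is_limit_def
  proof (intro conjI allI impI)
    show "is_cone (poset_op (Restr chain S)) D diagram (FObj diagram s) (\<lambda>u. FArr diagram (s, u))"
      unfolding cone_iff s'(2) diagram_vertex
    proof (intro conjI ballI impI)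
      show "Dom D (p0 s') \<in> Obj D" using wide_pullback_facts(1)[OF wp[OF s'(1)]] by simp
      show "tr s' u \<in> hom D (Dom D (p0 s')) (Dom D (p0 u))" if "u \<in> S'" for u
        using tr[OF s'(1) ub[OF that]] by (simp add: hom_iff)
      show "tr a b \<odot> tr s' a = tr s' b" if "a \<in> S'" "b \<in> S'" "(b, a) \<in> kap" for a b
        by (rule tr_comp[OF s'(1) ub[OF that(1)] that(3)])
    qed
    fix y q assume "is_cone (poset_op (Restr chain S)) D diagram y q"
    then have c: "y \<in> Obj D" "\<And>u. u \<in> S' \<Longrightarrow> q (vertex u) \<in> hom D y (Dom D (p0 u))"
      "\<And>a b. \<lbrakk>a \<in> S'; b \<in> S'; (b, a) \<in> kap\<rbrakk> \<Longrightarrow> tr a b \<odot> q (vertex a) = q (vertex b)"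
      unfolding cone_iff by auto
    have "\<exists>!h. h \<in> hom D y (Dom D (p0 s')) \<and> (\<forall>u\<in>S'. tr s' u \<odot> h = q (vertex u))"
      by (rule tr_limit[OF S'(1) _ s'(1) ub lub' c(1), of "\<lambda>u. q (vertex u)"]) (use S(2) S' c(2,3) in auto)
    then show "\<exists>!h. h \<in> hom D y (FObj diagram s) \<and> (\<forall>j\<in>Obj (poset_op (Restr chain S)). FArr diagram (s, j) \<odot> h = q j)"
      unfolding poset_op_simps FS s'(2) diagram_vertex(1) unfolding S'(2) by simp
  qed
qed

lemma diagram_proper: "proper_diagram D chain diagram"
  unfolding proper_diagram_def
proof (intro conjI ballI impI)
  show "is_functor (poset_op chain) D diagram" by (rule diagram_functor)
  fix v assume v: "v \<in> Field chain" "successors chain v \<noteq> {}"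
  then obtain x where x: "x \<in> successors chain v" by blast
  then have "(v, x) \<in> chain" "v \<noteq> x" unfolding successors_def by auto
  then obtain a b where ab: "v = vertex b" "x = vertex a" "(b, a) \<in> kap" "a \<in> seg" "b \<noteq> a"
    unfolding chain_iff by auto
  have bs: "b \<in> seg" using seg_down ab by blast
  have sx: "successors chain v = {x}" using x successor_unique by blast
  have "i \<in> insert b (underS kap b)" if i: "i \<in> underS kap a" for i
  proof (rule ccontr)
    assume ni: "i \<notin> insert b (underS kap b)"
    have ia: "(i, a) \<in> kap" "i \<noteq> a" using i unfolding underS_def by auto
    then have is_: "i \<in> seg" using seg_down ab by blast
    have "(b, i) \<in> kap" using kap_order(4)[of b i] seg_Field is_ bs ni unfolding underS_def by blast
    then have "(v, vertex i) \<in> chain" "(vertex i, x) \<in> chain" using ab bs is_ ia by auto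
    then have "vertex i = v \<or> vertex i = x" using x unfolding successors_def by blast
    then show False using ni ia ab by auto
  qed
  then have cov: "cover (Dom D (p0 b)) {tr a b}" using tr_successor[OF ab(4,3,5)] by blast
  note t = tr[OF ab(4,3)]
  show "jointly_epi D (FObj diagram v) (successors chain v) (\<lambda>x. FArr diagram (x, v))"
    unfolding jointly_epi_def
  proof (intro conjI ballI impI)
    have fx: "FArr diagram (x', v) = tr a b" if "x' \<in> successors chain v" for x'
      using that ab sx by simp
    show "FArr diagram (x', v) \<in> Arr D" "Cod D (FArr diagram (x', v)) = FObj diagram v"
      if "x' \<in> successors chain v" for x'
      using fx[OF that] t ab by simp_all
    fix y h k assume hk: "h \<in> hom D (FObj diagram v) y" "k \<in> hom D (FObj diagram v) y"
      "\<forall>i\<in>successors chain v. h \<odot> FArr diagram (i, v) = k \<odot> FArr diagram (i, v)"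
    show "h = k"
    proof (rule cover_eq[OF cov])
      show "h \<odot> f = k \<odot> f" if "f \<in> {tr a b}" for f using that hk(3) fx x by auto
    qed (use hk(1,2) ab in \<open>auto simp: hom_iff\<close>)
  qed
next
  fix b assume "b \<in> branches chain"
  then have b: "b = Field chain" unfolding branches_chain by simp
  show "branch_continuous D chain diagram b"
    unfolding branch_continuous_def b using chain_limit by blast
qed

lemma simultaneous_lift: "locally z (\<lambda>f. \<forall>i\<in>underS kap top. sub_le D f (w i))"
proof -
  have "completely_proper_diagram D chain diagram"
    using lk_regular chain_tree diagram_proper unfolding lk_regular_def by blast
  then obtain L \<pi> where lim: "is_limit (poset_op (Restr chain (Field chain))) D diagram (L (Field chain)) (\<pi> (Field chain))"
    and eff: "\<And>\<rho>. is_root chain \<rho> \<Longrightarrow> effective_epi_family D (FObj diagram \<rho>) {Field chain} (\<lambda>b. \<pi> b \<rho>)"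
    unfolding completely_proper_diagram_def branches_chain by auto
  obtain \<rho> where \<rho>: "is_root chain \<rho>" using chain_tree unfolding is_tree_def by blast
  then obtain r where r: "r \<in> seg" "\<rho> = vertex r" unfolding is_root_def Field_chain by blast
  have rmin: "(r, a) \<in> kap" if "a \<in> seg" for a
  proof -
    have "(\<rho>, vertex a) \<in> chain" using \<rho> that unfolding is_root_def Field_chain by blast
    then show ?thesis using r by simp
  qed
  have rS: "underS kap r = {}"
    using rmin seg_down r(1) kap_antisym unfolding underS_def by blast
  define \<sigma> where "\<sigma> a = \<pi> (Field chain) (vertex a)" for a
  define M where "M = L (Field chain)"
  have cov: "cover (Dom D (p0 r)) {\<sigma> r}"
    using effective_epi_family_cover[OF eff[OF \<rho>]] unfolding \<sigma>_def r(2) by simp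
  have cone: "is_cone (poset_op chain) D diagram M (\<pi> (Field chain))"
    using lim Restr_Field[of chain] unfolding is_limit_def M_def by simp
  have \<sigma>: "\<sigma> a \<in> Arr D" "Dom D (\<sigma> a) = M" "Cod D (\<sigma> a) = Dom D (p0 a)" if "a \<in> seg" for a
  proof -
    have "vertex a \<in> Field chain" using that unfolding Field_chain by blast
    then have "\<pi> (Field chain) (vertex a) \<in> hom D M (FObj diagram (vertex a))"
      using cone unfolding is_cone_def poset_op_simps by blast
    then show "\<sigma> a \<in> Arr D" "Dom D (\<sigma> a) = M" "Cod D (\<sigma> a) = Dom D (p0 a)"
      unfolding \<sigma>_def by (simp_all add: hom_iff)
  qed
  have \<sigma>tr: "tr top r \<odot> \<sigma> top = \<sigma> r"
  proof -
    have "(vertex top, vertex r) \<in> Arr (poset_op chain)"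
      unfolding Arr_poset_op using rmin[OF top_seg] r(1) top_seg by simp
    then have "FArr diagram (vertex top, vertex r) \<odot> \<pi> (Field chain) (Dom (poset_op chain) (vertex top, vertex r)) =
        \<pi> (Field chain) (Cod (poset_op chain) (vertex top, vertex r))"
      using cone unfolding is_cone_def by blast
    then show ?thesis unfolding \<sigma>_def by (simp add: poset_op_simps)
  qed
  note R = wide_pullback_facts[OF wp[OF r(1)]] and Tp = wide_pullback_facts[OF wp[OF top_seg]]
  obtain d where d: "d \<in> Arr D" "Dom D d = z" "Cod D d = Dom D (p0 r)" "p0 r \<odot> d = Id D z"
    using wide_pullback_lift[OF wp[OF r(1)], of "Id D z"] z rS by auto
  have "locally (Dom D d) (\<lambda>g. \<exists>f\<in>{\<sigma> r}. sub_le D (d \<odot> g) f)"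
    by (rule locally_cover[OF cov finite_ordLess_lam d(1,3)]) simp
  then have l: "locally z (\<lambda>g. sub_le D (d \<odot> g) (\<sigma> r))" unfolding d(2) by simp
  show ?thesis
  proof (rule locally_mono[OF l], intro ballI)
    fix f i assume f: "f \<in> Arr D" "Cod D f = z" "sub_le D (d \<odot> f) (\<sigma> r)" and i: "i \<in> underS kap top"
    obtain k where k: "k \<in> Arr D" "Dom D k = Dom D (d \<odot> f)" "Cod D k = Dom D (\<sigma> r)" "\<sigma> r \<odot> k = d \<odot> f"
      using f(3) by (rule sub_leE) (use f d in simp)
    have kM: "Cod D k = M" using k \<sigma>(2)[OF r(1)] by simp
    have tk: "tr top r \<odot> (\<sigma> top \<odot> k) = d \<odot> f"
      unfolding k(4)[symmetric]
      by (rule comp_eq_assoc[OF \<sigma>tr]) (use \<sigma>[OF top_seg] tr[OF top_seg rmin[OF top_seg]] k(1) kM in auto)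
    have "f = p0 r \<odot> (d \<odot> f)"
      using comp_eq_assoc[OF d(4), of f] d(1-3) R(1) f(1,2) by simp
    also have "\<dots> = p0 top \<odot> (\<sigma> top \<odot> k)"
      unfolding tk[symmetric] by (rule tr_p0[OF top_seg rmin[OF top_seg]]) (use \<sigma>[OF top_seg] k(1) kM in auto)
    also have "\<dots> = w i \<odot> (p top i \<odot> (\<sigma> top \<odot> k))"
      by (rule comp_eq_assoc[OF Tp(6)[OF i], symmetric])
        (use \<sigma>[OF top_seg] k(1) kM Tp(3-5)[OF i] w_arr[OF top_seg i] in auto)
    finally have fw: "f = w i \<odot> (p top i \<odot> (\<sigma> top \<odot> k))" .
    show "sub_le D f (w i)"
      by (rule sub_leI[of "p top i \<odot> (\<sigma> top \<odot> k)"])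
        (use fw[symmetric] \<sigma>[OF top_seg] k(1) kM Tp(3-5)[OF i] w_arr[OF top_seg i] in auto)
  qed
qed

end

lemma (in category_loc) wide_pullback_inter:
  assumes wp: "is_wide_pullback z A w p0 p" and w: "\<And>i. i \<in> A \<Longrightarrow> w i \<in> Sub D z"
  shows "is_inter D z A w p0"
proof -
  note P = wide_pullback_facts[OF wp]
  have wa: "w i \<in> Arr D" "is_mono D (w i)" "Cod D (w i) = z" if "i \<in> A" for i
    using w[OF that] mono_arr by (auto simp: Sub_iff)
  have "is_mono D p0"
  proof (rule monoI[OF P(1)])
    fix h k assume hk: "h \<in> Arr D" "k \<in> Arr D" "Dom D h = Dom D k" "Cod D h = Dom D p0" "Cod D k = Dom D p0"
      "p0 \<odot> h = p0 \<odot> k"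
    show "h = k"
    proof (rule wide_pullback_unique[OF wp hk(1-6) wa(1)])
      fix i assume i: "i \<in> A"
      have "w i \<odot> (p i \<odot> h) = p0 \<odot> h" by (rule comp_eq_assoc[OF P(6)[OF i]]) (use hk P(3-5)[OF i] wa[OF i] in auto)
      also have "\<dots> = w i \<odot> (p i \<odot> k)" unfolding hk(6)
        by (rule comp_eq_assoc[OF P(6)[OF i], symmetric]) (use hk P(3-5)[OF i] wa[OF i] in auto)
      finally show "p i \<odot> h = p i \<odot> k"
        by (rule mono_cancel[OF _ wa(2)[OF i]]) (use hk P(3-5)[OF i] in auto)
    qed
  qed
  moreover have "sub_le D p0 (w i)" if "i \<in> A" for i
    by (rule sub_leI[of "p i"]) (use P(3-6)[OF that] wa[OF that] in auto)
  moreover have "sub_le D v p0" if v: "v \<in> Sub D z" "\<forall>i\<in>A. sub_le D v (w i)" for v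
  proof -
    have va: "v \<in> Arr D" "Cod D v = z" using v mono_arr by (auto simp: Sub_iff)
    have "\<exists>q. q \<in> Arr D \<and> Dom D q = Dom D v \<and> Cod D q = Dom D (w i) \<and> w i \<odot> q = v" if "i \<in> A" for i
      using sub_leE[OF v(2)[rule_format, OF that] va(1)] by metis
    then obtain q where "\<And>i. i \<in> A \<Longrightarrow> q i \<in> Arr D \<and> Dom D (q i) = Dom D v \<and> Cod D (q i) = Dom D (w i) \<and> w i \<odot> q i = v"
      by metis
    then obtain h where "h \<in> Arr D" "Cod D h = Dom D p0" "p0 \<odot> h = v"
      using wide_pullback_lift[OF wp va, of q] by metis
    then show ?thesis by (intro sub_leI[of h]) (use P(1) in auto)
  qed
  ultimately show ?thesis unfolding is_inter_def using w P(2) by (simp add: Sub_iff)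
qed

context geometric_category
begin

lemma is_union_reindex:
  assumes "bij_betw \<theta> K' K" "is_union D x K a u"
  shows "is_union D x K' (\<lambda>k. a (\<theta> k)) u"
proof -
  have "K = \<theta> ` K'" using assms(1) unfolding bij_betw_def by simp
  then show ?thesis using assms(2) unfolding is_union_def by simp
qed

lemma stable_union:
  fixes L :: "'l set"
  assumes "x \<in> Obj D" "|L| <o lam" "is_union D x L a u" "f \<in> Arr D" "Cod D f = x"
    "\<forall>l\<in>L. is_base_change D f (a l) (a' l)" "is_base_change D f u u'"
  shows "is_union D (Dom D f) L a' u'"
proof -
  have "\<forall>l\<in>L. a l \<in> Sub D x" using assms(3) unfolding is_union_def by blast
  then show ?thesis using stable_unions assms unfolding has_stable_unions_def by blast
qed

lemma union_pullback:
  fixes K :: "'n set"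
  assumes "|K| <o lam" "is_union D x K a u" "f \<in> Arr D" "Cod D f = x"
    "\<And>k. k \<in> K \<Longrightarrow> is_pullback D f (a k) (a' k) (q k)" "is_pullback D f u u' r"
  shows "is_union D (Dom D f) K a' u'"
proof -
  obtain L :: "'l set" and \<theta> where L: "|L| <o lam" "bij_betw \<theta> L K" using reindex_lam[OF assms(1)] .
  have x: "x \<in> Obj D" using assms(3,4) by auto
  have u: "is_union D x L (\<lambda>l. a (\<theta> l)) u" by (rule is_union_reindex[OF L(2) assms(2)])
  have \<theta>: "\<theta> l \<in> K" if "l \<in> L" for l using bij_betw_apply[OF L(2) that] .
  have "\<forall>l\<in>L. is_base_change D f (a (\<theta> l)) (a' (\<theta> l))" "is_base_change D f u u'"
    using assms(5,6) \<theta> unfolding is_base_change_def by blast+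
  then have "is_union D (Dom D f) L (\<lambda>l. a' (\<theta> l)) u'"
    by (intro stable_union[OF x L(1) u assms(3,4)])
  then have "is_union D (Dom D f) K (\<lambda>k. a' (\<theta> (inv_into L \<theta> k))) u'"
    by (rule is_union_reindex[OF bij_betw_inv_into[OF L(2)]])
  moreover have "\<theta> (inv_into L \<theta> k) = k" if "k \<in> K" for k using bij_betw_inv_into_right[OF L(2) that] .
  ultimately show ?thesis unfolding is_union_def by simp
qed

end

context lk_pretopos_cat
begin

lemma locally_choice_epi:
  fixes A :: "'i set"
  assumes A: "|A| <o kap" and z: "z \<in> Obj D"
    and e: "\<And>i. i \<in> A \<Longrightarrow> is_regular_epi D (e i)"
    and \<xi>: "\<And>i. i \<in> A \<Longrightarrow> \<xi> i \<in> Arr D \<and> Dom D (\<xi> i) = z \<and> Cod D (\<xi> i) = Cod D (e i)"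
  shows "locally z (\<lambda>f. \<forall>i\<in>A. sub_le D (\<xi> i \<odot> f) (e i))"
proof -
  obtain top where top: "top \<in> Field kap" "|A| =o Restr kap (underS kap top)"
    using A ordLess_iff_ordIso_Restr[OF kap_Well_order card_of_Well_order] by blast
  have "underS kap top \<subseteq> Field kap" unfolding underS_def by (auto intro: FieldI1)
  then have "Field (Restr kap (underS kap top)) = underS kap top"
    using kap_Well_order
    by (intro Refl_Field_Restr2) (auto simp: well_order_on_def linear_order_on_def partial_order_on_def preorder_on_def)
  then have "|A| =o |underS kap top|" using card_of_cong[OF top(2)] by (simp add: Field_card_of)
  then obtain \<beta> where \<beta>: "bij_betw \<beta> A (underS kap top)" using card_of_ordIso by blast
  define \<psi> where "\<psi> = inv_into A \<beta>"
  have \<psi>: "\<psi> b \<in> A" if "b \<in> underS kap top" for b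
    using that bij_betw_apply[OF bij_betw_inv_into[OF \<beta>]] unfolding \<psi>_def by auto
  have \<beta>': "\<beta> i \<in> underS kap top" "\<psi> (\<beta> i) = i" if "i \<in> A" for i
    using bij_betw_inv_into_left[OF \<beta>] that bij_betw_apply[OF \<beta>] unfolding \<psi>_def by auto
  have "\<exists>p q. is_pullback D (\<xi> i) (e i) p q" if "i \<in> A" for i
    using ex_pb[of "\<xi> i" "e i"] \<xi>[OF that] regular_epi_arr[OF e[OF that]] by simp
  then obtain p q where pq: "\<And>i. i \<in> A \<Longrightarrow> is_pullback D (\<xi> i) (e i) (p i) (q i)" by metis
  define w where "w b = p (\<psi> b)" for b
  have w: "is_regular_epi D (w b) \<and> Cod D (w b) = z" if "b \<in> underS kap top" for b
    using regular_epi_pullback[OF pq e] pullback_facts(7)[OF pq] \<xi> \<psi>[OF that] unfolding w_def by simp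
  have "\<exists>p0 p. is_wide_pullback z (underS kap a) w p0 p" if a: "a \<in> under kap top" for a
  proof (rule ex_kap_wide_pullback[OF _ z])
    have "a \<in> Field kap" using a unfolding under_def by (auto intro: FieldI1)
    then show "|underS kap a| <o kap" by (rule card_of_underS[OF kap(1)])
    fix i assume "i \<in> underS kap a"
    then have "i \<in> underS kap top"
      using a kap_Well_order unfolding under_def underS_def well_order_on_def linear_order_on_def partial_order_on_def preorder_on_def
      by (auto dest: transD antisymD)
    then show "w i \<in> Arr D \<and> Cod D (w i) = z" using w regular_epi_arr by blast
  qed
  then obtain p0 r where wp: "\<And>a. a \<in> under kap top \<Longrightarrow> is_wide_pullback z (underS kap a) w (p0 a) (r a)" by metis
  interpret epi_chain D lam kap z top w p0 r "undefined :: 'l"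
    by unfold_locales (use z top(1) w wp in auto)
  show ?thesis
  proof (rule locally_mono[OF simultaneous_lift], intro ballI)
    fix f i assume f: "f \<in> Arr D" "Cod D f = z" "\<forall>i\<in>underS kap top. sub_le D f (w i)" and i: "i \<in> A"
    then have "sub_le D f (p i)" using \<beta>'[OF i] unfolding w_def by force
    then show "sub_le D (\<xi> i \<odot> f) (e i)"
      using sub_le_pullback_iff[OF pq[OF i] f(1)] f(2) \<xi>[OF i] by simp
  qed
qed

lemma Times_finite_ordLess_kap:
  assumes "|A| <o kap" "finite K"
  shows "|A \<times> K| <o kap"
  using assms(2)
proof (induction K)
  case empty
  show ?case by (rule finite_ordLess_kap) simp
next
  case (insert k K)
  have "|(\<lambda>a. (a, k)) ` A| <o kap" using card_of_image assms(1) ordLeq_ordLess_trans by blast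
  then have "|(\<lambda>a. (a, k)) ` A \<union> A \<times> K| <o kap"
    using card_of_Un_ordLess_infinite_Field[OF kap_infinite kap(1)] insert.IH by blast
  moreover have "(\<lambda>a. (a, k)) ` A \<union> A \<times> K = A \<times> insert k K" by auto
  ultimately show ?case by simp
qed

lemma PiE_finite_ordLess_lam:
  assumes "|A| <o kap" "finite K"
  shows "|Pi\<^sub>E A (\<lambda>_. K)| <o lam"
proof -
  define gr where "gr \<phi> = (\<lambda>a. (a, \<phi> a)) ` A" for \<phi> :: "'a \<Rightarrow> 'b"
  have "inj_on gr (Pi\<^sub>E A (\<lambda>_. K))"
  proof (rule inj_onI)
    fix \<phi> \<phi>' assume *: "\<phi> \<in> Pi\<^sub>E A (\<lambda>_. K)" "\<phi>' \<in> Pi\<^sub>E A (\<lambda>_. K)" "gr \<phi> = gr \<phi>'"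
    show "\<phi> = \<phi>'"
    proof (rule PiE_ext[OF *(1,2)])
      fix a assume "a \<in> A"
      then have "(a, \<phi> a) \<in> gr \<phi>" unfolding gr_def by (rule imageI)
      then have "(a, \<phi> a) \<in> gr \<phi>'" by (simp only: *(3))
      then show "\<phi> a = \<phi>' a" unfolding gr_def by auto
    qed
  qed
  moreover have "gr ` Pi\<^sub>E A (\<lambda>_. K) \<subseteq> Pow (A \<times> K)" unfolding gr_def by (auto dest: PiE_mem)
  ultimately have "|Pi\<^sub>E A (\<lambda>_. K)| \<le>o |Pow (A \<times> K)|" using card_of_ordLeq by blast
  then show ?thesis using Pow_ordLess_lam[OF Times_finite_ordLess_kap[OF assms]] ordLeq_ordLess_trans by blast
qed

lemma locally_choice_union:
  fixes A :: "'i set" and K :: "nat set"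
  assumes A: "|A| <o kap" and K: "finite K" and z: "z \<in> Obj D"
    and u: "\<And>i. i \<in> A \<Longrightarrow> is_union D (X i) K (a i) (u i)"
    and \<xi>: "\<And>i. i \<in> A \<Longrightarrow> \<xi> i \<in> Arr D \<and> Dom D (\<xi> i) = z \<and> Cod D (\<xi> i) = X i \<and> sub_le D (\<xi> i) (u i)"
  shows "locally z (\<lambda>f. \<exists>\<phi>. \<forall>i\<in>A. \<phi> i \<in> K \<and> sub_le D (\<xi> i \<odot> f) (a i (\<phi> i)))"
proof -
  have Kl: "|K| <o lam" using finite_ordLess_lam[OF K] .
  obtain L :: "'l set" and \<theta> where L: "|L| <o lam" "bij_betw \<theta> L K" using reindex_lam[OF Kl] .
  have fL: "finite L" using bij_betw_finite[OF L(2)] K by simp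
  have \<theta>: "\<theta> l \<in> K" if "l \<in> L" for l using bij_betw_apply[OF L(2) that] .
  obtain B :: "'k set" and \<beta> where B: "|B| <o kap" "bij_betw \<beta> A B" using reindex_kap[OF A] .
  define \<psi> where "\<psi> = inv_into A \<beta>"
  have \<psi>: "\<psi> b \<in> A" if "b \<in> B" for b
    using that bij_betw_apply[OF bij_betw_inv_into[OF B(2)]] unfolding \<psi>_def by auto
  have \<beta>: "\<beta> i \<in> B" "\<psi> (\<beta> i) = i" if "i \<in> A" for i
    using bij_betw_inv_into_left[OF B(2)] that bij_betw_apply[OF B(2)] unfolding \<psi>_def by auto
  have aS: "a i k \<in> Arr D" "is_mono D (a i k)" "Cod D (a i k) = X i" if "i \<in> A" "k \<in> K" for i k
    using u[OF that(1)] that(2) mono_arr unfolding is_union_def by (auto simp: Sub_iff)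
  have uS: "u i \<in> Arr D" "is_mono D (u i)" "Cod D (u i) = X i" if "i \<in> A" for i
    using u[OF that(1)] mono_arr unfolding is_union_def by (auto simp: Sub_iff)
  have "\<exists>a' q. is_pullback D (\<xi> i) (a i k) a' q" if "i \<in> A" "k \<in> K" for i k
    using ex_pb[of "\<xi> i" "a i k"] \<xi>[OF that(1)] aS[OF that] by simp
  then obtain a' q where a': "\<And>i k. \<lbrakk>i \<in> A; k \<in> K\<rbrakk> \<Longrightarrow> is_pullback D (\<xi> i) (a i k) (a' i k) (q i k)" by metis
  have "\<exists>u' q. is_pullback D (\<xi> i) (u i) u' q" if "i \<in> A" for i
    using ex_pb[of "\<xi> i" "u i"] \<xi>[OF that(1)] uS[OF that] by simp
  then obtain u' q' where u': "\<And>i. i \<in> A \<Longrightarrow> is_pullback D (\<xi> i) (u i) (u' i) (q' i)" by metis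
  have un: "is_union D z K (a' i) (u' i)" if i: "i \<in> A" for i
    using union_pullback[OF Kl u[OF i] _ _ a'[OF i] u'[OF i]] \<xi>[OF i] by simp
  have unL: "is_union D z L (\<lambda>l. a' (\<psi> b) (\<theta> l)) (u' (\<psi> b))" if "b \<in> B" for b
    by (rule is_union_reindex[OF L(2) un[OF \<psi>[OF that]]])
  have Iu: "sub_le D (Id D z) (u' i)" if i: "i \<in> A" for i
    using sub_le_pullback_iff[OF u'[OF i], of "Id D z"] \<xi>[OF i] z by simp
  have "is_inter D z B (\<lambda>b. u' (\<psi> b)) (Id D z)"
    unfolding is_inter_def
  proof (intro conjI ballI impI)
    show "u' (\<psi> b) \<in> Sub D z" if "b \<in> B" for b using un[OF \<psi>[OF that]] unfolding is_union_def by blast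
    show "Id D z \<in> Sub D z" using mono_id[OF z] z by (simp add: Sub_iff)
    show "sub_le D (Id D z) (u' (\<psi> b))" if "b \<in> B" for b using Iu[OF \<psi>[OF that]] .
    show "sub_le D v (Id D z)" if "v \<in> Sub D z" for v
      using that mono_arr z by (intro sub_leI[of v]) (auto simp: Sub_iff)
  qed
  note inter = this
  have "\<exists>g. is_inter D z B (\<lambda>b. a' (\<psi> b) (\<theta> (\<phi> b))) g" if \<phi>: "\<phi> \<in> Pi\<^sub>E B (\<lambda>_. L)" for \<phi>
  proof -
    have S: "a' (\<psi> b) (\<theta> (\<phi> b)) \<in> Sub D z" if b: "b \<in> B" for b
    proof -
      have "\<phi> b \<in> L" using \<phi> b by (rule PiE_mem)
      then show ?thesis using unL[OF b] unfolding is_union_def by blast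
    qed
    then have "\<exists>p0 p. is_wide_pullback z B (\<lambda>b. a' (\<psi> b) (\<theta> (\<phi> b))) p0 p"
      by (intro ex_kap_wide_pullback[OF B(1) z]) (auto simp: Sub_iff mono_arr)
    then show ?thesis using wide_pullback_inter S by blast
  qed
  then obtain g where g: "\<And>\<phi>. \<phi> \<in> Pi\<^sub>E B (\<lambda>_. L) \<Longrightarrow> is_inter D z B (\<lambda>b. a' (\<psi> b) (\<theta> (\<phi> b))) (g \<phi>)" by metis
  have gu: "is_union D z (Pi\<^sub>E B (\<lambda>_. L)) g (Id D z)"
    by (rule distributive[unfolded meets_distribute_over_joins_def, rule_format, OF z,
        where I = B and J = "\<lambda>_. L" and a = "\<lambda>b l. a' (\<psi> b) (\<theta> l)" and u = "\<lambda>b. u' (\<psi> b)"])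
      (use B(1) L(1) unL inter g in blast)
  have gS: "g \<phi> \<in> Sub D z" if "\<phi> \<in> Pi\<^sub>E B (\<lambda>_. L)" for \<phi> using gu that unfolding is_union_def by blast
  have "cover z (g ` Pi\<^sub>E B (\<lambda>_. L))"
    unfolding cover_def
  proof (intro conjI ballI impI)
    show "k \<in> Arr D" "Cod D k = z" if "k \<in> g ` Pi\<^sub>E B (\<lambda>_. L)" for k
      using that gS mono_arr by (auto simp: Sub_iff)
    show "sub_le D (Id D z) m" if "m \<in> Sub D z" "\<forall>f\<in>g ` Pi\<^sub>E B (\<lambda>_. L). sub_le D f m" for m
      using gu that unfolding is_union_def by blast
  qed (rule z)
  moreover have "|g ` Pi\<^sub>E B (\<lambda>_. L)| <o lam"
    by (rule image_ordLess_lam[OF PiE_finite_ordLess_lam[OF B(1) fL]])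
  moreover have "\<exists>\<phi>'. \<forall>i\<in>A. \<phi>' i \<in> K \<and> sub_le D (\<xi> i \<odot> f) (a i (\<phi>' i))" if "f \<in> g ` Pi\<^sub>E B (\<lambda>_. L)" for f
  proof -
    obtain \<phi> where \<phi>: "\<phi> \<in> Pi\<^sub>E B (\<lambda>_. L)" "f = g \<phi>" using \<open>f \<in> g ` Pi\<^sub>E B (\<lambda>_. L)\<close> by blast
    have f: "f \<in> Arr D" "Cod D f = z" using gS[OF \<phi>(1)] \<phi>(2) mono_arr by (auto simp: Sub_iff)
    have "\<theta> (\<phi> (\<beta> i)) \<in> K \<and> sub_le D (\<xi> i \<odot> f) (a i (\<theta> (\<phi> (\<beta> i))))" if i: "i \<in> A" for i
    proof -
      have k: "\<theta> (\<phi> (\<beta> i)) \<in> K" using \<theta> PiE_mem[OF \<phi>(1) \<beta>(1)[OF i]] by blast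
      have "sub_le D (g \<phi>) (a' (\<psi> (\<beta> i)) (\<theta> (\<phi> (\<beta> i))))"
        using g[OF \<phi>(1)] \<beta>(1)[OF i] unfolding is_inter_def by blast
      then have "sub_le D f (a' i (\<theta> (\<phi> (\<beta> i))))" using \<phi>(2) \<beta>(2)[OF i] by simp
      then show ?thesis using sub_le_pullback_iff[OF a'[OF i k] f(1)] f(2) \<xi>[OF i] k by simp
    qed
    then show ?thesis by (intro exI[of _ "\<lambda>i. \<theta> (\<phi> (\<beta> i))"]) blast
  qed
  ultimately show ?thesis unfolding locally_def by blast
qed

end

section \<open>Subobjects of ultraproducts\<close>

context pretopos
begin

lemma ex_terminal: "\<exists>t. is_terminal D t"
proof -
  obtain t p where t: "is_product D {} (\<lambda>i. undefined) t p"
    using ex_finite_product[of "{}" "\<lambda>i. undefined"] by auto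
  then have "is_terminal D t" unfolding is_terminal_def is_product_def by simp
  then show ?thesis by blast
qed

lemma terminal_arrow:
  assumes "is_terminal D t" "x \<in> Obj D"
  obtains f where "f \<in> Arr D" "Dom D f = x" "Cod D f = t"
  using assms unfolding is_terminal_def hom_iff by blast

lemma disjoint_initial:
  assumes w: "is_inter D x {u, b} id w" "is_initial D (Dom D w)"
    and v: "v \<in> Arr D" "sub_le D v u" "sub_le D v b"
  shows "is_initial D (Dom D v)"
proof -
  have ub: "is_mono D u" "Cod D u = x" "is_mono D b" "Cod D b = x" "is_mono D w" "Cod D w = x"
    and glb: "\<And>n. \<lbrakk>n \<in> Sub D x; sub_le D n u; sub_le D n b\<rbrakk> \<Longrightarrow> sub_le D n w"
    using w(1) unfolding is_inter_def by (simp_all add: Sub_iff)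
  have a: "u \<in> Arr D" "b \<in> Arr D" "w \<in> Arr D" using ub mono_arr by auto
  have vx: "Cod D v = x" using sub_le_cod[OF v(2) a(1)] ub by simp
  obtain e m where em: "is_regular_epi D e" "is_mono D m" "Dom D m = Cod D e" "Dom D e = Dom D v"
    "Cod D m = Cod D v" "m \<odot> e = v" by (rule ex_image[OF v(1)]) (rule that; assumption?)
  have ea: "e \<in> Arr D" "m \<in> Arr D" using em regular_epi_arr mono_arr by auto
  have "sub_le D m u" by (rule sub_le_cover_precomp[OF em(1) ub(1)]) (use em ea vx ub v in auto)
  moreover have "sub_le D m b" by (rule sub_le_cover_precomp[OF em(1) ub(3)]) (use em ea vx ub v in auto)
  ultimately have "sub_le D m w" using glb em vx by (simp add: Sub_iff)
  then obtain k where k: "k \<in> Arr D" "Dom D k = Dom D m" "Cod D k = Dom D w"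
    by (rule sub_leE) (use ea in auto)
  have "is_initial D (Dom D (k \<odot> e))"
    by (rule strict_initial[OF w(2)]) (use k ea em in auto)
  then show ?thesis using k ea em by simp
qed

end

context lk_pretopos_cat
begin

lemma terminal_not_initial:
  assumes "zero_kappa_prime kap D" "is_terminal D t"
  shows "\<not> is_initial D t"
proof
  assume i: "is_initial D t"
  have t: "t \<in> Obj D" using i unfolding is_initial_def by blast
  have "sub_le D v (Id D t)" if "v \<in> Sub D t" for v
    using that mono_arr t by (intro sub_leI[of v]) (auto simp: Sub_iff)
  then have "is_inter D t ({} :: 'k set) (\<lambda>i. undefined) (Id D t)"
    unfolding is_inter_def using mono_id[OF t] t by (simp add: Sub_iff)
  moreover have "is_initial D (Dom D (Id D t))" using i t by simp
  moreover have "|{} :: 'k set| <o kap" by (rule finite_ordLess_kap) simp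
  ultimately show False using assms unfolding zero_kappa_prime_def by blast
qed

lemma nonzero_regular_epi:
  assumes wb: "weakly_boolean D" and prime: "zero_kappa_prime kap D" and t: "is_terminal D t"
    and f: "f \<in> Arr D" "Cod D f = t" and nz: "\<not> is_initial D (Dom D f)"
  shows "is_regular_epi D f"
proof -
  have to: "t \<in> Obj D" using f by auto
  obtain e m where em: "is_regular_epi D e" "is_mono D m" "Dom D m = Cod D e" "Dom D e = Dom D f"
    "Cod D m = Cod D f" "m \<odot> e = f" by (rule ex_image[OF f(1)]) (rule that; assumption?)
  have ea: "e \<in> Arr D" "m \<in> Arr D" using em regular_epi_arr mono_arr by auto
  have mt: "m \<in> Sub D t" using em f by (simp add: Sub_iff)
  have Im: "sub_le D (Id D t) m"
  proof (rule ccontr)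
    assume "\<not> sub_le D (Id D t) m"
    moreover have "Id D t \<in> Sub D t" using mono_id[OF to] to by (simp add: Sub_iff)
    ultimately obtain u w where u: "u \<in> Sub D t" "\<not> is_initial D (Dom D u)"
      and w: "is_inter D t {u, m} id w" "is_initial D (Dom D w)"
      using wb mt to unfolding weakly_boolean_def by blast
    obtain i where "i \<in> Field kap" using kap_infinite by fastforce
    moreover have "infinite (Field kap - {i})" using kap_infinite by simp
    then obtain j where "j \<in> Field kap" "j \<noteq> i" by (metis Diff_iff ex_in_conv finite.emptyI singletonI)
    define a where "a k = (if k = i then u else m)" for k
    have "is_inter D t {i, j} a w"
      using w(1) \<open>j \<noteq> i\<close> unfolding is_inter_def a_def by simp
    moreover have "|{i, j}| <o kap" by (rule finite_ordLess_kap) simp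
    ultimately have "\<exists>k\<in>{i, j}. is_initial D (Dom D (a k))"
      using prime t w(2) unfolding zero_kappa_prime_def by blast
    then have "is_initial D (Dom D m)" using u(2) unfolding a_def by (auto split: if_splits)
    then have "is_initial D (Dom D e)" using strict_initial em ea by metis
    then show False using nz em by simp
  qed
  have "cover t {f}" unfolding cover_def
  proof (intro conjI ballI impI)
    fix n assume n: "n \<in> Sub D t" "\<forall>g\<in>{f}. sub_le D g n"
    then have na: "is_mono D n" "n \<in> Arr D" "Cod D n = t" using mono_arr by (auto simp: Sub_iff)
    have "sub_le D m n" by (rule sub_le_cover_precomp[OF em(1) na(1)]) (use em ea na f n in auto)
    then show "sub_le D (Id D t) n" using Im sub_le_trans na by blast
  qed (use to f in auto)
  then show ?thesis using cover_regular_epi f by simp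
qed

end

context ultrafilter_pretopos
begin

lemma U_finite_union:
  assumes K: "K \<in> U" and T: "finite T" "\<And>i. i \<in> K \<Longrightarrow> \<phi> i \<in> T"
  shows "\<exists>k\<in>T. {i \<in> K. \<phi> i = k} \<in> U"
proof (rule ccontr)
  assume no: "\<not> (\<exists>k\<in>T. {i \<in> K. \<phi> i = k} \<in> U)"
  have "I - {i \<in> K. \<phi> i = k} \<in> U" if "k \<in> T" for k
    using U_facts(6)[of "{i \<in> K. \<phi> i = k}"] no that U_sub[OF K] by blast
  then obtain L where L: "L \<in> U" "\<forall>k\<in>T. L \<subseteq> I - {i \<in> K. \<phi> i = k}"
    using U_Int_finite[OF T(1), of "\<lambda>k. I - {i \<in> K. \<phi> i = k}"] by blast
  have "L \<inter> K \<noteq> {}" using U_facts(3) U_facts(4)[OF L(1) K] by metis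
  then obtain i where "i \<in> L" "i \<in> K" by blast
  then show False using L(2) T(2)[of i] by blast
qed

lemma rep_finite:
  assumes A: "finite A" and z: "z \<in> Obj D" and E: "\<And>j. j \<in> A \<Longrightarrow> is_ultraproduct D U (X j) (E j)"
    and y: "\<And>j. j \<in> A \<Longrightarrow> y j \<in> Arr D \<and> Dom D (y j) = z \<and> Cod D (y j) = uobj (E j)"
  shows "locally z (\<lambda>f. \<exists>K\<in>U. \<exists>\<xi>. \<forall>j\<in>A. rep (E j) K (\<xi> j) (y j \<odot> f))"
proof -
  have "locally z (\<lambda>f. \<forall>j\<in>A. \<exists>K \<xi>. rep (E j) K \<xi> (y j \<odot> f))"
  proof (rule locally_ball_finite[OF A z])
    fix j assume j: "j \<in> A"
    show "locally z (\<lambda>f. \<exists>K \<xi>. rep (E j) K \<xi> (y j \<odot> f))"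
      using rep_locally[OF E[OF j], of "y j"] y[OF j] by simp
    show "sieve z (\<lambda>f. \<exists>K \<xi>. rep (E j) K \<xi> (y j \<odot> f))"
    proof (rule sieveI)
      fix f k assume fk: "f \<in> Arr D" "Cod D f = z" "k \<in> Arr D" "Cod D k = Dom D f"
        "\<exists>K \<xi>. rep (E j) K \<xi> (y j \<odot> f)"
      then obtain K \<xi> where "rep (E j) K \<xi> (y j \<odot> f)" by blast
      from rep_precomp[OF E[OF j] this fk(3)] have "rep (E j) K (\<lambda>i. \<xi> i \<odot> k) (y j \<odot> (f \<odot> k))"
        using fk(1-4) y[OF j] by simp
      then show "\<exists>K \<xi>. rep (E j) K \<xi> (y j \<odot> (f \<odot> k))" by blast
    qed
  qed
  then show ?thesis
  proof (rule locally_mono)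
    fix f assume "\<forall>j\<in>A. \<exists>K \<xi>. rep (E j) K \<xi> (y j \<odot> f)"
    then obtain K \<xi> where r: "\<And>j. j \<in> A \<Longrightarrow> rep (E j) (K j) (\<xi> j) (y j \<odot> f)" by metis
    have "\<exists>L\<in>U. \<forall>j\<in>A. L \<subseteq> K j"
      by (rule U_Int_finite[OF A]) (use rep_typing(1)[OF E r] in blast)
    then obtain L where "L \<in> U" "\<forall>j\<in>A. L \<subseteq> K j" by blast
    then show "\<exists>K\<in>U. \<exists>\<xi>. \<forall>j\<in>A. rep (E j) K (\<xi> j) (y j \<odot> f)"
      using rep_subset[OF E r] by blast
  qed
qed

lemma rep_pair:
  assumes E: "is_ultraproduct D U X E" "is_ultraproduct D U X' E'"
    and y: "y \<in> Arr D" "Cod D y = uobj E" "y' \<in> Arr D" "Cod D y' = uobj E'" "Dom D y' = Dom D y"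
  shows "locally (Dom D y) (\<lambda>f. \<exists>K \<xi> \<xi>'. rep E K \<xi> (y \<odot> f) \<and> rep E' K \<xi>' (y' \<odot> f))"
proof -
  have "locally (Dom D y) (\<lambda>f. \<exists>K\<in>U. \<exists>\<xi>. \<forall>j\<in>UNIV. rep (if j then E else E') K (\<xi> j) ((if j then y else y') \<odot> f))"
    by (rule rep_finite[of UNIV _ "\<lambda>j. if j then X else X'"]) (use E y in auto)
  then show ?thesis by (rule locally_mono) (auto simp: all_bool_eq)
qed

lemma ultra_arrow_eqI:
  assumes E: "is_ultraproduct D U X E" and hk: "h \<in> Arr D" "k \<in> Arr D" "Dom D h = uobj E" "Dom D k = uobj E"
    "Cod D h = Cod D k" and eq: "\<And>J \<xi> y. rep E J \<xi> y \<Longrightarrow> h \<odot> y = k \<odot> y"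
  shows "h = k"
proof (rule locally_eq[OF _ hk])
  have o: "uobj E \<in> Obj D" using hk by (metis dom_obj)
  have "locally (uobj E) (\<lambda>f. \<exists>J \<xi>. rep E J \<xi> (Id D (uobj E) \<odot> f))"
    using rep_locally[OF E, of "Id D (uobj E)"] o by simp
  then show "locally (uobj E) (\<lambda>f. h \<odot> f = k \<odot> f)"
    by (rule locally_mono) (use eq in auto)
qed

lemma ultra_map_arr:
  "is_ultraproduct_map D U E E' f h \<Longrightarrow> h \<in> Arr D \<and> Dom D h = uobj E \<and> Cod D h = uobj E'"
  unfolding is_ultraproduct_map_def hom_iff by simp

lemma ultra_map_mono:
  assumes E: "is_ultraproduct D U X E" and E': "is_ultraproduct D U X' E'"
    and f: "\<And>i. i \<in> I \<Longrightarrow> f i \<in> hom D (X i) (X' i)" "\<And>i. i \<in> I \<Longrightarrow> is_mono D (f i)"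
    and h: "is_ultraproduct_map D U E E' f h"
  shows "is_mono D h"
proof (rule monoI)
  note ha = ultra_map_arr[OF h]
  show "h \<in> Arr D" using ha by simp
  fix a b assume ab: "a \<in> Arr D" "b \<in> Arr D" "Dom D a = Dom D b" "Cod D a = Dom D h" "Cod D b = Dom D h"
    "h \<odot> a = h \<odot> b"
  have "locally (Dom D a) (\<lambda>k. \<exists>J \<xi> \<xi>'. rep E J \<xi> (a \<odot> k) \<and> rep E J \<xi>' (b \<odot> k))"
    by (rule rep_pair[OF E E]) (use ab ha in auto)
  then have "locally (Dom D a) (\<lambda>k. a \<odot> k = b \<odot> k)"
  proof (rule locally_bind)
    fix k assume k: "k \<in> Arr D" "Cod D k = Dom D a" "\<exists>J \<xi> \<xi>'. rep E J \<xi> (a \<odot> k) \<and> rep E J \<xi>' (b \<odot> k)"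
    then obtain J \<xi> \<xi>' where r: "rep E J \<xi> (a \<odot> k)" "rep E J \<xi>' (b \<odot> k)" by blast
    note t = rep_typing[OF E r(1)] and t' = rep_typing[OF E r(2)]
    have hk: "h \<odot> (a \<odot> k) = h \<odot> (b \<odot> k)"
      using comp_eq_assoc[OF ab(6), of k] ab(1-5) k(1,2) ha by simp
    have "locally (Dom D (h \<odot> (a \<odot> k))) (\<lambda>g. \<exists>K\<in>U. K \<subseteq> J \<inter> J \<and> (\<forall>i\<in>K. (f i \<odot> \<xi> i) \<odot> g = (f i \<odot> \<xi>' i) \<odot> g))"
      by (rule rep_separated[OF E' ultra_map_rep[OF E E' f(1) h r(1)]])
        (use ultra_map_rep[OF E E' f(1) h r(2)] hk in auto)
    then have l: "locally (Dom D k) (\<lambda>g. \<exists>K\<in>U. K \<subseteq> J \<inter> J \<and> (\<forall>i\<in>K. (f i \<odot> \<xi> i) \<odot> g = (f i \<odot> \<xi>' i) \<odot> g))"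
      using ab(1-5) k(1,2) ha by simp
    show "locally (Dom D k) (\<lambda>g. a \<odot> (k \<odot> g) = b \<odot> (k \<odot> g))"
    proof (rule locally_mono[OF l])
      fix g assume g: "g \<in> Arr D" "Cod D g = Dom D k"
        "\<exists>K\<in>U. K \<subseteq> J \<inter> J \<and> (\<forall>i\<in>K. (f i \<odot> \<xi> i) \<odot> g = (f i \<odot> \<xi>' i) \<odot> g)"
      then obtain K where K: "K \<in> U" "K \<subseteq> J" "\<And>i. i \<in> K \<Longrightarrow> (f i \<odot> \<xi> i) \<odot> g = (f i \<odot> \<xi>' i) \<odot> g" by blast
      have eq: "\<xi> i \<odot> g = \<xi>' i \<odot> g" if i: "i \<in> K" for i
      proof (rule mono_cancel[OF _ f(2)[OF U_sub[OF K(1) i]]])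
        have iJ: "i \<in> J" using i K by blast
        have fi: "f i \<in> Arr D" "Dom D (f i) = X i" using f(1)[OF U_sub[OF K(1) i]] by (auto simp: hom_iff)
        have d: "Dom D (\<xi> i) = Dom D k" "Dom D (\<xi>' i) = Dom D k"
          using t(5)[OF iJ] t'(5)[OF iJ] ab(1-5) k(1,2) by simp_all
        show "f i \<odot> (\<xi> i \<odot> g) = f i \<odot> (\<xi>' i \<odot> g)"
          using K(3)[OF i] fi t(4,6)[OF iJ] t'(4,6)[OF iJ] d g(1,2) by simp
        show "\<xi> i \<odot> g \<in> Arr D" "\<xi>' i \<odot> g \<in> Arr D" "Dom D (\<xi> i \<odot> g) = Dom D (\<xi>' i \<odot> g)"
          "Cod D (\<xi> i \<odot> g) = Dom D (f i)" "Cod D (\<xi>' i \<odot> g) = Dom D (f i)"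
          using fi t(4,6)[OF iJ] t'(4,6)[OF iJ] d g(1,2) by simp_all
      qed
      have g': "Cod D g = Dom D (a \<odot> k)" "Cod D g = Dom D (b \<odot> k)" using g(2) ab(1-5) k(1,2) by simp_all
      have "(a \<odot> k) \<odot> g = (b \<odot> k) \<odot> g"
        by (rule rep_unique[OF E rep_precomp[OF E rep_subset[OF E r(1) K(1,2)] g(1) g'(1)]
            rep_precomp[OF E rep_subset[OF E r(2) K(1,2)] g(1) g'(2)]])
          (use eq ab(1-5) k(1,2) g(1,2) in auto)
      then show "a \<odot> (k \<odot> g) = b \<odot> (k \<odot> g)" using ab(1-5) k(1,2) g(1,2) by simp
    qed
  qed
  then show "a = b" by (rule locally_eq) (use ab in auto)
qed

context
  fixes X a b PX PA PB a' b'
  assumes a: "\<And>i. i \<in> I \<Longrightarrow> a i \<in> Sub D (X i)" and b: "\<And>i. i \<in> I \<Longrightarrow> b i \<in> Sub D (X i)"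
    and PX: "is_ultraproduct D U X PX"
    and PA: "is_ultraproduct D U (\<lambda>i. Dom D (a i)) PA" and PB: "is_ultraproduct D U (\<lambda>i. Dom D (b i)) PB"
    and a': "is_ultraproduct_map D U PA PX a a'" and b': "is_ultraproduct_map D U PB PX b b'"
begin

lemma sub_facts:
  assumes "i \<in> I"
  shows "a i \<in> Arr D" "is_mono D (a i)" "Cod D (a i) = X i" "b i \<in> Arr D" "is_mono D (b i)" "Cod D (b i) = X i"
  using a[OF assms] b[OF assms] mono_arr by (auto simp: Sub_iff)

lemma sub_hom: "i \<in> I \<Longrightarrow> a i \<in> hom D (Dom D (a i)) (X i)" "i \<in> I \<Longrightarrow> b i \<in> hom D (Dom D (b i)) (X i)"
  using sub_facts by (auto simp: hom_iff)

lemma ultra_Sub: "a' \<in> Sub D (uobj PX)" "b' \<in> Sub D (uobj PX)"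
  using ultra_map_mono[OF PA PX sub_hom(1) sub_facts(2) a'] ultra_map_mono[OF PB PX sub_hom(2) sub_facts(5) b']
    ultra_map_arr[OF a'] ultra_map_arr[OF b'] by (auto simp: Sub_iff)

lemma ultra_sub_leI:
  assumes K: "{i \<in> I. sub_le D (a i) (b i)} \<in> U" (is "?K \<in> U")
  shows "sub_le D a' b'"
proof (rule locally_factor)
  note aa = ultra_map_arr[OF a'] and ba = ultra_map_arr[OF b']
  have o: "uobj PA \<in> Obj D" using aa by (metis dom_obj)
  have "locally (uobj PA) (\<lambda>f. \<exists>J \<xi>. rep PA J \<xi> (Id D (uobj PA) \<odot> f))"
    using rep_locally[OF PA, of "Id D (uobj PA)"] o by simp
  then show "locally (uobj PA) (\<lambda>f. sub_le D (a' \<odot> f) b')"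
  proof (rule locally_mono)
    fix f assume f: "f \<in> Arr D" "Cod D f = uobj PA" "\<exists>J \<xi>. rep PA J \<xi> (Id D (uobj PA) \<odot> f)"
    then obtain J \<xi> where J: "rep PA J \<xi> f" by auto
    define L where "L = J \<inter> ?K"
    have L: "L \<in> U" "L \<subseteq> J" using U_facts(4)[OF rep_typing(1)[OF PA J] K] unfolding L_def by auto
    have r: "rep PA L \<xi> f" by (rule rep_subset[OF PA J L])
    note t = rep_typing[OF PA r]
    have LI: "i \<in> I" "sub_le D (a i) (b i)" if "i \<in> L" for i using that unfolding L_def by auto
    have "\<exists>h. h \<in> Arr D \<and> Dom D h = Dom D (a i) \<and> Cod D h = Dom D (b i) \<and> b i \<odot> h = a i" if "i \<in> L" for i
      using sub_leE[OF LI(2)[OF that] sub_facts(1)[OF LI(1)[OF that]]] by metis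
    then obtain h where h: "\<And>i. i \<in> L \<Longrightarrow> h i \<in> Arr D \<and> Dom D (h i) = Dom D (a i) \<and> Cod D (h i) = Dom D (b i)"
      and bh: "\<And>i. i \<in> L \<Longrightarrow> b i \<odot> h i = a i" by metis
    have "h i \<odot> \<xi> i \<in> hom D (Dom D f) (Dom D (b i))" if "i \<in> L" for i
      using h[OF that] t(4-6)[OF that] by (simp add: hom_iff)
    then obtain y where y: "y \<in> Arr D" "Dom D y = Dom D f" "Cod D y = uobj PB" "rep PB L (\<lambda>i. h i \<odot> \<xi> i) y"
      using rep_exists[OF PB L(1) dom_obj[OF f(1)], of "\<lambda>i. h i \<odot> \<xi> i"] by blast
    have "b' \<odot> y = a' \<odot> f"
    proof (rule rep_unique[OF PX ultra_map_rep[OF PB PX sub_hom(2) b' y(4)] ultra_map_rep[OF PA PX sub_hom(1) a' r]])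
      show "Dom D (b' \<odot> y) = Dom D (a' \<odot> f)" using aa ba y(1-3) f(1,2) by simp
      show "b i \<odot> (h i \<odot> \<xi> i) = a i \<odot> \<xi> i" if "i \<in> L" for i
        by (rule comp_eq_assoc[OF bh[OF that]]) (use h[OF that] t(4-6)[OF that] sub_facts[OF LI(1)[OF that]] in auto)
    qed
    then show "sub_le D (a' \<odot> f) b'" by (intro sub_leI[of y]) (use y ba in auto)
  qed
qed (use ultra_Sub ultra_map_arr[OF a'] in \<open>auto simp: Sub_iff\<close>)

lemma ultra_sub_leD:
  assumes wb: "weakly_boolean D" and prime: "zero_kappa_prime kap D" and le: "sub_le D a' b'"
  shows "{i \<in> I. sub_le D (a i) (b i)} \<in> U"
proof (rule ccontr)
  note aa = ultra_map_arr[OF a'] and ba = ultra_map_arr[OF b']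
  assume no: "{i \<in> I. sub_le D (a i) (b i)} \<notin> U"
  define K where "K = I - {i \<in> I. sub_le D (a i) (b i)}"
  have K: "K \<in> U" using U_facts(6)[of "{i \<in> I. sub_le D (a i) (b i)}"] no unfolding K_def by auto
  have KI: "i \<in> I" "\<not> sub_le D (a i) (b i)" if "i \<in> K" for i using that unfolding K_def by auto
  have "\<exists>u w. u \<in> Sub D (X i) \<and> \<not> is_initial D (Dom D u) \<and> sub_le D u (a i) \<and>
      is_inter D (X i) {u, b i} id w \<and> is_initial D (Dom D w)" if i: "i \<in> K" for i
  proof -
    have "X i \<in> Obj D" using sub_facts(1,3)[OF KI(1)[OF i]] by (metis cod_obj)
    then show ?thesis using wb a[OF KI(1)[OF i]] b[OF KI(1)[OF i]] KI(2)[OF i] unfolding weakly_boolean_def by blast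
  qed
  then obtain u w where u: "\<And>i. i \<in> K \<Longrightarrow> u i \<in> Sub D (X i)" "\<And>i. i \<in> K \<Longrightarrow> \<not> is_initial D (Dom D (u i))"
    "\<And>i. i \<in> K \<Longrightarrow> sub_le D (u i) (a i)" and w: "\<And>i. i \<in> K \<Longrightarrow> is_inter D (X i) {u i, b i} id (w i)"
    "\<And>i. i \<in> K \<Longrightarrow> is_initial D (Dom D (w i))" by metis
  have ua: "u i \<in> Arr D" "is_mono D (u i)" "Cod D (u i) = X i" if "i \<in> K" for i
    using u(1)[OF that] mono_arr by (auto simp: Sub_iff)
  have "\<exists>g. g \<in> Arr D \<and> Dom D g = Dom D (u i) \<and> Cod D g = Dom D (a i) \<and> a i \<odot> g = u i" if i: "i \<in> K" for i
    using sub_leE[OF u(3)[OF i] ua(1)[OF i]] by metis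
  then obtain g where g: "\<And>i. i \<in> K \<Longrightarrow> g i \<in> Arr D \<and> Dom D (g i) = Dom D (u i) \<and> Cod D (g i) = Dom D (a i)"
    and ag: "\<And>i. i \<in> K \<Longrightarrow> a i \<odot> g i = u i" by metis
  obtain t where t: "is_terminal D t" using ex_terminal by blast
  have to: "t \<in> Obj D" using t unfolding is_terminal_def by blast
  have "\<exists>\<tau>. \<tau> \<in> Arr D \<and> Dom D \<tau> = Dom D (u i) \<and> Cod D \<tau> = t" if i: "i \<in> K" for i
    using terminal_arrow[OF t, of "Dom D (u i)"] ua[OF i] by (metis dom_obj)
  then obtain \<tau> where \<tau>: "\<And>i. i \<in> K \<Longrightarrow> \<tau> i \<in> Arr D \<and> Dom D (\<tau> i) = Dom D (u i) \<and> Cod D (\<tau> i) = t" by metis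
  have \<tau>r: "is_regular_epi D (\<tau> i)" if i: "i \<in> K" for i
    by (rule nonzero_regular_epi[OF wb prime t]) (use \<tau>[OF i] u(2)[OF i] in auto)
  have l: "locally t (\<lambda>f. \<forall>i\<in>K. sub_le D (Id D t \<odot> f) (\<tau> i))"
    by (rule locally_choice_epi[OF U_member_small[OF K] to \<tau>r]) (use \<tau> to in auto)
  obtain s where s: "s \<in> Arr D" "Dom D s = Dom D a'" "Cod D s = Dom D b'" "b' \<odot> s = a'"
    using le by (rule sub_leE) (use aa in auto)
  have "locally t (\<lambda>f. is_initial D (Dom D f))"
  proof (rule locally_mono[OF l])
    fix f assume f: "f \<in> Arr D" "Cod D f = t" "\<forall>i\<in>K. sub_le D (Id D t \<odot> f) (\<tau> i)"
    have "\<exists>k. k \<in> Arr D \<and> Dom D k = Dom D f \<and> Cod D k = Dom D (u i)" if i: "i \<in> K" for i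
    proof -
      have "sub_le D f (\<tau> i)" using f i by simp
      then show ?thesis using sub_leE[of f "\<tau> i"] f(1) \<tau>[OF i] by metis
    qed
    then obtain k where k: "\<And>i. i \<in> K \<Longrightarrow> k i \<in> Arr D \<and> Dom D (k i) = Dom D f \<and> Cod D (k i) = Dom D (u i)" by metis
    have "g i \<odot> k i \<in> hom D (Dom D f) (Dom D (a i))" if "i \<in> K" for i
      using g[OF that] k[OF that] by (simp add: hom_iff)
    then obtain y where y: "y \<in> Arr D" "Dom D y = Dom D f" "Cod D y = uobj PA" "rep PA K (\<lambda>i. g i \<odot> k i) y"
      using rep_exists[OF PA K dom_obj[OF f(1)], of "\<lambda>i. g i \<odot> k i"] by blast
    have sy: "s \<odot> y \<in> Arr D" "Dom D (s \<odot> y) = Dom D f" "Cod D (s \<odot> y) = uobj PB" using s(1-3) y(1-3) aa ba by auto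
    have "locally (Dom D f) (\<lambda>h. \<exists>J \<eta>. rep PB J \<eta> ((s \<odot> y) \<odot> h))"
      using rep_locally[OF PB sy(1,3)] sy(2) by simp
    then have "locally (Dom D f) (\<lambda>h. is_initial D (Dom D h))"
    proof (rule locally_mono)
      fix h assume h: "h \<in> Arr D" "Cod D h = Dom D f" "\<exists>J \<eta>. rep PB J \<eta> ((s \<odot> y) \<odot> h)"
      then obtain J \<eta> where J: "rep PB J \<eta> ((s \<odot> y) \<odot> h)" by blast
      note tJ = rep_typing[OF PB J]
      have yh: "rep PA K (\<lambda>i. (g i \<odot> k i) \<odot> h) (y \<odot> h)"
        by (rule rep_precomp[OF PA y(4)]) (use h y in auto)
      have eq: "b' \<odot> ((s \<odot> y) \<odot> h) = a' \<odot> (y \<odot> h)"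
        using comp_eq_assoc[OF s(4), of "y \<odot> h"] s(1-3) y(1-3) h(1,2) aa ba by simp
      have "locally (Dom D (a' \<odot> (y \<odot> h))) (\<lambda>f. \<exists>L\<in>U. L \<subseteq> K \<inter> J \<and> (\<forall>i\<in>L. (a i \<odot> ((g i \<odot> k i) \<odot> h)) \<odot> f = (b i \<odot> \<eta> i) \<odot> f))"
        by (rule rep_separated[OF PX ultra_map_rep[OF PA PX sub_hom(1) a' yh]])
          (use ultra_map_rep[OF PB PX sub_hom(2) b' J] eq in auto)
      then have l': "locally (Dom D h) (\<lambda>f. \<exists>L\<in>U. L \<subseteq> K \<inter> J \<and> (\<forall>i\<in>L. (a i \<odot> ((g i \<odot> k i) \<odot> h)) \<odot> f = (b i \<odot> \<eta> i) \<odot> f))"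
        using aa y(1-3) h(1,2) by simp
      have "locally (Dom D h) (\<lambda>f. is_initial D (Dom D f))"
      proof (rule locally_mono[OF l'])
        fix v assume v: "v \<in> Arr D" "Cod D v = Dom D h"
          "\<exists>L\<in>U. L \<subseteq> K \<inter> J \<and> (\<forall>i\<in>L. (a i \<odot> ((g i \<odot> k i) \<odot> h)) \<odot> v = (b i \<odot> \<eta> i) \<odot> v)"
        then obtain L where L: "L \<in> U" "L \<subseteq> K" "L \<subseteq> J"
          "\<And>i. i \<in> L \<Longrightarrow> (a i \<odot> ((g i \<odot> k i) \<odot> h)) \<odot> v = (b i \<odot> \<eta> i) \<odot> v" by blast
        have "L \<noteq> {}" using L(1) U_facts(3) by metis
        then obtain i where i: "i \<in> L" by blast
        have iK: "i \<in> K" and iJ: "i \<in> J" using i L by auto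
        note sf = sub_facts[OF KI(1)[OF iK]]
        have d\<eta>: "Dom D (\<eta> i) = Dom D h" using tJ(5)[OF iJ] sy h(1,2) by simp
        have kh: "k i \<odot> (h \<odot> v) \<in> Arr D" "Dom D (k i \<odot> (h \<odot> v)) = Dom D v" "Cod D (k i \<odot> (h \<odot> v)) = Dom D (u i)"
          using k[OF iK] h(1,2) v(1,2) by auto
        have "u i \<odot> (k i \<odot> (h \<odot> v)) = a i \<odot> (g i \<odot> (k i \<odot> (h \<odot> v)))"
          by (rule comp_eq_assoc[OF ag[OF iK], symmetric]) (use g[OF iK] kh sf in auto)
        also have "\<dots> = (a i \<odot> ((g i \<odot> k i) \<odot> h)) \<odot> v" using g[OF iK] k[OF iK] h(1,2) v(1,2) sf by simp
        also have "\<dots> = b i \<odot> (\<eta> i \<odot> v)" unfolding L(4)[OF i] using tJ(4,6)[OF iJ] d\<eta> sf v(1,2) by simp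
        finally have uv: "u i \<odot> (k i \<odot> (h \<odot> v)) = b i \<odot> (\<eta> i \<odot> v)" .
        have "is_initial D (Dom D (u i \<odot> (k i \<odot> (h \<odot> v))))"
        proof (rule disjoint_initial[OF w[OF iK]])
          show "sub_le D (u i \<odot> (k i \<odot> (h \<odot> v))) (u i)" by (rule sub_le_comp) (use kh ua[OF iK] in auto)
          show "sub_le D (u i \<odot> (k i \<odot> (h \<odot> v))) (b i)" unfolding uv
            by (rule sub_le_comp) (use tJ(4,6)[OF iJ] d\<eta> sf v(1,2) in auto)
        qed (use kh ua[OF iK] in auto)
        then show "is_initial D (Dom D v)" using kh ua[OF iK] by simp
      qed
      then show "is_initial D (Dom D h)" by (rule initial_of_locally)
    qed
    then show "is_initial D (Dom D f)" by (rule initial_of_locally)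
  qed
  then have "is_initial D t" by (rule initial_of_locally)
  then show False using terminal_not_initial[OF prime t] by blast
qed

end

end

section \<open>Ultraproducts of coherent functors\<close>

context category_loc
begin

lemma limit_lift:
  assumes "is_limit J D F x p" "is_cone J D F y q"
  obtains h where "h \<in> Arr D" "Dom D h = y" "Cod D h = x" "\<And>j. j \<in> Obj J \<Longrightarrow> p j \<odot> h = q j"
proof -
  have "\<exists>!h. h \<in> hom D y x \<and> (\<forall>j \<in> Obj J. p j \<odot> h = q j)" using assms unfolding is_limit_def by blast
  then obtain h where "h \<in> hom D y x \<and> (\<forall>j \<in> Obj J. p j \<odot> h = q j)" by (elim ex1E)
  then show ?thesis by (intro that[of h]) (simp_all add: hom_iff)
qed

lemma cone_facts:
  assumes "is_cone J D F x p"
  shows "x \<in> Obj D" "\<And>j. j \<in> Obj J \<Longrightarrow> p j \<in> Arr D" "\<And>j. j \<in> Obj J \<Longrightarrow> Dom D (p j) = x"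
    "\<And>j. j \<in> Obj J \<Longrightarrow> Cod D (p j) = FObj F j" "\<And>f. f \<in> Arr J \<Longrightarrow> FArr F f \<odot> p (Dom J f) = p (Cod J f)"
  using assms unfolding is_cone_def by (auto simp: hom_iff)

lemma limit_unique:
  assumes J: "category J" and F: "is_functor J D F" and lim: "is_limit J D F x p"
    and hk: "h \<in> Arr D" "k \<in> Arr D" "Dom D h = Dom D k" "Cod D h = x" "Cod D k = x"
    and eq: "\<And>j. j \<in> Obj J \<Longrightarrow> p j \<odot> h = p j \<odot> k"
  shows "h = k"
proof -
  note c = cone_facts[of J F x p]
  have cone: "is_cone J D F x p" using lim unfolding is_limit_def by simp
  have "is_cone J D F (Dom D h) (\<lambda>j. p j \<odot> h)" unfolding is_cone_def
  proof (intro conjI ballI)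
    show "p j \<odot> h \<in> hom D (Dom D h) (FObj F j)" if "j \<in> Obj J" for j
      using c(2-4)[OF cone that] hk by (simp add: hom_iff)
    fix f assume f: "f \<in> Arr J"
    have "Dom J f \<in> Obj J" using J f unfolding category_def by blast
    moreover have "FArr F f \<in> Arr D" "Dom D (FArr F f) = FObj F (Dom J f)"
      using F f unfolding is_functor_def by (auto simp: hom_iff)
    ultimately show "FArr F f \<odot> (p (Dom J f) \<odot> h) = p (Cod J f) \<odot> h"
      using hk c(2-4)[OF cone] by (intro comp_eq_assoc[OF c(5)[OF cone f]]) auto
  qed (use hk in simp)
  then have "\<exists>!u. u \<in> hom D (Dom D h) x \<and> (\<forall>j \<in> Obj J. p j \<odot> u = p j \<odot> h)"
    using lim unfolding is_limit_def by blast
  moreover have "h \<in> hom D (Dom D h) x \<and> (\<forall>j \<in> Obj J. p j \<odot> h = p j \<odot> h)"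
    "k \<in> hom D (Dom D h) x \<and> (\<forall>j \<in> Obj J. p j \<odot> k = p j \<odot> h)"
    using hk eq by (simp_all add: hom_iff)
  ultimately show ?thesis by (elim ex1E) metis
qed

end

lemma functor_arr:
  assumes "is_functor C D F" "f \<in> Arr C"
  shows "FArr F f \<in> Arr D" "Dom D (FArr F f) = FObj F (Dom C f)" "Cod D (FArr F f) = FObj F (Cod C f)"
  using assms unfolding is_functor_def hom_def by auto

lemma functor_obj: "\<lbrakk>is_functor C D F; x \<in> Obj C\<rbrakk> \<Longrightarrow> FObj F x \<in> Obj D"
  unfolding is_functor_def by blast

lemma functor_id: "\<lbrakk>is_functor C D F; x \<in> Obj C\<rbrakk> \<Longrightarrow> FArr F (Id C x) = Id D (FObj F x)"
  unfolding is_functor_def by blast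

lemma functor_comp:
  "\<lbrakk>is_functor C D F; f \<in> Arr C; g \<in> Arr C; Dom C g = Cod C f\<rbrakk> \<Longrightarrow>
    FArr F (Comp C g f) = Comp D (FArr F g) (FArr F f)"
  unfolding is_functor_def by blast

locale ultraproduct_of_functors = ultrafilter_pretopos D lam kap I U
  for D :: "('o, 'm) cat" and lam :: "'l rel" and kap :: "'k rel" and I :: "'i set" and U +
  fixes C :: "('a, 'b) cat" and F :: "'i \<Rightarrow> ('a, 'b, 'o, 'm) func"
  assumes C: "category C" and Ff: "\<And>i. i \<in> I \<Longrightarrow> is_functor C D (F i)"
begin

interpretation C: category_loc C by unfold_locales (rule C)

lemma F_arr:
  assumes "i \<in> I" "f \<in> Arr C"
  shows "FArr (F i) f \<in> Arr D" "Dom D (FArr (F i) f) = FObj (F i) (Dom C f)"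
    "Cod D (FArr (F i) f) = FObj (F i) (Cod C f)"
  using functor_arr[OF Ff[OF assms(1)] assms(2)] .

lemma F_hom: "\<lbrakk>f \<in> Arr C; i \<in> I\<rbrakk> \<Longrightarrow> FArr (F i) f \<in> hom D (FObj (F i) (Dom C f)) (FObj (F i) (Cod C f))"
  using F_arr by (simp add: hom_iff)

lemma ex_functor_ultraproduct: "\<exists>G. is_functor_ultraproduct C D U F G"
proof -
  have "\<exists>E. is_ultraproduct D U (\<lambda>i. FObj (F i) c) E" if "c \<in> Obj C" for c
    by (rule ex_ultraproduct) (rule functor_obj[OF Ff that])
  then obtain E where E: "\<And>c. c \<in> Obj C \<Longrightarrow> is_ultraproduct D U (\<lambda>i. FObj (F i) c) (E c)" by metis
  have "\<exists>h. is_ultraproduct_map D U (E (Dom C f)) (E (Cod C f)) (\<lambda>i. FArr (F i) f) h" if f: "f \<in> Arr C" for f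
    by (rule ex_ultraproduct_map[OF E E F_hom[OF f]]) (use f in auto)
  then obtain G where G: "\<And>f. f \<in> Arr C \<Longrightarrow> is_ultraproduct_map D U (E (Dom C f)) (E (Cod C f)) (\<lambda>i. FArr (F i) f) (G f)"
    by metis
  note Ga = ultra_map_arr[OF G]
  have Gr: "rep (E (Cod C f)) J (\<lambda>i. FArr (F i) f \<odot> \<xi> i) (G f \<odot> y)"
    if "f \<in> Arr C" "rep (E (Dom C f)) J \<xi> y" for f J \<xi> y
    by (rule ultra_map_rep[OF E E F_hom[OF that(1)] G[OF that(1)] that(2)]) (use that(1) in auto)
  define H where "H = \<lparr>FObj = (\<lambda>c. uobj (E c)), FArr = G\<rparr>"
  have eobj: "uobj (E c) \<in> Obj D" if "c \<in> Obj C" for c using ultra_inj(1)[OF E[OF that]] .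
  have "is_functor C D H" unfolding is_functor_def
  proof (intro conjI ballI impI)
    show "FObj H c \<in> Obj D" if "c \<in> Obj C" for c using eobj[OF that] unfolding H_def by simp
    show "FArr H f \<in> hom D (FObj H (Dom C f)) (FObj H (Cod C f))" if "f \<in> Arr C" for f
      using Ga[OF that] unfolding H_def by (simp add: hom_iff)
    show "FArr H (Id C c) = Id D (FObj H c)" if c: "c \<in> Obj C" for c
    proof -
      have i: "Id C c \<in> Arr C" "Dom C (Id C c) = c" "Cod C (Id C c) = c" using c by auto
      have "G (Id C c) = Id D (uobj (E c))"
      proof (rule ultra_arrow_eqI[OF E[OF c]])
        fix J \<xi> y assume r: "rep (E c) J \<xi> y"
        note t = rep_typing[OF E[OF c] r]
        have r': "rep (E c) J (\<lambda>j. FArr (F j) (Id C c) \<odot> \<xi> j) (G (Id C c) \<odot> y)"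
          using Gr[OF i(1), unfolded i, OF r] .
        have "G (Id C c) \<odot> y = y"
        proof (rule rep_unique[OF E[OF c] r' r])
          show "Dom D (G (Id C c) \<odot> y) = Dom D y" using Ga[OF i(1)] i t by simp
          fix j assume j: "j \<in> J"
          then show "FArr (F j) (Id C c) \<odot> \<xi> j = \<xi> j"
            using functor_id[OF Ff[OF U_sub[OF t(1) j]] c] t(4-6)[OF j] by simp
        qed
        then show "G (Id C c) \<odot> y = Id D (uobj (E c)) \<odot> y" using t by simp
      qed (use Ga[OF i(1)] i eobj[OF c] in auto)
      then show ?thesis unfolding H_def by simp
    qed
    fix f g assume fg: "f \<in> Arr C" "g \<in> Arr C" "Dom C g = Cod C f"
    have gf: "C.cmp g f \<in> Arr C" "Dom C (C.cmp g f) = Dom C f" "Cod C (C.cmp g f) = Cod C g"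
      using fg by auto
    have Ed: "is_ultraproduct D U (\<lambda>i. FObj (F i) (Dom C f)) (E (Dom C f))" by (rule E) (use fg in auto)
    have Ec: "is_ultraproduct D U (\<lambda>i. FObj (F i) (Cod C g)) (E (Cod C g))" by (rule E) (use fg in auto)
    have "G (C.cmp g f) = G g \<odot> G f"
    proof (rule ultra_arrow_eqI[OF Ed])
      fix J \<xi> y assume r: "rep (E (Dom C f)) J \<xi> y"
      note t = rep_typing[OF Ed r]
      have r1: "rep (E (Cod C g)) J (\<lambda>j. FArr (F j) (C.cmp g f) \<odot> \<xi> j) (G (C.cmp g f) \<odot> y)"
        using Gr[OF gf(1), unfolded gf, OF r] .
      have "rep (E (Cod C f)) J (\<lambda>j. FArr (F j) f \<odot> \<xi> j) (G f \<odot> y)" by (rule Gr[OF fg(1) r])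
      then have r2: "rep (E (Cod C g)) J (\<lambda>j. FArr (F j) g \<odot> (FArr (F j) f \<odot> \<xi> j)) (G g \<odot> (G f \<odot> y))"
        by (intro Gr[OF fg(2)]) (simp add: fg(3))
      have "G (C.cmp g f) \<odot> y = G g \<odot> (G f \<odot> y)"
      proof (rule rep_unique[OF Ec r1 r2])
        show "Dom D (G (C.cmp g f) \<odot> y) = Dom D (G g \<odot> (G f \<odot> y))"
          using Ga[OF gf(1)] Ga[OF fg(1)] Ga[OF fg(2)] gf fg(3) t by simp
        fix j assume j: "j \<in> J"
        have jI: "j \<in> I" using U_sub[OF t(1) j] .
        show "FArr (F j) (C.cmp g f) \<odot> \<xi> j = FArr (F j) g \<odot> (FArr (F j) f \<odot> \<xi> j)"
          unfolding functor_comp[OF Ff[OF jI] fg]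
          using F_arr[OF jI fg(1)] F_arr[OF jI fg(2)] fg(3) t(4-6)[OF j] by simp
      qed
      then show "G (C.cmp g f) \<odot> y = (G g \<odot> G f) \<odot> y"
        using Ga[OF fg(1)] Ga[OF fg(2)] fg(3) t by simp
    qed (use Ga[OF gf(1)] Ga[OF fg(1)] Ga[OF fg(2)] gf fg(3) in auto)
    then show "FArr H (C.cmp g f) = FArr H g \<odot> FArr H f" unfolding H_def by simp
  qed
  then have "is_functor_ultraproduct C D U F H"
    unfolding is_functor_ultraproduct_def using E G by (intro conjI exI[of _ E]) (auto simp: H_def)
  then show ?thesis by blast
qed

context
  fixes G
  assumes coherent: "\<And>i. i \<in> I \<Longrightarrow> coherent_functor C D (F i)"
    and G: "is_functor_ultraproduct C D U F G"
begin

lemma G_functor: "is_functor C D G"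
  using G unfolding is_functor_ultraproduct_def by blast

definition E where "E = (SOME E. (\<forall>c \<in> Obj C. is_ultraproduct D U (\<lambda>i. FObj (F i) c) (E c) \<and> uobj (E c) = FObj G c) \<and>
        (\<forall>f \<in> Arr C.
           is_ultraproduct_map D U (E (Dom C f)) (E (Cod C f)) (\<lambda>i. FArr (F i) f) (FArr G f)))"

lemma E:
  shows E_ultra: "c \<in> Obj C \<Longrightarrow> is_ultraproduct D U (\<lambda>i. FObj (F i) c) (E c)"
    and E_obj: "c \<in> Obj C \<Longrightarrow> uobj (E c) = FObj G c"
    and E_map: "f \<in> Arr C \<Longrightarrow> is_ultraproduct_map D U (E (Dom C f)) (E (Cod C f)) (\<lambda>i. FArr (F i) f) (FArr G f)"
proof -
  have "\<exists>E. (\<forall>c \<in> Obj C. is_ultraproduct D U (\<lambda>i. FObj (F i) c) (E c) \<and> uobj (E c) = FObj G c) \<and>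
        (\<forall>f \<in> Arr C.
           is_ultraproduct_map D U (E (Dom C f)) (E (Cod C f)) (\<lambda>i. FArr (F i) f) (FArr G f))"
    using G unfolding is_functor_ultraproduct_def by blast
  note e = someI_ex[OF this, folded E_def]
  show "c \<in> Obj C \<Longrightarrow> is_ultraproduct D U (\<lambda>i. FObj (F i) c) (E c)"
    "c \<in> Obj C \<Longrightarrow> uobj (E c) = FObj G c"
    "f \<in> Arr C \<Longrightarrow> is_ultraproduct_map D U (E (Dom C f)) (E (Cod C f)) (\<lambda>i. FArr (F i) f) (FArr G f)"
    using e by simp_all
qed

lemmas G_arr = functor_arr[OF G_functor]

lemma G_rep:
  assumes "f \<in> Arr C" "rep (E (Dom C f)) J \<xi> y"
  shows "rep (E (Cod C f)) J (\<lambda>i. FArr (F i) f \<odot> \<xi> i) (FArr G f \<odot> y)"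
  by (rule ultra_map_rep[OF E_ultra E_ultra F_hom[OF assms(1)] E_map[OF assms(1)] assms(2)]) (use assms(1) in auto)

lemma G_locally:
  assumes "c \<in> Obj C" "y \<in> Arr D" "Cod D y = FObj G c"
  shows "locally (Dom D y) (\<lambda>f. \<exists>J \<xi>. rep (E c) J \<xi> (y \<odot> f))"
  by (rule rep_locally[OF E_ultra[OF assms(1)]]) (use assms E_obj in auto)

lemma G_regular_epi:
  assumes "is_regular_epi C e"
  shows "is_regular_epi D (FArr G e)"
proof (rule regular_epi_of_locally)
  have e: "e \<in> Arr C" using assms unfolding is_regular_epi_def is_coequalizer_def by auto
  note Ge = G_arr[OF e]
  have Eo: "is_ultraproduct D U (\<lambda>i. FObj (F i) (Dom C e)) (E (Dom C e))"
    "is_ultraproduct D U (\<lambda>i. FObj (F i) (Cod C e)) (E (Cod C e))" using e E_ultra by auto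
  show "FArr G e \<in> Arr D" by fact
  have o: "FObj G (Cod C e) \<in> Obj D" using functor_obj[OF G_functor] e by simp
  have "locally (FObj G (Cod C e)) (\<lambda>f. \<exists>J \<xi>. rep (E (Cod C e)) J \<xi> (Id D (FObj G (Cod C e)) \<odot> f))"
    using G_locally[of "Cod C e" "Id D (FObj G (Cod C e))"] o e by simp
  then have "locally (FObj G (Cod C e)) (\<lambda>f. sub_le D f (FArr G e))"
  proof (rule locally_bind)
    fix f assume f: "f \<in> Arr D" "Cod D f = FObj G (Cod C e)"
      "\<exists>J \<xi>. rep (E (Cod C e)) J \<xi> (Id D (FObj G (Cod C e)) \<odot> f)"
    then obtain J \<xi> where r: "rep (E (Cod C e)) J \<xi> f" by auto
    note t = rep_typing[OF Eo(2) r]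
    have l: "locally (Dom D f) (\<lambda>g. \<forall>i\<in>J. sub_le D (\<xi> i \<odot> g) (FArr (F i) e))"
    proof (rule locally_choice_epi[OF U_member_small[OF t(1)]])
      show "is_regular_epi D (FArr (F i) e)" if "i \<in> J" for i
        using coherent[OF U_sub[OF t(1) that]] assms unfolding coherent_functor_def by blast
      show "\<xi> i \<in> Arr D \<and> Dom D (\<xi> i) = Dom D f \<and> Cod D (\<xi> i) = Cod D (FArr (F i) e)" if "i \<in> J" for i
        using t(4-6)[OF that] F_arr(3)[OF U_sub[OF t(1) that] e] by simp
    qed (use f in simp)
    show "locally (Dom D f) (\<lambda>g. sub_le D (f \<odot> g) (FArr G e))"
    proof (rule locally_mono[OF l])
      fix g assume g: "g \<in> Arr D" "Cod D g = Dom D f" "\<forall>i\<in>J. sub_le D (\<xi> i \<odot> g) (FArr (F i) e)"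
      have "\<exists>k. k \<in> Arr D \<and> Dom D k = Dom D g \<and> Cod D k = FObj (F i) (Dom C e) \<and> FArr (F i) e \<odot> k = \<xi> i \<odot> g"
        if i: "i \<in> J" for i
      proof -
        have "\<xi> i \<odot> g \<in> Arr D" "Dom D (\<xi> i \<odot> g) = Dom D g" using t(4,5)[OF i] g(1,2) by simp_all
        then show ?thesis using sub_leE[of "\<xi> i \<odot> g" "FArr (F i) e"] g(3) i F_arr(2)[OF U_sub[OF t(1) i] e] by metis
      qed
      then obtain k where k: "\<And>i. i \<in> J \<Longrightarrow> k i \<in> Arr D \<and> Dom D (k i) = Dom D g \<and> Cod D (k i) = FObj (F i) (Dom C e)"
        and ek: "\<And>i. i \<in> J \<Longrightarrow> FArr (F i) e \<odot> k i = \<xi> i \<odot> g" by metis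
      have "k i \<in> hom D (Dom D g) (FObj (F i) (Dom C e))" if "i \<in> J" for i using k[OF that] by (simp add: hom_iff)
      then obtain y where y: "y \<in> Arr D" "Dom D y = Dom D g" "Cod D y = uobj (E (Dom C e))" "rep (E (Dom C e)) J k y"
        using rep_exists[OF Eo(1) t(1) dom_obj[OF g(1)], of k] by blast
      have yG: "Cod D y = FObj G (Dom C e)" using y(3) E_obj e by simp
      have "FArr G e \<odot> y = f \<odot> g"
        by (rule rep_unique[OF Eo(2) G_rep[OF e y(4)] rep_precomp[OF Eo(2) r g(1,2)]])
          (use ek Ge y(1,2) yG f g(1,2) in auto)
      then show "sub_le D (f \<odot> g) (FArr G e)" by (intro sub_leI[of y]) (use y(1) yG Ge in auto)
    qed
  qed
  then show "locally (Cod D (FArr G e)) (\<lambda>f. sub_le D f (FArr G e))" using Ge by simp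
qed

lemma G_union:
  assumes x: "x \<in> Obj C" and K: "finite (K :: nat set)" and un: "is_union C x K a u"
  shows "is_union D (FObj G x) K (\<lambda>k. FArr G (a k)) (FArr G u)"
proof -
  have aC: "a k \<in> Arr C" "Cod C (a k) = x" if "k \<in> K" for k
    using un that unfolding is_union_def by (auto simp: C.Sub_iff C.mono_arr)
  have uC: "u \<in> Arr C" "Cod C u = x" using un unfolding is_union_def by (auto simp: C.Sub_iff C.mono_arr)
  have Fu: "is_union D (FObj (F i) x) K (\<lambda>k. FArr (F i) (a k)) (FArr (F i) u)" if "i \<in> I" for i
    using coherent[OF that] x K un unfolding coherent_functor_def by blast
  have mono: "is_mono D (FArr G f)" if f: "f \<in> Arr C" "\<And>i. i \<in> I \<Longrightarrow> is_mono D (FArr (F i) f)" for f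
    by (rule ultra_map_mono[OF E_ultra E_ultra F_hom[OF f(1)] f(2) E_map[OF f(1)]]) (use f in auto)
  have Ga: "is_mono D (FArr G (a k))" if k: "k \<in> K" for k
    by (rule mono[OF aC(1)[OF k]]) (use Fu k in \<open>auto simp: is_union_def Sub_iff\<close>)
  have Gu: "is_mono D (FArr G u)"
    by (rule mono[OF uC(1)]) (use Fu in \<open>auto simp: is_union_def Sub_iff\<close>)
  note Gua = G_arr[OF uC(1), unfolded uC(2)]
  have Ex: "is_ultraproduct D U (\<lambda>i. FObj (F i) x) (E x)" by (rule E_ultra[OF x])
  have Eu: "is_ultraproduct D U (\<lambda>i. FObj (F i) (Dom C u)) (E (Dom C u))" by (rule E_ultra) (use uC in auto)
  show ?thesis unfolding is_union_def
  proof (intro conjI ballI impI)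
    show "FArr G (a k) \<in> Sub D (FObj G x)" if "k \<in> K" for k
      using Ga[OF that] G_arr(3)[OF aC(1)[OF that]] aC(2)[OF that] by (simp add: Sub_iff)
    show "FArr G u \<in> Sub D (FObj G x)" using Gu Gua by (simp add: Sub_iff)
    show "sub_le D (FArr G (a k)) (FArr G u)" if k: "k \<in> K" for k
    proof -
      have "sub_le C (a k) u" using un k unfolding is_union_def by blast
      then obtain h where h: "h \<in> Arr C" "Dom C h = Dom C (a k)" "Cod C h = Dom C u" "Comp C u h = a k"
        by (rule C.sub_leE) (rule aC(1)[OF k])
      have "FArr G u \<odot> FArr G h = FArr G (a k)"
        using functor_comp[OF G_functor h(1) uC(1)] h by simp
      then show ?thesis by (intro sub_leI[of "FArr G h"]) (use G_arr[OF h(1)] Gua h in auto)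
    qed
    fix v assume v: "v \<in> Sub D (FObj G x)" "\<forall>k\<in>K. sub_le D (FArr G (a k)) v"
    have vm: "is_mono D v" "v \<in> Arr D" "Cod D v = FObj G x" using v mono_arr by (auto simp: Sub_iff)
    have o: "FObj G (Dom C u) \<in> Obj D" using functor_obj[OF G_functor] uC by simp
    have l0: "locally (FObj G (Dom C u)) (\<lambda>f. \<exists>J \<xi>. rep (E (Dom C u)) J \<xi> (Id D (FObj G (Dom C u)) \<odot> f))"
      using G_locally[of "Dom C u" "Id D (FObj G (Dom C u))"] o uC by simp
    show "sub_le D (FArr G u) v"
    proof (rule locally_factor[OF _ Gua(1,2) vm(1)])
      show "locally (FObj G (Dom C u)) (\<lambda>f. sub_le D (FArr G u \<odot> f) v)"
      proof (rule locally_bind[OF l0])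
        fix f assume f: "f \<in> Arr D" "Cod D f = FObj G (Dom C u)"
          "\<exists>J \<xi>. rep (E (Dom C u)) J \<xi> (Id D (FObj G (Dom C u)) \<odot> f)"
        then obtain J \<xi> where r: "rep (E (Dom C u)) J \<xi> f" by auto
        note t = rep_typing[OF Eu r]
        note Fua = F_arr[OF U_sub[OF t(1)] uC(1), unfolded uC(2)]
        have \<xi>: "FArr (F i) u \<odot> \<xi> i \<in> Arr D" "Dom D (FArr (F i) u \<odot> \<xi> i) = Dom D f"
          "Cod D (FArr (F i) u \<odot> \<xi> i) = FObj (F i) x" if "i \<in> J" for i
          using t(4-6)[OF that] Fua[OF that] by simp_all
        have l: "locally (Dom D f) (\<lambda>g. \<exists>\<phi>. \<forall>i\<in>J. \<phi> i \<in> K \<and>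
            sub_le D ((FArr (F i) u \<odot> \<xi> i) \<odot> g) (FArr (F i) (a (\<phi> i))))"
        proof (rule locally_choice_union[OF U_member_small[OF t(1)] K])
          show "is_union D (FObj (F i) x) K (\<lambda>k. FArr (F i) (a k)) (FArr (F i) u)" if "i \<in> J" for i
            by (rule Fu[OF U_sub[OF t(1) that]])
          show "FArr (F i) u \<odot> \<xi> i \<in> Arr D \<and> Dom D (FArr (F i) u \<odot> \<xi> i) = Dom D f \<and>
            Cod D (FArr (F i) u \<odot> \<xi> i) = FObj (F i) x \<and> sub_le D (FArr (F i) u \<odot> \<xi> i) (FArr (F i) u)" if i: "i \<in> J" for i
            using \<xi>[OF i] sub_le_comp[of "\<xi> i" "FArr (F i) u"] t(4-6)[OF i] Fua[OF i] by simp
        qed (use f in simp)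
        show "locally (Dom D f) (\<lambda>g. sub_le D (FArr G u \<odot> (f \<odot> g)) v)"
        proof (rule locally_mono[OF l])
          fix g assume g: "g \<in> Arr D" "Cod D g = Dom D f" "\<exists>\<phi>. \<forall>i\<in>J. \<phi> i \<in> K \<and>
            sub_le D ((FArr (F i) u \<odot> \<xi> i) \<odot> g) (FArr (F i) (a (\<phi> i)))"
          then obtain \<phi> where \<phi>: "\<And>i. i \<in> J \<Longrightarrow> \<phi> i \<in> K"
            "\<And>i. i \<in> J \<Longrightarrow> sub_le D ((FArr (F i) u \<odot> \<xi> i) \<odot> g) (FArr (F i) (a (\<phi> i)))" by metis
          have "\<exists>k\<in>K. {i \<in> J. \<phi> i = k} \<in> U" by (rule U_finite_union[OF t(1) K]) (rule \<phi>(1))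
          then obtain k where k: "k \<in> K" "{i \<in> J. \<phi> i = k} \<in> U" by blast
          define L where "L = {i \<in> J. \<phi> i = k}"
          have L: "L \<in> U" "L \<subseteq> J" "\<And>i. i \<in> L \<Longrightarrow> i \<in> J" "\<And>i. i \<in> L \<Longrightarrow> \<phi> i = k" using k unfolding L_def by auto
          have Ek: "is_ultraproduct D U (\<lambda>i. FObj (F i) (Dom C (a k))) (E (Dom C (a k)))"
            by (rule E_ultra) (use aC[OF k(1)] in auto)
          have "\<exists>\<eta>. \<eta> \<in> Arr D \<and> Dom D \<eta> = Dom D g \<and> Cod D \<eta> = FObj (F i) (Dom C (a k)) \<and>
              FArr (F i) (a k) \<odot> \<eta> = (FArr (F i) u \<odot> \<xi> i) \<odot> g" if i: "i \<in> L" for i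
          proof -
            have "(FArr (F i) u \<odot> \<xi> i) \<odot> g \<in> Arr D" "Dom D ((FArr (F i) u \<odot> \<xi> i) \<odot> g) = Dom D g"
              using \<xi>[OF L(3)[OF i]] g(1,2) by (simp_all only: comp_arr dom_comp)
            then show ?thesis
              using sub_leE[OF \<phi>(2)[OF L(3)[OF i]]] L(4)[OF i] F_arr(2)[OF U_sub[OF L(1) i] aC(1)[OF k(1)]] by metis
          qed
          then obtain \<eta> where \<eta>: "\<And>i. i \<in> L \<Longrightarrow> \<eta> i \<in> Arr D \<and> Dom D (\<eta> i) = Dom D g \<and> Cod D (\<eta> i) = FObj (F i) (Dom C (a k))"
            and a\<eta>: "\<And>i. i \<in> L \<Longrightarrow> FArr (F i) (a k) \<odot> \<eta> i = (FArr (F i) u \<odot> \<xi> i) \<odot> g" by metis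
          have "\<eta> i \<in> hom D (Dom D g) (FObj (F i) (Dom C (a k)))" if "i \<in> L" for i
            using \<eta>[OF that] by (simp add: hom_iff)
          then obtain y where y: "y \<in> Arr D" "Dom D y = Dom D g" "Cod D y = uobj (E (Dom C (a k)))"
            "rep (E (Dom C (a k))) L \<eta> y"
            using rep_exists[OF Ek L(1) dom_obj[OF g(1)], of \<eta>] by blast
          have yG: "Cod D y = FObj G (Dom C (a k))" using y(3) E_obj aC[OF k(1)] by simp
          note Gak = G_arr[OF aC(1)[OF k(1)], unfolded aC(2)[OF k(1)]]
          have r1: "rep (E x) L (\<lambda>i. FArr (F i) (a k) \<odot> \<eta> i) (FArr G (a k) \<odot> y)"
            using G_rep[OF aC(1)[OF k(1)] y(4)] aC(2)[OF k(1)] by simp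
          have "rep (E x) L (\<lambda>i. FArr (F i) u \<odot> \<xi> i) (FArr G u \<odot> f)"
            using G_rep[OF uC(1) rep_subset[OF Eu r L(1,2)]] uC(2) by simp
          then have r2: "rep (E x) L (\<lambda>i. (FArr (F i) u \<odot> \<xi> i) \<odot> g) ((FArr G u \<odot> f) \<odot> g)"
            by (rule rep_precomp[OF Ex]) (use g Gua f in auto)
          have "FArr G (a k) \<odot> y = (FArr G u \<odot> f) \<odot> g"
            by (rule rep_unique[OF Ex r1 r2]) (use a\<eta> Gak Gua y(1,2) yG f(1,2) g(1,2) in auto)
          then have "FArr G u \<odot> (f \<odot> g) = FArr G (a k) \<odot> y" using Gua f(1,2) g(1,2) by simp
          moreover have "sub_le D (FArr G (a k) \<odot> y) v"
            using sub_le_precomp[OF _ vm(2) y(1)] v(2) k(1) yG Gak by simp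
          ultimately show "sub_le D (FArr G u \<odot> (f \<odot> g)) v" by simp
        qed
      qed
    qed (use vm Gua in auto)
  qed
qed

lemma G_limit:
  fixes J :: "(nat, nat) cat"
  assumes J: "category J" "|Arr J| <o natLeq" and H: "is_functor J C H" and lim: "is_limit J C H x p"
  shows "is_limit J D (func_comp G H) (FObj G x) (\<lambda>j. FArr G (p j))"
proof -
  interpret J: category_loc J by unfold_locales (rule J(1))
  have fA: "finite (Arr J)" using J(2) finite_iff_ordLess_natLeq by blast
  have "Obj J \<subseteq> Dom J ` Arr J"
  proof
    fix j assume j: "j \<in> Obj J"
    show "j \<in> Dom J ` Arr J" by (rule image_eqI[of _ _ "Id J j"]) (use j in auto)
  qed
  then have fO: "finite (Obj J)" using fA finite_surj by blast
  have cC: "is_cone J C H x p" using lim unfolding is_limit_def by simp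
  note cf = C.cone_facts[OF cC]
  note Ho = functor_obj[OF H] and Ha = functor_arr[OF H]
  have Flim: "is_limit J D (func_comp (F i) H) (FObj (F i) x) (\<lambda>j. FArr (F i) (p j))" if "i \<in> I" for i
    using coherent[OF that] J H lim unfolding coherent_functor_def by blast
  have FH: "is_functor J D (func_comp (F i) H)" if "i \<in> I" for i
    unfolding is_functor_def func_comp_def using H Ff[OF that] Ha Ho F_arr[OF that]
    by (auto simp: functor_obj functor_id functor_comp hom_iff)
  have simps: "FObj (func_comp K H) j = FObj K (FObj H j)" "FArr (func_comp K H) f = FArr K (FArr H f)"
    for K :: "('a, 'b, 'o, 'm) func" and j f
    unfolding func_comp_def by simp_all
  have Gp: "FArr G (p j) \<in> Arr D" "Dom D (FArr G (p j)) = FObj G x" "Cod D (FArr G (p j)) = FObj G (FObj H j)"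
    if "j \<in> Obj J" for j
    using G_arr[OF cf(2)[OF that]] cf(3,4)[OF that] by simp_all
  have Fp: "FArr (F i) (p j) \<in> Arr D" "Dom D (FArr (F i) (p j)) = FObj (F i) x"
    "Cod D (FArr (F i) (p j)) = FObj (F i) (FObj H j)" if "i \<in> I" "j \<in> Obj J" for i j
    using F_arr[OF that(1) cf(2)[OF that(2)]] cf(3,4)[OF that(2)] by simp_all
  have Ex: "is_ultraproduct D U (\<lambda>i. FObj (F i) x) (E x)" "uobj (E x) = FObj G x"
    using E_ultra E_obj cf(1) by auto
  have EH: "is_ultraproduct D U (\<lambda>i. FObj (F i) (FObj H j)) (E (FObj H j))"
    "uobj (E (FObj H j)) = FObj G (FObj H j)" if "j \<in> Obj J" for j
    using E_ultra E_obj Ho[OF that] by auto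
  have Gp_rep: "rep (E (FObj H j)) K (\<lambda>i. FArr (F i) (p j) \<odot> \<xi> i) (FArr G (p j) \<odot> y)"
    if "j \<in> Obj J" "rep (E x) K \<xi> y" for j K \<xi> y
    using G_rep[OF cf(2)[OF that(1)]] that(2) cf(3,4)[OF that(1)] by simp
  have joint: "g = g'"
    if g: "g \<in> Arr D" "g' \<in> Arr D" "Dom D g = Dom D g'" "Cod D g = FObj G x" "Cod D g' = FObj G x"
      "\<And>j. j \<in> Obj J \<Longrightarrow> FArr G (p j) \<odot> g = FArr G (p j) \<odot> g'" for g g'
  proof (rule locally_eq)
    have "locally (Dom D g) (\<lambda>f. \<exists>K \<xi> \<xi>'. rep (E x) K \<xi> (g \<odot> f) \<and> rep (E x) K \<xi>' (g' \<odot> f))"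
      by (rule rep_pair[OF Ex(1) Ex(1)]) (use g Ex(2) in auto)
    then show "locally (Dom D g) (\<lambda>f. g \<odot> f = g' \<odot> f)"
    proof (rule locally_bind)
      fix f assume f: "f \<in> Arr D" "Cod D f = Dom D g"
        "\<exists>K \<xi> \<xi>'. rep (E x) K \<xi> (g \<odot> f) \<and> rep (E x) K \<xi>' (g' \<odot> f)"
      then obtain K \<xi> \<xi>' where r: "rep (E x) K \<xi> (g \<odot> f)" "rep (E x) K \<xi>' (g' \<odot> f)" by blast
      note t = rep_typing[OF Ex(1) r(1)] and t' = rep_typing[OF Ex(1) r(2)]
      have df: "Dom D (g \<odot> f) = Dom D f" "Dom D (g' \<odot> f) = Dom D f" using f g(1-5) by simp_all
      define \<Phi> where "\<Phi> j h \<longleftrightarrow> (\<exists>L\<in>U. \<forall>i\<in>L \<inter> K. FArr (F i) (p j) \<odot> (\<xi> i \<odot> h) = FArr (F i) (p j) \<odot> (\<xi>' i \<odot> h))" for j h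
      have "locally (Dom D f) (\<lambda>h. \<forall>j\<in>Obj J. \<Phi> j h)"
      proof (rule locally_ball_finite[OF fO])
        show "Dom D f \<in> Obj D" using f by simp
        fix j assume j: "j \<in> Obj J"
        have same: "FArr G (p j) \<odot> (g \<odot> f) = FArr G (p j) \<odot> (g' \<odot> f)"
          using comp_eq_assoc[OF g(6)[OF j], of f] Gp[OF j] g(1-5) f(1,2) by simp
        have "locally (Dom D (FArr G (p j) \<odot> (g \<odot> f))) (\<lambda>h. \<exists>L\<in>U. L \<subseteq> K \<inter> K \<and>
            (\<forall>i\<in>L. (FArr (F i) (p j) \<odot> \<xi> i) \<odot> h = (FArr (F i) (p j) \<odot> \<xi>' i) \<odot> h))"
          by (rule rep_separated[OF EH(1)[OF j] Gp_rep[OF j r(1)]]) (use Gp_rep[OF j r(2)] same in auto)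
        then have l: "locally (Dom D f) (\<lambda>h. \<exists>L\<in>U. L \<subseteq> K \<inter> K \<and>
            (\<forall>i\<in>L. (FArr (F i) (p j) \<odot> \<xi> i) \<odot> h = (FArr (F i) (p j) \<odot> \<xi>' i) \<odot> h))"
          using Gp[OF j] g(1-5) f(1,2) by simp
        show "locally (Dom D f) (\<Phi> j)"
        proof (rule locally_mono[OF l])
          fix h assume h: "h \<in> Arr D" "Cod D h = Dom D f" "\<exists>L\<in>U. L \<subseteq> K \<inter> K \<and>
            (\<forall>i\<in>L. (FArr (F i) (p j) \<odot> \<xi> i) \<odot> h = (FArr (F i) (p j) \<odot> \<xi>' i) \<odot> h)"
          then obtain L where L: "L \<in> U" "L \<subseteq> K"
            "\<And>i. i \<in> L \<Longrightarrow> (FArr (F i) (p j) \<odot> \<xi> i) \<odot> h = (FArr (F i) (p j) \<odot> \<xi>' i) \<odot> h" by blast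
          have "FArr (F i) (p j) \<odot> (\<xi> i \<odot> h) = FArr (F i) (p j) \<odot> (\<xi>' i \<odot> h)" if i: "i \<in> L \<inter> K" for i
            using L(3)[of i] i t(4-6)[of i] t'(4-6)[of i] Fp[OF U_sub[OF L(1)] j, of i] h(1,2) df by simp
          then show "\<Phi> j h" unfolding \<Phi>_def using L(1) by blast
        qed
        show "sieve (Dom D f) (\<Phi> j)"
        proof (rule sieveI)
          fix h k assume hk: "h \<in> Arr D" "Cod D h = Dom D f" "k \<in> Arr D" "Cod D k = Dom D h" "\<Phi> j h"
          then obtain L where L: "L \<in> U"
            "\<And>i. i \<in> L \<inter> K \<Longrightarrow> FArr (F i) (p j) \<odot> (\<xi> i \<odot> h) = FArr (F i) (p j) \<odot> (\<xi>' i \<odot> h)"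
            unfolding \<Phi>_def by blast
          have "FArr (F i) (p j) \<odot> (\<xi> i \<odot> (h \<odot> k)) = FArr (F i) (p j) \<odot> (\<xi>' i \<odot> (h \<odot> k))" if i: "i \<in> L \<inter> K" for i
          proof -
            have iL: "i \<in> L" "i \<in> K" using i by auto
            have "(FArr (F i) (p j) \<odot> (\<xi> i \<odot> h)) \<odot> k = (FArr (F i) (p j) \<odot> (\<xi>' i \<odot> h)) \<odot> k"
              by (simp only: L(2)[OF i])
            then show ?thesis
              using t(4-6)[OF iL(2)] t'(4-6)[OF iL(2)] Fp[OF U_sub[OF L(1) iL(1)] j] hk(1-4) df by simp
          qed
          then show "\<Phi> j (h \<odot> k)" unfolding \<Phi>_def using L(1) by blast
        qed
      qed
      then show "locally (Dom D f) (\<lambda>h. g \<odot> (f \<odot> h) = g' \<odot> (f \<odot> h))"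
      proof (rule locally_mono)
        fix h assume h: "h \<in> Arr D" "Cod D h = Dom D f" "\<forall>j\<in>Obj J. \<Phi> j h"
        then obtain M where M: "\<And>j. j \<in> Obj J \<Longrightarrow> M j \<in> U" "\<And>j i. \<lbrakk>j \<in> Obj J; i \<in> M j \<inter> K\<rbrakk> \<Longrightarrow>
          FArr (F i) (p j) \<odot> (\<xi> i \<odot> h) = FArr (F i) (p j) \<odot> (\<xi>' i \<odot> h)" unfolding \<Phi>_def by metis
        have "\<exists>L\<in>U. \<forall>j\<in>Obj J. L \<subseteq> M j" by (rule U_Int_finite[OF fO]) (rule M(1))
        then obtain L0 where L0: "L0 \<in> U" "\<forall>j\<in>Obj J. L0 \<subseteq> M j" by blast
        define L where "L = L0 \<inter> K"
        have L: "L \<in> U" "L \<subseteq> K" "\<And>j i. \<lbrakk>j \<in> Obj J; i \<in> L\<rbrakk> \<Longrightarrow> i \<in> M j \<inter> K"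
          using U_facts(4)[OF L0(1) t(1)] L0(2) unfolding L_def by auto
        have eq: "\<xi> i \<odot> h = \<xi>' i \<odot> h" if i: "i \<in> L" for i
        proof (rule limit_unique[OF J(1) FH[OF U_sub[OF L(1) i]] Flim[OF U_sub[OF L(1) i]]])
          have iK: "i \<in> K" using i L by blast
          show "\<xi> i \<odot> h \<in> Arr D" "\<xi>' i \<odot> h \<in> Arr D" "Dom D (\<xi> i \<odot> h) = Dom D (\<xi>' i \<odot> h)"
            "Cod D (\<xi> i \<odot> h) = FObj (F i) x" "Cod D (\<xi>' i \<odot> h) = FObj (F i) x"
            using t(4-6)[OF iK] t'(4-6)[OF iK] h(1,2) df by simp_all
          show "FArr (F i) (p j) \<odot> (\<xi> i \<odot> h) = FArr (F i) (p j) \<odot> (\<xi>' i \<odot> h)" if "j \<in> Obj J" for j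
            by (rule M(2)[OF that L(3)[OF that i]])
        qed
        have h': "Cod D h = Dom D (g \<odot> f)" "Cod D h = Dom D (g' \<odot> f)" using h(2) df by simp_all
        have "(g \<odot> f) \<odot> h = (g' \<odot> f) \<odot> h"
          by (rule rep_unique[OF Ex(1) rep_precomp[OF Ex(1) rep_subset[OF Ex(1) r(1) L(1,2)] h(1) h'(1)]
              rep_precomp[OF Ex(1) rep_subset[OF Ex(1) r(2) L(1,2)] h(1) h'(2)]])
            (use eq g(1-5) f(1,2) h(1,2) in auto)
        then show "g \<odot> (f \<odot> h) = g' \<odot> (f \<odot> h)" using g(1-5) f(1,2) h(1,2) by simp
      qed
    qed
  qed (use g in auto)
  show ?thesis unfolding is_limit_def
  proof (intro conjI allI impI)
    show "is_cone J D (func_comp G H) (FObj G x) (\<lambda>j. FArr G (p j))"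
      unfolding is_cone_def simps
    proof (intro conjI ballI)
      show "FObj G x \<in> Obj D" using functor_obj[OF G_functor cf(1)] .
      show "FArr G (p j) \<in> hom D (FObj G x) (FObj G (FObj H j))" if "j \<in> Obj J" for j
        using Gp[OF that] by (simp add: hom_iff)
      fix f assume f: "f \<in> Arr J"
      then have d: "Dom J f \<in> Obj J" by simp
      have "FArr G (Comp C (FArr H f) (p (Dom J f))) = FArr G (FArr H f) \<odot> FArr G (p (Dom J f))"
        by (rule functor_comp[OF G_functor]) (use cf(2,4)[OF d] Ha[OF f] in auto)
      then show "FArr G (FArr H f) \<odot> FArr G (p (Dom J f)) = FArr G (p (Cod J f))" unfolding cf(5)[OF f] by simp
    qed
    fix y q assume "is_cone J D (func_comp G H) y q"
    note qf = cone_facts[OF this, unfolded simps]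
    define R where "R f g \<longleftrightarrow> g \<in> Arr D \<and> Dom D g = Dom D f \<and> Cod D g = FObj G x \<and>
      (\<forall>j\<in>Obj J. FArr G (p j) \<odot> g = q j \<odot> f)" for f g
    have "locally y (\<lambda>f. \<exists>K\<in>U. \<exists>\<xi>. \<forall>j\<in>Obj J. rep (E (FObj H j)) K (\<xi> j) (q j \<odot> f))"
      by (rule rep_finite[OF fO qf(1), of "\<lambda>j i. FObj (F i) (FObj H j)"]) (use EH qf in auto)
    then have "locally y (\<lambda>f. \<exists>g. R f g)"
    proof (rule locally_bind)
      fix f assume f: "f \<in> Arr D" "Cod D f = y" "\<exists>K\<in>U. \<exists>\<xi>. \<forall>j\<in>Obj J. rep (E (FObj H j)) K (\<xi> j) (q j \<odot> f)"
      then obtain K \<xi> where K: "K \<in> U" and r: "\<And>j. j \<in> Obj J \<Longrightarrow> rep (E (FObj H j)) K (\<xi> j) (q j \<odot> f)" by blast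
      note t = rep_typing[OF EH(1) r]
      have dq: "Dom D (q j \<odot> f) = Dom D f" if "j \<in> Obj J" for j using qf(2,3)[OF that] f(1,2) by simp
      have \<xi>: "\<xi> j i \<in> Arr D" "Dom D (\<xi> j i) = Dom D f" "Cod D (\<xi> j i) = FObj (F i) (FObj H j)"
        if "j \<in> Obj J" "i \<in> K" for j i
        using t(4-6)[OF that(1,1) that(2)] dq[OF that(1)] by simp_all
      have FHa: "FArr (F i) (FArr H c) \<in> Arr D" "Dom D (FArr (F i) (FArr H c)) = FObj (F i) (FObj H (Dom J c))"
        "Cod D (FArr (F i) (FArr H c)) = FObj (F i) (FObj H (Cod J c))" if "i \<in> K" "c \<in> Arr J" for i c
        using F_arr[OF U_sub[OF K that(1)] Ha(1)[OF that(2)]] Ha(2,3)[OF that(2)] by simp_all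
      define \<Phi> where "\<Phi> c h \<longleftrightarrow> (\<exists>L\<in>U. \<forall>i\<in>L \<inter> K. FArr (F i) (FArr H c) \<odot> (\<xi> (Dom J c) i \<odot> h) = \<xi> (Cod J c) i \<odot> h)" for c h
      have "locally (Dom D f) (\<lambda>h. \<forall>c\<in>Arr J. \<Phi> c h)"
      proof (rule locally_ball_finite[OF fA])
        show "Dom D f \<in> Obj D" using f by simp
        fix c assume c: "c \<in> Arr J"
        have d: "Dom J c \<in> Obj J" "Cod J c \<in> Obj J" using c by auto
        have "rep (E (FObj H (Cod J c))) K (\<lambda>i. FArr (F i) (FArr H c) \<odot> \<xi> (Dom J c) i) (FArr G (FArr H c) \<odot> (q (Dom J c) \<odot> f))"
          using G_rep[OF Ha(1)[OF c]] r[OF d(1)] Ha(2,3)[OF c] by simp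
        moreover have "FArr G (FArr H c) \<odot> (q (Dom J c) \<odot> f) = q (Cod J c) \<odot> f"
          by (rule comp_eq_assoc[OF qf(5)[OF c]]) (use G_arr[OF Ha(1)[OF c]] Ha[OF c] qf(2-4)[OF d(1)] f(1,2) in auto)
        ultimately have r': "rep (E (FObj H (Cod J c))) K (\<lambda>i. FArr (F i) (FArr H c) \<odot> \<xi> (Dom J c) i) (q (Cod J c) \<odot> f)" by simp
        have l: "locally (Dom D f) (\<lambda>h. \<exists>L\<in>U. L \<subseteq> K \<inter> K \<and>
            (\<forall>i\<in>L. (FArr (F i) (FArr H c) \<odot> \<xi> (Dom J c) i) \<odot> h = \<xi> (Cod J c) i \<odot> h))"
          using rep_separated[OF EH(1)[OF d(2)] r' r[OF d(2)]] dq[OF d(2)] by simp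
        show "locally (Dom D f) (\<Phi> c)"
        proof (rule locally_mono[OF l])
          fix h assume h: "h \<in> Arr D" "Cod D h = Dom D f" "\<exists>L\<in>U. L \<subseteq> K \<inter> K \<and>
            (\<forall>i\<in>L. (FArr (F i) (FArr H c) \<odot> \<xi> (Dom J c) i) \<odot> h = \<xi> (Cod J c) i \<odot> h)"
          then obtain L where L: "L \<in> U" "L \<subseteq> K"
            "\<And>i. i \<in> L \<Longrightarrow> (FArr (F i) (FArr H c) \<odot> \<xi> (Dom J c) i) \<odot> h = \<xi> (Cod J c) i \<odot> h" by blast
          have "FArr (F i) (FArr H c) \<odot> (\<xi> (Dom J c) i \<odot> h) = \<xi> (Cod J c) i \<odot> h" if i: "i \<in> L \<inter> K" for i
            using L(3)[of i] i \<xi>[OF d(1), of i] FHa[of i, OF _ c] h(1,2) by simp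
          then show "\<Phi> c h" unfolding \<Phi>_def using L(1) by blast
        qed
        show "sieve (Dom D f) (\<Phi> c)"
        proof (rule sieveI)
          fix h k assume hk: "h \<in> Arr D" "Cod D h = Dom D f" "k \<in> Arr D" "Cod D k = Dom D h" "\<Phi> c h"
          then obtain L where L: "L \<in> U"
            "\<And>i. i \<in> L \<inter> K \<Longrightarrow> FArr (F i) (FArr H c) \<odot> (\<xi> (Dom J c) i \<odot> h) = \<xi> (Cod J c) i \<odot> h"
            unfolding \<Phi>_def by blast
          have "FArr (F i) (FArr H c) \<odot> (\<xi> (Dom J c) i \<odot> (h \<odot> k)) = \<xi> (Cod J c) i \<odot> (h \<odot> k)" if i: "i \<in> L \<inter> K" for i
          proof -
            have iK: "i \<in> K" using i by auto
            have "(FArr (F i) (FArr H c) \<odot> (\<xi> (Dom J c) i \<odot> h)) \<odot> k = (\<xi> (Cod J c) i \<odot> h) \<odot> k"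
              by (simp only: L(2)[OF i])
            then show ?thesis using \<xi>[OF d(1) iK] \<xi>[OF d(2) iK] FHa[OF iK c] hk(1-4) by simp
          qed
          then show "\<Phi> c (h \<odot> k)" unfolding \<Phi>_def using L(1) by blast
        qed
      qed
      then show "locally (Dom D f) (\<lambda>h. \<exists>g. R (f \<odot> h) g)"
      proof (rule locally_mono)
        fix h assume h: "h \<in> Arr D" "Cod D h = Dom D f" "\<forall>c\<in>Arr J. \<Phi> c h"
        then obtain M where M: "\<And>c. c \<in> Arr J \<Longrightarrow> M c \<in> U" "\<And>c i. \<lbrakk>c \<in> Arr J; i \<in> M c \<inter> K\<rbrakk> \<Longrightarrow>
          FArr (F i) (FArr H c) \<odot> (\<xi> (Dom J c) i \<odot> h) = \<xi> (Cod J c) i \<odot> h" unfolding \<Phi>_def by metis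
        have "\<exists>L\<in>U. \<forall>c\<in>Arr J. L \<subseteq> M c" by (rule U_Int_finite[OF fA]) (rule M(1))
        then obtain L0 where L0: "L0 \<in> U" "\<forall>c\<in>Arr J. L0 \<subseteq> M c" by blast
        define L where "L = L0 \<inter> K"
        have L: "L \<in> U" "L \<subseteq> K" "\<And>c i. \<lbrakk>c \<in> Arr J; i \<in> L\<rbrakk> \<Longrightarrow> i \<in> M c \<inter> K"
          using U_facts(4)[OF L0(1) K] L0(2) unfolding L_def by auto
        have "\<exists>\<eta>. \<eta> \<in> Arr D \<and> Dom D \<eta> = Dom D h \<and> Cod D \<eta> = FObj (F i) x \<and>
            (\<forall>j\<in>Obj J. FArr (F i) (p j) \<odot> \<eta> = \<xi> j i \<odot> h)" if i: "i \<in> L" for i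
        proof -
          have iK: "i \<in> K" using i L by blast
          have "is_cone J D (func_comp (F i) H) (Dom D h) (\<lambda>j. \<xi> j i \<odot> h)"
            unfolding is_cone_def simps using \<xi>[OF _ iK] h(1,2) M(2)[OF _ L(3)[OF _ i]] by (simp add: hom_iff)
          then obtain \<eta> where "\<eta> \<in> Arr D" "Dom D \<eta> = Dom D h" "Cod D \<eta> = FObj (F i) x"
            "\<And>j. j \<in> Obj J \<Longrightarrow> FArr (F i) (p j) \<odot> \<eta> = \<xi> j i \<odot> h"
            by (rule limit_lift[OF Flim[OF U_sub[OF L(1) i]]]) (rule that; assumption?)
          then show ?thesis by blast
        qed
        then obtain \<eta> where \<eta>: "\<And>i. i \<in> L \<Longrightarrow> \<eta> i \<in> Arr D \<and> Dom D (\<eta> i) = Dom D h \<and> Cod D (\<eta> i) = FObj (F i) x \<and>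
            (\<forall>j\<in>Obj J. FArr (F i) (p j) \<odot> \<eta> i = \<xi> j i \<odot> h)" by metis
        have "\<eta> i \<in> hom D (Dom D h) (FObj (F i) x)" if "i \<in> L" for i using \<eta>[OF that] by (simp add: hom_iff)
        then obtain v where v: "v \<in> Arr D" "Dom D v = Dom D h" "Cod D v = uobj (E x)" "rep (E x) L \<eta> v"
          using rep_exists[OF Ex(1) L(1) dom_obj[OF h(1)], of \<eta>] by blast
        have "FArr G (p j) \<odot> v = (q j \<odot> f) \<odot> h" if j: "j \<in> Obj J" for j
        proof (rule rep_unique[OF EH(1)[OF j] Gp_rep[OF j v(4)] rep_precomp[OF EH(1)[OF j] rep_subset[OF EH(1)[OF j] r[OF j] L(1,2)] h(1)]])
          show "Cod D h = Dom D (q j \<odot> f)" using dq[OF j] h(2) by simp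
          show "Dom D (FArr G (p j) \<odot> v) = Dom D ((q j \<odot> f) \<odot> h)"
            using Gp[OF j] v(1-3) Ex(2) qf(2,3)[OF j] f(1,2) h(1,2) by simp
          show "FArr (F i) (p j) \<odot> \<eta> i = \<xi> j i \<odot> h" if "i \<in> L" for i using \<eta>[OF that] j by blast
        qed
        then have "R (f \<odot> h) v" unfolding R_def using v(1-3) Ex(2) f(1,2) h(1,2) qf(2,3) by simp
        then show "\<exists>g. R (f \<odot> h) g" by blast
      qed
    qed
    then have "\<exists>h. h \<in> Arr D \<and> Dom D h = y \<and> Cod D h = FObj G x \<and> locally y (\<lambda>f. R f (h \<odot> f))"
    proof (rule locally_glue)
      show "FObj G x \<in> Obj D" using functor_obj[OF G_functor cf(1)] .
      show "g \<in> Arr D \<and> Dom D g = Dom D f \<and> Cod D g = FObj G x" if "R f g" for f g using that unfolding R_def by simp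
      fix f g f' g' u v assume R: "R f g" "R f' g'" and a: "f \<in> Arr D" "f' \<in> Arr D" "Cod D f = y" "Cod D f' = y"
        "u \<in> Arr D" "v \<in> Arr D" "Dom D u = Dom D v" "Cod D u = Dom D f" "Cod D v = Dom D f'" "f \<odot> u = f' \<odot> v"
      have g: "g \<in> Arr D" "Dom D g = Dom D f" "Cod D g = FObj G x" "\<And>j. j \<in> Obj J \<Longrightarrow> FArr G (p j) \<odot> g = q j \<odot> f"
        using R(1) unfolding R_def by auto
      have g': "g' \<in> Arr D" "Dom D g' = Dom D f'" "Cod D g' = FObj G x" "\<And>j. j \<in> Obj J \<Longrightarrow> FArr G (p j) \<odot> g' = q j \<odot> f'"
        using R(2) unfolding R_def by auto
      show "g \<odot> u = g' \<odot> v"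
      proof (rule joint)
        fix j assume j: "j \<in> Obj J"
        have "FArr G (p j) \<odot> (g \<odot> u) = (q j \<odot> f) \<odot> u"
          by (rule comp_eq_assoc[OF g(4)[OF j]]) (use Gp[OF j] g(1-3) a(1-9) in auto)
        also have "\<dots> = q j \<odot> (f' \<odot> v)" unfolding a(10)[symmetric] using qf(2,3)[OF j] a(1-9) by simp
        also have "\<dots> = (q j \<odot> f') \<odot> v" using qf(2,3)[OF j] a(1-9) by simp
        also have "\<dots> = FArr G (p j) \<odot> (g' \<odot> v)"
          by (rule comp_eq_assoc[OF g'(4)[OF j], symmetric]) (use Gp[OF j] g'(1-3) a(1-9) in auto)
        finally show "FArr G (p j) \<odot> (g \<odot> u) = FArr G (p j) \<odot> (g' \<odot> v)" .
      qed (use g(1-3) g'(1-3) a(1-9) in auto)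
    qed
    then obtain h where h: "h \<in> Arr D" "Dom D h = y" "Cod D h = FObj G x" "locally y (\<lambda>f. R f (h \<odot> f))" by blast
    have hq: "FArr G (p j) \<odot> h = q j" if j: "j \<in> Obj J" for j
    proof (rule locally_eq)
      show "locally y (\<lambda>f. (FArr G (p j) \<odot> h) \<odot> f = q j \<odot> f)"
      proof (rule locally_mono[OF h(4)])
        fix f assume f: "f \<in> Arr D" "Cod D f = y" "R f (h \<odot> f)"
        then have "FArr G (p j) \<odot> (h \<odot> f) = q j \<odot> f" using j unfolding R_def by blast
        then show "(FArr G (p j) \<odot> h) \<odot> f = q j \<odot> f" using Gp[OF j] h(1-3) f(1,2) by simp
      qed
    qed (use Gp[OF j] h(1-3) qf(2-4)[OF j] in auto)
    show "\<exists>!h. h \<in> hom D y (FObj G x) \<and> (\<forall>j\<in>Obj J. FArr G (p j) \<odot> h = q j)"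
    proof (rule ex1I[of _ h])
      fix h' assume h': "h' \<in> hom D y (FObj G x) \<and> (\<forall>j\<in>Obj J. FArr G (p j) \<odot> h' = q j)"
      show "h' = h" by (rule joint) (use h' h(1-3) hq in \<open>auto simp: hom_iff\<close>)
    qed (use h(1-3) hq in \<open>auto simp: hom_iff\<close>)
  qed
qed

lemma G_coherent: "G \<in> Coh C D"
  unfolding Coh_def coherent_functor_def
  using G_functor G_limit G_regular_epi G_union by blast

end

end

theorem theorem5p13:
  fixes lam :: "'l rel" and kap :: "'k rel" and D :: "('o, 'm) cat"
  assumes lam: "Card_order lam" "regularCard lam"
    and kap: "Card_order kap" "regularCard kap" "natLeq \<le>o kap" "kap \<le>o lam"
    and pow: "\<forall>\<gamma> :: 'k rel. Card_order \<gamma> \<and> \<gamma> <o kap \<longrightarrow> ctwo ^c \<gamma> <o lam"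
    and D: "lk_pretopos lam kap D" "weakly_boolean D" "zero_kappa_prime kap D"
  shows "(\<forall>(C :: ('a, 'b) cat) (I :: 'i set) U F.
            coherent_category C \<and> |I| <o kap \<and> ultrafilter_on I U \<and> (\<forall>i \<in> I. F i \<in> Coh C D) \<longrightarrow>
            (\<exists>G. is_functor_ultraproduct C D U F G) \<and>
            (\<forall>G. is_functor_ultraproduct C D U F G \<longrightarrow> G \<in> Coh C D)) \<and>
         (\<forall>(I :: 'i set) U X a b.
            |I| <o kap \<and> ultrafilter_on I U \<and>
            (\<forall>i \<in> I. X i \<in> Obj D \<and> a i \<in> Sub D (X i) \<and> b i \<in> Sub D (X i)) \<longrightarrow>
            (\<exists>PX PA PB. is_ultraproduct D U X PX \<and>
               is_ultraproduct D U (\<lambda>i. Dom D (a i)) PA \<and>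
               is_ultraproduct D U (\<lambda>i. Dom D (b i)) PB) \<and>
            (\<forall>PX PA PB a' b'.
               is_ultraproduct D U X PX \<and>
               is_ultraproduct D U (\<lambda>i. Dom D (a i)) PA \<and>
               is_ultraproduct D U (\<lambda>i. Dom D (b i)) PB \<and>
               is_ultraproduct_map D U PA PX a a' \<and> is_ultraproduct_map D U PB PX b b' \<longrightarrow>
               a' \<in> Sub D (uobj PX) \<and> b' \<in> Sub D (uobj PX) \<and>
               (sub_le D a' b' \<longleftrightarrow> {i \<in> I. sub_le D (a i) (b i)} \<in> U)))"
proof -
  have pt: "lambda_pretopos lam D" using D(1) unfolding lk_pretopos_def by simp
  then have geo: "lambda_geometric lam D" unfolding lambda_pretopos_def by simp
  then have cat: "category D"
    unfolding lambda_geometric_def coherent_category_def regular_category_def by simp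
  interpret lk_pretopos_cat D lam kap
    by unfold_locales (use lam kap pow D pt geo cat ordLeq_transitive in blast)+
  show ?thesis
  proof (intro conjI allI impI)
    fix C :: "('a, 'b) cat" and I :: "'i set" and U and F :: "'i \<Rightarrow> ('a, 'b, 'o, 'm) func"
    assume *: "coherent_category C \<and> |I| <o kap \<and> ultrafilter_on I U \<and> (\<forall>i \<in> I. F i \<in> Coh C D)"
    then have F: "\<And>i. i \<in> I \<Longrightarrow> coherent_functor C D (F i)" unfolding Coh_def by blast
    interpret ultraproduct_of_functors D lam kap I U C F
    proof unfold_locales
      show "category C" using * unfolding coherent_category_def regular_category_def by blast
      show "is_functor C D (F i)" if "i \<in> I" for i using F[OF that] unfolding coherent_functor_def by blast
    qed (use * in blast)+
    show "\<exists>G. is_functor_ultraproduct C D U F G" by (rule ex_functor_ultraproduct)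
    show "G \<in> Coh C D" if "is_functor_ultraproduct C D U F G" for G by (rule G_coherent[OF F that])
  next
    fix I :: "'i set" and U X a b
    assume *: "|I| <o kap \<and> ultrafilter_on I U \<and>
      (\<forall>i \<in> I. X i \<in> Obj D \<and> a i \<in> Sub D (X i) \<and> b i \<in> Sub D (X i))"
    interpret ultrafilter_pretopos D lam kap I U by unfold_locales (use * in blast)+
    have ab: "X i \<in> Obj D" "a i \<in> Sub D (X i)" "b i \<in> Sub D (X i)" if "i \<in> I" for i using * that by auto
    have o: "Dom D (a i) \<in> Obj D" "Dom D (b i) \<in> Obj D" if "i \<in> I" for i
      using ab[OF that] mono_arr by (auto simp: Sub_iff)
    show "\<exists>PX PA PB. is_ultraproduct D U X PX \<and> is_ultraproduct D U (\<lambda>i. Dom D (a i)) PA \<and>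
      is_ultraproduct D U (\<lambda>i. Dom D (b i)) PB"
      using ex_ultraproduct[of X] ex_ultraproduct[of "\<lambda>i. Dom D (a i)"] ex_ultraproduct[of "\<lambda>i. Dom D (b i)"] ab(1) o
      by blast
    fix PX PA PB a' b'
    assume P: "is_ultraproduct D U X PX \<and> is_ultraproduct D U (\<lambda>i. Dom D (a i)) PA \<and>
      is_ultraproduct D U (\<lambda>i. Dom D (b i)) PB \<and>
      is_ultraproduct_map D U PA PX a a' \<and> is_ultraproduct_map D U PB PX b b'"
    show "a' \<in> Sub D (uobj PX)" by (rule ultra_Sub(1)[OF ab(2,3)]) (use P in auto)
    show "b' \<in> Sub D (uobj PX)" by (rule ultra_Sub(2)[OF ab(2,3)]) (use P in auto)
    show "sub_le D a' b' \<longleftrightarrow> {i \<in> I. sub_le D (a i) (b i)} \<in> U"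
    proof
      show "{i \<in> I. sub_le D (a i) (b i)} \<in> U" if "sub_le D a' b'"
        by (rule ultra_sub_leD[OF ab(2,3) _ _ _ _ _ D(2,3) that]) (use P in auto)
      show "sub_le D a' b'" if "{i \<in> I. sub_le D (a i) (b i)} \<in> U"
        by (rule ultra_sub_leI[OF ab(2,3) _ _ _ _ _ that]) (use P in auto)
    qed
  qed
qed

end
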